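(* Let $S \subseteq \mathbb{R}^d$ be a measurable set of finite measure and let $\Lambda \subseteq \mathbb{R}^d$ be separated. Then the following assertions hold: (i) Suppose $E(\Lambda)$ is a frame for $L^2(S)$. Then $D^-(\Lambda) = |S|$ if and only if there exists $\Gamma \in W(\Lambda)$ such that $E(\Gamma)$ is a Riesz basis for $L^2(S)$. (ii) Suppose $E(\Lambda)$ is a Riesz sequence in $L^2(S)$. Then $D^+(\Lambda) = |S|$ if and only if there exists $\Gamma \in W(\Lambda)$ such that $E(\Gamma)$ is a Riesz basis for $L^2(S)$.
   Context: $|U|$ denotes the Lebesgue measure of $U \subseteq \mathbb{R}^d$, $B_r(x)$ the open Euclidean ball of radius $r$ and center $x$. For $\lambda \in \mathbb{R}^d$ let $e_\lambda(t) = e^{2\pi i \lambda \cdot t}$, $t \in S$, regarded as an element of $L^2(S)$, and $E(\Lambda) = \{e_\lambda : \lambda \in \Lambda\}$. A set $\Lambda \subseteq \mathbb{R}^d$ is separated if $\inf\{|\lambda-\lambda'| : \lambda,\lambda' \in \Lambda,\ \lambda \neq \lambda'\} > 0$. $E(\Lambda)$ is a frame for $L^2(S)$ if there are $0<A\le B<\infty$ with $A\|f\|^2 \le \sum_{\lambda\in\Lambda} |\langle f, e_\lambda\rangle|^2 \le B\|f\|^2$ for all $f \in L^2(S)$. It is a Riesz sequence in $L^2(S)$ if there are $0<A\le B<\infty$ with $A\|c\|_{\ell^2(\Lambda)}^2 \le \|\sum_{\lambda\in\Lambda} c_\lambda e_\lambda\|^2 \le B\|c\|_{\ell^2(\Lambda)}^2$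 for all $c \in \ell^2(\Lambda)$. It is a Riesz basis for $L^2(S)$ if it is a complete Riesz sequence (equivalently, simultaneously a frame and a Riesz sequence). The lower and upper Beurling densities are $$D^-(\Lambda) = \liminf_{r\to\infty}\inf_{x\in\mathbb{R}^d} \frac{\#(\Lambda\cap B_r(x))}{|B_r(0)|}, \qquad D^+(\Lambda) = \limsup_{r\to\infty}\sup_{x\in\mathbb{R}^d} \frac{\#(\Lambda\cap B_r(x))}{|B_r(0)|}.$$ A sequence $\{\Lambda_n\}_{n\in\mathbb{N}}$ of subsets of $\mathbb{R}^d$ converges weakly to $\Gamma \subseteq \mathbb{R}^d$ if: (1) for every $\gamma \in \Gamma$ there exist $\lambda_n \in \Lambda_n$ with $\lambda_n \to \gamma$; and (2) whenever $(n_k)_k$ is a subsequence of $\mathbb{N}$ and $\lambda_{n_k} \in \Lambda_{n_k}$ satisfy $\lambda_{n_k} \to \gamma \in \mathbb{R}^d$, then $\gamma \in \Gamma$. $W(\Lambda)$ is the set of all weak limits of sequences of translates $\{\Lambda - x_n\}_{n\in\mathbb{N}}$, $x_n \in \mathbb{R}^d$. *)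

theory Defs
  imports "HOL-Analysis.Analysis"
begin

(* "Separated" is the library's uniform_discrete.  The infimum is taken in [0, infinity], so
   that sets with at most one point are separated. *)

lemma uniform_discrete_iff_INF_dist:
  fixes \<Lambda> :: "'a::metric_space set"
  shows "uniform_discrete \<Lambda> \<longleftrightarrow>
    0 < (INF (x, y) \<in> {(x, y). x \<in> \<Lambda> \<and> y \<in> \<Lambda> \<and> x \<noteq> y}. ennreal (dist x y))"
    (is "_ \<longleftrightarrow> 0 < ?I")
proof
  assume "uniform_discrete \<Lambda>"
  then obtain e where e: "e > 0" "\<forall>x\<in>\<Lambda>. \<forall>y\<in>\<Lambda>. dist x y < e \<longrightarrow> x = y"
    unfolding uniform_discrete_def by blast
  have "ennreal e \<le> ?I"
    using e by (intro INF_greatest) (force intro!: ennreal_leI simp: not_less[symmetric])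
  with e(1) show "0 < ?I"
    by (meson ennreal_less_zero_iff less_le_trans)
next
  assume I: "0 < ?I"
  then obtain z where z: "0 < z" "z < ?I"
    using dense by blast
  then obtain e where e: "z = ennreal e" "0 \<le> e"
    by (cases z) auto
  have "e > 0" using z e by simp
  moreover have "x = y" if "x \<in> \<Lambda>" "y \<in> \<Lambda>" "dist x y < e" for x y
  proof (rule ccontr)
    assume "x \<noteq> y"
    with that have "?I \<le> ennreal (dist x y)"
      by (intro INF_lower2[of "(x, y)"]) auto
    also have "\<dots> \<le> z"
      using that e by (simp add: ennreal_leI)
    finally show False using z(2) by simp
  qed
  ultimately show "uniform_discrete \<Lambda>"
    unfolding uniform_discrete_def by blast
qed

(* Elements of L^2(S) are represented by functions on the whole space of which only the values
   on S matter; almost everywhere equal functions are not identified, so L2_norm is a seminorm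
   and "zero" means "of seminorm zero". *)

definition L2_space :: "'a::euclidean_space set \<Rightarrow> ('a \<Rightarrow> complex) set" where
  "L2_space S = {f \<in> borel_measurable (lebesgue_on S).
     integrable (lebesgue_on S) (\<lambda>t. (cmod (f t))\<^sup>2)}"

definition L2_inner :: "'a::euclidean_space set \<Rightarrow> ('a \<Rightarrow> complex) \<Rightarrow> ('a \<Rightarrow> complex) \<Rightarrow> complex" where
  "L2_inner S f g = (LINT t|lebesgue_on S. f t * cnj (g t))"

definition L2_norm :: "'a::euclidean_space set \<Rightarrow> ('a \<Rightarrow> complex) \<Rightarrow> real" where
  "L2_norm S f = sqrt (LINT t|lebesgue_on S. (cmod (f t))\<^sup>2)"

definition expo :: "'a::euclidean_space \<Rightarrow> 'a \<Rightarrow> complex" where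
  "expo l t = exp (2 * of_real pi * \<i> * of_real (l \<bullet> t))"

(* The summability clause says that the sum, a priori in [0, infinity], is finite; this is part
   of the upper frame bound, since infsum of a non-summable real family is 0. *)

definition exp_frame :: "'a::euclidean_space set \<Rightarrow> 'a set \<Rightarrow> bool" where
  "exp_frame S \<Lambda> \<longleftrightarrow> (\<exists>A B. 0 < A \<and> A \<le> B \<and> (\<forall>f\<in>L2_space S.
     (\<lambda>l. (cmod (L2_inner S f (expo l)))\<^sup>2) summable_on \<Lambda> \<and>
     A * (L2_norm S f)\<^sup>2 \<le> (\<Sum>\<^sub>\<infinity>l\<in>\<Lambda>. (cmod (L2_inner S f (expo l)))\<^sup>2) \<and>
     (\<Sum>\<^sub>\<infinity>l\<in>\<Lambda>. (cmod (L2_inner S f (expo l)))\<^sup>2) \<le> B * (L2_norm S f)\<^sup>2))"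

definition ell2 :: "'a set \<Rightarrow> ('a \<Rightarrow> complex) set" where
  "ell2 \<Lambda> = {c. (\<lambda>l. (cmod (c l))\<^sup>2) summable_on \<Lambda>}"

(* g is the unconditional sum, in the L^2(S) norm, of the series of the c l * expo l, l in
   \<Lambda>; such a g is unique up to null sets. *)

definition exp_has_L2_sum ::
  "'a::euclidean_space set \<Rightarrow> 'a set \<Rightarrow> ('a \<Rightarrow> complex) \<Rightarrow> ('a \<Rightarrow> complex) \<Rightarrow> bool" where
  "exp_has_L2_sum S \<Lambda> c g \<longleftrightarrow> g \<in> L2_space S \<and>
     ((\<lambda>F. L2_norm S (\<lambda>t. (\<Sum>l\<in>F. c l * expo l t) - g t)) \<longlongrightarrow> 0) (finite_subsets_at_top \<Lambda>)"

definition exp_riesz_sequence :: "'a::euclidean_space set \<Rightarrow> 'a set \<Rightarrow> bool" where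
  "exp_riesz_sequence S \<Lambda> \<longleftrightarrow> (\<exists>A B. 0 < A \<and> A \<le> B \<and> (\<forall>c\<in>ell2 \<Lambda>.
     \<exists>g. exp_has_L2_sum S \<Lambda> c g \<and>
       A * (\<Sum>\<^sub>\<infinity>l\<in>\<Lambda>. (cmod (c l))\<^sup>2) \<le> (L2_norm S g)\<^sup>2 \<and>
       (L2_norm S g)\<^sup>2 \<le> B * (\<Sum>\<^sub>\<infinity>l\<in>\<Lambda>. (cmod (c l))\<^sup>2)))"

definition exp_complete :: "'a::euclidean_space set \<Rightarrow> 'a set \<Rightarrow> bool" where
  "exp_complete S \<Lambda> \<longleftrightarrow> (\<forall>f\<in>L2_space S. \<forall>\<epsilon>>0. \<exists>F c. finite F \<and> F \<subseteq> \<Lambda> \<and>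
     L2_norm S (\<lambda>t. f t - (\<Sum>l\<in>F. c l * expo l t)) < \<epsilon>)"

definition exp_riesz_basis :: "'a::euclidean_space set \<Rightarrow> 'a set \<Rightarrow> bool" where
  "exp_riesz_basis S \<Lambda> \<longleftrightarrow> exp_riesz_sequence S \<Lambda> \<and> exp_complete S \<Lambda>"

(* Points are counted by the counting measure, with values in [0, infinity], because card of an
   infinite set is 0. *)

definition lower_density :: "'a::euclidean_space set \<Rightarrow> ennreal" where
  "lower_density \<Lambda> = Liminf at_top (\<lambda>r::real. INF x.
     emeasure (count_space UNIV) (\<Lambda> \<inter> ball x r) / emeasure lebesgue (ball (0::'a) r))"

definition upper_density :: "'a::euclidean_space set \<Rightarrow> ennreal" where
  "upper_density \<Lambda> = Limsup at_top (\<lambda>r::real. SUP x.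
     emeasure (count_space UNIV) (\<Lambda> \<inter> ball x r) / emeasure lebesgue (ball (0::'a) r))"

definition weakly_converges ::
  "(nat \<Rightarrow> 'a::euclidean_space set) \<Rightarrow> 'a set \<Rightarrow> bool" where
  "weakly_converges L \<Gamma> \<longleftrightarrow>
     (\<forall>\<gamma>\<in>\<Gamma>. \<exists>l. (\<forall>n. l n \<in> L n) \<and> l \<longlonglongrightarrow> \<gamma>) \<and>
     (\<forall>k l \<gamma>. strict_mono (k :: nat \<Rightarrow> nat) \<and> (\<forall>j. l j \<in> L (k j)) \<and> l \<longlonglongrightarrow> \<gamma> \<longrightarrow> \<gamma> \<in> \<Gamma>)"

definition weak_limits :: "'a::euclidean_space set \<Rightarrow> 'a set set" where
  "weak_limits \<Lambda> = {\<Gamma>. \<exists>x. weakly_converges (\<lambda>n. (\<lambda>l. l - x n) ` \<Lambda>) \<Gamma>}"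

end

theory Submission
  imports Defs "HOL-Probability.Probability"
begin

text \<open>
  If \<open>E(\<Lambda>)\<close> is a frame with frame operator \<open>T\<close>, the numbers \<open>lev \<Lambda> \<lambda> = \<langle>e\<^sub>\<lambda>, T\<inverse>e\<^sub>\<lambda>\<rangle>\<close> lie in
  \<open>[0, 1]\<close>.  Comparing the discrete frame with the continuous Parseval frame of all \<open>e\<^sub>x\<close> gives that their
  sum over a large ball is about \<open>|S|\<close> times the volume of the ball.  Hence \<open>D\<^sup>-(\<Lambda>) \<ge> |S|\<close>, and equality
  produces translates of \<open>\<Lambda>\<close> for which these numbers tend to 1 on growing balls.  Since
  \<open>\<langle>T\<inverse>e\<^sub>\<lambda>, e\<^sub>\<mu>\<rangle>\<close> is then almost diagonal, a weak limit of the translates is a Riesz sequence, and it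
  inherits the lower frame bound.

  If \<open>E(\<Lambda>)\<close> is a Riesz sequence, the squared distances of \<open>e\<^sub>x\<close> from the span of the \<open>e\<^sub>\<lambda>\<close> with \<open>\<lambda>\<close> in
  a large ball have integral over this ball at most about \<open>|S|\<close> times its volume minus the number of its
  points.  Hence \<open>D\<^sup>+(\<Lambda>) \<le> |S|\<close>, and equality produces translates of \<open>\<Lambda>\<close> whose exponentials approximate
  every \<open>e\<^sub>x\<close> on growing balls of \<open>x\<close>, so that a weak limit is complete; it inherits the Riesz bounds.

  Conversely, a weak limit that is a Riesz basis has uniform density \<open>|S|\<close> by the two inequalities, and
  point counts pass between \<open>\<Lambda>\<close> and its weak limits up to a boundary layer.
\<close>

section \<open>Semi-inner product spaces of functions\<close>

text \<open>The sum of the scores over a ball is a localised trace. By Plancherel each score is the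
  integral over x of \<open>ft (dual \<Lambda> l) x * cnj (ft (expo l) x)\<close>, and for fixed x
  these integrands, summed over all l, give <e_x, e_x> = |S|. Restricting both l and x to one ball
  disturbs only a boundary layer; separation enters here, through packing and through tail estimates
  uniform in the position of the ball. S may be unbounded and its Fourier transform need not decay
  at any rate, so tails are controlled by square integrability alone. Riesz sequences use the same
  trace with biorthogonal vectors, whose scores are exactly 1. A density only says that the total
  defect on large balls is small relative to volume; averaging over centres turns this into balls of
  any prescribed radius with small total defect. Functions equal almost everywhere are not
  identified, hence semi-inner products. The locale serves for L^2(S), for the frame form that
  stands in for T, for the defect in Plancherel's identity and for the closed span of the
  exponentials.\<close>

locale semi_ip =
  fixes V :: "('b \<Rightarrow> complex) set" and ip :: "('b \<Rightarrow> complex) \<Rightarrow> ('b \<Rightarrow> complex) \<Rightarrow> complex"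
  assumes zero_mem: "(\<lambda>_. 0) \<in> V"
    and lin_mem: "f \<in> V \<Longrightarrow> g \<in> V \<Longrightarrow> (\<lambda>t. a * f t + g t) \<in> V"
    and ip_lin: "f \<in> V \<Longrightarrow> g \<in> V \<Longrightarrow> h \<in> V \<Longrightarrow> ip (\<lambda>t. a * f t + g t) h = a * ip f h + ip g h"
    and ip_herm: "f \<in> V \<Longrightarrow> g \<in> V \<Longrightarrow> ip g f = cnj (ip f g)"
    and ip_nonneg: "f \<in> V \<Longrightarrow> 0 \<le> Re (ip f f)"
begin

definition nsq where "nsq f = Re (ip f f)"

definition nm where "nm f = sqrt (nsq f)"

lemma scale_mem: "f \<in> V \<Longrightarrow> (\<lambda>t. a * f t) \<in> V"
  using lin_mem[of f "\<lambda>_. 0" a] zero_mem by simp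

lemma diff_mem: "f \<in> V \<Longrightarrow> g \<in> V \<Longrightarrow> (\<lambda>t. f t - g t) \<in> V"
  using lin_mem[of g f "-1"] by simp

lemma sum_mem: "(\<And>i. i \<in> I \<Longrightarrow> u i \<in> V) \<Longrightarrow> (\<lambda>t. \<Sum>i\<in>I. c i * u i t) \<in> V"
proof (induction I rule: infinite_finite_induct)
  case (insert i I)
  then show ?case using lin_mem[of "u i" "\<lambda>t. \<Sum>i\<in>I. c i * u i t" "c i"] by simp
qed (simp_all add: zero_mem)

lemma ip_diff: "f \<in> V \<Longrightarrow> g \<in> V \<Longrightarrow> h \<in> V \<Longrightarrow> ip (\<lambda>t. f t - g t) h = ip f h - ip g h"
  using ip_lin[of g f h "-1"] by simp

lemma ip_zero: "h \<in> V \<Longrightarrow> ip (\<lambda>_. 0) h = 0"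
  using ip_diff[OF zero_mem zero_mem, of h] by simp

lemma ip_scale: "f \<in> V \<Longrightarrow> h \<in> V \<Longrightarrow> ip (\<lambda>t. a * f t) h = a * ip f h"
  using ip_lin[of f "\<lambda>_. 0" h a] zero_mem ip_zero by simp

lemma ip_sum: "(\<And>i. i \<in> I \<Longrightarrow> u i \<in> V) \<Longrightarrow> h \<in> V \<Longrightarrow>
    ip (\<lambda>t. \<Sum>i\<in>I. c i * u i t) h = (\<Sum>i\<in>I. c i * ip (u i) h)"
proof (induction I rule: infinite_finite_induct)
  case (insert i I)
  then show ?case using ip_lin[of "u i" "\<lambda>t. \<Sum>i\<in>I. c i * u i t" h "c i"] sum_mem[of I u c]
    by simp
qed (simp_all add: ip_zero)

lemma ip_diff_right: "f \<in> V \<Longrightarrow> g \<in> V \<Longrightarrow> h \<in> V \<Longrightarrow> ip h (\<lambda>t. f t - g t) = ip h f - ip h g"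
  using ip_herm[of "\<lambda>t. f t - g t" h] ip_diff[of f g h] ip_herm[of f h] ip_herm[of g h] diff_mem[of f g]
  by simp

lemma ip_sum_right:
  assumes "\<And>i. i \<in> I \<Longrightarrow> u i \<in> V" "h \<in> V"
  shows "ip h (\<lambda>t. \<Sum>i\<in>I. c i * u i t) = (\<Sum>i\<in>I. cnj (c i) * ip h (u i))"
proof -
  have "ip h (\<lambda>t. \<Sum>i\<in>I. c i * u i t) = cnj (\<Sum>i\<in>I. c i * ip (u i) h)"
    using ip_herm[OF sum_mem assms(2), of I u c] ip_sum[of I u h c] assms by simp
  also have "\<dots> = (\<Sum>i\<in>I. cnj (c i) * ip h (u i))"
    using assms by (simp add: ip_herm[OF assms(1) assms(2)])
  finally show ?thesis .
qed

lemma nsq_nonneg: "f \<in> V \<Longrightarrow> 0 \<le> nsq f"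
  by (simp add: nsq_def ip_nonneg)

lemma ip_self: "f \<in> V \<Longrightarrow> ip f f = of_real (nsq f)"
  using ip_herm[of f f] by (simp add: nsq_def complex_eq_iff)

lemma nm_sq: "f \<in> V \<Longrightarrow> (nm f)\<^sup>2 = nsq f"
  by (simp add: nm_def nsq_nonneg)

lemma nm_nonneg: "f \<in> V \<Longrightarrow> 0 \<le> nm f"
  by (simp add: nm_def nsq_nonneg)

lemma nsq_lin:
  assumes "f \<in> V" "g \<in> V"
  shows "nsq (\<lambda>t. a * f t + g t) = (cmod a)\<^sup>2 * nsq f + 2 * Re (a * ip f g) + nsq g"
proof -
  let ?k = "\<lambda>t. a * f t + g t"
  have k: "?k \<in> V" using lin_mem assms by simp
  have "ip ?k ?k = a * ip f ?k + ip g ?k" using ip_lin assms k by simp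
  moreover have "ip f ?k = cnj (a * ip f f + ip g f)"
    using ip_herm[of ?k f] ip_lin[of f g f a] assms k by simp
  moreover have "ip g ?k = cnj (a * ip f g + ip g g)"
    using ip_herm[of ?k g] ip_lin[of f g g a] assms k by simp
  moreover have "ip g f = cnj (ip f g)" using assms by (rule ip_herm)
  ultimately have "ip ?k ?k = a * cnj a * of_real (nsq f) + (a * ip f g + cnj (a * ip f g)) + of_real (nsq g)"
    using ip_self[OF assms(1)] ip_self[OF assms(2)] by (simp add: algebra_simps)
  also have "a * cnj a = of_real ((cmod a)\<^sup>2)"
    by (rule complex_norm_square[symmetric])
  also have "a * ip f g + cnj (a * ip f g) = of_real (2 * Re (a * ip f g))"
    by (rule complex_add_cnj)
  finally have "ip ?k ?k = of_real ((cmod a)\<^sup>2 * nsq f + 2 * Re (a * ip f g) + nsq g)"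
    by simp
  then show ?thesis by (simp only: nsq_def[of ?k] Re_complex_of_real)
qed

lemma nsq_add: "f \<in> V \<Longrightarrow> g \<in> V \<Longrightarrow> nsq (\<lambda>t. f t + g t) = nsq f + 2 * Re (ip f g) + nsq g"
  using nsq_lin[of f g 1] by simp

lemma nsq_diff: "f \<in> V \<Longrightarrow> g \<in> V \<Longrightarrow> nsq (\<lambda>t. f t - g t) = nsq f - 2 * Re (ip f g) + nsq g"
  using nsq_lin[of g f "-1"] ip_herm[of f g] by simp

lemma nsq_scale: "f \<in> V \<Longrightarrow> nsq (\<lambda>t. a * f t) = (cmod a)\<^sup>2 * nsq f"
  using nsq_lin[of f "\<lambda>_. 0" a] zero_mem ip_zero[OF zero_mem] ip_herm[OF zero_mem, of f] ip_zero[of f]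
  by (simp add: nsq_def)

text \<open>The form may vanish on nonzero vectors, so division by \<open>nsq f\<close> is not
  always possible. Nonnegativity at \<open>g\<close> plus \<open>- s * cnj z\<close> times
  \<open>f\<close> gives, for every real \<open>s\<close>, an inequality quadratic in
  \<open>s\<close>; it settles both cases.\<close>

lemma cauchy_schwarz_sq:
  assumes "f \<in> V" "g \<in> V"
  shows "(cmod (ip f g))\<^sup>2 \<le> nsq f * nsq g"
proof -
  define z where "z = ip f g"
  have key: "0 \<le> s\<^sup>2 * (cmod z)\<^sup>2 * nsq f - 2 * s * (cmod z)\<^sup>2 + nsq g" for s :: real
  proof -
    let ?a = "- of_real s * cnj z"
    have "0 \<le> nsq (\<lambda>t. ?a * f t + g t)" using assms by (intro nsq_nonneg lin_mem)
    also have "\<dots> = (cmod ?a)\<^sup>2 * nsq f + 2 * Re (?a * z) + nsq g"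
      unfolding z_def by (rule nsq_lin[OF assms])
    also have "Re (?a * z) = - s * (cmod z)\<^sup>2"
      by (simp add: cmod_power2) (simp add: power2_eq_square algebra_simps)
    also have "(cmod ?a)\<^sup>2 = s\<^sup>2 * (cmod z)\<^sup>2"
      by (simp add: norm_mult power_mult_distrib)
    finally show ?thesis by simp
  qed
  have f0: "0 \<le> nsq f" and g0: "0 \<le> nsq g" using assms nsq_nonneg by auto
  show ?thesis
  proof (cases "nsq f = 0")
    case True
    have "z = 0"
    proof (rule ccontr)
      assume "z \<noteq> 0"
      then have "(cmod z)\<^sup>2 > 0" by simp
      \<comment> \<open>For a degenerate \<open>f\<close> the inequality is linear in
        \<open>s\<close>; this value makes its right side equal to
        \<open>- nsq g - 2\<close>.\<close>
      define s where "s = (nsq g + 1) / (cmod z)\<^sup>2"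
      have "s * (cmod z)\<^sup>2 = nsq g + 1" using \<open>(cmod z)\<^sup>2 > 0\<close> by (simp add: s_def)
      moreover have "0 \<le> nsq g - 2 * (s * (cmod z)\<^sup>2)" using key[of s] True by simp
      ultimately show False using g0 by linarith
    qed
    then show ?thesis using True unfolding z_def by simp
  next
    case False
    then have "nsq f > 0" using f0 by simp
    then show ?thesis
      using key[of "1 / nsq f"] unfolding z_def[symmetric]
      by (simp add: field_simps power2_eq_square)
  qed
qed

lemma cauchy_schwarz: "f \<in> V \<Longrightarrow> g \<in> V \<Longrightarrow> cmod (ip f g) \<le> nm f * nm g"
  using cauchy_schwarz_sq[of f g]
  by (metis nm_def norm_ge_zero real_le_rsqrt real_sqrt_mult)

lemma nm_add:
  assumes "f \<in> V" "g \<in> V"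
  shows "nm (\<lambda>t. f t + g t) \<le> nm f + nm g"
proof -
  have "nsq (\<lambda>t. f t + g t) \<le> (nm f + nm g)\<^sup>2"
    using nsq_add[OF assms] cauchy_schwarz[OF assms] complex_Re_le_cmod[of "ip f g"]
      nm_sq[OF assms(1)] nm_sq[OF assms(2)] by (simp add: power2_sum)
  then show ?thesis
    unfolding nm_def[of "\<lambda>t. f t + g t"] using assms nm_nonneg
    by (intro real_le_lsqrt) auto
qed

lemma nm_scale: "f \<in> V \<Longrightarrow> nm (\<lambda>t. a * f t) = cmod a * nm f"
  by (simp add: nm_def nsq_scale real_sqrt_mult)

lemma nm_minus_commute: "f \<in> V \<Longrightarrow> g \<in> V \<Longrightarrow> nm (\<lambda>t. f t - g t) = nm (\<lambda>t. g t - f t)"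
  using nm_scale[of "\<lambda>t. f t - g t" "-1"] diff_mem[of f g] by simp

lemma nm_triangle:
  "f \<in> V \<Longrightarrow> g \<in> V \<Longrightarrow> h \<in> V \<Longrightarrow> nm (\<lambda>t. f t - h t) \<le> nm (\<lambda>t. f t - g t) + nm (\<lambda>t. g t - h t)"
  using nm_add[of "\<lambda>t. f t - g t" "\<lambda>t. g t - h t"] diff_mem[of f g] diff_mem[of g h] by simp

lemma nm_le_add_diff: "f \<in> V \<Longrightarrow> g \<in> V \<Longrightarrow> nm f \<le> nm g + nm (\<lambda>t. f t - g t)"
  using nm_add[of g "\<lambda>t. f t - g t"] diff_mem[of f g] by simp

lemma nm_sum:
  "(\<And>i. i \<in> I \<Longrightarrow> u i \<in> V) \<Longrightarrow> nm (\<lambda>t. \<Sum>i\<in>I. c i * u i t) \<le> (\<Sum>i\<in>I. cmod (c i) * nm (u i))"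
proof (induction I rule: infinite_finite_induct)
  case (insert i I)
  then have "nm (\<lambda>t. c i * u i t + (\<Sum>i\<in>I. c i * u i t)) \<le> nm (\<lambda>t. c i * u i t) + nm (\<lambda>t. \<Sum>i\<in>I. c i * u i t)"
    by (intro nm_add scale_mem sum_mem) auto
  also have "nm (\<lambda>t. c i * u i t) = cmod (c i) * nm (u i)" using insert by (simp add: nm_scale)
  finally show ?case using insert by fastforce
qed (simp_all add: nm_def nsq_def ip_zero zero_mem)

lemma nsq_sum:
  assumes "\<And>i. i \<in> I \<Longrightarrow> u i \<in> V"
  shows "of_real (nsq (\<lambda>t. \<Sum>i\<in>I. c i * u i t)) = (\<Sum>i\<in>I. \<Sum>j\<in>I. c i * cnj (c j) * ip (u i) (u j))"
proof -
  have "of_real (nsq (\<lambda>t. \<Sum>i\<in>I. c i * u i t)) = (\<Sum>i\<in>I. c i * ip (u i) (\<lambda>t. \<Sum>i\<in>I. c i * u i t))"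
    using assms sum_mem[of I u c] by (simp add: ip_self[symmetric] ip_sum)
  then show ?thesis
    using assms by (simp add: ip_sum_right sum_distrib_left mult.assoc)
qed

text \<open>Gram--Schmidt: a vector is added to the family by splitting off its component orthogonal to
  the vectors already present; if that component has norm zero then nothing has to be corrected.\<close>

lemma finite_projection:
  assumes "finite I" "\<And>i. i \<in> I \<Longrightarrow> u i \<in> V" "f \<in> V"
  shows "\<exists>c. \<forall>j\<in>I. ip (\<lambda>t. f t - (\<Sum>i\<in>I. c i * u i t)) (u j) = 0"
  using assms
proof (induction I arbitrary: f rule: finite_induct)
  case (insert k I)
  have uV: "\<And>i. i \<in> I \<Longrightarrow> u i \<in> V" and kV: "u k \<in> V" using insert by auto
  obtain c where c: "\<forall>j\<in>I. ip (\<lambda>t. f t - (\<Sum>i\<in>I. c i * u i t)) (u j) = 0"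
    using insert.IH[OF uV insert.prems(2)] by blast
  obtain d where d: "\<forall>j\<in>I. ip (\<lambda>t. u k t - (\<Sum>i\<in>I. d i * u i t)) (u j) = 0"
    using insert.IH[OF uV kV] by blast
  define F where "F = (\<lambda>t. f t - (\<Sum>i\<in>I. c i * u i t))"
  define K where "K = (\<lambda>t. u k t - (\<Sum>i\<in>I. d i * u i t))"
  have FV: "F \<in> V" unfolding F_def using insert.prems(2) uV by (intro diff_mem sum_mem)
  have KV: "K \<in> V" unfolding K_def using kV uV by (intro diff_mem sum_mem)
  have Fo: "ip F (u j) = 0" and Ko: "ip K (u j) = 0" if "j \<in> I" for j
    using c d that by (auto simp: F_def K_def)
  have s0: "ip g (\<lambda>t. \<Sum>i\<in>I. d i * u i t) = 0" if "g \<in> V" "\<And>j. j \<in> I \<Longrightarrow> ip g (u j) = 0" for g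
    using that uV by (simp add: ip_sum_right)
  have gK: "ip g K = ip g (u k)" if "g \<in> V" "\<And>j. j \<in> I \<Longrightarrow> ip g (u j) = 0" for g
    unfolding K_def using s0[OF that] that kV sum_mem[of I u d] uV by (simp add: ip_diff_right)
  define b where "b = (if nsq K = 0 then 0 else ip F K / of_real (nsq K))"
  \<comment> \<open>\<open>K\<close> is \<open>u k\<close> minus a combination of the old vectors
    with coefficients \<open>d\<close>, so removing \<open>b * K\<close> from the remainder changes
    each old coefficient by \<open>- b * d i\<close>.\<close>
  define c' where "c' i = (if i = k then b else c i - b * d i)" for i
  have "(\<lambda>t. f t - (\<Sum>i\<in>insert k I. c' i * u i t)) = (\<lambda>t. - b * K t + F t)"
  proof
    fix t
    have "(\<Sum>i\<in>I. c' i * u i t) = (\<Sum>i\<in>I. (c i - b * d i) * u i t)"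
      using insert.hyps by (intro sum.cong) (auto simp: c'_def)
    also have "\<dots> = (\<Sum>i\<in>I. c i * u i t) - b * (\<Sum>i\<in>I. d i * u i t)"
      by (simp add: left_diff_distrib sum_subtractf sum_distrib_left mult.assoc)
    finally have "(\<Sum>i\<in>I. c' i * u i t) = \<dots>" .
    moreover have "c' k = b" by (simp add: c'_def)
    ultimately show "f t - (\<Sum>i\<in>insert k I. c' i * u i t) = - b * K t + F t"
      using insert.hyps by (simp add: F_def K_def algebra_simps)
  qed
  moreover have "ip (\<lambda>t. - b * K t + F t) (u j) = 0" if "j \<in> insert k I" for j
  proof (cases "j = k")
    case True
    have "ip (\<lambda>t. - b * K t + F t) (u k) = - b * ip K (u k) + ip F (u k)"
      using ip_lin KV FV kV by blast
    also have "ip K (u k) = of_real (nsq K)" using gK[OF KV Ko] ip_self[OF KV] by simp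
    also have "ip F (u k) = ip F K" using gK[OF FV Fo] by simp
    also have "- b * of_real (nsq K) + ip F K = 0"
      using cauchy_schwarz_sq[OF FV KV] by (auto simp: b_def)
    finally show ?thesis using True by simp
  next
    case False
    then show ?thesis using ip_lin[OF KV FV, of "u j" "- b"] Fo Ko that uV by auto
  qed
  ultimately show ?case by (intro exI[of _ c']) simp
qed simp

text \<open>The representing vector is the limit of a minimizing sequence of
  \<open>nsq f - 2 * Re (\<phi> f)\<close>.\<close>

lemma riesz_representation:
  fixes \<phi> :: "('b \<Rightarrow> complex) \<Rightarrow> complex"
  assumes C: "0 \<le> C" and complete: "\<And>X. (\<And>n::nat. X n \<in> V) \<Longrightarrow>
      (\<And>e. e > 0 \<Longrightarrow> \<exists>N. \<forall>m\<ge>N. \<forall>n\<ge>N. nsq (\<lambda>t. X m t - X n t) < e) \<Longrightarrow>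
      \<exists>h\<in>V. (\<lambda>n. nsq (\<lambda>t. X n t - h t)) \<longlonglongrightarrow> 0"
    and lin: "\<And>f g a. f \<in> V \<Longrightarrow> g \<in> V \<Longrightarrow> \<phi> (\<lambda>t. a * f t + g t) = a * \<phi> f + \<phi> g"
    and bounded: "\<And>f. f \<in> V \<Longrightarrow> (cmod (\<phi> f))\<^sup>2 \<le> C * nsq f"
  shows "\<exists>h\<in>V. \<forall>f\<in>V. \<phi> f = ip f h"
proof -
  define \<Phi> where "\<Phi> f = nsq f - 2 * Re (\<phi> f)" for f
  have lower: "\<Phi> f \<ge> - C" if "f \<in> V" for f
  proof -
    have n0: "nsq f \<ge> 0" using that nsq_nonneg by simp
    have "2 * Re (\<phi> f) \<le> 2 * cmod (\<phi> f)" using complex_Re_le_cmod by simp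
    also have "\<dots> \<le> nsq f + C"
    proof (rule power2_le_imp_le)
      show "(2 * cmod (\<phi> f))\<^sup>2 \<le> (nsq f + C)\<^sup>2"
        using bounded[OF that] sum_squares_bound[of "nsq f" C]
        by (simp add: power2_sum power_mult_distrib algebra_simps)
    qed (use n0 C in simp)
    finally show ?thesis by (simp add: \<Phi>_def)
  qed
  define m where "m = Inf (\<Phi> ` V)"
  have bdd: "bdd_below (\<Phi> ` V)" using lower by (auto intro!: bdd_belowI2)
  have m_le: "m \<le> \<Phi> f" if "f \<in> V" for f
    unfolding m_def using that bdd by (simp add: cINF_lower)
  have "\<exists>f\<in>V. \<Phi> f < m + 1 / real (Suc n)" for n
    using cInf_lessD[of "\<Phi> ` V" "m + 1 / real (Suc n)"] zero_mem unfolding m_def by force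
  then obtain X where XV: "\<And>n. X n \<in> V" and X: "\<And>n. \<Phi> (X n) < m + 1 / real (Suc n)"
    by metis
  \<comment> \<open>Parallelogram law: as \<open>\<phi>\<close> is linear, the values of
    \<open>\<Phi>\<close> at two points and at their midpoint determine the distance of the points,
    and at the midpoint \<open>\<Phi>\<close> is still at least \<open>m\<close>.\<close>
  have cauchy: "nsq (\<lambda>t. X i t - X j t) \<le> 2 / real (Suc i) + 2 / real (Suc j)" for i j
  proof -
    let ?M = "\<lambda>t. (1/2) * X i t + (1/2) * X j t"
    have half: "(\<lambda>t. (1/2) * X j t) \<in> V" using XV scale_mem by blast
    have MV: "?M \<in> V" using XV half by (intro lin_mem)
    have "\<phi> (\<lambda>t. 0) = 0" using lin[OF zero_mem zero_mem, of 1] by simp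
    then have "\<phi> (\<lambda>t. (1/2) * X j t) = 1/2 * \<phi> (X j)"
      using lin[OF XV[of j] zero_mem, of "1/2"] by simp
    then have phi: "\<phi> ?M = (1/2) * \<phi> (X i) + (1/2) * \<phi> (X j)"
      using lin[OF XV half, of "1/2"] by simp
    have "nsq ?M = (1/4) * nsq (X i) + Re ((1/2) * ip (X i) (X j)) + (1/4) * nsq (X j)"
    proof -
      have "ip (X i) (\<lambda>t. (1/2) * X j t) = cnj ((1/2) * ip (X j) (X i))"
        by (simp only: ip_herm[OF half XV[of i]] ip_scale[OF XV[of j] XV[of i]])
      also have "\<dots> = (1/2) * ip (X i) (X j)" using ip_herm[OF XV[of j] XV[of i]] by simp
      finally have e: "ip (X i) (\<lambda>t. (1/2) * X j t) = (1/2) * ip (X i) (X j)" .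
      show ?thesis
        unfolding nsq_lin[OF XV[of i] half] nsq_scale[OF XV[of j]] e by (simp add: power_divide)
    qed
    then have "nsq (\<lambda>t. X i t - X j t) = 2 * \<Phi> (X i) + 2 * \<Phi> (X j) - 4 * \<Phi> ?M"
      using nsq_diff[OF XV[of i] XV[of j]] phi by (simp add: \<Phi>_def algebra_simps)
    also have "\<dots> \<le> 2 / real (Suc i) + 2 / real (Suc j)"
      using X[of i] X[of j] m_le[OF MV] by simp
    finally show ?thesis .
  qed
  have "\<exists>h\<in>V. (\<lambda>n. nsq (\<lambda>t. X n t - h t)) \<longlonglongrightarrow> 0"
  proof (rule complete[OF XV])
    fix e :: real assume "e > 0"
    then obtain N where N: "inverse (real (Suc N)) < e / 4"
      using reals_Archimedean[of "e/4"] by auto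
    have "nsq (\<lambda>t. X i t - X j t) < e" if "i \<ge> N" "j \<ge> N" for i j
    proof -
      have "1 / real (Suc i) \<le> inverse (real (Suc N))" "1 / real (Suc j) \<le> inverse (real (Suc N))"
        using that by (auto simp: field_simps)
      then show ?thesis using cauchy[of i j] N by simp
    qed
    then show "\<exists>N. \<forall>m\<ge>N. \<forall>n\<ge>N. nsq (\<lambda>t. X m t - X n t) < e" by blast
  qed
  then obtain h where hV: "h \<in> V" and h: "(\<lambda>n. nsq (\<lambda>t. X n t - h t)) \<longlonglongrightarrow> 0" by blast
  have "\<phi> f = ip f h" if fV: "f \<in> V" for f
  proof -
    have d_bound: "(cmod (ip f (X n) - \<phi> f))\<^sup>2 \<le> (nsq f + 1) / real (Suc n)" for n
    proof -
      define d where "d = ip f (X n) - \<phi> f"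
      \<comment> \<open>First variation at an almost minimizer: moving from \<open>X n\<close> along
        \<open>f\<close> can lower \<open>\<Phi>\<close> by at most \<open>1 / Suc n\<close>. The
        optimal step \<open>1 / nsq f\<close> may not exist; adding 1 gives
        \<open>s * nsq f \<le> 1\<close> in every case.\<close>
      define s where "s = 1 / (nsq f + 1)"
      have n1: "nsq f + 1 > 0" using nsq_nonneg[OF fV] by simp
      let ?a = "- of_real s * cnj d"
      let ?g = "\<lambda>t. ?a * f t + X n t"
      have "m \<le> \<Phi> ?g" using fV XV by (intro m_le lin_mem)
      also have "\<Phi> ?g = (cmod ?a)\<^sup>2 * nsq f + 2 * Re (?a * d) + \<Phi> (X n)"
        unfolding \<Phi>_def nsq_lin[OF fV XV] lin[OF fV XV] by (simp add: d_def algebra_simps)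
      also have "Re (?a * d) = - s * (cmod d)\<^sup>2"
        by (simp add: cmod_power2) (simp add: power2_eq_square algebra_simps)
      also have "(cmod ?a)\<^sup>2 = s\<^sup>2 * (cmod d)\<^sup>2"
        by (simp add: norm_mult power_mult_distrib)
      finally have 1: "2 * s * (cmod d)\<^sup>2 - s\<^sup>2 * nsq f * (cmod d)\<^sup>2 \<le> 1 / real (Suc n)"
        using X[of n] by (simp add: algebra_simps)
      have "s * nsq f \<le> 1" using n1 by (simp add: s_def)
      then have "s * (s * nsq f) \<le> s * 1" using n1 by (intro mult_left_mono) (simp_all add: s_def)
      then have "s\<^sup>2 * nsq f * (cmod d)\<^sup>2 \<le> s * (cmod d)\<^sup>2"
        by (intro mult_right_mono) (simp_all add: power2_eq_square mult.assoc)
      then have "s * (cmod d)\<^sup>2 \<le> 1 / real (Suc n)" using 1 by simp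
      then show ?thesis using n1 unfolding d_def[symmetric] s_def by (simp add: field_simps)
    qed
    have lim1: "(\<lambda>n. (nsq f + 1) / real (Suc n)) \<longlonglongrightarrow> 0"
      by (rule LIMSEQ_Suc[OF lim_const_over_n])
    have "(\<lambda>n. (cmod (ip f (X n) - \<phi> f))\<^sup>2) \<longlonglongrightarrow> 0"
      by (rule real_tendsto_sandwich[OF _ _ tendsto_const lim1]) (use d_bound in auto)
    then have "(\<lambda>n. sqrt ((cmod (ip f (X n) - \<phi> f))\<^sup>2)) \<longlonglongrightarrow> sqrt 0"
      by (rule tendsto_real_sqrt)
    then have "(\<lambda>n. ip f (X n) - \<phi> f) \<longlonglongrightarrow> 0" by (simp add: tendsto_norm_zero_iff)
    then have a: "(\<lambda>n. ip f (X n)) \<longlonglongrightarrow> \<phi> f" by (simp add: LIM_zero_iff)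
    have "(\<lambda>n. ip f (X n) - ip f h) \<longlonglongrightarrow> 0"
    proof (rule Lim_null_comparison)
      show "\<forall>\<^sub>F n in sequentially. norm (ip f (X n) - ip f h) \<le> nm f * sqrt (nsq (\<lambda>t. X n t - h t))"
        using cauchy_schwarz[OF fV diff_mem[OF XV hV]] ip_diff_right[OF XV hV fV]
        by (intro always_eventually) (simp add: nm_def)
      show "(\<lambda>n. nm f * sqrt (nsq (\<lambda>t. X n t - h t))) \<longlonglongrightarrow> 0"
        using tendsto_mult_left[OF tendsto_real_sqrt[OF h], of "nm f"] by simp
    qed
    then have "(\<lambda>n. ip f (X n)) \<longlonglongrightarrow> ip f h" by (simp add: LIM_zero_iff)
    then show ?thesis using a LIMSEQ_unique by blast
  qed
  then show ?thesis using hV by blast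
qed

end


section \<open>The space of square integrable functions\<close>

definition sq_space :: "'b measure \<Rightarrow> ('b \<Rightarrow> complex) set" where
  "sq_space M = {f \<in> borel_measurable M. integrable M (\<lambda>t. (cmod (f t))\<^sup>2)}"

definition sq_ip :: "'b measure \<Rightarrow> ('b \<Rightarrow> complex) \<Rightarrow> ('b \<Rightarrow> complex) \<Rightarrow> complex" where
  "sq_ip M f g = (LINT t|M. f t * cnj (g t))"

lemma sq_space_measurable [measurable_dest]: "f \<in> sq_space M \<Longrightarrow> f \<in> borel_measurable M"
  by (simp add: sq_space_def)

lemma sq_space_integrable: "f \<in> sq_space M \<Longrightarrow> integrable M (\<lambda>t. (cmod (f t))\<^sup>2)"
  by (simp add: sq_space_def)

lemma cnj_measurable [measurable]: "cnj \<in> borel_measurable borel"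
  by (intro borel_measurable_continuous_onI continuous_intros)

lemma cmod_mult_le: "cmod (a * b) \<le> (cmod a)\<^sup>2 + (cmod b)\<^sup>2"
proof -
  have "2 * (cmod a * cmod b) \<le> (cmod a)\<^sup>2 + (cmod b)\<^sup>2"
    using sum_squares_bound[of "cmod a" "cmod b"] by simp
  moreover have "0 \<le> cmod a * cmod b" by simp
  ultimately show ?thesis unfolding norm_mult by linarith
qed

lemma cmod_add_sq_le: "(cmod (a + b))\<^sup>2 \<le> 2 * (cmod a)\<^sup>2 + 2 * (cmod b)\<^sup>2"
proof -
  have "(cmod (a + b))\<^sup>2 \<le> (cmod a + cmod b)\<^sup>2"
    by (intro power_mono norm_triangle_ineq norm_ge_zero)
  also have "\<dots> \<le> 2 * (cmod a)\<^sup>2 + 2 * (cmod b)\<^sup>2"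
    using sum_squares_bound[of "cmod a" "cmod b"] by (simp add: power2_sum)
  finally show ?thesis .
qed

lemma sq_space_mult_integrable:
  assumes "f \<in> sq_space M" "g \<in> sq_space M"
  shows "integrable M (\<lambda>t. f t * cnj (g t))"
proof (rule Bochner_Integration.integrable_bound)
  show "integrable M (\<lambda>t. (cmod (f t))\<^sup>2 + (cmod (g t))\<^sup>2)"
    using assms by (intro Bochner_Integration.integrable_add sq_space_integrable)
  show "(\<lambda>t. f t * cnj (g t)) \<in> borel_measurable M"
    using assms by measurable
  show "AE t in M. norm (f t * cnj (g t)) \<le> norm ((cmod (f t))\<^sup>2 + (cmod (g t))\<^sup>2)"
  proof (rule AE_I2)
    fix t show "norm (f t * cnj (g t)) \<le> norm ((cmod (f t))\<^sup>2 + (cmod (g t))\<^sup>2)"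
      using cmod_mult_le[of "f t" "cnj (g t)"] by simp
  qed
qed

lemma sq_space_bound:
  assumes "g \<in> sq_space M" "f \<in> borel_measurable M" "\<And>t. t \<in> space M \<Longrightarrow> cmod (f t) \<le> C * cmod (g t)"
  shows "f \<in> sq_space M"
proof -
  have "integrable M (\<lambda>t. (cmod (f t))\<^sup>2)"
  proof (rule Bochner_Integration.integrable_bound)
    show "integrable M (\<lambda>t. C\<^sup>2 * (cmod (g t))\<^sup>2)"
      using sq_space_integrable[OF assms(1)] by simp
    show "AE t in M. norm ((cmod (f t))\<^sup>2) \<le> norm (C\<^sup>2 * (cmod (g t))\<^sup>2)"
    proof (rule AE_I2)
      fix t assume "t \<in> space M"
      then have "(cmod (f t))\<^sup>2 \<le> (C * cmod (g t))\<^sup>2" using assms(3) by (intro power_mono) auto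
      then show "norm ((cmod (f t))\<^sup>2) \<le> norm (C\<^sup>2 * (cmod (g t))\<^sup>2)"
        by (simp add: power_mult_distrib)
    qed
  qed (use assms(2) in measurable)
  then show ?thesis using assms(2) by (simp add: sq_space_def)
qed

lemma sq_space_lin:
  assumes "f \<in> sq_space M" "g \<in> sq_space M"
  shows "(\<lambda>t. a * f t + g t) \<in> sq_space M"
proof -
  have "integrable M (\<lambda>t. (cmod (a * f t + g t))\<^sup>2)"
  proof (rule Bochner_Integration.integrable_bound)
    show "integrable M (\<lambda>t. 2 * (cmod a)\<^sup>2 * (cmod (f t))\<^sup>2 + 2 * (cmod (g t))\<^sup>2)"
      using assms by (intro Bochner_Integration.integrable_add integrable_mult_right sq_space_integrable)
    show "AE t in M. norm ((cmod (a * f t + g t))\<^sup>2) \<le> norm (2 * (cmod a)\<^sup>2 * (cmod (f t))\<^sup>2 + 2 * (cmod (g t))\<^sup>2)"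
    proof (rule AE_I2)
      fix t show "norm ((cmod (a * f t + g t))\<^sup>2) \<le> norm (2 * (cmod a)\<^sup>2 * (cmod (f t))\<^sup>2 + 2 * (cmod (g t))\<^sup>2)"
        using cmod_add_sq_le[of "a * f t" "g t"] by (simp add: norm_mult power_mult_distrib)
    qed
  qed (use assms in measurable)
  moreover have "(\<lambda>t. a * f t + g t) \<in> borel_measurable M" using assms by measurable
  ultimately show ?thesis by (simp add: sq_space_def)
qed

interpretation sq: semi_ip "sq_space M" "sq_ip M" for M
proof
  show "(\<lambda>_. 0) \<in> sq_space M" by (simp add: sq_space_def)
  show "(\<lambda>t. a * f t + g t) \<in> sq_space M" if "f \<in> sq_space M" "g \<in> sq_space M" for f g a
    using that by (rule sq_space_lin)
  show "sq_ip M (\<lambda>t. a * f t + g t) h = a * sq_ip M f h + sq_ip M g h"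
    if "f \<in> sq_space M" "g \<in> sq_space M" "h \<in> sq_space M" for f g h a
    using sq_space_mult_integrable[OF that(1,3)] sq_space_mult_integrable[OF that(2,3)]
    by (simp add: sq_ip_def distrib_right mult.assoc)
  show "sq_ip M g f = cnj (sq_ip M f g)" if "f \<in> sq_space M" "g \<in> sq_space M" for f g
    using Bochner_Integration.integral_cnj[of M "\<lambda>t. f t * cnj (g t)"]
    by (simp add: sq_ip_def mult.commute del: Bochner_Integration.integral_cnj)
  show "0 \<le> Re (sq_ip M f f)" if "f \<in> sq_space M" for f
  proof -
    have "(\<lambda>t. f t * cnj (f t)) = (\<lambda>t. of_real ((cmod (f t))\<^sup>2))"
      by (rule ext) (rule complex_norm_square[symmetric])
    then show ?thesis by (simp only: sq_ip_def integral_complex_of_real Re_complex_of_real) simp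
  qed
qed

lemma sq_nsq: "sq.nsq M f = (LINT t|M. (cmod (f t))\<^sup>2)"
proof -
  have "(\<lambda>t. f t * cnj (f t)) = (\<lambda>t. of_real ((cmod (f t))\<^sup>2))"
    by (rule ext) (rule complex_norm_square[symmetric])
  then show ?thesis by (simp only: sq.nsq_def sq_ip_def integral_complex_of_real Re_complex_of_real)
qed

lemma sq_nn: "f \<in> sq_space M \<Longrightarrow> (\<integral>\<^sup>+t. ennreal ((cmod (f t))\<^sup>2) \<partial>M) = ennreal (sq.nsq M f)"
  unfolding sq_nsq by (intro nn_integral_eq_integral sq_space_integrable) auto

lemma sq_spaceI:
  assumes "f \<in> borel_measurable M" "(\<integral>\<^sup>+t. ennreal ((cmod (f t))\<^sup>2) \<partial>M) \<le> ennreal C"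
  shows "f \<in> sq_space M" and "0 \<le> C \<Longrightarrow> sq.nsq M f \<le> C"
proof -
  have "integrable M (\<lambda>t. (cmod (f t))\<^sup>2)"
    using assms by (intro integrableI_bounded) (auto intro: le_less_trans)
  then show 1: "f \<in> sq_space M" using assms by (simp add: sq_space_def)
  show "sq.nsq M f \<le> C" if "0 \<le> C"
    using assms(2) sq_nn[OF 1] that by (simp add: ennreal_le_iff)
qed

text \<open>Riesz--Fischer: a rapidly Cauchy subsequence converges almost everywhere, and Fatou's lemma
  turns this into convergence in the seminorm.\<close>

lemma sq_complete:
  fixes X :: "nat \<Rightarrow> 'b \<Rightarrow> complex"
  assumes XV: "\<And>n. X n \<in> sq_space M"
    and cauchy: "\<And>e. e > 0 \<Longrightarrow> \<exists>N. \<forall>m\<ge>N. \<forall>n\<ge>N. sq.nsq M (\<lambda>t. X m t - X n t) < e"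
  shows "\<exists>h\<in>sq_space M. (\<lambda>n. sq.nsq M (\<lambda>t. X n t - h t)) \<longlonglongrightarrow> 0"
proof -
  \<comment> \<open>The bound \<open>(1/4)^k\<close> leaves a geometric series even after the weight
    \<open>2^k\<close> inserted below.\<close>
  have "\<exists>N. \<forall>m\<ge>N. \<forall>n\<ge>N. sq.nsq M (\<lambda>t. X m t - X n t) < (1/4)^k" for k
    by (rule cauchy) simp
  then obtain N where N: "\<And>k m n. m \<ge> N k \<Longrightarrow> n \<ge> N k \<Longrightarrow> sq.nsq M (\<lambda>t. X m t - X n t) < (1/4)^k"
    by metis
  define r where "r = rec_nat (N 0) (\<lambda>k rk. max (Suc rk) (N (Suc k)))"
  have rS: "r (Suc k) = max (Suc (r k)) (N (Suc k))" for k by (simp add: r_def)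
  have rN: "r k \<ge> N k" for k
    by (cases k) (simp_all add: r_def)
  have r_mono: "strict_mono r" by (simp add: strict_mono_Suc_iff rS less_max_iff_disj)
  define d where "d k t = X (r (Suc k)) t - X (r k) t" for k t
  have dV: "d k \<in> sq_space M" for k unfolding d_def using XV by (intro sq.diff_mem)
  have [measurable]: "X n \<in> borel_measurable M" "d n \<in> borel_measurable M" for n
    using XV dV by (auto dest: sq_space_measurable)
  have d_le: "sq.nsq M (d k) \<le> (1/4)^k" for k
  proof -
    have "N k \<le> r (Suc k)" using rN[of k] by (simp add: rS)
    then show ?thesis unfolding d_def using N[of k "r (Suc k)" "r k"] rN[of k] by simp
  qed
  \<comment> \<open>The weight \<open>2^k\<close> turns the finiteness of one integral into a
    pointwise geometric bound on the increments \<open>d k t\<close>, hence into absolute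
    convergence almost everywhere.\<close>
  have "(\<integral>\<^sup>+t. (\<Sum>k. ennreal (2^k * (cmod (d k t))\<^sup>2)) \<partial>M) = (\<Sum>k. \<integral>\<^sup>+t. ennreal (2^k * (cmod (d k t))\<^sup>2) \<partial>M)"
    by (intro nn_integral_suminf) measurable
  also have "\<dots> \<le> (\<Sum>k. ennreal ((1/2)^k))"
  proof (intro suminf_le summableI)
    fix k
    have "(\<integral>\<^sup>+t. ennreal (2^k * (cmod (d k t))\<^sup>2) \<partial>M) = ennreal (2^k) * (\<integral>\<^sup>+t. ennreal ((cmod (d k t))\<^sup>2) \<partial>M)"
      by (simp add: ennreal_mult nn_integral_cmult)
    also have "\<dots> = ennreal (2^k * sq.nsq M (d k))"
      by (simp add: sq_nn[OF dV] ennreal_mult' )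
    also have "\<dots> \<le> ennreal ((1/2)^k)"
    proof (rule ennreal_leI)
      have "2^k * sq.nsq M (d k) \<le> 2^k * (1/4)^k" using d_le by simp
      also have "\<dots> = (1/2)^k" by (simp add: power_mult_distrib[symmetric])
      finally show "2^k * sq.nsq M (d k) \<le> (1/2)^k" .
    qed
    finally show "(\<integral>\<^sup>+t. ennreal (2^k * (cmod (d k t))\<^sup>2) \<partial>M) \<le> ennreal ((1/2)^k)" .
  qed
  also have "\<dots> = ennreal 2"
    using geometric_sums[of "1/2::real"] by (intro suminf_ennreal_eq) simp_all
  also have "\<dots> < \<infinity>" by simp
  finally have "AE t in M. (\<Sum>k. ennreal (2^k * (cmod (d k t))\<^sup>2)) \<noteq> \<infinity>"
    by (intro nn_integral_noteq_infinite) (auto simp: less_top)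
  then have conv: "AE t in M. convergent (\<lambda>k. X (r k) t)"
  proof eventually_elim
    fix t assume fin: "(\<Sum>k. ennreal (2^k * (cmod (d k t))\<^sup>2)) \<noteq> \<infinity>"
    define u where "u k = ennreal (2^k * (cmod (d k t))\<^sup>2)" for k
    define s where "s = suminf u"
    have "s \<noteq> \<infinity>" unfolding s_def u_def by (rule fin)
    then obtain C where C: "C \<ge> 0" "s = ennreal C" by (cases s) auto
    have nd: "norm (d k t) \<le> sqrt C * (sqrt (1/2))^k" for k
    proof -
      have "u k \<le> s"
        unfolding s_def using sum_le_suminf[OF summableI, of "{k}" u] by simp
      then have "ennreal (2^k * (cmod (d k t))\<^sup>2) \<le> ennreal C"
        unfolding C(2) u_def .
      then have "2^k * (cmod (d k t))\<^sup>2 \<le> C" using C by (simp add: ennreal_le_iff)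
      then have "(cmod (d k t))\<^sup>2 \<le> C * (1/2)^k" by (simp add: power_divide field_simps)
      then have "cmod (d k t) \<le> sqrt (C * (1/2)^k)" by (intro real_le_rsqrt)
      then show ?thesis by (simp add: real_sqrt_mult real_sqrt_power)
    qed
    have sg: "summable (\<lambda>k. sqrt C * (sqrt (1/2))^k)"
      by (intro summable_mult summable_geometric) (simp add: real_sqrt_divide)
    have "summable (\<lambda>k. d k t)" by (rule summable_comparison_test'[OF sg nd])
    then have "convergent (\<lambda>n. \<Sum>k<n. d k t)" by (simp add: summable_iff_convergent)
    moreover have "(\<Sum>k<n. d k t) = X (r n) t - X (r 0) t" for n
      unfolding d_def by (rule sum_lessThan_telescope)
    ultimately have "convergent (\<lambda>n. (X (r n) t - X (r 0) t) + X (r 0) t)"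
      by (intro convergent_add convergent_const) simp
    then show "convergent (\<lambda>k. X (r k) t)" by simp
  qed
  define h where "h t = lim (\<lambda>k. X (r k) t)" for t
  have [measurable]: "h \<in> borel_measurable M" unfolding h_def by measurable
  have le: "(\<integral>\<^sup>+t. ennreal ((cmod (X n t - h t))\<^sup>2) \<partial>M) \<le> ennreal ((1/4)^j)" if "n \<ge> N j" for n j
  proof -
    have "(\<integral>\<^sup>+t. ennreal ((cmod (X n t - h t))\<^sup>2) \<partial>M)
        \<le> (\<integral>\<^sup>+t. liminf (\<lambda>k. ennreal ((cmod (X n t - X (r k) t))\<^sup>2)) \<partial>M)"
    proof (rule nn_integral_mono_AE)
      show "AE t in M. ennreal ((cmod (X n t - h t))\<^sup>2) \<le> liminf (\<lambda>k. ennreal ((cmod (X n t - X (r k) t))\<^sup>2))"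
        using conv
      proof eventually_elim
        fix t assume "convergent (\<lambda>k. X (r k) t)"
        then have "(\<lambda>k. X (r k) t) \<longlonglongrightarrow> h t" by (simp add: h_def convergent_LIMSEQ_iff)
        then have "(\<lambda>k. ennreal ((cmod (X n t - X (r k) t))\<^sup>2)) \<longlonglongrightarrow> ennreal ((cmod (X n t - h t))\<^sup>2)"
          by (intro tendsto_ennrealI tendsto_intros)
        then show "ennreal ((cmod (X n t - h t))\<^sup>2) \<le> liminf (\<lambda>k. ennreal ((cmod (X n t - X (r k) t))\<^sup>2))"
          using lim_imp_Liminf[OF sequentially_bot] by (metis order_refl)
      qed
    qed
    also have "\<dots> \<le> liminf (\<lambda>k. \<integral>\<^sup>+t. ennreal ((cmod (X n t - X (r k) t))\<^sup>2) \<partial>M)"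
      by (intro nn_integral_liminf) measurable
    also have "\<dots> \<le> ennreal ((1/4)^j)"
    proof (rule Liminf_le)
      show "\<forall>\<^sub>F k in sequentially. (\<integral>\<^sup>+t. ennreal ((cmod (X n t - X (r k) t))\<^sup>2) \<partial>M) \<le> ennreal ((1/4)^j)"
      proof (rule eventually_sequentiallyI[of "N j"])
        fix k assume "N j \<le> k"
        then have "N j \<le> r k" using seq_suble[OF r_mono, of k] by simp
        then have "sq.nsq M (\<lambda>t. X n t - X (r k) t) \<le> (1/4)^j" using N[of j n "r k"] that by simp
        then show "(\<integral>\<^sup>+t. ennreal ((cmod (X n t - X (r k) t))\<^sup>2) \<partial>M) \<le> ennreal ((1/4)^j)"
          by (subst sq_nn) (auto intro: sq.diff_mem XV ennreal_leI)
      qed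
    qed simp
    finally show ?thesis .
  qed
  have diffV: "(\<lambda>t. X n t - h t) \<in> sq_space M" "sq.nsq M (\<lambda>t. X n t - h t) \<le> (1/4)^j" if "n \<ge> N j" for n j
    using sq_spaceI[OF _ le[OF that]] by simp_all
  have hV: "h \<in> sq_space M"
    using sq.diff_mem[OF XV[of "N 0"] diffV(1)[of 0 "N 0"]] by simp
  moreover have "(\<lambda>n. sq.nsq M (\<lambda>t. X n t - h t)) \<longlonglongrightarrow> 0"
  proof (rule LIMSEQ_I)
    fix e :: real assume "e > 0"
    then obtain j where "(1/4)^j < e" using real_arch_pow_inv[of e "1/4"] by auto
    then show "\<exists>no. \<forall>n\<ge>no. norm (sq.nsq M (\<lambda>t. X n t - h t) - 0) < e"
      using diffV(2)[of j] sq.nsq_nonneg[OF sq.diff_mem[OF XV hV]]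
      by (intro exI[of _ "N j"]) (auto intro: le_less_trans)
  qed
  ultimately show ?thesis by blast
qed

section \<open>Exponentials and Gaussian kernels\<close>

lemma expo_eq_cis: "expo l t = cis (2 * pi * (l \<bullet> t))"
  by (simp add: expo_def cis_conv_exp mult.commute mult.left_commute)

lemma norm_expo [simp]: "cmod (expo l t) = 1"
  by (simp add: expo_eq_cis)

lemma expo_add: "expo (l + m) t = expo l t * expo m t"
  by (simp add: expo_eq_cis cis_mult inner_add_left algebra_simps)

lemma expo_0 [simp]: "expo 0 t = 1"
  by (simp add: expo_eq_cis)

lemma cnj_expo: "cnj (expo l t) = expo (- l) t"
  by (simp add: expo_eq_cis cis_cnj)

lemma expo_commute: "expo l t = expo t l"
  by (simp add: expo_eq_cis inner_commute)

lemma expo_diff: "expo (l - m) t = expo l t * cnj (expo m t)"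
  using expo_add[of l "-m" t] by (simp add: cnj_expo)

lemma expo_pair_measurable [measurable (raw)]:
  assumes [measurable]: "f \<in> borel_measurable M" "g \<in> borel_measurable M"
  shows "(\<lambda>x. expo (f x) (g x)) \<in> borel_measurable M"
  unfolding expo_def by measurable

section \<open>Fourier transforms of Gaussians\<close>

lemma lborel_integral_prod:
  fixes f :: "'a::euclidean_space \<Rightarrow> real \<Rightarrow> complex"
  assumes "\<And>b. b \<in> Basis \<Longrightarrow> integrable lborel (f b)"
  shows "integrable lborel (\<lambda>x::'a. \<Prod>b\<in>Basis. f b (x \<bullet> b))" (is ?I)
    and "(LINT x|lborel. (\<Prod>b\<in>Basis. f b ((x::'a) \<bullet> b))) = (\<Prod>b\<in>Basis. LINT y|lborel. f b y)" (is ?E)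
proof -
  interpret product_sigma_finite "\<lambda>b::'a. lborel :: real measure"
    by standard
  let ?P = "\<Pi>\<^sub>M b\<in>(Basis::'a set). (lborel :: real measure)"
  let ?T = "\<lambda>h::'a \<Rightarrow> real. \<Sum>b\<in>Basis. h b *\<^sub>R b"
  have [measurable]: "?T \<in> measurable ?P borel" by measurable
  have [measurable]: "\<And>b. b \<in> Basis \<Longrightarrow> f b \<in> borel_measurable borel"
    using borel_measurable_integrable[OF assms] by simp
  have meas: "(\<lambda>x::'a. \<Prod>b\<in>Basis. f b (x \<bullet> b)) \<in> borel_measurable borel"
    by measurable
  have eq: "(\<Prod>b\<in>Basis. f b (?T h \<bullet> b)) = (\<Prod>b\<in>Basis. f b (h b))" for h
    by (intro prod.cong) (auto simp: inner_sum_left inner_Basis if_distrib[of "\<lambda>x. _ * x"] cong: if_cong)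
  have int: "integrable ?P (\<lambda>h. \<Prod>b\<in>Basis. f b (h b))"
    using assms by (intro product_integrable_prod) auto
  show ?I
    by (subst lborel_eq, subst integrable_distr_eq) (use meas int eq in \<open>simp_all\<close>)
  have "(LINT x|lborel. (\<Prod>b\<in>Basis. f b ((x::'a) \<bullet> b))) = (LINT h|?P. (\<Prod>b\<in>Basis. f b (h b)))"
    by (subst lborel_eq, subst integral_distr) (use meas eq in \<open>simp_all\<close>)
  also have "\<dots> = (\<Prod>b\<in>Basis. LINT y|lborel. f b y)"
    using assms by (intro product_integral_prod) auto
  finally show ?E .
qed

text \<open>Substitute x = s y in the characteristic function of the standard normal distribution,
  taken at \<open>t = 2 * pi * v / s\<close>. The value is itself a normal density, of standard
  deviation \<open>s / (2 * pi)\<close>.\<close>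

lemma gaussian_fourier_real:
  fixes s v :: real
  assumes "s > 0"
  shows "integrable lborel (\<lambda>y. of_real (exp (- s\<^sup>2 * y\<^sup>2 / 2)) * cis (2 * pi * y * v))" (is ?I)
    and "(LINT y|lborel. of_real (exp (- s\<^sup>2 * y\<^sup>2 / 2)) * cis (2 * pi * y * v))
         = of_real (normal_density 0 (s / (2 * pi)) v)" (is ?E)
proof -
  define t where "t = 2 * pi * v / s"
  let ?g = "\<lambda>x. of_real (std_normal_density x) * cis (t * x)"
  have st: "(LINT x|std_normal_distribution. iexp (t * x)) = of_real (exp (- t\<^sup>2 / 2))"
    using char_std_normal_distribution by (simp add: char_def fun_eq_iff)
  have "(LINT x|std_normal_distribution. iexp (t * x)) = (LINT x|lborel. std_normal_density x *\<^sub>R iexp (t * x))"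
    by (intro integral_density) auto
  then have E0: "(LINT x|lborel. ?g x) = of_real (exp (- t\<^sup>2 / 2))"
    using st by (simp add: scaleR_conv_of_real cis_conv_exp)
  have I0: "integrable lborel ?g"
  proof (rule Bochner_Integration.integrable_bound)
    show "integrable lborel std_normal_density" by simp
    have "(\<lambda>x. cis (t * x)) \<in> borel_measurable borel"
      by (intro borel_measurable_continuous_onI continuous_intros)
    then show "?g \<in> borel_measurable lborel" by simp
  qed (simp add: norm_mult)
  have eq: "?g (0 + s * y) = of_real (1 / sqrt (2 * pi)) * (of_real (exp (- s\<^sup>2 * y\<^sup>2 / 2)) * cis (2 * pi * y * v))" for y
    using assms by (simp add: normal_density_def t_def power_mult_distrib field_simps)
  have I1: "integrable lborel (\<lambda>y. ?g (0 + s * y))"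
    using assms by (subst lborel_integrable_real_affine_iff) (use I0 in auto)
  show ?I
  proof -
    define h where "h y = of_real (exp (- s\<^sup>2 * y\<^sup>2 / 2)) * cis (2 * pi * y * v)" for y
    have "integrable lborel (\<lambda>y. of_real (sqrt (2 * pi)) * (of_real (1 / sqrt (2 * pi)) * h y))"
      using integrable_mult_right[OF I1, of "of_real (sqrt (2 * pi))"] unfolding eq h_def .
    then have "integrable lborel h" by (simp flip: mult.assoc of_real_mult)
    then show ?thesis unfolding h_def .
  qed
  have "of_real (exp (- t\<^sup>2 / 2)) = s *\<^sub>R (LINT y|lborel. ?g (0 + s * y))"
    using lborel_integral_real_affine[of s ?g 0] assms E0 by simp
  also have "(LINT y|lborel. ?g (0 + s * y)) = of_real (1 / sqrt (2 * pi)) *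
      (LINT y|lborel. of_real (exp (- s\<^sup>2 * y\<^sup>2 / 2)) * cis (2 * pi * y * v))"
    unfolding eq by (rule integral_mult_right_zero)
  finally have "(LINT y|lborel. of_real (exp (- s\<^sup>2 * y\<^sup>2 / 2)) * cis (2 * pi * y * v))
     = of_real (sqrt (2 * pi) / s * exp (- t\<^sup>2 / 2))"
    using assms by (simp add: scaleR_conv_of_real field_simps)
  also have "sqrt (2 * pi) / s * exp (- t\<^sup>2 / 2) = normal_density 0 (s / (2 * pi)) v"
  proof -
    have a: "2 * pi * (s / (2 * pi))\<^sup>2 = s\<^sup>2 / (2 * pi)" by (simp add: power2_eq_square)
    have b: "sqrt (s\<^sup>2 / (2 * pi)) = s / sqrt (2 * pi)" using assms by (simp add: real_sqrt_divide)
    have c: "(v - 0)\<^sup>2 / (2 * (s / (2 * pi))\<^sup>2) = t\<^sup>2 / 2"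
      using assms by (simp add: t_def power2_eq_square field_simps)
    show ?thesis unfolding normal_density_def a b minus_divide_left[symmetric] c by simp
  qed
  finally show ?E .
qed

definition gauss_weight :: "real \<Rightarrow> 'a::euclidean_space \<Rightarrow> real" where
  "gauss_weight s x = exp (- s\<^sup>2 * (x \<bullet> x) / 2)"

text \<open>The Fourier transform of \<open>gauss_weight s\<close>. It is a probability density that
  concentrates at 0 as s tends to 0, while the weight then tends to 1; the proof of Plancherel's
  identity rests on this pair of limits.\<close>

definition gauss_kernel :: "real \<Rightarrow> 'a::euclidean_space \<Rightarrow> real" where
  "gauss_kernel s u = (\<Prod>b\<in>Basis. normal_density 0 (s / (2 * pi)) (u \<bullet> b))"

lemma gauss_kernel_measurable [measurable]: "gauss_kernel s \<in> borel_measurable borel"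
  unfolding gauss_kernel_def by measurable

lemma gauss_weight_measurable [measurable]: "gauss_weight s \<in> borel_measurable borel"
  unfolding gauss_weight_def by measurable

lemma gauss_kernel_nonneg [simp]: "0 \<le> gauss_kernel s u"
  unfolding gauss_kernel_def by (intro prod_nonneg) simp

lemma gauss_weight_nonneg [simp]: "0 \<le> gauss_weight s u"
  unfolding gauss_weight_def by simp

lemma gauss_weight_le_1 [simp]: "gauss_weight s u \<le> 1"
  unfolding gauss_weight_def by simp

lemma gauss_fourier:
  fixes u :: "'a::euclidean_space"
  assumes "s > 0"
  shows "integrable lborel (\<lambda>x. of_real (gauss_weight s x) * expo u x)" (is ?I)
    and "(LINT x|lborel. of_real (gauss_weight s x) * expo u x) = of_real (gauss_kernel s u)" (is ?E)
proof -
  let ?f = "\<lambda>b::'a. \<lambda>y. of_real (exp (- s\<^sup>2 * y\<^sup>2 / 2)) * cis (2 * pi * y * (u \<bullet> b))"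
  have eq: "of_real (gauss_weight s x) * expo u x = (\<Prod>b\<in>Basis. ?f b (x \<bullet> b))" for x
  proof -
    have "gauss_weight s x = (\<Prod>b\<in>Basis. exp (- s\<^sup>2 * (x \<bullet> b)\<^sup>2 / 2))"
      unfolding gauss_weight_def
      by (simp add: exp_sum[symmetric] euclidean_inner[of x x] sum_divide_distrib sum_negf sum_distrib_left power2_eq_square)
    moreover have "expo u x = (\<Prod>b\<in>Basis. cis (2 * pi * (x \<bullet> b) * (u \<bullet> b)))"
      unfolding expo_eq_cis
      by (simp add: cis_conv_exp exp_sum[symmetric] euclidean_inner[of u x] sum_distrib_left mult_ac)
    ultimately show ?thesis by (simp add: prod.distrib)
  qed
  show ?I unfolding eq by (intro lborel_integral_prod gaussian_fourier_real assms)
  have "(LINT x|lborel. of_real (gauss_weight s x) * expo u x) = (\<Prod>b\<in>Basis. LINT y|lborel. ?f b y)"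
    unfolding eq by (intro lborel_integral_prod gaussian_fourier_real assms)
  also have "\<dots> = (\<Prod>b\<in>Basis. of_real (normal_density 0 (s / (2 * pi)) (u \<bullet> b)))"
    by (simp only: gaussian_fourier_real(2)[OF assms])
  finally show ?E by (simp add: gauss_kernel_def)
qed

lemma gauss_weight_integrable:
  assumes "s > 0"
  shows "integrable lborel (gauss_weight s :: 'a::euclidean_space \<Rightarrow> real)"
  using integrable_norm[OF gauss_fourier(1)[OF assms, of "0::'a"]] by simp

lemma gauss_kernel_nn_integral:
  assumes "s > 0"
  shows "(\<integral>\<^sup>+u. ennreal (gauss_kernel s (u::'a::euclidean_space)) \<partial>lborel) = 1"
proof -
  have s2: "s / (2 * pi) > 0" using assms by simp
  have "(\<integral>\<^sup>+u. ennreal (gauss_kernel s (u::'a)) \<partial>lborel)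
      = (\<integral>\<^sup>+u. (\<Prod>b\<in>Basis. ennreal (normal_density 0 (s / (2 * pi)) ((u::'a) \<bullet> b))) \<partial>lborel)"
    by (simp add: gauss_kernel_def prod_ennreal)
  also have "\<dots> = (\<Prod>b\<in>(Basis::'a set). \<integral>\<^sup>+y. ennreal (normal_density 0 (s / (2 * pi)) y) \<partial>lborel)"
    by (rule nn_integral_lborel_prod) simp_all
  also have "(\<integral>\<^sup>+y. ennreal (normal_density 0 (s / (2 * pi)) y) \<partial>lborel) = 1"
    using integrable_normal_density[OF s2, of 0] integral_normal_density[OF s2, of 0]
    by (subst nn_integral_eq_integral) auto
  finally show ?thesis by simp
qed

text \<open>Dilation by \<open>s\<close> reduces the concentration of the kernel near 0 to the mass
  that the single kernel with parameter 1 has on large balls.\<close>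

lemma gauss_kernel_scale:
  assumes "s > 0"
  shows "gauss_kernel s (s *\<^sub>R u) * s ^ DIM('a) = gauss_kernel 1 (u::'a::euclidean_space)"
proof -
  have "normal_density 0 (s / (2 * pi)) (s *\<^sub>R u \<bullet> b) * s = normal_density 0 (1 / (2 * pi)) (u \<bullet> b)" for b
  proof -
    have "sqrt (2 * pi * (s / (2 * pi))\<^sup>2) = s * sqrt (2 * pi * (1 / (2 * pi))\<^sup>2)"
      using assms by (simp add: power_divide real_sqrt_mult real_sqrt_divide)
    moreover have "(s * (u \<bullet> b) - 0)\<^sup>2 / (2 * (s / (2 * pi))\<^sup>2) = (u \<bullet> b - 0)\<^sup>2 / (2 * (1 / (2 * pi))\<^sup>2)"
      using assms by (simp add: power_divide power_mult_distrib)
    ultimately show ?thesis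
      using assms unfolding normal_density_def minus_divide_left[symmetric] by simp
  qed
  then show ?thesis
    unfolding gauss_kernel_def using prod.distrib[of "\<lambda>b. normal_density 0 (s / (2 * pi)) (s *\<^sub>R u \<bullet> b)" "\<lambda>_. s" Basis] by simp
qed

section \<open>Plancherel's theorem on a set of finite measure\<close>

lemma gauss_kernel_minus: "gauss_kernel s (- u) = gauss_kernel s (u::'a::euclidean_space)"
  unfolding gauss_kernel_def normal_density_def by simp

lemma gauss_kernel_commute: "gauss_kernel s (a - b) = gauss_kernel s (b - (a::'a::euclidean_space))"
  using gauss_kernel_minus[of s "b - a"] by simp

lemma nn_integral_lborel_shift:
  fixes f :: "'a::euclidean_space \<Rightarrow> ennreal"
  assumes [measurable]: "f \<in> borel_measurable borel"
  shows "(\<integral>\<^sup>+x. f (x - c) \<partial>lborel) = (\<integral>\<^sup>+x. f x \<partial>lborel)"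
proof -
  have "(\<integral>\<^sup>+x. f x \<partial>lborel) = (\<integral>\<^sup>+x. f x \<partial>distr lborel borel ((+) (- c)))"
    by (simp add: lborel_distr_plus)
  also have "\<dots> = (\<integral>\<^sup>+x. f (- c + x) \<partial>lborel)"
    by (subst nn_integral_distr) simp_all
  finally show ?thesis by simp
qed

lemma integrable_lborel_shift:
  fixes f :: "'a::euclidean_space \<Rightarrow> 'b::{banach, second_countable_topology}"
  assumes "integrable lborel f"
  shows "integrable lborel (\<lambda>x. f (x - c))" and "(LINT x|lborel. f (x - c)) = (LINT x|lborel. f x)"
proof -
  have [measurable]: "f \<in> borel_measurable borel" using borel_measurable_integrable[OF assms] by simp
  have "integrable (distr lborel borel ((+) (- c))) f" using assms by (simp add: lborel_distr_plus)
  then show "integrable lborel (\<lambda>x. f (x - c))"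
    by (subst (asm) integrable_distr_eq) simp_all
  have "(LINT x|lborel. f x) = (LINT x|distr lborel borel ((+) (- c)). f x)"
    by (simp add: lborel_distr_plus)
  then show "(LINT x|lborel. f (x - c)) = (LINT x|lborel. f x)"
    by (subst (asm) integral_distr) simp_all
qed

lemma nn_integral_gauss_kernel_shift:
  assumes "s > 0"
  shows "(\<integral>\<^sup>+u. ennreal (gauss_kernel s (u - (c::'a::euclidean_space))) \<partial>lborel) = 1"
  using nn_integral_lborel_shift[of "\<lambda>u. ennreal (gauss_kernel s u)" c] gauss_kernel_nn_integral[OF assms, where 'a='a]
  by simp

lemma nn_integral_lebesgue_on_le:
  assumes "S \<in> sets lebesgue"
  shows "(\<integral>\<^sup>+x. f x \<partial>lebesgue_on S) \<le> (\<integral>\<^sup>+x. f x \<partial>lborel)"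
proof -
  have "(\<integral>\<^sup>+x. f x \<partial>lebesgue_on S) = (\<integral>\<^sup>+x. f x * indicator S x \<partial>lebesgue)"
    using assms by (intro nn_integral_restrict_space) simp
  also have "\<dots> \<le> (\<integral>\<^sup>+x. f x \<partial>lebesgue)"
    by (intro nn_integral_mono) (simp add: indicator_def)
  finally show ?thesis by (simp add: nn_integral_completion)
qed

lemma nn_integral_lebesgue_on_ge:
  assumes "S \<in> sets lebesgue" "\<And>x. g x \<le> f x * indicator S x"
  shows "(\<integral>\<^sup>+x. g x \<partial>lborel) \<le> (\<integral>\<^sup>+x. f x \<partial>lebesgue_on S)"
proof -
  have "(\<integral>\<^sup>+x. f x \<partial>lebesgue_on S) = (\<integral>\<^sup>+x. f x * indicator S x \<partial>lebesgue)"
    using assms by (intro nn_integral_restrict_space) simp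
  also have "\<dots> \<ge> (\<integral>\<^sup>+x. g x \<partial>lebesgue)"
    by (intro nn_integral_mono assms)
  finally show ?thesis by (simp add: nn_integral_completion)
qed

lemma (in pair_sigma_finite) integrable_prod_mult:
  fixes f :: "'a \<Rightarrow> complex" and g :: "'b \<Rightarrow> complex"
  assumes "integrable M1 f" "integrable M2 g"
  shows "integrable (M1 \<Otimes>\<^sub>M M2) (\<lambda>p. f (fst p) * g (snd p))"
    and "(LINT p|(M1 \<Otimes>\<^sub>M M2). f (fst p) * g (snd p)) = (LINT x|M1. f x) * (LINT y|M2. g y)"
proof -
  have [measurable]: "f \<in> borel_measurable M1" "g \<in> borel_measurable M2" using assms by auto
  show 1: "integrable (M1 \<Otimes>\<^sub>M M2) (\<lambda>p. f (fst p) * g (snd p))"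
  proof (rule integrableI_bounded)
    have "(\<integral>\<^sup>+p. ennreal (norm (f (fst p) * g (snd p))) \<partial>(M1 \<Otimes>\<^sub>M M2))
        = (\<integral>\<^sup>+x. (\<integral>\<^sup>+y. ennreal (norm (f x)) * ennreal (norm (g y)) \<partial>M2) \<partial>M1)"
      by (subst M2.nn_integral_fst[symmetric]) (simp_all add: norm_mult ennreal_mult)
    also have "\<dots> = (\<integral>\<^sup>+x. ennreal (norm (f x)) \<partial>M1) * (\<integral>\<^sup>+y. ennreal (norm (g y)) \<partial>M2)"
      by (simp add: nn_integral_cmult nn_integral_multc)
    also have "\<dots> < \<infinity>"
      using assms by (simp add: integrable_iff_bounded ennreal_mult_less_top)
    finally show "(\<integral>\<^sup>+p. ennreal (norm (f (fst p) * g (snd p))) \<partial>(M1 \<Otimes>\<^sub>M M2)) < \<infinity>" .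
  qed measurable
  have "(LINT p|(M1 \<Otimes>\<^sub>M M2). f (fst p) * g (snd p)) = (LINT x|M1. (LINT y|M2. f x * g y))"
    using integral_fst'[OF 1] by simp
  then show "(LINT p|(M1 \<Otimes>\<^sub>M M2). f (fst p) * g (snd p)) = (LINT x|M1. f x) * (LINT y|M2. g y)"
    by simp
qed

locale fin_region =
  fixes S :: "'a::euclidean_space set"
  assumes S_meas: "S \<in> sets lebesgue" and S_fin: "emeasure lebesgue S < \<infinity>"
begin

abbreviation "M \<equiv> lebesgue_on S"

abbreviation "V \<equiv> sq_space M"

abbreviation "mS \<equiv> measure lebesgue S"

text \<open>The Fourier transform of \<open>f\<close> extended by zero outside \<open>S\<close>.
  Because \<open>S\<close> has finite measure, \<open>V\<close> consists of integrable functions, so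
  the transform is defined at every point and continuous.\<close>

definition ft :: "('a \<Rightarrow> complex) \<Rightarrow> 'a \<Rightarrow> complex" where
  "ft f x = sq_ip M f (expo x)"

lemma emeasure_S: "emeasure lebesgue S = ennreal mS"
  using S_fin by (simp add: emeasure_eq_ennreal_measure)

lemma fin_M: "finite_measure M"
  using S_meas S_fin by (intro finite_measure_lebesgue_on fmeasurableI)

sublocale M: finite_measure M by (rule fin_M)

sublocale PM: pair_sigma_finite M M ..

sublocale PL: pair_sigma_finite "M \<Otimes>\<^sub>M M" "lborel :: 'a measure" ..

lemma id_measurable: "(\<lambda>x. x) \<in> measurable M borel"
  by (intro measurable_restrict_space1 measurable_completion) simp

lemma expo_measurable [measurable]: "expo l \<in> borel_measurable M"
proof -
  note id_measurable [measurable]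
  show ?thesis by measurable
qed

lemma measure_M: "measure M S = mS"
  using S_meas by (simp add: measure_restrict_space)

lemma bounded_mem: "f \<in> borel_measurable M \<Longrightarrow> (\<And>t. t \<in> S \<Longrightarrow> cmod (f t) \<le> C) \<Longrightarrow> f \<in> V"
  by (rule sq_space_bound[of "\<lambda>_. 1" _ _ C]) (simp_all add: sq_space_def)

lemma expo_mem [simp]: "expo l \<in> V"
  by (rule bounded_mem[of _ 1]) auto

lemma nsq_expo: "sq.nsq M (expo l) = mS"
  by (simp add: sq_nsq measure_M)

lemma nm_expo: "sq.nm M (expo l) = sqrt mS"
  by (simp add: sq.nm_def nsq_expo)

lemma modulate_mem: "f \<in> V \<Longrightarrow> (\<lambda>t. f t * expo l t) \<in> V"
  by (rule sq_space_bound[of f _ _ 1]) (auto simp: norm_mult)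

lemma one_mem: "(\<lambda>_. 1) \<in> V"
  using expo_mem[of 0] unfolding expo_0[abs_def] .

lemma V_integrable: "f \<in> V \<Longrightarrow> integrable M f"
  using sq_space_mult_integrable[OF _ one_mem, of f] by simp

lemma ft_alt: "ft f x = (LINT t|M. f t * cnj (expo x t))"
  by (simp add: ft_def sq_ip_def)

lemma ft_integrable: "f \<in> V \<Longrightarrow> integrable M (\<lambda>t. f t * cnj (expo x t))"
  by (rule sq_space_mult_integrable) auto

lemma ft_bound: "f \<in> V \<Longrightarrow> cmod (ft f x) \<le> sq.nm M f * sqrt mS"
  using sq.cauchy_schwarz[of f M "expo x"] by (simp add: ft_def nm_expo)

lemma ft_diff: "f \<in> V \<Longrightarrow> g \<in> V \<Longrightarrow> ft (\<lambda>t. f t - g t) x = ft f x - ft g x"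
  by (simp add: ft_def sq.ip_diff)

lemma ft_lin: "f \<in> V \<Longrightarrow> g \<in> V \<Longrightarrow> ft (\<lambda>t. a * f t + g t) x = a * ft f x + ft g x"
  by (simp add: ft_def sq.ip_lin)

text \<open>Modulation by an exponential becomes translation of frequencies; this is how sample
  estimates for \<open>\<Lambda>\<close> are carried over to its translates.\<close>

lemma ft_modulate: "ft (\<lambda>t. f t * expo l t) x = ft f (x - l)"
  by (simp add: ft_alt expo_diff mult_ac)

lemma continuous_on_ft:
  assumes "f \<in> V"
  shows "continuous_on A (ft f)"
proof (rule continuous_on_subset[OF _ subset_UNIV], rule continuous_on_sequentiallyI)
  fix u :: "nat \<Rightarrow> 'a" and x assume u: "u \<longlonglongrightarrow> x"
  have [measurable]: "f \<in> borel_measurable M" using assms by (rule sq_space_measurable)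
  show "(\<lambda>n. ft f (u n)) \<longlonglongrightarrow> ft f x"
    unfolding ft_alt
  proof (rule integral_dominated_convergence)
    show "integrable M (\<lambda>t. cmod (f t))" using V_integrable[OF assms] by simp
    show "AE t in M. (\<lambda>n. f t * cnj (expo (u n) t)) \<longlonglongrightarrow> f t * cnj (expo x t)"
      unfolding expo_def by (intro AE_I2 tendsto_intros u)
    show "AE t in M. norm (f t * cnj (expo (u n) t)) \<le> cmod (f t)" for n
      by (simp add: norm_mult)
  qed measurable
qed

lemma ft_measurable [measurable]: "f \<in> V \<Longrightarrow> ft f \<in> borel_measurable borel"
  by (rule borel_measurable_continuous_onI[OF continuous_on_ft])

section \<open>Gaussian damping and Bessel's inequality for the Fourier transform\<close>

lemma gauss_identity:
  assumes f: "f \<in> V" and s: "s > 0"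
  shows "integrable lborel (\<lambda>x. gauss_weight s x * (cmod (ft f x))\<^sup>2)"
    and "integrable (M \<Otimes>\<^sub>M M) (\<lambda>p. f (fst p) * cnj (f (snd p)) * of_real (gauss_kernel s (snd p - fst p)))"
    and "of_real (LINT x|lborel. gauss_weight s x * (cmod (ft f x))\<^sup>2)
       = (LINT p|(M \<Otimes>\<^sub>M M). f (fst p) * cnj (f (snd p)) * of_real (gauss_kernel s (snd p - fst p)))"
proof -
  note id_measurable [measurable]
  have [measurable]: "f \<in> borel_measurable M" using f by (rule sq_space_measurable)
  have fi: "integrable M f" "integrable M (\<lambda>t. cnj (f t))" using V_integrable[OF f] by auto
  define h where "h = (\<lambda>(p::'a \<times> 'a). f (fst p) * cnj (f (snd p)))"
  have [measurable]: "h \<in> borel_measurable (M \<Otimes>\<^sub>M M)" unfolding h_def by measurable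
  have hi: "integrable (M \<Otimes>\<^sub>M M) h"
    using PM.integrable_prod_mult(1)[OF fi] by (simp add: h_def split_beta')
  have wi: "integrable lborel (\<lambda>x. complex_of_real (gauss_weight s (x::'a)))"
    using gauss_weight_integrable[OF s] by (rule integrable_of_real)
  \<comment> \<open>The Gaussian weight makes the triple integral absolutely convergent, so Fubini's
    theorem applies to the squared modulus of \<open>ft f x\<close> written as a double
    integral.\<close>
  define H where "H = (\<lambda>(p::'a \<times> 'a) (x::'a). h p * (of_real (gauss_weight s x) * expo (snd p - fst p) x))"
  have Hi: "integrable ((M \<Otimes>\<^sub>M M) \<Otimes>\<^sub>M lborel) (\<lambda>(p, x). H p x)"
  proof (rule Bochner_Integration.integrable_bound[OF PL.integrable_prod_mult(1)[OF hi wi]])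
    show "(\<lambda>(p, x). H p x) \<in> borel_measurable ((M \<Otimes>\<^sub>M M) \<Otimes>\<^sub>M lborel)"
      unfolding H_def by measurable
  qed (auto simp: H_def norm_mult)
  have inner1: "(LINT x|lborel. H p x) = f (fst p) * cnj (f (snd p)) * of_real (gauss_kernel s (snd p - fst p))" for p
    unfolding H_def by (simp add: h_def gauss_fourier(2)[OF s])
  have inner2: "(LINT p|(M \<Otimes>\<^sub>M M). H p x) = of_real (gauss_weight s x * (cmod (ft f x))\<^sup>2)" for x
  proof -
    have "H p x = of_real (gauss_weight s x) *
        ((f (fst p) * cnj (expo x (fst p))) * cnj (f (snd p) * cnj (expo x (snd p))))" for p
    proof -
      have "expo (snd p - fst p) x = expo x (snd p) * cnj (expo x (fst p))"
        unfolding expo_diff expo_commute[of "snd p" x] expo_commute[of "fst p" x] ..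
      then show ?thesis by (simp add: H_def h_def)
    qed
    then have "(LINT p|(M \<Otimes>\<^sub>M M). H p x) = of_real (gauss_weight s x) *
        (LINT p|(M \<Otimes>\<^sub>M M). (f (fst p) * cnj (expo x (fst p))) * cnj (f (snd p) * cnj (expo x (snd p))))"
      by simp
    also have "(LINT p|(M \<Otimes>\<^sub>M M). (f (fst p) * cnj (expo x (fst p))) * cnj (f (snd p) * cnj (expo x (snd p)))) = ft f x * cnj (ft f x)"
      unfolding ft_alt using PM.integrable_prod_mult(2)[OF ft_integrable[OF f, of x] integrable_cnj[OF ft_integrable[OF f, of x]]]
      by (simp only: Bochner_Integration.integral_cnj)
    finally show ?thesis using complex_norm_square[of "ft f x"] by simp
  qed
  have "integrable lborel (\<lambda>x. LINT p|(M \<Otimes>\<^sub>M M). H p x)" by (rule PL.integrable_snd[OF Hi])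
  then have "integrable lborel (\<lambda>x. complex_of_real (gauss_weight s x * (cmod (ft f x))\<^sup>2))"
    unfolding inner2 .
  then show 1: "integrable lborel (\<lambda>x. gauss_weight s x * (cmod (ft f x))\<^sup>2)"
    by (simp only: complex_of_real_integrable_eq)
  have "integrable (M \<Otimes>\<^sub>M M) (\<lambda>p. LINT x|lborel. H p x)" by (rule PL.integrable_fst[OF Hi])
  then show "integrable (M \<Otimes>\<^sub>M M) (\<lambda>p. f (fst p) * cnj (f (snd p)) * of_real (gauss_kernel s (snd p - fst p)))"
    unfolding inner1 .
  have "(LINT x|lborel. LINT p|(M \<Otimes>\<^sub>M M). H p x) = (LINT p|(M \<Otimes>\<^sub>M M). LINT x|lborel. H p x)"
    by (rule PL.Fubini_integral[OF Hi])
  then show "of_real (LINT x|lborel. gauss_weight s x * (cmod (ft f x))\<^sup>2)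
       = (LINT p|(M \<Otimes>\<^sub>M M). f (fst p) * cnj (f (snd p)) * of_real (gauss_kernel s (snd p - fst p)))"
    unfolding inner1 inner2 integral_complex_of_real .
qed

text \<open>Schur test: the product of \<open>cmod (f a)\<close> and \<open>cmod (f b)\<close> is at
  most the mean of the two squares, and integrating the kernel in the remaining variable costs a
  factor at most 1.\<close>

lemma gauss_bessel:
  assumes f: "f \<in> V" and s: "s > 0"
  shows "(\<integral>\<^sup>+x. ennreal (gauss_weight s x * (cmod (ft f x))\<^sup>2) \<partial>lborel) \<le> ennreal (sq.nsq M f)"
proof -
  note id_measurable [measurable]
  have [measurable]: "f \<in> borel_measurable M" using f by (rule sq_space_measurable)
  define G where "G = (\<lambda>(a, b). ennreal ((cmod (f a))\<^sup>2 * gauss_kernel s (b - a)))"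
  define G' where "G' = (\<lambda>(a, b). ennreal ((cmod (f b))\<^sup>2 * gauss_kernel s (b - a)))"
  have [measurable]: "G \<in> borel_measurable (M \<Otimes>\<^sub>M M)" "G' \<in> borel_measurable (M \<Otimes>\<^sub>M M)"
    unfolding G_def G'_def by measurable
  have k1: "(\<integral>\<^sup>+b. ennreal (gauss_kernel s (b - a)) \<partial>M) \<le> 1" for a
    using nn_integral_lebesgue_on_le[OF S_meas, of "\<lambda>b. ennreal (gauss_kernel s (b - a))"]
      nn_integral_gauss_kernel_shift[OF s, of a] by simp
  have one: "(\<integral>\<^sup>+a. (\<integral>\<^sup>+b. ennreal ((cmod (f a))\<^sup>2 * gauss_kernel s (b - a)) \<partial>M) \<partial>M) \<le> ennreal (sq.nsq M f)"
  proof -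
    have "(\<integral>\<^sup>+a. (\<integral>\<^sup>+b. ennreal ((cmod (f a))\<^sup>2 * gauss_kernel s (b - a)) \<partial>M) \<partial>M)
        = (\<integral>\<^sup>+a. ennreal ((cmod (f a))\<^sup>2) * (\<integral>\<^sup>+b. ennreal (gauss_kernel s (b - a)) \<partial>M) \<partial>M)"
      by (simp add: ennreal_mult nn_integral_cmult)
    also have "\<dots> \<le> (\<integral>\<^sup>+a. ennreal ((cmod (f a))\<^sup>2) * 1 \<partial>M)"
      by (intro nn_integral_mono mult_left_mono k1) simp
    finally show ?thesis by (simp add: sq_nn[OF f])
  qed
  have "ennreal (LINT x|lborel. gauss_weight s x * (cmod (ft f x))\<^sup>2)
      \<le> ennreal (cmod (of_real (LINT x|lborel. gauss_weight s x * (cmod (ft f x))\<^sup>2)))"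
    by (intro ennreal_leI) simp
  also have "\<dots> \<le> (\<integral>\<^sup>+p. ennreal (norm (f (fst p) * cnj (f (snd p)) * of_real (gauss_kernel s (snd p - fst p)))) \<partial>(M \<Otimes>\<^sub>M M))"
    unfolding gauss_identity(3)[OF f s] by (rule integral_norm_bound_ennreal[OF gauss_identity(2)[OF f s]])
  also have "\<dots> \<le> (\<integral>\<^sup>+p. (1/2) * G p + (1/2) * G' p \<partial>(M \<Otimes>\<^sub>M M))"
  proof (rule nn_integral_mono)
    fix p :: "'a \<times> 'a"
    define a b where "a = fst p" and "b = snd p"
    have "cmod (f a) * cmod (f b) \<le> (1/2) * (cmod (f a))\<^sup>2 + (1/2) * (cmod (f b))\<^sup>2"
      using sum_squares_bound[of "cmod (f a)" "cmod (f b)"] by simp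
    then have "cmod (f a) * cmod (f b) * gauss_kernel s (b - a)
        \<le> ((1/2) * (cmod (f a))\<^sup>2 + (1/2) * (cmod (f b))\<^sup>2) * gauss_kernel s (b - a)"
      by (rule mult_right_mono) simp
    then have "ennreal (norm (f a * cnj (f b) * of_real (gauss_kernel s (b - a))))
       \<le> ennreal ((1/2) * ((cmod (f a))\<^sup>2 * gauss_kernel s (b - a)) + (1/2) * ((cmod (f b))\<^sup>2 * gauss_kernel s (b - a)))"
      by (intro ennreal_leI) (simp add: norm_mult algebra_simps)
    also have "\<dots> = ennreal (1/2) * G (a, b) + ennreal (1/2) * G' (a, b)"
    proof -
      have "ennreal ((1/2) * X + (1/2) * Y) = ennreal (1/2) * ennreal X + ennreal (1/2) * ennreal Y"
        if "0 \<le> X" "0 \<le> Y" for X Y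
      proof -
        have "ennreal ((1/2) * X + (1/2) * Y) = ennreal ((1/2) * X) + ennreal ((1/2) * Y)"
          using that by (intro ennreal_plus) auto
        also have "ennreal ((1/2) * X) = ennreal (1/2) * ennreal X" by (rule ennreal_mult') simp
        also have "ennreal ((1/2) * Y) = ennreal (1/2) * ennreal Y" by (rule ennreal_mult') simp
        finally show ?thesis .
      qed
      then show ?thesis unfolding G_def G'_def prod.case by simp
    qed
    also have "ennreal (1/2) = 1/2" by (simp add: divide_ennreal_def)
    finally show "ennreal (norm (f (fst p) * cnj (f (snd p)) * of_real (gauss_kernel s (snd p - fst p))))
        \<le> (1/2) * G p + (1/2) * G' p" by (simp add: a_def b_def)
  qed
  also have "\<dots> = (1/2) * (\<integral>\<^sup>+p. G p \<partial>(M \<Otimes>\<^sub>M M)) + (1/2) * (\<integral>\<^sup>+p. G' p \<partial>(M \<Otimes>\<^sub>M M))"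
    by (simp add: nn_integral_add nn_integral_cmult)
  also have "(\<integral>\<^sup>+p. G p \<partial>(M \<Otimes>\<^sub>M M)) = (\<integral>\<^sup>+a. (\<integral>\<^sup>+b. ennreal ((cmod (f a))\<^sup>2 * gauss_kernel s (b - a)) \<partial>M) \<partial>M)"
    by (subst M.nn_integral_fst[symmetric]) (simp_all add: G_def)
  also have "(\<integral>\<^sup>+p. G' p \<partial>(M \<Otimes>\<^sub>M M)) = (\<integral>\<^sup>+a. (\<integral>\<^sup>+b. ennreal ((cmod (f a))\<^sup>2 * gauss_kernel s (b - a)) \<partial>M) \<partial>M)"
    by (subst PM.nn_integral_snd[symmetric]) (simp_all add: G'_def gauss_kernel_commute[of s] split_beta')
  also have "(1/2) * (\<integral>\<^sup>+a. (\<integral>\<^sup>+b. ennreal ((cmod (f a))\<^sup>2 * gauss_kernel s (b - a)) \<partial>M) \<partial>M) +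
      (1/2) * (\<integral>\<^sup>+a. (\<integral>\<^sup>+b. ennreal ((cmod (f a))\<^sup>2 * gauss_kernel s (b - a)) \<partial>M) \<partial>M)
      \<le> (1/2) * ennreal (sq.nsq M f) + (1/2) * ennreal (sq.nsq M f)"
    by (intro add_mono mult_left_mono one) simp_all
  also have "\<dots> = ennreal (sq.nsq M f)"
  proof -
    have h: "(1/2::ennreal) = ennreal (1/2)" by (simp add: divide_ennreal_def)
    have "(1/2::ennreal) + 1/2 = 1" unfolding h by (subst ennreal_plus[symmetric]) simp_all
    then show ?thesis by (metis distrib_right mult_1)
  qed
  finally have "ennreal (LINT x|lborel. gauss_weight s x * (cmod (ft f x))\<^sup>2) \<le> ennreal (sq.nsq M f)" .
  then show ?thesis
    by (subst nn_integral_eq_integral[OF gauss_identity(1)[OF f s]]) auto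
qed

text \<open>The Gaussian weight tends to 1 along \<open>1 / Suc n\<close>, and Fatou's lemma passes
  the damped inequality to the limit.\<close>

lemma ft_bessel:
  assumes f: "f \<in> V"
  shows "(\<integral>\<^sup>+x. ennreal ((cmod (ft f x))\<^sup>2) \<partial>lborel) \<le> ennreal (sq.nsq M f)"
    and "ft f \<in> sq_space lborel" and "sq.nsq lborel (ft f) \<le> sq.nsq M f"
proof -
  let ?w = "\<lambda>n (x::'a). gauss_weight (1 / real (Suc n)) x"
  have [measurable]: "ft f \<in> borel_measurable borel" by (rule ft_measurable[OF f])
  have "(\<integral>\<^sup>+x. ennreal ((cmod (ft f x))\<^sup>2) \<partial>lborel)
      \<le> (\<integral>\<^sup>+x. liminf (\<lambda>n. ennreal (?w n x * (cmod (ft f x))\<^sup>2)) \<partial>lborel)"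
  proof (rule nn_integral_mono)
    fix x :: 'a
    have "(\<lambda>n. ?w n x) \<longlonglongrightarrow> exp (- 0\<^sup>2 * (x \<bullet> x) / 2)"
      unfolding gauss_weight_def by (intro tendsto_intros LIMSEQ_Suc[OF lim_const_over_n]) simp
    then have "(\<lambda>n. ?w n x * (cmod (ft f x))\<^sup>2) \<longlonglongrightarrow> 1 * (cmod (ft f x))\<^sup>2"
      by (intro tendsto_mult tendsto_const) simp
    then have "(\<lambda>n. ennreal (?w n x * (cmod (ft f x))\<^sup>2)) \<longlonglongrightarrow> ennreal (1 * (cmod (ft f x))\<^sup>2)"
      by (rule tendsto_ennrealI)
    from lim_imp_Liminf[OF sequentially_bot this]
    show "ennreal ((cmod (ft f x))\<^sup>2) \<le> liminf (\<lambda>n. ennreal (?w n x * (cmod (ft f x))\<^sup>2))"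
      by simp
  qed
  also have "\<dots> \<le> liminf (\<lambda>n. \<integral>\<^sup>+x. ennreal (?w n x * (cmod (ft f x))\<^sup>2) \<partial>lborel)"
    by (intro nn_integral_liminf) measurable
  also have "\<dots> \<le> ennreal (sq.nsq M f)"
    by (intro Liminf_le always_eventually allI gauss_bessel f) simp_all
  finally show 1: "(\<integral>\<^sup>+x. ennreal ((cmod (ft f x))\<^sup>2) \<partial>lborel) \<le> ennreal (sq.nsq M f)" .
  show "ft f \<in> sq_space lborel" "sq.nsq lborel (ft f) \<le> sq.nsq M f"
    using sq_spaceI[OF _ 1] f sq.nsq_nonneg[OF f] by auto
qed


section \<open>Plancherel's identity for indicator functions\<close>

lemma gauss_kernel_mass:
  assumes "d > 0" "\<epsilon> > 0"
  shows "\<exists>s0>0. \<forall>s. 0 < s \<and> s \<le> s0 \<longrightarrow>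
    ennreal (1 - \<epsilon>) \<le> (\<integral>\<^sup>+u. ennreal (gauss_kernel s (u::'a)) * indicator (ball 0 d) u \<partial>lborel)"
proof -
  let ?I = "\<lambda>n::nat. \<integral>\<^sup>+u. ennreal (gauss_kernel 1 (u::'a)) * indicator (ball 0 (real n)) u \<partial>lborel"
  have [measurable]: "ball (0::'a) r \<in> sets borel" for r by simp
  have "(\<lambda>n. ?I n) \<longlonglongrightarrow> (\<integral>\<^sup>+u. ennreal (gauss_kernel 1 (u::'a)) \<partial>lborel)"
  proof (rule nn_integral_LIMSEQ)
    show "incseq (\<lambda>n u. ennreal (gauss_kernel 1 (u::'a)) * indicator (ball 0 (real n)) u)"
      by (auto simp: incseq_def le_fun_def indicator_def)
    fix u :: 'a
    obtain N where N: "norm u < real N" using reals_Archimedean2 by blast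
    show "(\<lambda>n. ennreal (gauss_kernel 1 u) * indicator (ball 0 (real n)) u) \<longlonglongrightarrow> ennreal (gauss_kernel 1 u)"
      by (rule tendsto_eventually, rule eventually_sequentiallyI[of N]) (use N in \<open>auto simp: indicator_def\<close>)
  qed measurable
  then have "(\<lambda>n. ?I n) \<longlonglongrightarrow> 1" by (simp add: gauss_kernel_nn_integral)
  moreover have "ennreal (1 - \<epsilon>) < 1" using assms by (cases "\<epsilon> \<le> 1") (auto simp: ennreal_neg ennreal_less_one_iff)
  ultimately have "\<forall>\<^sub>F n in sequentially. ennreal (1 - \<epsilon>) < ?I n" by (rule order_tendstoD)
  then obtain n where n: "ennreal (1 - \<epsilon>) < ?I n" by (auto simp: eventually_sequentially)
  \<comment> \<open>For \<open>s\<close> up to this value the dilated ball of radius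
    \<open>s * real n\<close> lies inside \<open>ball 0 d\<close>.\<close>
  define s0 where "s0 = d / (real n + 1)"
  have "s0 > 0" using assms by (simp add: s0_def)
  moreover have "ennreal (1 - \<epsilon>) \<le> (\<integral>\<^sup>+u. ennreal (gauss_kernel s (u::'a)) * indicator (ball 0 d) u \<partial>lborel)"
    if s: "0 < s" "s \<le> s0" for s
  proof -
    have sn: "s * real n < d"
    proof -
      have "s * real n \<le> s0 * real n" using s by (simp add: mult_right_mono)
      also have "\<dots> < d" using assms by (simp add: s0_def field_simps)
      finally show ?thesis .
    qed
    have "(\<integral>\<^sup>+u. ennreal (gauss_kernel s (u::'a)) * indicator (ball 0 d) u \<partial>lborel)
      = (\<integral>\<^sup>+u. ennreal (gauss_kernel s (u::'a)) * indicator (ball 0 d) u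
          \<partial>density (distr lborel borel (\<lambda>x. 0 + s *\<^sub>R x)) (\<lambda>_. \<bar>s\<bar>^DIM('a)))"
      using s by (subst lborel_affine[of s "0::'a"]) simp_all
    also have "\<dots> = (\<integral>\<^sup>+u. ennreal (s^DIM('a)) * (ennreal (gauss_kernel s (s *\<^sub>R u)) * indicator (ball 0 d) (s *\<^sub>R u)) \<partial>(lborel::'a measure))"
      using s by (subst nn_integral_density) (simp_all add: nn_integral_distr)
    also have "\<dots> \<ge> ?I n"
    proof (rule nn_integral_mono)
      fix u :: 'a
      have "ennreal (gauss_kernel 1 u) = ennreal (s^DIM('a)) * ennreal (gauss_kernel s (s *\<^sub>R u))"
        using s gauss_kernel_scale[OF s(1), of u] by (simp add: ennreal_mult'[symmetric] mult.commute)
      moreover have "(indicator (ball 0 (real n)) u :: ennreal) \<le> indicator (ball 0 d) (s *\<^sub>R u)"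
      proof -
        have "norm u < real n \<Longrightarrow> s * norm u < d"
          using sn s by (meson less_imp_le less_le_trans mult_left_mono order.strict_trans1)
        then show ?thesis using s by (auto simp: indicator_def)
      qed
      ultimately show "ennreal (gauss_kernel 1 u) * indicator (ball 0 (real n)) u
          \<le> ennreal (s^DIM('a)) * (ennreal (gauss_kernel s (s *\<^sub>R u)) * indicator (ball 0 d) (s *\<^sub>R u))"
        by (simp add: mult.assoc[symmetric] mult_left_mono)
    qed
    finally show ?thesis using n by (meson less_imp_le order_trans)
  qed
  ultimately show ?thesis by blast
qed

text \<open>A short translation keeps \<open>K\<close> inside an open superset \<open>U\<close> of
  almost the same measure. Inclusion and exclusion for \<open>K\<close> and its translate, both
  contained in \<open>U\<close>, then force a large overlap.\<close>

lemma translate_overlap: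
  assumes K: "compact (K::'a set)" and e: "\<epsilon> > 0"
  shows "\<exists>d>0. \<forall>u. norm u < d \<longrightarrow> measure lebesgue K - \<epsilon> \<le> measure lebesgue (K \<inter> (\<lambda>a. a + u) ` K)"
proof -
  have Kl: "K \<in> lmeasurable" using K by (rule lmeasurable_compact)
  obtain U where U: "open U" "K \<subseteq> U" "U - K \<in> lmeasurable" "emeasure lebesgue (U - K) < ennreal \<epsilon>"
    using sets_lebesgue_outer_open[of K \<epsilon>] Kl e by blast
  have Um: "U \<in> lmeasurable"
    using fmeasurable.Un[OF Kl U(3)] U(2) by (simp add: Un_absorb1)
  have mU: "measure lebesgue U \<le> measure lebesgue K + \<epsilon>"
  proof -
    have "measure lebesgue (U - K) < \<epsilon>"
      using U(3,4) e by (simp add: emeasure_eq_measure2 ennreal_less_iff)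
    moreover have "measure lebesgue (U - K) = measure lebesgue U - measure lebesgue K"
      using U(2) Um Kl by (intro measurable_measure_Diff) (auto simp: fmeasurableD)
    ultimately show ?thesis by simp
  qed
  have "closed (- U)" "K \<inter> - U = {}" using U(1,2) by auto
  then obtain d where d: "d > 0" "\<And>x y. x \<in> K \<Longrightarrow> y \<in> - U \<Longrightarrow> d \<le> dist x y"
    using separate_compact_closed[of K "- U"] K by metis
  have "measure lebesgue K - \<epsilon> \<le> measure lebesgue (K \<inter> (\<lambda>a. a + u) ` K)" if u: "norm u < d" for u
  proof -
    let ?Ku = "(\<lambda>a. a + u) ` K"
    have Ku: "?Ku = (+) u ` K" by (auto simp: add.commute)
    have Kum: "?Ku \<in> lmeasurable" "measure lebesgue ?Ku = measure lebesgue K"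
      unfolding Ku using Kl by (auto simp: measurable_translation measure_translation)
    have "?Ku \<subseteq> U"
    proof
      fix y assume "y \<in> ?Ku"
      then obtain a where a: "a \<in> K" "y = a + u" by auto
      show "y \<in> U"
        using d(2)[of a y] a u by (force simp: dist_norm)
    qed
    then have "measure lebesgue (K \<union> ?Ku) \<le> measure lebesgue U"
      using U(2) Um Kl Kum by (intro measure_mono_fmeasurable) (auto simp: fmeasurableD)
    moreover have "measure lebesgue (K \<union> ?Ku) = measure lebesgue K + measure lebesgue ?Ku - measure lebesgue (K \<inter> ?Ku)"
      using Kl Kum(1) by (rule measure_Un3)
    ultimately show ?thesis using mU Kum(2) by simp
  qed
  then show ?thesis using d(1) by blast
qed

lemma indicator_mem: "E \<in> sets M \<Longrightarrow> (\<lambda>t. indicator E t) \<in> V"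
  by (rule bounded_mem[of _ 1]) (auto simp: indicator_def)

lemma nsq_indicator: "E \<in> sets M \<Longrightarrow> sq.nsq M (\<lambda>t. indicator E t) = measure lebesgue E"
proof -
  assume E: "E \<in> sets M"
  then have E': "E \<subseteq> S" using sets.sets_into_space by fastforce
  have "sq.nsq M (\<lambda>t. indicator E t) = (LINT t|M. indicator E t)"
    unfolding sq_nsq by (intro Bochner_Integration.integral_cong) (auto simp: indicator_def)
  also have "\<dots> = measure M E" using E E' by (simp add: Int_absorb1 Int_absorb2)
  also have "\<dots> = measure lebesgue E" using E' S_meas by (simp add: measure_restrict_space)
  finally show ?thesis .
qed

text \<open>The lower bound comes from the mass of the Gaussian kernel near the origin, where the translates
  of a compact subset of \<open>E\<close> overlap almost completely.\<close>

lemma plancherel_indicator: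
  assumes E: "E \<in> sets M"
  shows "sq.nsq lborel (ft (\<lambda>t. indicator E t)) = measure lebesgue E"
proof (rule antisym)
  let ?f = "\<lambda>t. indicator E t :: complex"
  have fV: "?f \<in> V" using E by (rule indicator_mem)
  show "sq.nsq lborel (ft ?f) \<le> measure lebesgue E"
    using ft_bessel(3)[OF fV] nsq_indicator[OF E] by simp
  have E': "E \<subseteq> S" "E \<in> sets lebesgue"
    using E S_meas sets.sets_into_space[OF E] by (auto simp: sets_restrict_space_iff)
  have Efin: "E \<in> lmeasurable"
    using E' S_meas S_fin fmeasurableI2[of S lebesgue E] by (simp add: fmeasurableI)
  show "measure lebesgue E \<le> sq.nsq lborel (ft ?f)"
  proof (rule field_le_epsilon)
    fix e :: real assume e0: "e > 0"
    \<comment> \<open>Chosen so that \<open>(m - 2 * \<epsilon>) * (1 - \<epsilon>)\<close> is at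
      least \<open>m - e\<close>, with \<open>m\<close> the measure of \<open>E\<close>.\<close>
    define \<epsilon> where "\<epsilon> = e / (measure lebesgue E + 3)"
    have \<epsilon>: "\<epsilon> > 0" using e0 by (simp add: \<epsilon>_def add_nonneg_pos)
    \<comment> \<open>Inner regularity in two stages: cut \<open>E\<close> off by a large ball, then
      take a closed subset of the rest; the result is closed and bounded.\<close>
    obtain K where K: "compact K" "K \<subseteq> E" "measure lebesgue E < measure lebesgue K + \<epsilon>"
    proof -
      have "(\<lambda>n. measure lebesgue (E \<inter> cball 0 (real n))) \<longlonglongrightarrow> measure lebesgue (\<Union>n. E \<inter> cball 0 (real n))"
      proof (rule Lim_measure_incseq)
        show "incseq (\<lambda>n. E \<inter> cball 0 (real n))" by (auto simp: incseq_def)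
        have "(\<Union>n. E \<inter> cball 0 (real n)) = E" using real_arch_simple by fastforce
        then show "emeasure lebesgue (\<Union>n. E \<inter> cball 0 (real n)) \<noteq> \<infinity>"
          using fmeasurableD2[OF Efin] by (metis infinity_ennreal_def)
      qed (use E' in auto)
      moreover have "(\<Union>n. E \<inter> cball 0 (real n)) = E" using real_arch_simple by fastforce
      moreover have "measure lebesgue E - \<epsilon> / 2 < measure lebesgue E" using \<epsilon> by simp
      ultimately have "\<forall>\<^sub>F n in sequentially. measure lebesgue E - \<epsilon> / 2 < measure lebesgue (E \<inter> cball 0 (real n))"
        by (simp add: order_tendstoD)
      then obtain n where n: "measure lebesgue E - \<epsilon> / 2 < measure lebesgue (E \<inter> cball 0 (real n))"
        by (auto simp: eventually_sequentially)
      define E1 where "E1 = E \<inter> cball 0 (real n)"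
      have E1: "E1 \<in> lmeasurable" unfolding E1_def using Efin by (intro fmeasurable_Int_fmeasurable) auto
      obtain T where T: "closed T" "T \<subseteq> E1" "E1 - T \<in> lmeasurable" "emeasure lebesgue (E1 - T) < ennreal (\<epsilon> / 2)"
        using sets_lebesgue_inner_closed[of E1 "\<epsilon>/2"] E1 \<epsilon> by (auto simp: fmeasurableD)
      have cT: "compact T"
        using T(1,2) unfolding E1_def compact_eq_bounded_closed by (auto intro: bounded_subset)
      have "measure lebesgue (E1 - T) < \<epsilon> / 2"
        using T(3,4) \<epsilon> by (simp add: emeasure_eq_measure2 ennreal_less_iff)
      moreover have "measure lebesgue (E1 - T) = measure lebesgue E1 - measure lebesgue T"
        using T(2) E1 cT by (intro measurable_measure_Diff) (auto simp: fmeasurableD lmeasurable_compact)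
      ultimately show ?thesis using n cT T(2) unfolding E1_def[symmetric]
        by (intro that[of T]) (auto simp: E1_def)
    qed
    show "measure lebesgue E \<le> sq.nsq lborel (ft ?f) + e"
    proof (cases "measure lebesgue E \<le> e")
      case True
      then show ?thesis using sq.nsq_nonneg[OF ft_bessel(2)[OF fV]] by simp
    next
      case False
      define m where "m = measure lebesgue E"
      have me: "e < m" "0 \<le> m" using False by (auto simp: m_def)
      have \<epsilon>m: "\<epsilon> * (m + 3) = e" using me by (simp add: \<epsilon>_def m_def[symmetric])
      have \<epsilon>1: "\<epsilon> < 1"
      proof (rule ccontr)
        assume "\<not> \<epsilon> < 1"
        then have "1 * (m + 3) \<le> \<epsilon> * (m + 3)" using me by (intro mult_right_mono) auto
        then show False using \<epsilon>m me by simp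
      qed
      have e3: "3 * \<epsilon> \<le> e" using \<epsilon>m \<epsilon> me by (simp add: algebra_simps flip: \<epsilon>m)
      have Kpos: "0 \<le> measure lebesgue K - \<epsilon>" using K(3) e3 me \<epsilon> unfolding m_def by linarith
      obtain d where d: "d > 0" "\<And>u. norm u < d \<Longrightarrow>
          measure lebesgue K - \<epsilon> \<le> measure lebesgue (K \<inter> (\<lambda>a. a + u) ` K)"
        using translate_overlap[OF K(1) \<epsilon>] by blast
      obtain s where s: "s > 0" and mass: "ennreal (1 - \<epsilon>)
          \<le> (\<integral>\<^sup>+u. ennreal (gauss_kernel s (u::'a)) * indicator (ball 0 d) u \<partial>lborel)"
        using gauss_kernel_mass[OF d(1) \<epsilon>] by blast
      have [measurable]: "ball (0::'a) d \<in> sets borel" by simp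
      have [measurable]: "K \<in> sets borel" using K(1) by (simp add: borel_compact)
      let ?k = "\<lambda>p. indicator E (fst p) * indicator E (snd p) * gauss_kernel s (snd p - fst p) :: real"
      have kc: "?f (fst p) * cnj (?f (snd p)) * of_real (gauss_kernel s (snd p - fst p)) = complex_of_real (?k p)" for p
        by (simp add: indicator_def)
      have ki: "integrable (M \<Otimes>\<^sub>M M) ?k"
        using gauss_identity(2)[OF fV s] unfolding kc complex_of_real_integrable_eq .
      have keq: "(LINT x|lborel. gauss_weight s x * (cmod (ft ?f x))\<^sup>2) = (LINT p|(M \<Otimes>\<^sub>M M). ?k p)"
        using gauss_identity(3)[OF fV s] unfolding kc integral_complex_of_real of_real_eq_iff .
      \<comment> \<open>For a displacement \<open>u\<close>, the points \<open>a\<close> with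
        \<open>a\<close> and \<open>a - u\<close> both in \<open>K\<close> form the overlap of
        \<open>K\<close> with its translate by \<open>u\<close>.\<close>
      have pt: "ennreal (measure lebesgue K - \<epsilon>) * (ennreal (gauss_kernel s u) * indicator (ball 0 d) u)
          \<le> (\<integral>\<^sup>+a. indicator K a * (indicator K (a - u) * ennreal (gauss_kernel s u)) \<partial>lborel)" for u
      proof (cases "u \<in> ball 0 d")
        case True
        have Ku: "compact ((\<lambda>a. a + u) ` K)"
          using compact_translation[OF K(1), of u] by (simp add: add.commute)
        have eq: "indicator K a * (indicator K (a - u) * ennreal (gauss_kernel s u))
            = ennreal (gauss_kernel s u) * indicator (K \<inter> (\<lambda>a. a + u) ` K) a" for a
          by (force simp: indicator_def)
        have "(\<integral>\<^sup>+a. indicator K a * (indicator K (a - u) * ennreal (gauss_kernel s u)) \<partial>lborel)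
          = ennreal (gauss_kernel s u) * emeasure lborel (K \<inter> (\<lambda>a. a + u) ` K)"
          unfolding eq using Ku K(1) by (subst nn_integral_cmult_indicator) (auto simp: borel_compact)
        also have "emeasure lborel (K \<inter> (\<lambda>a. a + u) ` K) = ennreal (measure lebesgue (K \<inter> (\<lambda>a. a + u) ` K))"
        proof -
          have c: "compact (K \<inter> (\<lambda>a. a + u) ` K)" by (rule compact_Int[OF K(1) Ku])
          have "emeasure lborel (K \<inter> (\<lambda>a. a + u) ` K) = emeasure lebesgue (K \<inter> (\<lambda>a. a + u) ` K)"
            using c by (simp add: borel_compact)
          then show ?thesis using lmeasurable_compact[OF c] by (simp add: emeasure_eq_measure2)
        qed
        finally show ?thesis using True d(2)[of u]
          by (simp add: mult.commute mult_left_mono ennreal_leI)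
      qed simp
      have "ennreal (measure lebesgue K - \<epsilon>) * ennreal (1 - \<epsilon>)
          \<le> ennreal (measure lebesgue K - \<epsilon>) * (\<integral>\<^sup>+u. ennreal (gauss_kernel s (u::'a)) * indicator (ball 0 d) u \<partial>lborel)"
        by (intro mult_left_mono mass) simp
      also have "\<dots> = (\<integral>\<^sup>+u. ennreal (measure lebesgue K - \<epsilon>) * (ennreal (gauss_kernel s (u::'a)) * indicator (ball 0 d) u) \<partial>lborel)"
        by (rule nn_integral_cmult[symmetric]) measurable
      also have "\<dots> \<le> (\<integral>\<^sup>+u. (\<integral>\<^sup>+a. indicator K a * (indicator K (a - u) * ennreal (gauss_kernel s u)) \<partial>lborel) \<partial>(lborel::'a measure))"
        by (intro nn_integral_mono pt)
      also have "\<dots> = (\<integral>\<^sup>+a. (\<integral>\<^sup>+u. indicator K a * (indicator K (a - u) * ennreal (gauss_kernel s u)) \<partial>lborel) \<partial>(lborel::'a measure))"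
        by (rule lborel_pair.Fubini') measurable
      \<comment> \<open>Substitute \<open>b = a - u\<close>; the kernel is even.\<close>
      also have "\<dots> = (\<integral>\<^sup>+a. (\<integral>\<^sup>+b. indicator K a * (indicator K b * ennreal (gauss_kernel s (b - a))) \<partial>lborel) \<partial>(lborel::'a measure))"
      proof (rule nn_integral_cong)
        fix a :: 'a
        have "(\<integral>\<^sup>+b. indicator K a * (indicator K b * ennreal (gauss_kernel s (b - a))) \<partial>lborel)
           = (\<integral>\<^sup>+b. indicator K a * (indicator K b * ennreal (gauss_kernel s (b - a)))
               \<partial>density (distr lborel borel (\<lambda>x. a + (-1) *\<^sub>R x)) (\<lambda>_. \<bar>-1::real\<bar>^DIM('a)))"
          by (subst lborel_affine[of "-1" a]) simp_all
        also have "\<dots> = (\<integral>\<^sup>+u. indicator K a * (indicator K (a - u) * ennreal (gauss_kernel s (- u))) \<partial>lborel)"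
          by (simp add: density_1 nn_integral_distr)
        finally show "(\<integral>\<^sup>+u. indicator K a * (indicator K (a - u) * ennreal (gauss_kernel s u)) \<partial>lborel)
          = (\<integral>\<^sup>+b. indicator K a * (indicator K b * ennreal (gauss_kernel s (b - a))) \<partial>lborel)"
          by (simp add: gauss_kernel_minus)
      qed
      also have "\<dots> \<le> (\<integral>\<^sup>+a. (\<integral>\<^sup>+b. ennreal (?k (a, b)) \<partial>M) \<partial>M)"
      proof (rule nn_integral_lebesgue_on_ge[OF S_meas])
        fix a :: 'a
        show "(\<integral>\<^sup>+b. indicator K a * (indicator K b * ennreal (gauss_kernel s (b - a))) \<partial>lborel)
          \<le> (\<integral>\<^sup>+b. ennreal (?k (a, b)) \<partial>M) * indicator S a"
        proof (cases "a \<in> K")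
          case True
          then have "a \<in> S" "a \<in> E" using K(2) E' by auto
          then show ?thesis using K(2) E' True
            by simp (rule nn_integral_lebesgue_on_ge[OF S_meas], auto simp: indicator_def)
        qed simp
      qed
      also have "\<dots> = (\<integral>\<^sup>+p. ennreal (?k p) \<partial>(M \<Otimes>\<^sub>M M))"
        using borel_measurable_integrable[OF ki] by (subst M.nn_integral_fst[symmetric]) simp_all
      also have "\<dots> = ennreal (LINT p|(M \<Otimes>\<^sub>M M). ?k p)"
        by (rule nn_integral_eq_integral[OF ki]) simp
      also have "\<dots> = (\<integral>\<^sup>+x. ennreal (gauss_weight s x * (cmod (ft ?f x))\<^sup>2) \<partial>lborel)"
        unfolding keq[symmetric] by (rule nn_integral_eq_integral[OF gauss_identity(1)[OF fV s], symmetric]) simp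
      also have "\<dots> \<le> (\<integral>\<^sup>+x. ennreal ((cmod (ft ?f x))\<^sup>2) \<partial>lborel)"
        by (intro nn_integral_mono ennreal_leI mult_left_le_one_le) simp_all
      also have "\<dots> = ennreal (sq.nsq lborel (ft ?f))" by (rule sq_nn[OF ft_bessel(2)[OF fV]])
      finally have "(measure lebesgue K - \<epsilon>) * (1 - \<epsilon>) \<le> sq.nsq lborel (ft ?f)"
        using Kpos \<epsilon>1 sq.nsq_nonneg[OF ft_bessel(2)[OF fV]] by (simp flip: ennreal_mult add: ennreal_le_iff)
      moreover have "(m - 2 * \<epsilon>) * (1 - \<epsilon>) \<le> (measure lebesgue K - \<epsilon>) * (1 - \<epsilon>)"
        using K(3) \<epsilon>1 unfolding m_def by (intro mult_right_mono) auto
      moreover have "m - e \<le> (m - 2 * \<epsilon>) * (1 - \<epsilon>)"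
        using \<epsilon>m \<epsilon> by (simp add: algebra_simps flip: \<epsilon>m)
      ultimately show ?thesis unfolding m_def by simp
    qed
  qed
qed


section \<open>From indicators to exponentials\<close>

lemma plancherel_defect: "semi_ip V (\<lambda>f g. sq_ip M f g - sq_ip lborel (ft f) (ft g))"
proof
  show "(\<lambda>_. 0) \<in> V" by (rule sq.zero_mem)
  show "(\<lambda>t. a * f t + g t) \<in> V" if "f \<in> V" "g \<in> V" for f g a using that by (rule sq.lin_mem)
  show "sq_ip M (\<lambda>t. a * f t + g t) h - sq_ip lborel (ft (\<lambda>t. a * f t + g t)) (ft h)
      = a * (sq_ip M f h - sq_ip lborel (ft f) (ft h)) + (sq_ip M g h - sq_ip lborel (ft g) (ft h))"
    if "f \<in> V" "g \<in> V" "h \<in> V" for f g h a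
  proof -
    have "ft (\<lambda>t. a * f t + g t) = (\<lambda>x. a * ft f x + ft g x)" using that ft_lin by blast
    then show ?thesis
      using sq.ip_lin[OF that, of a] sq.ip_lin[OF ft_bessel(2)[OF that(1)] ft_bessel(2)[OF that(2)] ft_bessel(2)[OF that(3)], of a]
      by (simp add: algebra_simps)
  qed
  show "sq_ip M g f - sq_ip lborel (ft g) (ft f) = cnj (sq_ip M f g - sq_ip lborel (ft f) (ft g))"
    if "f \<in> V" "g \<in> V" for f g
    using sq.ip_herm[OF that] sq.ip_herm[OF ft_bessel(2)[OF that(1)] ft_bessel(2)[OF that(2)]] by simp
  show "0 \<le> Re (sq_ip M f f - sq_ip lborel (ft f) (ft f))" if "f \<in> V" for f
    using ft_bessel(3)[OF that] by (simp add: sq.nsq_def)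
qed

text \<open>By Bessel's inequality the difference of the two inner products is again a semi-inner
  product. If it vanishes at the pair \<open>g\<close>, \<open>g\<close>, its own Cauchy--Schwarz
  inequality makes it vanish against every \<open>f\<close>; so equality of norms for
  \<open>g\<close> alone is enough.\<close>

lemma plancherel_polarized:
  assumes f: "f \<in> V" and g: "g \<in> V" and eq: "sq.nsq lborel (ft g) = sq.nsq M g"
  shows "sq_ip lborel (ft f) (ft g) = sq_ip M f g"
proof -
  interpret Q: semi_ip V "\<lambda>f g. sq_ip M f g - sq_ip lborel (ft f) (ft g)"
    by (rule plancherel_defect)
  have "Q.nsq g = 0" using eq by (simp add: Q.nsq_def sq.nsq_def)
  then show ?thesis using Q.cauchy_schwarz_sq[OF f g] by simp
qed

lemma ft_expo: "ft (expo l) x = ft (\<lambda>_. 1) (x - l)"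
  using ft_modulate[of "\<lambda>_. 1" l x] by simp

lemma plancherel_one: "sq.nsq lborel (ft (\<lambda>_. 1)) = mS"
proof -
  have "ft (\<lambda>_. 1) = ft (\<lambda>t. indicator S t)"
    unfolding ft_alt[abs_def] by (intro ext Bochner_Integration.integral_cong) auto
  then show ?thesis
    using plancherel_indicator[of S] S_meas by (simp add: sets_restrict_space_iff)
qed

text \<open>The transform of \<open>expo l\<close> is a translate of the transform of the constant
  1, so the norm equality for the indicator of \<open>S\<close> covers all exponentials.\<close>

lemma plancherel_expo:
  assumes "f \<in> V"
  shows "sq_ip lborel (ft f) (ft (expo l)) = sq_ip M f (expo l)"
proof (rule plancherel_polarized[OF assms expo_mem])
  have "sq.nsq lborel (ft (expo l)) = (LINT x|lborel. (cmod (ft (\<lambda>_. 1) (x - l)))\<^sup>2)"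
    by (simp add: sq_nsq ft_expo)
  also have "\<dots> = (LINT x|lborel. (cmod (ft (\<lambda>_. 1) x))\<^sup>2)"
    by (rule integrable_lborel_shift[OF sq_space_integrable[OF ft_bessel(2)[OF one_mem]]])
  finally show "sq.nsq lborel (ft (expo l)) = sq.nsq M (expo l)"
    using plancherel_one by (simp add: sq_nsq measure_M)
qed

section \<open>Injectivity of the transform and density of the exponentials\<close>

lemma Re_nonpos_AE:
  assumes h: "h \<in> V" and orth: "\<And>E. E \<in> sets M \<Longrightarrow> sq_ip M h (\<lambda>t. indicator E t) = 0"
  shows "AE t in M. Re (c * h t) \<le> 0"
proof -
  note id_measurable [measurable]
  have [measurable]: "h \<in> borel_measurable M" using h by (rule sq_space_measurable)
  define E where "E = {t \<in> space M. 0 < Re (c * h t)}"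
  have E: "E \<in> sets M" unfolding E_def by measurable
  have i: "integrable M (\<lambda>t. c * (h t * cnj (indicator E t)))"
    by (intro integrable_mult_right sq_space_mult_integrable h indicator_mem E)
  have "(LINT t|M. Re (c * (h t * cnj (indicator E t)))) = Re (c * sq_ip M h (\<lambda>t. indicator E t))"
    using i by (simp only: integral_Re sq_ip_def integral_mult_right_zero)
  then have z: "(LINT t|M. Re (c * (h t * cnj (indicator E t)))) = 0" using orth[OF E] by simp
  have "AE t in M. Re (c * (h t * cnj (indicator E t))) = 0"
  proof (subst integral_nonneg_eq_0_iff_AE[symmetric])
    show "integrable M (\<lambda>t. Re (c * (h t * cnj (indicator E t))))" using i by (rule integrable_Re)
    show "AE t in M. 0 \<le> Re (c * (h t * cnj (indicator E t)))"
      by (rule AE_I2) (auto simp: indicator_def E_def)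
  qed (rule z)
  then show ?thesis
    by (rule AE_mp) (rule AE_I2, auto simp: indicator_def E_def split: if_splits intro: ccontr)
qed

text \<open>Plancherel's identity against indicators makes \<open>h\<close> orthogonal to the
  indicator of every measurable set, in particular of the sets on which its real or imaginary part
  has a fixed sign.\<close>

lemma ft_inject:
  assumes h: "h \<in> V" and z: "\<And>x. ft h x = 0"
  shows "sq.nsq M h = 0"
proof -
  have orth: "sq_ip M h (\<lambda>t. indicator E t) = 0" if E: "E \<in> sets M" for E
  proof -
    have "sq_ip M h (\<lambda>t. indicator E t) = sq_ip lborel (ft h) (ft (\<lambda>t. indicator E t))"
      using plancherel_polarized[OF h indicator_mem[OF E]] plancherel_indicator[OF E] nsq_indicator[OF E] by simp
    also have "\<dots> = 0" by (simp add: sq_ip_def z)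
    finally show ?thesis .
  qed
  \<comment> \<open>The multipliers 1, -1, i and -i control both signs of the real and of the
    imaginary part.\<close>
  have A: "AE t in M. Re (c * h t) \<le> 0" for c by (rule Re_nonpos_AE[OF h orth])
  have "AE t in M. h t = 0"
    using A[of 1] A[of "-1"] A[of \<i>] A[of "-\<i>"]
    by eventually_elim (simp add: complex_eq_iff)
  then have "AE t in M. (cmod (h t))\<^sup>2 = 0" by eventually_elim simp
  then show ?thesis unfolding sq_nsq by (rule integral_eq_zero_AE)
qed

lemma sum_expo_mem: "(\<lambda>t. \<Sum>x\<in>X. a x * expo x t) \<in> V"
  by (intro sq.sum_mem) simp

text \<open>The closed span of all exponentials is complete, so a vector has an orthogonal projection onto it;
  the remainder has vanishing Fourier transform.\<close>

lemma expo_dense: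
  assumes f: "f \<in> V" and e: "\<epsilon> > 0"
  shows "\<exists>X a. finite X \<and> sq.nm M (\<lambda>t. f t - (\<Sum>x\<in>X. a x * expo x t)) < \<epsilon>"
proof -
  define W where "W = {g \<in> V. \<forall>e>0. \<exists>X a. finite X \<and> sq.nm M (\<lambda>t. g t - (\<Sum>x\<in>X. a x * expo x t)) < e}"
  have WV: "g \<in> V" if "g \<in> W" for g using that by (simp add: W_def)
  have approx: "\<exists>X a. finite X \<and> sq.nm M (\<lambda>t. g t - (\<Sum>x\<in>X. a x * expo x t)) < e" if "g \<in> W" "e > 0" for g e
    using that by (simp add: W_def)
  have W_lin: "(\<lambda>t. c * g t + h t) \<in> W" if g: "g \<in> W" and h: "h \<in> W" for c g h
  proof -
    have "\<exists>X a. finite X \<and> sq.nm M (\<lambda>t. c * g t + h t - (\<Sum>x\<in>X. a x * expo x t)) < e" if "e > 0" for e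
    proof -
      define e' where "e' = e / (cmod c + 1)"
      have e': "e' > 0" using that by (simp add: e'_def add_nonneg_pos)
      obtain X a where X: "finite X" "sq.nm M (\<lambda>t. g t - (\<Sum>x\<in>X. a x * expo x t)) < e'"
        using approx[OF g e'] by blast
      obtain Y b where Y: "finite Y" "sq.nm M (\<lambda>t. h t - (\<Sum>x\<in>Y. b x * expo x t)) < e'"
        using approx[OF h e'] by blast
      \<comment> \<open>The two approximating combinations may share frequencies, so the
        coefficients are added on the union of both index sets.\<close>
      define d where "d x = c * (if x \<in> X then a x else 0) + (if x \<in> Y then b x else 0)" for x
      define u where "u = (\<lambda>t. g t - (\<Sum>x\<in>X. a x * expo x t))"
      define v where "v = (\<lambda>t. h t - (\<Sum>x\<in>Y. b x * expo x t))"
      have uV: "u \<in> V" "v \<in> V"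
        unfolding u_def v_def by (intro sq.diff_mem sum_expo_mem WV g h)+
      have "(\<Sum>x\<in>X \<union> Y. d x * expo x t) = c * (\<Sum>x\<in>X. a x * expo x t) + (\<Sum>x\<in>Y. b x * expo x t)" for t
      proof -
        have "(\<Sum>x\<in>X \<union> Y. d x * expo x t) = c * (\<Sum>x\<in>X \<union> Y. (if x \<in> X then a x * expo x t else 0))
            + (\<Sum>x\<in>X \<union> Y. (if x \<in> Y then b x * expo x t else 0))"
          unfolding sum_distrib_left sum.distrib[symmetric]
          by (intro sum.cong) (auto simp: d_def algebra_simps)
        then show ?thesis using X(1) Y(1)
          by (simp add: sum.If_cases Int_absorb1 Int_absorb2 Un_Int_distrib)
      qed
      then have eq: "(\<lambda>t. c * g t + h t - (\<Sum>x\<in>X \<union> Y. d x * expo x t)) = (\<lambda>t. c * u t + v t)"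
        by (simp add: u_def v_def algebra_simps)
      have "sq.nm M (\<lambda>t. c * u t + v t) \<le> cmod c * sq.nm M u + sq.nm M v"
        using sq.nm_add[OF sq.scale_mem[OF uV(1)] uV(2), of c] by (simp add: sq.nm_scale[OF uV(1)])
      also have "\<dots> < cmod c * e' + e'"
        using X(2) Y(2) unfolding u_def[symmetric] v_def[symmetric]
        by (intro add_le_less_mono mult_left_mono) auto
      also have "\<dots> = e" by (simp add: e'_def field_simps add_nonneg_eq_0_iff)
      finally show ?thesis using X(1) Y(1) eq by (intro exI[of _ "X \<union> Y"] exI[of _ d]) simp
    qed
    then show ?thesis using g h by (simp add: W_def sq.lin_mem)
  qed
  interpret W: semi_ip W "sq_ip M"
  proof
    have "\<exists>X a. finite X \<and> sq.nm M (\<lambda>t. 0 - (\<Sum>x\<in>X. a x * expo x t)) < e" if "e > 0" for e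
      by (rule exI[of _ "{}"]) (use that in \<open>simp add: sq.nm_def sq_nsq\<close>)
    then show "(\<lambda>_. 0) \<in> W" by (simp add: W_def sq.zero_mem)
  qed (auto intro: W_lin sq.ip_lin WV sq.ip_herm sq.ip_nonneg)
  have expoW: "expo y \<in> W" for y
  proof -
    have "\<exists>X a. finite X \<and> sq.nm M (\<lambda>t. expo y t - (\<Sum>x\<in>X. a x * expo x t)) < e" if "e > 0" for e
      by (intro exI[of _ "{y}"] exI[of _ "\<lambda>_. 1"]) (use that in \<open>simp add: sq.nm_def sq_nsq\<close>)
    then show ?thesis by (simp add: W_def)
  qed
  have "\<exists>p\<in>W. \<forall>g\<in>W. sq_ip M g f = sq_ip M g p"
  proof (rule W.riesz_representation)
    show "0 \<le> sq.nsq M f" by (rule sq.nsq_nonneg[OF f])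
    show "sq_ip M (\<lambda>t. a * g t + h t) f = a * sq_ip M g f + sq_ip M h f" if "g \<in> W" "h \<in> W" for g h a
      by (rule sq.ip_lin[OF WV[OF that(1)] WV[OF that(2)] f])
    show "(cmod (sq_ip M g f))\<^sup>2 \<le> sq.nsq M f * W.nsq g" if "g \<in> W" for g
      using sq.cauchy_schwarz_sq[OF WV[OF that] f] by (simp add: mult.commute)
    fix X :: "nat \<Rightarrow> 'a \<Rightarrow> complex"
    assume X: "\<And>n. X n \<in> W" and C: "\<And>e. 0 < e \<Longrightarrow> \<exists>N. \<forall>m\<ge>N. \<forall>n\<ge>N. W.nsq (\<lambda>t. X m t - X n t) < e"
    obtain h where h: "h \<in> V" and lim: "(\<lambda>n. sq.nsq M (\<lambda>t. X n t - h t)) \<longlonglongrightarrow> 0"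
      using sq_complete[of X M, OF WV[OF X] C] by auto
    have "h \<in> W"
    proof -
      have "\<exists>Y a. finite Y \<and> sq.nm M (\<lambda>t. h t - (\<Sum>x\<in>Y. a x * expo x t)) < e" if e0: "e > 0" for e
      proof -
        have l0: "(\<lambda>n. sq.nm M (\<lambda>t. X n t - h t)) \<longlonglongrightarrow> 0"
          using tendsto_real_sqrt[OF lim] by (simp add: sq.nm_def)
        then obtain n where n: "sq.nm M (\<lambda>t. X n t - h t) < e / 2"
          using eventually_happens'[OF sequentially_bot order_tendstoD(2)[OF l0, of "e/2"]] e0 by auto
        obtain Y a where Y: "finite Y" "sq.nm M (\<lambda>t. X n t - (\<Sum>x\<in>Y. a x * expo x t)) < e / 2"
          using approx[OF X, of "e/2" n] e0 by auto
        have "sq.nm M (\<lambda>t. h t - (\<Sum>x\<in>Y. a x * expo x t))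
            \<le> sq.nm M (\<lambda>t. h t - X n t) + sq.nm M (\<lambda>t. X n t - (\<Sum>x\<in>Y. a x * expo x t))"
          by (rule sq.nm_triangle[OF h WV[OF X] sum_expo_mem])
        also have "sq.nm M (\<lambda>t. h t - X n t) = sq.nm M (\<lambda>t. X n t - h t)"
          by (rule sq.nm_minus_commute[OF h WV[OF X]])
        finally show ?thesis using n Y by (intro exI[of _ Y] exI[of _ a]) simp
      qed
      then show ?thesis using h by (simp add: W_def)
    qed
    then show "\<exists>h\<in>W. (\<lambda>n. W.nsq (\<lambda>t. X n t - h t)) \<longlonglongrightarrow> 0" using lim by blast
  qed
  then obtain p where p: "p \<in> W" "\<And>g. g \<in> W \<Longrightarrow> sq_ip M g f = sq_ip M g p" by blast
  have fp: "(\<lambda>t. f t - p t) \<in> V" by (rule sq.diff_mem[OF f WV[OF p(1)]])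
  have "ft (\<lambda>t. f t - p t) x = 0" for x
  proof -
    have "sq_ip M (expo x) (\<lambda>t. f t - p t) = 0"
      using p(2)[OF expoW[of x]] sq.ip_diff_right[OF f WV[OF p(1)] expo_mem[of x]] by simp
    then show ?thesis unfolding ft_def using sq.ip_herm[OF expo_mem fp, of x] by simp
  qed
  then have "sq.nm M (\<lambda>t. f t - p t) = 0" using ft_inject[OF fp] by (simp add: sq.nm_def)
  moreover obtain X a where X: "finite X" "sq.nm M (\<lambda>t. p t - (\<Sum>x\<in>X. a x * expo x t)) < \<epsilon>"
    using approx[OF p(1) e] by blast
  moreover have "sq.nm M (\<lambda>t. f t - (\<Sum>x\<in>X. a x * expo x t))
      \<le> sq.nm M (\<lambda>t. f t - p t) + sq.nm M (\<lambda>t. p t - (\<Sum>x\<in>X. a x * expo x t))"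
    by (rule sq.nm_triangle[OF f WV[OF p(1)] sum_expo_mem])
  ultimately show ?thesis by (intro exI[of _ X] exI[of _ a]) simp
qed

end

section \<open>Separated sets\<close>

text \<open>Dominated convergence. It gives no rate, which is why the radii derived from it depend
  on the function.\<close>

lemma integrable_tail:
  fixes g :: "'a::euclidean_space \<Rightarrow> real"
  assumes g: "integrable N g" and id: "(\<lambda>x. x) \<in> measurable N borel" and e: "e > 0"
  shows "\<exists>R. \<bar>LINT x|N. indicator {x. R \<le> norm x} x * g x\<bar> < e"
proof -
  have [measurable]: "g \<in> borel_measurable N" using g by auto
  have "(\<lambda>n. LINT x|N. indicator {x. real n \<le> norm x} x * g x) \<longlonglongrightarrow> (LINT x|N. 0)"
  proof (rule integral_dominated_convergence[where w = "\<lambda>x. \<bar>g x\<bar>"])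
    show "(\<lambda>x. indicator {x. real n \<le> norm x} x * g x) \<in> borel_measurable N" for n
    proof -
      have [measurable]: "norm \<in> borel_measurable N"
        using measurable_compose[OF id, of norm borel] by simp
      have "(\<lambda>x. indicator {x. real n \<le> norm x} x * g x) = (\<lambda>x. if real n \<le> norm x then g x else 0)"
        by (auto simp: indicator_def)
      then show ?thesis by simp
    qed
    show "AE x in N. (\<lambda>n. indicator {x. real n \<le> norm x} x * g x) \<longlonglongrightarrow> 0"
    proof (rule AE_I2)
      fix x :: 'a
      obtain n where "norm x < real n" using reals_Archimedean2 by blast
      then show "(\<lambda>n. indicator {x. real n \<le> norm x} x * g x) \<longlonglongrightarrow> 0"
        by (intro tendsto_eventually eventually_sequentiallyI[of n]) (auto simp: indicator_def)
    qed
    show "integrable N (\<lambda>x. \<bar>g x\<bar>)" using g by simp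
    show "AE x in N. norm (indicator {x. real n \<le> norm x} x * g x) \<le> \<bar>g x\<bar>" for n
      by (rule AE_I2) (simp add: indicator_def)
  qed simp
  then have "(\<lambda>n. \<bar>LINT x|N. indicator {x. real n \<le> norm x} x * g x\<bar>) \<longlonglongrightarrow> 0"
    by (simp add: tendsto_rabs_zero)
  from eventually_happens'[OF sequentially_bot order_tendstoD(2)[OF this e]]
  show ?thesis by blast
qed

text \<open>\<open>uniform_discrete\<close> with its constant made explicit: the same
  \<open>d\<close> then serves all translates and weak limits of a set.\<close>

definition sep :: "real \<Rightarrow> 'a::metric_space set \<Rightarrow> bool" where
  "sep d \<Lambda> \<longleftrightarrow> 0 < d \<and> (\<forall>x\<in>\<Lambda>. \<forall>y\<in>\<Lambda>. dist x y < d \<longrightarrow> x = y)"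

lemma sepD: "sep d \<Lambda> \<Longrightarrow> x \<in> \<Lambda> \<Longrightarrow> y \<in> \<Lambda> \<Longrightarrow> dist x y < d \<Longrightarrow> x = y"
  by (auto simp: sep_def)

lemma sep_subset: "sep d \<Lambda> \<Longrightarrow> F \<subseteq> \<Lambda> \<Longrightarrow> sep d F"
  by (auto simp: sep_def)

lemma sep_translate: "sep d \<Lambda> \<Longrightarrow> sep d ((\<lambda>l. l - x) ` \<Lambda>)" for x :: "'a::real_normed_vector"
  by (auto simp: sep_def dist_norm)

lemma sep_uniform_discrete: "sep d \<Lambda> \<Longrightarrow> uniform_discrete \<Lambda>"
  by (auto simp: sep_def uniform_discrete_def)

lemma sep_finite:
  fixes \<Lambda> :: "'a::euclidean_space set"
  assumes "sep d \<Lambda>" "bounded B"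
  shows "finite (\<Lambda> \<inter> B)"
proof -
  have "uniform_discrete (\<Lambda> \<inter> B)"
    using sep_uniform_discrete[OF assms(1)] by (rule uniform_discrete_subset) simp
  then show ?thesis using uniform_discrete_finite_iff assms(2) bounded_subset by blast
qed

lemma sep_balls_disjoint: "sep d F \<Longrightarrow> disjoint_family_on (\<lambda>l. ball l (d/2)) F"
  unfolding disjoint_family_on_def
proof (intro ballI impI)
  fix m n assume s: "sep d F" and mn: "m \<in> F" "n \<in> F" "m \<noteq> n"
  have "False" if "x \<in> ball m (d/2)" "x \<in> ball n (d/2)" for x
  proof -
    have "dist m n < d"
      using that dist_triangle2[of m n x] by (simp add: dist_commute)
    then show False using sepD[OF s mn(1,2)] mn(3) by simp
  qed
  then show "ball m (d/2) \<inter> ball n (d/2) = {}" by blast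
qed

text \<open>The type argument carries the dimension, which the radius alone does not determine. For
  a nonpositive radius the ball is empty and the value is 0.\<close>

definition vol :: "'a::euclidean_space itself \<Rightarrow> real \<Rightarrow> real" where
  "vol _ r = measure lebesgue (ball (0::'a) r)"

lemma vol_ball: "measure lebesgue (ball (c::'a::euclidean_space) r) = vol TYPE('a) r"
proof (cases "r \<ge> 0")
  case True
  then show ?thesis by (simp add: vol_def content_ball)
qed (simp add: vol_def ball_empty)

lemma vol_eq: "0 \<le> r \<Longrightarrow> vol TYPE('a::euclidean_space) r = unit_ball_vol (real DIM('a)) * r ^ DIM('a)"
  by (simp add: vol_def content_ball)

lemma vol_pos: "0 < r \<Longrightarrow> 0 < vol TYPE('a::euclidean_space) r"
  by (simp add: vol_eq)

lemma vol_nonneg [simp]: "0 \<le> vol TYPE('a::euclidean_space) r"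
  by (simp add: vol_def)

text \<open>Volume is a power of the radius, so layers of fixed thickness (\<open>c\<close> may have
  either sign) are negligible compared with large balls. The boundary terms below are absorbed
  through this limit.\<close>

lemma vol_ratio: "((\<lambda>r. vol TYPE('a::euclidean_space) (r + c) / vol TYPE('a) r) \<longlongrightarrow> 1) at_top"
proof -
  have "((\<lambda>r::real. c / r) \<longlongrightarrow> 0) at_top"
    by (rule tendsto_divide_0[OF tendsto_const filterlim_at_top_imp_at_infinity[OF filterlim_ident]])
  then have "((\<lambda>r::real. (1 + c / r) ^ DIM('a)) \<longlongrightarrow> (1 + 0) ^ DIM('a)) at_top"
    by (intro tendsto_intros)
  then have 1: "((\<lambda>r::real. (1 + c / r) ^ DIM('a)) \<longlongrightarrow> 1) at_top" by simp
  have "\<forall>\<^sub>F r in at_top. (1 + c / r) ^ DIM('a) = vol TYPE('a) (r + c) / vol TYPE('a) r"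
    using eventually_gt_at_top[of "max 0 (- c)"]
  proof eventually_elim
    case (elim r)
    then have "r > 0" "r + c > 0" by auto
    then show ?case
      using unit_ball_vol_pos[of "real DIM('a)"] by (simp add: less_imp_neq[THEN not_sym] vol_eq power_divide[symmetric] add_divide_distrib)
  qed
  then show ?thesis using 1 by (rule Lim_transform_eventually[rotated])
qed

text \<open>Packing: the balls of radius \<open>d/2\<close> around the points of a
  \<open>d\<close>-separated set are disjoint.\<close>

lemma sep_card_le:
  fixes F :: "'a::euclidean_space set"
  assumes F: "sep d F" "finite F" and T: "T \<in> lmeasurable" and sub: "\<And>l. l \<in> F \<Longrightarrow> ball l (d/2) \<subseteq> T"
  shows "real (card F) * vol TYPE('a) (d/2) \<le> measure lebesgue T"
proof -
  have "measure lebesgue (\<Union>l\<in>F. ball l (d/2)) = (\<Sum>l\<in>F. measure lebesgue (ball l (d/2)))"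
    using F sep_balls_disjoint[OF F(1)] emeasure_lborel_ball_finite
    by (intro measure_finite_Union) (auto simp: less_top[symmetric])
  also have "\<dots> = real (card F) * vol TYPE('a) (d/2)" by (simp add: vol_ball)
  finally have "real (card F) * vol TYPE('a) (d/2) = measure lebesgue (\<Union>l\<in>F. ball l (d/2))" by simp
  also have "\<dots> \<le> measure lebesgue T"
    using F T sub by (intro measure_mono_fmeasurable) auto
  finally show ?thesis .
qed

lemma sep_card_ball:
  fixes F :: "'a::euclidean_space set"
  assumes F: "sep d F" and sub: "F \<subseteq> ball y r"
  shows "real (card F) * vol TYPE('a) (d/2) \<le> vol TYPE('a) (r + d/2)"
proof -
  have fin: "finite F" using sep_finite[OF F, of "ball y r"] sub by (simp add: Int_absorb2)
  have "ball l (d/2) \<subseteq> ball y (r + d/2)" if "l \<in> F" for l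
  proof
    fix x assume "x \<in> ball l (d/2)"
    moreover have "dist y l < r" using that sub by auto
    ultimately show "x \<in> ball y (r + d/2)" using dist_triangle[of y x l] by simp
  qed
  then show ?thesis
    using sep_card_le[OF F fin, of "ball y (r + d/2)"] by (simp add: vol_ball)
qed

text \<open>The same packing in a shell thickened by \<open>d/2\<close> on both sides. Together with
  \<open>vol_ratio\<close> it shows that a shell of fixed thickness holds few points compared with
  the volume of the ball.\<close>

lemma sep_card_annulus:
  fixes F :: "'a::euclidean_space set"
  assumes F: "sep d F" and sub: "F \<subseteq> ball y r - ball y (r - R)" and R: "0 \<le> R"
  shows "real (card F) * vol TYPE('a) (d/2) \<le> vol TYPE('a) (r + d/2) - vol TYPE('a) (r - R - d/2)"
proof -
  have d: "d > 0" using F by (simp add: sep_def)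
  have fin: "finite F" using sep_finite[OF F, of "ball y r"] sub by (metis Diff_subset Int_absorb2 bounded_ball subset_trans)
  let ?T = "ball y (r + d/2) - ball y (r - R - d/2)"
  have "ball l (d/2) \<subseteq> ?T" if "l \<in> F" for l
  proof
    fix x assume x: "x \<in> ball l (d/2)"
    have l: "dist y l < r" "r - R \<le> dist y l" using that sub by (auto simp: not_less)
    have "dist y x < r + d/2" using x l dist_triangle[of y x l] by simp
    moreover have "r - R - d/2 \<le> dist y x" using x l dist_triangle[of y l x] by (simp add: dist_commute)
    ultimately show "x \<in> ?T" by simp
  qed
  then have "real (card F) * vol TYPE('a) (d/2) \<le> measure lebesgue ?T"
    by (intro sep_card_le[OF F fin]) auto
  also have "measure lebesgue ?T = vol TYPE('a) (r + d/2) - vol TYPE('a) (r - R - d/2)"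
    using R d by (subst measurable_measure_Diff) (auto simp: vol_ball intro!: subset_ball)
  finally show ?thesis .
qed

section \<open>Bessel families, uniform tails and the local trace\<close>

context fin_region
begin

text \<open>The upper frame inequality, stated for finite subfamilies so that it passes to subsets
  and to weak limits without any question of summability.\<close>

definition bessel :: "real \<Rightarrow> 'a set \<Rightarrow> bool" where
  "bessel B \<Lambda> \<longleftrightarrow> 0 \<le> B \<and>
     (\<forall>F f. finite F \<and> F \<subseteq> \<Lambda> \<and> f \<in> V \<longrightarrow> (\<Sum>l\<in>F. (cmod (ft f l))\<^sup>2) \<le> B * sq.nsq M f)"

lemma besselD: "bessel B \<Lambda> \<Longrightarrow> finite F \<Longrightarrow> F \<subseteq> \<Lambda> \<Longrightarrow> f \<in> V \<Longrightarrow> (\<Sum>l\<in>F. (cmod (ft f l))\<^sup>2) \<le> B * sq.nsq M f"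
  by (auto simp: bessel_def)

lemma nsq_modulate: "sq.nsq M (\<lambda>t. f t * expo l t) = sq.nsq M f"
  by (simp add: sq_nsq norm_mult)

lemma bessel_modulate:
  assumes "bessel B \<Lambda>" "finite F" "F \<subseteq> \<Lambda>" "f \<in> V"
  shows "(\<Sum>l\<in>F. (cmod (ft f (l - z)))\<^sup>2) \<le> B * sq.nsq M f"
  using besselD[OF assms(1-3) modulate_mem[OF assms(4), of z]]
  by (simp add: ft_modulate nsq_modulate)

definition trunc :: "real \<Rightarrow> ('a \<Rightarrow> complex) \<Rightarrow> 'a \<Rightarrow> complex" where
  "trunc R f t = (if norm t < R then f t else 0)"

lemma trunc_mem: "f \<in> V \<Longrightarrow> trunc R f \<in> V"
proof (rule sq_space_bound[of f _ _ 1])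
  assume f: "f \<in> V"
  note id_measurable [measurable]
  have [measurable]: "f \<in> borel_measurable M" using f by (rule sq_space_measurable)
  show "trunc R f \<in> borel_measurable M" unfolding trunc_def[abs_def] by measurable
qed (simp_all add: trunc_def)

lemma trunc_approx:
  assumes f: "f \<in> V" and e: "e > 0"
  shows "\<exists>R. sq.nsq M (\<lambda>t. f t - trunc R f t) < e"
proof -
  obtain R where "\<bar>LINT t|M. indicator {t. R \<le> norm t} t * (cmod (f t))\<^sup>2\<bar> < e"
    using integrable_tail[OF sq_space_integrable[OF f] id_measurable e] by blast
  moreover have "(cmod (f t - trunc R f t))\<^sup>2 = indicator {t. R \<le> norm t} t * (cmod (f t))\<^sup>2" for t
    by (simp add: trunc_def indicator_def)
  ultimately show ?thesis by (intro exI[of _ R]) (simp add: sq_nsq)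
qed

text \<open>The function \<open>\<psi>\<close> below is bounded away from zero on \<open>ball 0 K\<close>.  Writing \<open>trunc K f\<close> as the
  product of \<open>\<psi>\<close> with another square integrable function expresses its Fourier transform at a point as
  an integral over a small ball around this point.\<close>

lemma ft_trunc_local:
  assumes f: "f \<in> V" and d0: "d0 > 0"
  shows "\<exists>d h. 0 < d \<and> d \<le> d0 \<and> h \<in> V \<and>
    (\<forall>l. (cmod (ft (trunc K f) l))\<^sup>2 \<le> vol TYPE('a) d * (LINT x|lborel. indicator (ball l d) x * (cmod (ft h x))\<^sup>2))"
proof -
  note id_measurable [measurable]
  have [measurable]: "f \<in> borel_measurable M" using f by (rule sq_space_measurable)
  \<comment> \<open>With this radius \<open>2 * pi * (x \<bullet> t)\<close> stays in [-1, 1] for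
    \<open>x\<close> in the small ball and \<open>norm t < K\<close>, and on that interval the
    cosine is at least 1/2.\<close>
  define d where "d = min d0 (1 / (2 * pi * (\<bar>K\<bar> + 1)))"
  have d: "0 < d" "d \<le> d0" "2 * pi * d * \<bar>K\<bar> \<le> 1"
  proof -
    show "0 < d" "d \<le> d0" using d0 by (auto simp: d_def add_nonneg_pos)
    have "2 * pi * d * \<bar>K\<bar> \<le> 2 * pi * (1 / (2 * pi * (\<bar>K\<bar> + 1))) * \<bar>K\<bar>"
      by (intro mult_right_mono mult_left_mono) (auto simp: d_def)
    also have "\<dots> = \<bar>K\<bar> / (\<bar>K\<bar> + 1)" by simp
    also have "\<dots> \<le> 1" by simp
    finally show "2 * pi * d * \<bar>K\<bar> \<le> 1" .
  qed
  let ?B = "ball (0::'a) d"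
  have [measurable]: "?B \<in> sets borel" by simp
  have Bfin: "emeasure lborel ?B < \<infinity>" by (rule emeasure_lborel_ball_finite)
  have mB: "measure lborel ?B = vol TYPE('a) d" by (simp add: vol_def)
  have Bi: "integrable lborel (\<lambda>x. indicator ?B x :: complex)"
  proof -
    have "integrable lborel (indicator ?B :: 'a \<Rightarrow> real)" using Bfin by (simp add: integrable_indicator_iff)
    then have "integrable lborel (\<lambda>x. complex_of_real (indicator ?B x))" by (rule integrable_of_real)
    moreover have "(\<lambda>x. complex_of_real (indicator ?B x)) = indicator ?B" by (auto simp: indicator_def)
    ultimately show ?thesis by simp
  qed
  \<comment> \<open>The Fourier transform of the indicator of the small ball.\<close>
  define \<psi> where "\<psi> t = (LINT x|lborel. indicator ?B x * cnj (expo x t))" for t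
  have \<psi>i: "integrable lborel (\<lambda>x. indicator ?B x * cnj (expo x t))" for t
    by (rule Bochner_Integration.integrable_bound[OF Bi]) (auto simp: norm_mult)
  have [measurable]: "\<psi> \<in> borel_measurable M"
    unfolding \<psi>_def[abs_def] by measurable
  have \<psi>_low: "vol TYPE('a) d / 2 \<le> cmod (\<psi> t)" if t: "norm t < K" for t
  proof -
    have "vol TYPE('a) d / 2 = (LINT x|lborel. (1/2) * indicator ?B x)"
      by (simp add: mB)
    also have "\<dots> \<le> (LINT x|lborel. Re (indicator ?B x * cnj (expo x t)))"
    proof (rule integral_mono)
      show "integrable lborel (\<lambda>x. (1/2) * indicator ?B x :: real)"
        using Bfin by (intro integrable_mult_right) (simp add: integrable_indicator_iff)
      show "integrable lborel (\<lambda>x. Re (indicator ?B x * cnj (expo x t)))"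
        by (rule integrable_Re[OF \<psi>i])
      fix x :: 'a
      show "(1/2) * indicator ?B x \<le> Re (indicator ?B x * cnj (expo x t))"
      proof (cases "x \<in> ?B")
        case True
        define y where "y = 2 * pi * (x \<bullet> t)"
        have "\<bar>x \<bullet> t\<bar> \<le> norm x * norm t" by (rule Cauchy_Schwarz_ineq2)
        also have "\<dots> \<le> d * \<bar>K\<bar>" using True t d(1) by (intro mult_mono) auto
        finally have "\<bar>y\<bar> \<le> 2 * pi * (d * \<bar>K\<bar>)" by (simp add: y_def abs_mult)
        then have "\<bar>y\<bar> \<le> 1" using d(3) by (simp add: mult.assoc)
        then have "y\<^sup>2 \<le> 1" by (simp add: abs_square_le_1)
        moreover have "1 - y\<^sup>2 / 2 \<le> cos y"
        proof -
          have "\<bar>sin (y/2)\<bar> \<le> \<bar>y/2\<bar>" by (rule abs_sin_x_le_abs_x)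
          then have "(sin (y/2))\<^sup>2 \<le> (y/2)\<^sup>2" by (rule abs_le_square_iff[THEN iffD1])
          moreover have "cos y = 1 - 2 * (sin (y/2))\<^sup>2" using cos_double_sin[of "y/2"] by simp
          ultimately show ?thesis by (simp add: power_divide)
        qed
        ultimately have "1/2 \<le> cos y" by simp
        then show ?thesis using True by (simp add: expo_eq_cis y_def)
      qed simp
    qed
    also have "\<dots> = Re (\<psi> t)" unfolding \<psi>_def by (rule integral_Re[OF \<psi>i])
    also have "\<dots> \<le> cmod (\<psi> t)" by (rule complex_Re_le_cmod)
    finally show ?thesis .
  qed
  have vp: "vol TYPE('a) d > 0" using d by (intro vol_pos)
  define h where "h t = (if norm t < K then f t / \<psi> t else 0)" for t
  have hV: "h \<in> V"
  proof (rule sq_space_bound[OF f, where C = "2 / vol TYPE('a) d"])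
    show "h \<in> borel_measurable M" unfolding h_def[abs_def] by measurable
    show "cmod (h t) \<le> 2 / vol TYPE('a) d * cmod (f t)" for t
    proof (cases "norm t < K")
      case True
      have "cmod (f t) / cmod (\<psi> t) \<le> cmod (f t) / (vol TYPE('a) d / 2)"
        using \<psi>_low[OF True] vp by (intro divide_left_mono mult_pos_pos) (auto intro: less_le_trans[of _ "vol TYPE('a) d / 2"])
      then show ?thesis using True by (simp add: h_def norm_divide mult.commute)
    qed (simp add: h_def)
  qed
  have [measurable]: "h \<in> borel_measurable M" using hV by (rule sq_space_measurable)
  interpret P: pair_sigma_finite M "lborel :: 'a measure" ..
  have eq: "ft (trunc K f) l = (LINT x|lborel. indicator ?B x * ft h (x + l))" for l
  proof -
    define H where "H = (\<lambda>t (x::'a). h t * (indicator ?B x * cnj (expo (x + l) t)))"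
    have Hi: "integrable (M \<Otimes>\<^sub>M lborel) (case_prod H)"
    proof (rule Bochner_Integration.integrable_bound[OF P.integrable_prod_mult(1)[OF V_integrable[OF hV] Bi]])
      show "case_prod H \<in> borel_measurable (M \<Otimes>\<^sub>M lborel)" unfolding H_def by measurable
    qed (auto simp: H_def norm_mult)
    have "trunc K f t * cnj (expo l t) = (LINT x|lborel. H t x)" for t
    proof -
      have "H t x = (h t * cnj (expo l t)) * (indicator ?B x * cnj (expo x t))" for x
        by (simp add: H_def expo_add)
      then have "(LINT x|lborel. H t x) = h t * cnj (expo l t) * \<psi> t"
        by (simp only: \<psi>_def integral_mult_right_zero)
      moreover have "h t * \<psi> t = trunc K f t"
        using \<psi>_low[of t] vp by (auto simp: h_def trunc_def)
      ultimately show ?thesis by (simp add: mult_ac)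
    qed
    then have "ft (trunc K f) l = (LINT t|M. LINT x|lborel. H t x)" by (simp add: ft_alt)
    also have "\<dots> = (LINT x|lborel. LINT t|M. H t x)" by (rule P.Fubini_integral[OF Hi, symmetric])
    also have "\<dots> = (LINT x|lborel. indicator ?B x * ft h (x + l))"
    proof (rule Bochner_Integration.integral_cong[OF refl])
      fix x :: 'a
      have "H t x = indicator ?B x * (h t * cnj (expo (x + l) t))" for t by (simp add: H_def)
      then show "(LINT t|M. H t x) = indicator ?B x * ft h (x + l)"
        by (simp only: ft_alt integral_mult_right_zero)
    qed
    finally show ?thesis .
  qed
  have "(cmod (ft (trunc K f) l))\<^sup>2 \<le> vol TYPE('a) d * (LINT x|lborel. indicator (ball l d) x * (cmod (ft h x))\<^sup>2)" for l
  proof -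
    have hL: "ft h \<in> sq_space lborel" by (rule ft_bessel(2)[OF hV])
    have hm [measurable]: "ft h \<in> borel_measurable borel" by (rule ft_measurable[OF hV])
    have i2: "integrable lborel (\<lambda>x. (cmod (ft h (x - (- l))))\<^sup>2)"
      by (rule integrable_lborel_shift(1)[OF sq_space_integrable[OF hL]])
    have s1: "(\<lambda>x. indicator ?B x :: complex) \<in> sq_space lborel"
    proof -
      have "(cmod (indicator ?B x))\<^sup>2 = indicator ?B x" for x by (simp add: indicator_def)
      then show ?thesis using Bfin by (simp add: sq_space_def integrable_indicator_iff)
    qed
    have s0: "(\<lambda>x. ft h (x + l)) \<in> sq_space lborel"
      using i2 by (simp add: sq_space_def)
    have s2: "(\<lambda>x. indicator ?B x * cnj (ft h (x + l))) \<in> sq_space lborel"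
      by (rule sq_space_bound[OF s0, of _ 1]) (auto simp: indicator_def)
    \<comment> \<open>The indicator is written twice, so that Cauchy--Schwarz leaves the volume of
      the ball times an integral over the ball only.\<close>
    have "ft (trunc K f) l = sq_ip lborel (\<lambda>x. indicator ?B x) (\<lambda>x. indicator ?B x * cnj (ft h (x + l)))"
      unfolding eq sq_ip_def by (intro Bochner_Integration.integral_cong) (auto simp: indicator_def)
    then have "(cmod (ft (trunc K f) l))\<^sup>2 \<le> sq.nsq lborel (\<lambda>x. indicator ?B x) * sq.nsq lborel (\<lambda>x. indicator ?B x * cnj (ft h (x + l)))"
      using sq.cauchy_schwarz_sq[OF s1 s2] by simp
    also have "sq.nsq lborel (\<lambda>x. indicator ?B x) = vol TYPE('a) d"
    proof -
      have "(cmod (indicator ?B x))\<^sup>2 = indicator ?B x" for x by (simp add: indicator_def)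
      then show ?thesis by (simp add: sq_nsq mB)
    qed
    also have "sq.nsq lborel (\<lambda>x. indicator ?B x * cnj (ft h (x + l)))
        = (LINT x|lborel. indicator (ball l d) (x - (- l)) * (cmod (ft h (x - (- l))))\<^sup>2)"
      unfolding sq_nsq
      by (intro Bochner_Integration.integral_cong) (auto simp: indicator_def dist_norm)
    also have "\<dots> = (LINT x|lborel. indicator (ball l d) x * (cmod (ft h x))\<^sup>2)"
    proof (rule integrable_lborel_shift(2))
      show "integrable lborel (\<lambda>x. indicator (ball l d) x * (cmod (ft h x))\<^sup>2)"
        by (rule Bochner_Integration.integrable_bound[OF sq_space_integrable[OF hL]]) (auto simp: indicator_def)
    qed
    finally show ?thesis .
  qed
  then show ?thesis using d hV by blast
qed

text \<open>One radius serves all centres \<open>z\<close> at once; this uniformity is what survives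
  arbitrary translations of \<open>\<Lambda>\<close>.\<close>

definition tail_radius :: "'a set \<Rightarrow> ('a \<Rightarrow> complex) \<Rightarrow> real \<Rightarrow> real \<Rightarrow> bool" where
  "tail_radius \<Lambda> f e R \<longleftrightarrow> (\<forall>z F. finite F \<and> F \<subseteq> \<Lambda> \<and> (\<forall>l\<in>F. R \<le> dist l z) \<longrightarrow>
    (\<Sum>l\<in>F. (cmod (ft f (l - z)))\<^sup>2) \<le> e)"

lemma tail_radiusD:
  assumes "tail_radius \<Lambda> f e R" "finite F" "F \<subseteq> \<Lambda>" "\<And>l. l \<in> F \<Longrightarrow> R \<le> dist l z"
  shows "(\<Sum>l\<in>F. (cmod (ft f (l - z)))\<^sup>2) \<le> e"
  using assms unfolding tail_radius_def by simp

text \<open>Truncation splits \<open>f\<close>. The remainder is small in norm, so the Bessel bound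
  controls its samples uniformly in the centre. Each sample of the truncated part is bounded by an
  integral over a small ball; separation makes these balls disjoint, so samples far from the centre
  add up to at most a tail integral.\<close>

lemma bessel_tail:
  assumes L: "sep \<delta> \<Lambda>" and B: "bessel B \<Lambda>" and f: "f \<in> V" and e: "e > 0"
  shows "\<exists>R. tail_radius \<Lambda> f e R"
proof -
  have B0: "B \<ge> 0" using B by (simp add: bessel_def)
  \<comment> \<open>Each of the two parts of \<open>f\<close> is arranged to contribute
    \<open>e / 4\<close>, since squaring a sum costs a factor 2 on each part.\<close>
  define e1 where "e1 = e / (4 * (B + 1))"
  have e1: "e1 > 0" using e B0 by (simp add: e1_def)
  obtain K where K: "sq.nsq M (\<lambda>t. f t - trunc K f t) < e1" using trunc_approx[OF f e1] by blast
  have \<delta>: "\<delta> / 2 > 0" using L by (simp add: sep_def)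
  obtain d h where d: "0 < d" "d \<le> \<delta> / 2" and h: "h \<in> V" and
    loc: "\<And>l. (cmod (ft (trunc K f) l))\<^sup>2 \<le> vol TYPE('a) d * (LINT x|lborel. indicator (ball l d) x * (cmod (ft h x))\<^sup>2)"
    using ft_trunc_local[OF f \<delta>, of K] by blast
  have hL: "ft h \<in> sq_space lborel" by (rule ft_bessel(2)[OF h])
  have [measurable]: "ft h \<in> borel_measurable borel" by (rule ft_measurable[OF h])
  have vp: "vol TYPE('a) d > 0" using d by (intro vol_pos)
  define e2 where "e2 = e / (4 * vol TYPE('a) d)"
  have e2: "e2 > 0" using e vp by (simp add: e2_def)
  obtain R0 where R0: "\<bar>LINT x|lborel. indicator {x. R0 \<le> norm x} x * (cmod (ft h x))\<^sup>2\<bar> < e2"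
    using integrable_tail[OF sq_space_integrable[OF hL] _ e2] by auto
  \<comment> \<open>A ball of radius \<open>d\<close> whose centre has norm at least
    \<open>R\<close> stays outside \<open>ball 0 R0\<close>.\<close>
  define R where "R = R0 + d"
  have main: "(\<Sum>l\<in>F. (cmod (ft f (l - z)))\<^sup>2) \<le> e"
    if F: "finite F" "F \<subseteq> \<Lambda>" "\<And>l. l \<in> F \<Longrightarrow> R \<le> dist l z" for z F
  proof -
    have i: "integrable lborel (\<lambda>x. indicator A x * (cmod (ft h x))\<^sup>2)" if "A \<in> sets borel" for A
      using that hL by (intro Bochner_Integration.integrable_bound[OF sq_space_integrable[OF hL]])
        (auto simp: indicator_def)
    have "(\<Sum>l\<in>F. (LINT x|lborel. indicator (ball (l - z) d) x * (cmod (ft h x))\<^sup>2))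
        = (LINT x|lborel. (\<Sum>l\<in>F. indicator (ball (l - z) d) x * (cmod (ft h x))\<^sup>2))"
      using i by (subst Bochner_Integration.integral_sum) auto
    also have "\<dots> \<le> (LINT x|lborel. indicator {x. R0 \<le> norm x} x * (cmod (ft h x))\<^sup>2)"
    proof (rule integral_mono)
      show "integrable lborel (\<lambda>x. \<Sum>l\<in>F. indicator (ball (l - z) d) x * (cmod (ft h x))\<^sup>2)"
        using i by (intro Bochner_Integration.integrable_sum) auto
      show "integrable lborel (\<lambda>x. indicator {x. R0 \<le> norm x} x * (cmod (ft h x))\<^sup>2)"
        by (rule i) measurable
      fix x :: 'a
      have "(\<Sum>l\<in>F. indicator (ball (l - z) d) x) \<le> (indicator {x. R0 \<le> norm x} x :: real)"
      proof (cases "\<exists>l\<in>F. x \<in> ball (l - z) d")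
        case True
        then obtain l where l: "l \<in> F" "x \<in> ball (l - z) d" by blast
        have uniq: "l' = l" if "l' \<in> F" "x \<in> ball (l' - z) d" for l'
        proof -
          have "dist l' l \<le> dist (l' - z) x + dist (l - z) x"
            using dist_triangle2[of "l' - z" "l - z" x] by (simp add: dist_norm)
          then have "dist l' l < \<delta>" using that l d by simp
          then show ?thesis using sepD[OF L] that l F(2) by blast
        qed
        have "(\<Sum>l'\<in>F. indicator (ball (l' - z) d) x) = (\<Sum>l'\<in>{l}. indicator (ball (l' - z) d) x :: real)"
        proof (rule sum.mono_neutral_right)
          show "\<forall>i\<in>F - {l}. indicator (ball (i - z) d) x = (0::real)"
          proof
            fix i assume "i \<in> F - {l}"
            then have "x \<notin> ball (i - z) d" using uniq[of i] by blast
            then show "indicator (ball (i - z) d) x = (0::real)" by (rule indicator_simps(2))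
          qed
        qed (use F(1) l(1) in simp_all)
        moreover have "R0 \<le> norm x"
        proof -
          have "dist l z \<le> norm x + dist (l - z) x"
            using norm_triangle_ineq[of x "l - z - x"] by (simp add: dist_norm)
          then show ?thesis using F(3)[OF l(1)] l(2) by (simp add: R_def)
        qed
        ultimately show ?thesis using l by simp
      next
        case False
        then have "(\<Sum>l\<in>F. indicator (ball (l - z) d) x) = (0::real)"
          by (intro sum.neutral) (auto simp: indicator_def)
        then show ?thesis by simp
      qed
      then show "(\<Sum>l\<in>F. indicator (ball (l - z) d) x * (cmod (ft h x))\<^sup>2)
          \<le> indicator {x. R0 \<le> norm x} x * (cmod (ft h x))\<^sup>2"
        unfolding sum_distrib_right[symmetric] by (rule mult_right_mono) simp
    qed
    also have "\<dots> < e2" using R0 by simp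
    finally have S1: "(\<Sum>l\<in>F. (LINT x|lborel. indicator (ball (l - z) d) x * (cmod (ft h x))\<^sup>2)) \<le> e2" by simp
    have "(\<Sum>l\<in>F. (cmod (ft (trunc K f) (l - z)))\<^sup>2)
        \<le> (\<Sum>l\<in>F. vol TYPE('a) d * (LINT x|lborel. indicator (ball (l - z) d) x * (cmod (ft h x))\<^sup>2))"
      by (intro sum_mono loc)
    also have "\<dots> \<le> vol TYPE('a) d * e2"
      unfolding sum_distrib_left[symmetric] using S1 vp by (intro mult_left_mono) auto
    also have "\<dots> = e / 4" using vp by (simp add: e2_def)
    finally have S2: "(\<Sum>l\<in>F. (cmod (ft (trunc K f) (l - z)))\<^sup>2) \<le> e / 4" .
    have "(\<Sum>l\<in>F. (cmod (ft (\<lambda>t. f t - trunc K f t) (l - z)))\<^sup>2) \<le> B * sq.nsq M (\<lambda>t. f t - trunc K f t)"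
      by (intro bessel_modulate[OF B F(1,2)] sq.diff_mem f trunc_mem)
    also have "\<dots> \<le> B * e1" using K B0 by (intro mult_left_mono) auto
    also have "\<dots> \<le> e / 4" using B0 e by (simp add: e1_def field_simps)
    finally have S3: "(\<Sum>l\<in>F. (cmod (ft (\<lambda>t. f t - trunc K f t) (l - z)))\<^sup>2) \<le> e / 4" .
    have "(\<Sum>l\<in>F. (cmod (ft f (l - z)))\<^sup>2)
        \<le> (\<Sum>l\<in>F. 2 * (cmod (ft (trunc K f) (l - z)))\<^sup>2 + 2 * (cmod (ft (\<lambda>t. f t - trunc K f t) (l - z)))\<^sup>2)"
    proof (rule sum_mono)
      fix l
      show "(cmod (ft f (l - z)))\<^sup>2 \<le> 2 * (cmod (ft (trunc K f) (l - z)))\<^sup>2 + 2 * (cmod (ft (\<lambda>t. f t - trunc K f t) (l - z)))\<^sup>2"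
        using cmod_add_sq_le[of "ft (trunc K f) (l - z)" "ft (\<lambda>t. f t - trunc K f t) (l - z)"]
        by (simp add: ft_diff[OF f trunc_mem[OF f]])
    qed
    also have "\<dots> \<le> e" using S2 S3 by (simp add: sum.distrib sum_distrib_left[symmetric])
    finally show ?thesis .
  qed
  show ?thesis
    unfolding tail_radius_def
  proof (intro exI[of _ R] allI impI)
    fix z F assume "finite F \<and> F \<subseteq> \<Lambda> \<and> (\<forall>l\<in>F. R \<le> dist l z)"
    then show "(\<Sum>l\<in>F. (cmod (ft f (l - z)))\<^sup>2) \<le> e" by (intro main) simp_all
  qed
qed

text \<open>A local trace estimate: the integral is the Plancherel integral of the sum in front of
  it, cut down to the ball. The radius is uniform in the centre, in the subset \<open>F\<close> and
  in the vectors \<open>h m\<close> of bounded norm, so that it applies both to dual vectors of a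
  frame and to biorthogonal systems that change with the ball.\<close>

definition boundary_radius :: "'a set \<Rightarrow> real \<Rightarrow> real \<Rightarrow> real \<Rightarrow> bool" where
  "boundary_radius \<Lambda> C e r0 \<longleftrightarrow> 0 < r0 \<and>
    (\<forall>r y F h. r0 \<le> r \<and> F \<subseteq> \<Lambda> \<inter> ball y r \<and> (\<forall>m\<in>F. h m \<in> V \<and> sq.nsq M (h m) \<le> C) \<longrightarrow>
    cmod ((\<Sum>m\<in>F. sq_ip M (h m) (expo m)) -
      (LINT x|lborel. indicator (ball y r) x * (\<Sum>m\<in>F. ft (h m) x * cnj (ft (expo m) x)))) \<le> e * vol TYPE('a) r)"

lemma boundary_radiusD:
  assumes "boundary_radius \<Lambda> C e r0" "r0 \<le> r" "F \<subseteq> \<Lambda> \<inter> ball y r"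
    and "\<And>m. m \<in> F \<Longrightarrow> h m \<in> V" "\<And>m. m \<in> F \<Longrightarrow> sq.nsq M (h m) \<le> C"
  shows "cmod ((\<Sum>m\<in>F. sq_ip M (h m) (expo m)) -
      (LINT x|lborel. indicator (ball y r) x * (\<Sum>m\<in>F. ft (h m) x * cnj (ft (expo m) x)))) \<le> e * vol TYPE('a) r"
  using assms unfolding boundary_radius_def by simp

text \<open>Only the points of \<open>F\<close> near the boundary of the ball contribute substantially: for the others the
  omitted part of the Plancherel integral is small.\<close>

lemma boundary_estimate:
  assumes L: "sep \<delta> \<Lambda>" and C: "C \<ge> 0" and e: "e > 0"
  shows "\<exists>r0. boundary_radius \<Lambda> C e r0"
proof -
  have \<delta>: "\<delta> > 0" using L by (simp add: sep_def)
  have oneL: "ft (\<lambda>_. 1) \<in> sq_space lborel" by (rule ft_bessel(2)[OF one_mem])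
  have [measurable]: "ft (\<lambda>_. 1) \<in> borel_measurable borel" by (rule ft_measurable[OF one_mem])
  define v where "v = vol TYPE('a) (\<delta>/2)"
  have v: "v > 0" unfolding v_def using \<delta> by (intro vol_pos) simp
  \<comment> \<open>The cost of an interior point. Packing allows at most \<open>2 / v\<close>
    points per unit volume, each carrying a factor \<open>sqrt C\<close>, which makes
    \<open>e / 2\<close> in total; the summand 1 keeps the denominator positive.\<close>
  define \<eta> where "\<eta> = e * v / (4 * (sqrt C + 1))"
  have \<eta>: "\<eta> > 0" using e v C by (simp add: \<eta>_def add_nonneg_pos)
  have "\<eta>\<^sup>2 > 0" using \<eta> by simp
  then obtain R0 where R0: "\<bar>LINT x|lborel. indicator {x. R0 \<le> norm x} x * (cmod (ft (\<lambda>_. 1) x))\<^sup>2\<bar> < \<eta>\<^sup>2"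
    using integrable_tail[OF sq_space_integrable[OF oneL], of "\<eta>\<^sup>2"] by auto
  define R where "R = max 0 R0"
  have R: "R \<ge> 0" by (simp add: R_def)
  have l1: "((\<lambda>r. vol TYPE('a) (r + \<delta>/2) / vol TYPE('a) r) \<longlongrightarrow> 1) at_top" by (rule vol_ratio)
  have l2: "((\<lambda>r. vol TYPE('a) (r + - (R + \<delta>/2)) / vol TYPE('a) r) \<longlongrightarrow> 1) at_top" by (rule vol_ratio)
  \<comment> \<open>Up to the factor \<open>1 / v\<close>, the density allowed for points near the
    boundary, each of which may cost \<open>sqrt C * sqrt mS\<close>; they account for the other
    \<open>e / 2\<close>.\<close>
  define \<kappa> where "\<kappa> = e * v / (2 * (sqrt C + 1) * (sqrt mS + 1))"
  have \<kappa>: "\<kappa> > 0" using e v C by (simp add: \<kappa>_def add_nonneg_pos)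
  have "((\<lambda>r. vol TYPE('a) (r + \<delta>/2) / vol TYPE('a) r - vol TYPE('a) (r + - (R + \<delta>/2)) / vol TYPE('a) r) \<longlongrightarrow> 1 - 1) at_top"
    by (rule tendsto_diff[OF l1 l2])
  then have ev1: "\<forall>\<^sub>F r in at_top. vol TYPE('a) (r + \<delta>/2) / vol TYPE('a) r - vol TYPE('a) (r + - (R + \<delta>/2)) / vol TYPE('a) r < \<kappa>"
    using order_tendstoD(2)[of _ "1 - 1 :: real" _ \<kappa>] \<kappa> by simp
  have ev2: "\<forall>\<^sub>F r in at_top. vol TYPE('a) (r + \<delta>/2) / vol TYPE('a) r < 2"
    using order_tendstoD(2)[OF l1, of 2] by simp
  have "\<forall>\<^sub>F r::real in at_top. r > 0" by (rule eventually_gt_at_top)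
  with ev1 ev2 have "\<forall>\<^sub>F r in at_top. r > 0 \<and> vol TYPE('a) (r + \<delta>/2) \<le> 2 * vol TYPE('a) r
     \<and> vol TYPE('a) (r + \<delta>/2) - vol TYPE('a) (r - R - \<delta>/2) \<le> \<kappa> * vol TYPE('a) r"
  proof eventually_elim
    case (elim r)
    have vr: "vol TYPE('a) r > 0" using elim by (intro vol_pos)
    have eq: "r + - (R + \<delta>/2) = r - R - \<delta>/2" by simp
    show ?case using elim(1)[unfolded eq] elim(2,3) vr
      by (simp add: diff_divide_distrib[symmetric] divide_less_eq)
  qed
  then obtain r0 where r0: "\<And>r. r \<ge> r0 \<Longrightarrow> r > 0 \<and> vol TYPE('a) (r + \<delta>/2) \<le> 2 * vol TYPE('a) r
     \<and> vol TYPE('a) (r + \<delta>/2) - vol TYPE('a) (r - R - \<delta>/2) \<le> \<kappa> * vol TYPE('a) r"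
    by (auto simp: eventually_at_top_linorder)
  have main: "cmod ((\<Sum>m\<in>F. sq_ip M (h m) (expo m)) -
      (LINT x|lborel. indicator (ball y r) x * (\<Sum>m\<in>F. ft (h m) x * cnj (ft (expo m) x)))) \<le> e * vol TYPE('a) r"
    if r: "r \<ge> r0" and F: "F \<subseteq> \<Lambda> \<inter> ball y r" and h: "\<And>m. m \<in> F \<Longrightarrow> h m \<in> V" "\<And>m. m \<in> F \<Longrightarrow> sq.nsq M (h m) \<le> C"
    for r y F h
  proof -
    have fin: "finite F"
      using sep_finite[OF L bounded_ball] F finite_subset by blast
    have sF: "sep \<delta> F" using L F by (auto intro: sep_subset)
    have hL: "ft (h m) \<in> sq_space lborel" "ft (h m) \<in> borel_measurable borel" if "m \<in> F" for m
      using ft_bessel(2)[OF h(1)[OF that]] ft_measurable[OF h(1)[OF that]] by auto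
    have eL: "ft (expo m) \<in> sq_space lborel" "ft (expo m) \<in> borel_measurable borel" for m
      using ft_bessel(2)[OF expo_mem] ft_measurable[OF expo_mem] by auto
    define g where "g m x = ft (h m) x * cnj (ft (expo m) x)" for m x
    have gi: "integrable lborel (g m)" if "m \<in> F" for m
      unfolding g_def by (rule sq_space_mult_integrable[OF hL(1)[OF that] eL(1)])
    have gAi: "integrable lborel (\<lambda>x. indicator A x * g m x)" if "m \<in> F" "A \<in> sets borel" for m A
      using gi[OF that(1)] that(2) by (intro Bochner_Integration.integrable_bound[OF gi[OF that(1)]]) (auto simp: indicator_def)
    have total: "sq_ip M (h m) (expo m) = (LINT x|lborel. indicator (ball y r) x * g m x) + (LINT x|lborel. indicator (- ball y r) x * g m x)"
      if "m \<in> F" for m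
    proof -
      have "sq_ip M (h m) (expo m) = (LINT x|lborel. g m x)"
        unfolding plancherel_expo[OF h(1)[OF that], symmetric] by (simp add: sq_ip_def g_def)
      also have "\<dots> = (LINT x|lborel. indicator (ball y r) x * g m x + indicator (- ball y r) x * g m x)"
        by (intro Bochner_Integration.integral_cong) (auto simp: indicator_def)
      also have "\<dots> = (LINT x|lborel. indicator (ball y r) x * g m x) + (LINT x|lborel. indicator (- ball y r) x * g m x)"
        by (intro Bochner_Integration.integral_add gAi that) auto
      finally show ?thesis .
    qed
    have "(LINT x|lborel. indicator (ball y r) x * (\<Sum>m\<in>F. g m x)) = (\<Sum>m\<in>F. LINT x|lborel. indicator (ball y r) x * g m x)"
      unfolding sum_distrib_left by (intro Bochner_Integration.integral_sum gAi) auto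
    then have diff: "(\<Sum>m\<in>F. sq_ip M (h m) (expo m)) - (LINT x|lborel. indicator (ball y r) x * (\<Sum>m\<in>F. g m x))
        = (\<Sum>m\<in>F. LINT x|lborel. indicator (- ball y r) x * g m x)"
      using total by (simp add: sum.distrib)
    \<comment> \<open>A point of the inner ball is at distance at least \<open>R\<close> from the
      complement of \<open>ball y r\<close>, so only a tail of the transform of
      \<open>expo m\<close> is left there. The remaining points are charged the full norm.\<close>
    define b where "b m = (if m \<in> ball y (r - R) then \<eta> else sqrt mS)" for m
    have each: "cmod (LINT x|lborel. indicator (- ball y r) x * g m x) \<le> sqrt C * b m" if m: "m \<in> F" for m
    proof -
      let ?E = "\<lambda>x. indicator (- ball y r) x * ft (expo m) x"
      have EL: "?E \<in> sq_space lborel"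
        by (rule sq_space_bound[OF eL(1)[of m], of _ 1]) (use eL(2)[of m] in \<open>auto simp: indicator_def\<close>)
      have "(LINT x|lborel. indicator (- ball y r) x * g m x) = sq_ip lborel (ft (h m)) ?E"
        unfolding sq_ip_def g_def by (intro Bochner_Integration.integral_cong) (auto simp: indicator_def)
      then have "cmod (LINT x|lborel. indicator (- ball y r) x * g m x) \<le> sq.nm lborel (ft (h m)) * sq.nm lborel ?E"
        using sq.cauchy_schwarz[OF hL(1)[OF m] EL] by simp
      also have "\<dots> \<le> sqrt C * b m"
      proof (rule mult_mono)
        show "sq.nm lborel (ft (h m)) \<le> sqrt C"
          unfolding sq.nm_def using ft_bessel(3)[OF h(1)[OF m]] h(2)[OF m] by (intro real_sqrt_le_mono) simp
        have Ei: "integrable lborel (\<lambda>x. indicator (- ball y r) x * (cmod (ft (expo m) x))\<^sup>2)"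
          using eL(2)[of m] by (intro Bochner_Integration.integrable_bound[OF sq_space_integrable[OF eL(1)[of m]]]) (auto simp: indicator_def)
        have nE: "sq.nsq lborel ?E = (LINT x|lborel. indicator (- ball y r) x * (cmod (ft (expo m) x))\<^sup>2)"
          unfolding sq_nsq by (intro Bochner_Integration.integral_cong) (auto simp: indicator_def)
        show "sq.nm lborel ?E \<le> b m"
        proof (cases "m \<in> ball y (r - R)")
          case True
          have Ti: "integrable lborel (\<lambda>x. indicator {x. R0 \<le> norm x} x * (cmod (ft (\<lambda>_. 1) x))\<^sup>2)"
            by (intro Bochner_Integration.integrable_bound[OF sq_space_integrable[OF oneL]]) (auto simp: indicator_def)
          have "sq.nsq lborel ?E \<le> (LINT x|lborel. indicator {x. R0 \<le> norm x} (x - m) * (cmod (ft (\<lambda>_. 1) (x - m)))\<^sup>2)"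
            unfolding nE
          proof (rule integral_mono[OF Ei integrable_lborel_shift(1)[OF Ti]])
            fix x :: 'a
            have "R0 \<le> norm (x - m)" if "x \<notin> ball y r"
              using that True dist_triangle[of y x m] by (simp add: R_def dist_norm norm_minus_commute)
            then show "indicator (- ball y r) x * (cmod (ft (expo m) x))\<^sup>2
                \<le> indicator {x. R0 \<le> norm x} (x - m) * (cmod (ft (\<lambda>_. 1) (x - m)))\<^sup>2"
              by (auto simp: indicator_def ft_expo)
          qed
          also have "\<dots> = (LINT x|lborel. indicator {x. R0 \<le> norm x} x * (cmod (ft (\<lambda>_. 1) x))\<^sup>2)"
            by (rule integrable_lborel_shift(2)[OF Ti])
          also have "\<dots> \<le> \<eta>\<^sup>2" using R0 by simp
          finally have "sq.nm lborel ?E \<le> \<eta>"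
            unfolding sq.nm_def using \<eta> by (intro real_le_lsqrt) (simp_all add: sq.nsq_nonneg[OF EL])
          then show ?thesis using True by (simp add: b_def)
        next
          case False
          have "sq.nsq lborel ?E \<le> sq.nsq lborel (ft (expo m))"
            unfolding nE unfolding sq_nsq
            by (rule integral_mono[OF Ei sq_space_integrable[OF eL(1)]]) (auto simp: indicator_def)
          also have "\<dots> \<le> mS" using ft_bessel(3)[OF expo_mem[of m]] by (simp add: nsq_expo)
          finally show ?thesis using False by (simp add: b_def sq.nm_def real_sqrt_le_mono)
        qed
        show "0 \<le> sqrt C" using C by simp
        show "0 \<le> sq.nm lborel ?E" by (rule sq.nm_nonneg[OF EL])
      qed
      finally show ?thesis .
    qed
    let ?In = "F \<inter> ball y (r - R)" and ?Out = "F - ball y (r - R)"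
    have "cmod (\<Sum>m\<in>F. LINT x|lborel. indicator (- ball y r) x * g m x) \<le> (\<Sum>m\<in>F. sqrt C * b m)"
      by (rule order_trans[OF norm_sum]) (intro sum_mono each)
    also have "\<dots> = sqrt C * (\<Sum>m\<in>F. b m)" by (rule sum_distrib_left[symmetric])
    also have "(\<Sum>m\<in>F. b m) = real (card ?In) * \<eta> + real (card ?Out) * sqrt mS"
      unfolding b_def using fin by (simp add: sum.If_cases Diff_eq Int_def)
    also have "sqrt C * (real (card ?In) * \<eta> + real (card ?Out) * sqrt mS) \<le> e * vol TYPE('a) r"
    proof -
      have vr: "vol TYPE('a) r > 0" using r0[OF r] by (intro vol_pos) simp
      have c1: "real (card ?In) * v \<le> 2 * vol TYPE('a) r"
        using sep_card_ball[of \<delta> ?In y r] sep_subset[OF sF, of ?In] F r0[OF r] unfolding v_def by force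
      have c2: "real (card ?Out) * v \<le> \<kappa> * vol TYPE('a) r"
        using sep_card_annulus[of \<delta> ?Out y r R] sep_subset[OF sF, of ?Out] F r0[OF r] R unfolding v_def by force
      define q where "q = sqrt C + 1"
      define q' where "q' = sqrt mS + 1"
      have frac: "x / (x + 1) \<le> 1" if "0 \<le> x" for x :: real using that by (simp add: divide_le_eq)
      have C1: "sqrt C / (sqrt C + 1) \<le> 1" "0 \<le> sqrt C" using C by (auto intro!: frac)
      have C2: "sqrt mS / (sqrt mS + 1) \<le> 1" by (intro frac) simp
      have "sqrt C * (real (card ?In) * \<eta>) = (sqrt C / (sqrt C + 1)) * (e / 4) * (real (card ?In) * v)"
        unfolding \<eta>_def q_def[symmetric] by (simp add: mult_ac)
      also have "\<dots> \<le> 1 * (e / 4) * (2 * vol TYPE('a) r)"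
        by (rule mult_mono[OF mult_right_mono[OF C1(1)] c1]) (use e v vr in auto)
      finally have 1: "sqrt C * (real (card ?In) * \<eta>) \<le> e / 2 * vol TYPE('a) r" by simp
      have "sqrt C * (real (card ?Out) * sqrt mS) * v \<le> sqrt C * sqrt mS * (\<kappa> * vol TYPE('a) r)"
        using mult_left_mono[OF c2, of "sqrt C * sqrt mS"] C1(2) by (simp add: mult_ac)
      also have "\<dots> = (sqrt C / (sqrt C + 1)) * (sqrt mS / (sqrt mS + 1)) * (e / 2 * vol TYPE('a) r) * v"
        unfolding \<kappa>_def q_def[symmetric] q'_def[symmetric] by (simp add: mult_ac)
      also have "\<dots> \<le> 1 * 1 * (e / 2 * vol TYPE('a) r) * v"
        by (rule mult_right_mono[OF mult_right_mono[OF mult_mono[OF C1(1) C2]]]) (use e v vr in auto)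
      finally have 2: "sqrt C * (real (card ?Out) * sqrt mS) \<le> e / 2 * vol TYPE('a) r"
        using v by simp
      show ?thesis using 1 2 by (simp add: distrib_left)
    qed
    finally show ?thesis using diff unfolding g_def by simp
  qed
  show ?thesis
    unfolding boundary_radius_def
  proof (intro exI[of _ r0] conjI allI impI)
    show "0 < r0" using r0[of r0] by simp
    fix r y F h
    assume "r0 \<le> r \<and> F \<subseteq> \<Lambda> \<inter> ball y r \<and> (\<forall>m\<in>F. h m \<in> V \<and> sq.nsq M (h m) \<le> C)"
    then show "cmod ((\<Sum>m\<in>F. sq_ip M (h m) (expo m)) -
      (LINT x|lborel. indicator (ball y r) x * (\<Sum>m\<in>F. ft (h m) x * cnj (ft (expo m) x)))) \<le> e * vol TYPE('a) r"
      by (intro main) simp_all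
  qed
qed

end

lemma infsum_complex_of_real: "(\<Sum>\<^sub>\<infinity>x\<in>A. complex_of_real (f x)) = of_real (\<Sum>\<^sub>\<infinity>x\<in>A. f x)"
proof (cases "f summable_on A")
  case True
  then show ?thesis using has_sum_of_real[OF has_sum_infsum[OF True]] by (rule_tac infsumI)
next
  case False
  moreover have "\<not> (\<lambda>x. complex_of_real (f x)) summable_on A"
    using False summable_on_Re[of "\<lambda>x. complex_of_real (f x)" A] by auto
  ultimately show ?thesis by (simp add: infsum_not_exists)
qed

context fin_region
begin

lemma L2_space_eq: "L2_space S = V"
  by (simp add: L2_space_def sq_space_def)

lemma L2_inner_eq: "L2_inner S = sq_ip M"
  by (intro ext) (simp add: L2_inner_def sq_ip_def)

lemma L2_norm_eq: "L2_norm S = sq.nm M"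
  by (intro ext) (simp add: L2_norm_def sq.nm_def sq_nsq)

section \<open>Frames of exponentials\<close>

lemma bessel_summable:
  assumes B: "bessel B \<Lambda>" and f: "f \<in> V"
  shows "(\<lambda>l. (cmod (ft f l))\<^sup>2) summable_on \<Lambda>"
    and "(\<Sum>\<^sub>\<infinity>l\<in>\<Lambda>. (cmod (ft f l))\<^sup>2) \<le> B * sq.nsq M f"
proof -
  show s: "(\<lambda>l. (cmod (ft f l))\<^sup>2) summable_on \<Lambda>"
    using besselD[OF B _ _ f]
    by (intro nonneg_bdd_above_summable_on bdd_aboveI2[of _ _ "B * sq.nsq M f"]) auto
  show "(\<Sum>\<^sub>\<infinity>l\<in>\<Lambda>. (cmod (ft f l))\<^sup>2) \<le> B * sq.nsq M f"
    using besselD[OF B _ _ f] by (intro infsum_le_finite_sums s) auto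
qed

lemma bessel_subset: "bessel B \<Lambda> \<Longrightarrow> \<Lambda>' \<subseteq> \<Lambda> \<Longrightarrow> bessel B \<Lambda>'"
  by (auto simp: bessel_def)

text \<open>The form <T f, g> of the frame operator T. It stands in for T and, through its
  representing vectors, for the inverse of T.\<close>

definition fip :: "'a set \<Rightarrow> ('a \<Rightarrow> complex) \<Rightarrow> ('a \<Rightarrow> complex) \<Rightarrow> complex" where
  "fip \<Lambda> f g = (\<Sum>\<^sub>\<infinity>l\<in>\<Lambda>. ft f l * cnj (ft g l))"

lemma fip_summable:
  assumes B: "bessel B \<Lambda>" and f: "f \<in> V" and g: "g \<in> V"
  shows "(\<lambda>l. ft f l * cnj (ft g l)) summable_on \<Lambda>"
proof (rule Infinite_Sum.abs_summable_summable, rule Infinite_Sum.abs_summable_on_comparison_test')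
  show "(\<lambda>l. (cmod (ft f l))\<^sup>2 + (cmod (ft g l))\<^sup>2) summable_on \<Lambda>"
    by (intro summable_on_add bessel_summable[OF B] f g)
  show "norm (ft f l * cnj (ft g l)) \<le> (cmod (ft f l))\<^sup>2 + (cmod (ft g l))\<^sup>2" for l
    using cmod_mult_le[of "ft f l" "cnj (ft g l)"] by simp
qed

lemma fip_self: "fip \<Lambda> f f = of_real (\<Sum>\<^sub>\<infinity>l\<in>\<Lambda>. (cmod (ft f l))\<^sup>2)"
proof -
  have "(\<lambda>l. ft f l * cnj (ft f l)) = (\<lambda>l. of_real ((cmod (ft f l))\<^sup>2))"
    by (rule ext) (rule complex_norm_square[symmetric])
  then show ?thesis unfolding fip_def by (simp only: infsum_complex_of_real)
qed

lemma fip_semi_ip: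
  assumes B: "bessel B \<Lambda>"
  shows "semi_ip V (fip \<Lambda>)"
proof
  show "(\<lambda>_. 0) \<in> V" by (rule sq.zero_mem)
  show "(\<lambda>t. a * f t + g t) \<in> V" if "f \<in> V" "g \<in> V" for f g a using that by (rule sq.lin_mem)
  show "fip \<Lambda> (\<lambda>t. a * f t + g t) h = a * fip \<Lambda> f h + fip \<Lambda> g h" if V: "f \<in> V" "g \<in> V" "h \<in> V" for f g h a
  proof -
    have "fip \<Lambda> (\<lambda>t. a * f t + g t) h = (\<Sum>\<^sub>\<infinity>l\<in>\<Lambda>. a * (ft f l * cnj (ft h l)) + ft g l * cnj (ft h l))"
      unfolding fip_def by (simp add: ft_lin[OF V(1,2)] distrib_right mult.assoc)
    also have "\<dots> = (\<Sum>\<^sub>\<infinity>l\<in>\<Lambda>. a * (ft f l * cnj (ft h l))) + (\<Sum>\<^sub>\<infinity>l\<in>\<Lambda>. ft g l * cnj (ft h l))"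
      by (intro infsum_add summable_on_cmult_right fip_summable[OF B] V)
    also have "(\<Sum>\<^sub>\<infinity>l\<in>\<Lambda>. a * (ft f l * cnj (ft h l))) = a * (\<Sum>\<^sub>\<infinity>l\<in>\<Lambda>. ft f l * cnj (ft h l))"
      by (intro infsum_cmult_right fip_summable[OF B] V)
    finally show ?thesis by (simp add: fip_def)
  qed
  show "fip \<Lambda> g f = cnj (fip \<Lambda> f g)" for f g
    unfolding fip_def by (simp add: infsum_cnj[symmetric] mult.commute del: infsum_cnj)
  show "0 \<le> Re (fip \<Lambda> f f)" for f
    unfolding fip_self by (simp add: infsum_nonneg)
qed

text \<open>For a family that is not summable the infinite sum is 0, so this default can only make
  the inequality harder to satisfy.\<close>

definition lower_frame :: "real \<Rightarrow> 'a set \<Rightarrow> bool" where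
  "lower_frame A \<Lambda> \<longleftrightarrow> 0 < A \<and> (\<forall>f\<in>V. A * sq.nsq M f \<le> (\<Sum>\<^sub>\<infinity>l\<in>\<Lambda>. (cmod (ft f l))\<^sup>2))"

lemma exp_frame_bounds:
  assumes "exp_frame S \<Lambda>"
  shows "\<exists>A B. bessel B \<Lambda> \<and> lower_frame A \<Lambda>"
proof -
  obtain A B where AB: "0 < A" "A \<le> B" and fr: "\<And>f. f \<in> V \<Longrightarrow>
     (\<lambda>l. (cmod (ft f l))\<^sup>2) summable_on \<Lambda> \<and>
     A * sq.nsq M f \<le> (\<Sum>\<^sub>\<infinity>l\<in>\<Lambda>. (cmod (ft f l))\<^sup>2) \<and>
     (\<Sum>\<^sub>\<infinity>l\<in>\<Lambda>. (cmod (ft f l))\<^sup>2) \<le> B * sq.nsq M f"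
    using assms unfolding exp_frame_def L2_space_eq L2_inner_eq L2_norm_eq ft_def[symmetric]
    by (auto simp: sq.nm_sq)
  have "bessel B \<Lambda>"
    unfolding bessel_def
  proof (intro conjI allI impI)
    show "0 \<le> B" using AB by simp
    fix F f assume "finite F \<and> F \<subseteq> \<Lambda> \<and> f \<in> V"
    then have "(\<Sum>l\<in>F. (cmod (ft f l))\<^sup>2) \<le> (\<Sum>\<^sub>\<infinity>l\<in>\<Lambda>. (cmod (ft f l))\<^sup>2)"
      using fr by (intro finite_sum_le_infsum) auto
    also have "\<dots> \<le> B * sq.nsq M f" using fr \<open>finite F \<and> F \<subseteq> \<Lambda> \<and> f \<in> V\<close> by blast
    finally show "(\<Sum>l\<in>F. (cmod (ft f l))\<^sup>2) \<le> B * sq.nsq M f" .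
  qed
  moreover have "lower_frame A \<Lambda>" using AB fr by (simp add: lower_frame_def)
  ultimately show ?thesis by blast
qed

text \<open>The frame bounds make the seminorms of \<open>fip \<Lambda>\<close> and
  \<open>sq_ip M\<close> equivalent, so \<open>V\<close> is complete for
  \<open>fip \<Lambda>\<close> as well and Riesz representation applies there. The representing
  vector is the inverse frame operator applied to \<open>g\<close>.\<close>

lemma frame_riesz:
  assumes B: "bessel B \<Lambda>" and A: "lower_frame A \<Lambda>" and g: "g \<in> V"
  shows "\<exists>h\<in>V. \<forall>f\<in>V. sq_ip M f g = fip \<Lambda> f h"
proof -
  interpret F: semi_ip V "fip \<Lambda>" by (rule fip_semi_ip[OF B])
  have A0: "A > 0" using A by (simp add: lower_frame_def)
  have low: "A * sq.nsq M f \<le> F.nsq f" if "f \<in> V" for f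
    using A that by (simp add: lower_frame_def F.nsq_def fip_self)
  have up: "F.nsq f \<le> B * sq.nsq M f" if "f \<in> V" for f
    using bessel_summable(2)[OF B that] by (simp add: F.nsq_def fip_self)
  show ?thesis
  proof (rule F.riesz_representation)
    show "0 \<le> sq.nsq M g / A" using A0 sq.nsq_nonneg[OF g] by simp
    show "sq_ip M (\<lambda>t. a * f t + h t) g = a * sq_ip M f g + sq_ip M h g" if "f \<in> V" "h \<in> V" for f h a
      using that g by (intro sq.ip_lin)
    show "(cmod (sq_ip M f g))\<^sup>2 \<le> sq.nsq M g / A * F.nsq f" if "f \<in> V" for f
    proof -
      have "(cmod (sq_ip M f g))\<^sup>2 \<le> sq.nsq M f * sq.nsq M g" by (rule sq.cauchy_schwarz_sq[OF that g])
      also have "\<dots> \<le> (F.nsq f / A) * sq.nsq M g"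
        using low[OF that] A0 sq.nsq_nonneg[OF g] by (intro mult_right_mono) (simp_all add: field_simps)
      finally show ?thesis by (simp add: mult.commute)
    qed
    fix X :: "nat \<Rightarrow> 'a \<Rightarrow> complex"
    assume X: "\<And>n. X n \<in> V" and C: "\<And>e. 0 < e \<Longrightarrow> \<exists>N. \<forall>m\<ge>N. \<forall>n\<ge>N. F.nsq (\<lambda>t. X m t - X n t) < e"
    have "\<exists>N. \<forall>m\<ge>N. \<forall>n\<ge>N. sq.nsq M (\<lambda>t. X m t - X n t) < e" if "0 < e" for e
    proof -
      obtain N where N: "\<And>m n. m \<ge> N \<Longrightarrow> n \<ge> N \<Longrightarrow> F.nsq (\<lambda>t. X m t - X n t) < A * e"
        using C[of "A * e"] A0 \<open>0 < e\<close> by auto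
      have "sq.nsq M (\<lambda>t. X m t - X n t) < e" if "m \<ge> N" "n \<ge> N" for m n
      proof -
        have "A * sq.nsq M (\<lambda>t. X m t - X n t) < A * e"
          using low[OF sq.diff_mem[OF X[of m] X[of n]]] N[OF that] by (rule le_less_trans)
        then show ?thesis using A0 by simp
      qed
      then show ?thesis by blast
    qed
    from sq_complete[OF X this] obtain h where h: "h \<in> V" "(\<lambda>n. sq.nsq M (\<lambda>t. X n t - h t)) \<longlonglongrightarrow> 0" by blast
    have lim: "(\<lambda>n. B * sq.nsq M (\<lambda>t. X n t - h t)) \<longlonglongrightarrow> 0"
      using tendsto_mult_left[OF h(2), of B] by simp
    have "(\<lambda>n. F.nsq (\<lambda>t. X n t - h t)) \<longlonglongrightarrow> 0"
      by (rule real_tendsto_sandwich[OF _ _ tendsto_const lim])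
        (use up[OF sq.diff_mem[OF X h(1)]] F.nsq_nonneg[OF sq.diff_mem[OF X h(1)]] in auto)
    then show "\<exists>h\<in>V. (\<lambda>n. F.nsq (\<lambda>t. X n t - h t)) \<longlonglongrightarrow> 0" using h(1) by blast
  qed
qed

text \<open>The vector \<open>dual \<Lambda> x\<close> is the image of \<open>expo x\<close> under the inverse of the frame operator of \<open>\<Lambda>\<close>.\<close>

definition dual :: "'a set \<Rightarrow> 'a \<Rightarrow> 'a \<Rightarrow> complex" where
  "dual \<Lambda> x = (SOME h. h \<in> V \<and> (\<forall>f\<in>V. ft f x = fip \<Lambda> f h))"

lemma dual:
  assumes B: "bessel B \<Lambda>" and A: "lower_frame A \<Lambda>"
  shows "dual \<Lambda> x \<in> V" and "f \<in> V \<Longrightarrow> ft f x = fip \<Lambda> f (dual \<Lambda> x)"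
proof -
  have "\<exists>h. h \<in> V \<and> (\<forall>f\<in>V. ft f x = fip \<Lambda> f h)"
    using frame_riesz[OF B A expo_mem[of x]] unfolding ft_def by blast
  from someI_ex[OF this] show "dual \<Lambda> x \<in> V" "f \<in> V \<Longrightarrow> ft f x = fip \<Lambda> f (dual \<Lambda> x)"
    unfolding dual_def by auto
qed

text \<open>The frame energy of \<open>dual \<Lambda> x\<close> equals its own sample at
  \<open>x\<close>, hence is at most \<open>sqrt mS\<close> times its norm, whereas the lower frame
  bound says that it is at least \<open>A\<close> times the squared norm. The resulting bounds are
  uniform in \<open>x\<close>.\<close>

lemma dual_bounds:
  assumes B: "bessel B \<Lambda>" and A: "lower_frame A \<Lambda>"
  shows "sq.nsq M (dual \<Lambda> x) \<le> mS / A\<^sup>2"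
    and "(\<Sum>\<^sub>\<infinity>l\<in>\<Lambda>. (cmod (ft (dual \<Lambda> x) l))\<^sup>2) \<le> mS / A"
proof -
  note dl = dual[OF B A]
  have A0: "A > 0" using A by (simp add: lower_frame_def)
  define s where "s = (\<Sum>\<^sub>\<infinity>l\<in>\<Lambda>. (cmod (ft (dual \<Lambda> x) l))\<^sup>2)"
  define n where "n = sq.nm M (dual \<Lambda> x)"
  have n0: "n \<ge> 0" unfolding n_def by (rule sq.nm_nonneg[OF dl(1)])
  have n2: "sq.nsq M (dual \<Lambda> x) = n\<^sup>2" unfolding n_def by (rule sq.nm_sq[OF dl(1), symmetric])
  have An: "A * n\<^sup>2 \<le> s" using A dl(1) unfolding lower_frame_def s_def n2[symmetric] by blast
  have "ft (dual \<Lambda> x) x = of_real s" using dl(2)[OF dl(1)] by (simp add: fip_self s_def)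
  then have "s \<le> cmod (ft (dual \<Lambda> x) x)" by simp
  also have "\<dots> \<le> n * sqrt mS" unfolding n_def by (rule ft_bound[OF dl(1)])
  finally have sn: "s \<le> n * sqrt mS" .
  have nA: "n \<le> sqrt mS / A"
  proof (cases "n = 0")
    case False
    then have "n > 0" using n0 by simp
    moreover have "A * n * n \<le> sqrt mS * n" using An sn by (simp add: power2_eq_square mult_ac)
    ultimately have "A * n \<le> sqrt mS" by simp
    then show ?thesis using A0 by (simp add: field_simps)
  qed (use A0 in simp)
  have "n\<^sup>2 \<le> (sqrt mS / A)\<^sup>2" using nA n0 by (intro power_mono)
  then show "sq.nsq M (dual \<Lambda> x) \<le> mS / A\<^sup>2" unfolding n2 by (simp add: power_divide)
  have "s \<le> sqrt mS / A * sqrt mS" using sn mult_right_mono[OF nA, of "sqrt mS"] by simp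
  then show "(\<Sum>\<^sub>\<infinity>l\<in>\<Lambda>. (cmod (ft (dual \<Lambda> x) l))\<^sup>2) \<le> mS / A" by (simp add: s_def)
qed

text \<open>The inverse frame operator is self-adjoint.\<close>

lemma dual_sym:
  assumes B: "bessel B \<Lambda>" and A: "lower_frame A \<Lambda>"
  shows "ft (dual \<Lambda> x) y = cnj (ft (dual \<Lambda> y) x)"
proof -
  interpret F: semi_ip V "fip \<Lambda>" by (rule fip_semi_ip[OF B])
  note dl = dual[OF B A]
  show ?thesis
    unfolding dl(2)[OF dl(1)[of x], of y] dl(2)[OF dl(1)[of y], of x]
    by (rule F.ip_herm[OF dl(1) dl(1)])
qed

text \<open>The value \<open>lev \<Lambda> l\<close> is the leverage score of the frame element \<open>expo l\<close>.\<close>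

definition lev :: "'a set \<Rightarrow> 'a \<Rightarrow> real" where
  "lev \<Lambda> l = (\<Sum>\<^sub>\<infinity>m\<in>\<Lambda>. (cmod (ft (dual \<Lambda> l) m))\<^sup>2)"

lemma lev_eq:
  assumes B: "bessel B \<Lambda>" and A: "lower_frame A \<Lambda>"
  shows "ft (dual \<Lambda> l) l = of_real (lev \<Lambda> l)"
  using dual(2)[OF B A dual(1)[OF B A], of l l] by (simp add: fip_self lev_def)

text \<open>The sum defining \<open>lev \<Lambda> l\<close> contains its own square as the term at
  \<open>l\<close>. Hence a score is at most 1, and a score near 1 leaves little room for the other
  terms, which add up to at most the score minus its square.\<close>

lemma lev_bounds:
  assumes B: "bessel B \<Lambda>" and A: "lower_frame A \<Lambda>" and l: "l \<in> \<Lambda>"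
  shows "0 \<le> lev \<Lambda> l" and "lev \<Lambda> l \<le> 1"
    and "m \<in> \<Lambda> \<Longrightarrow> m \<noteq> l \<Longrightarrow> (cmod (ft (dual \<Lambda> l) m))\<^sup>2 \<le> 1 - lev \<Lambda> l"
proof -
  note dl = dual[OF B A]
  have s: "(\<lambda>m. (cmod (ft (dual \<Lambda> l) m))\<^sup>2) summable_on \<Lambda>"
    by (rule bessel_summable(1)[OF B dl(1)])
  show 0: "0 \<le> lev \<Lambda> l" unfolding lev_def by (intro infsum_nonneg) simp
  have "(\<Sum>m\<in>{l}. (cmod (ft (dual \<Lambda> l) m))\<^sup>2) \<le> lev \<Lambda> l"
    unfolding lev_def by (rule finite_sum_le_infsum[OF s]) (use l in auto)
  then have sq: "(lev \<Lambda> l)\<^sup>2 \<le> lev \<Lambda> l" using lev_eq[OF B A, of l] by simp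
  then have "lev \<Lambda> l * lev \<Lambda> l \<le> 1 * lev \<Lambda> l" by (simp add: power2_eq_square)
  then show 1: "lev \<Lambda> l \<le> 1" using 0 by (cases "lev \<Lambda> l = 0") auto
  assume m: "m \<in> \<Lambda>" "m \<noteq> l"
  have "(\<Sum>k\<in>{l, m}. (cmod (ft (dual \<Lambda> l) k))\<^sup>2) \<le> lev \<Lambda> l"
    unfolding lev_def by (rule finite_sum_le_infsum[OF s]) (use l m in auto)
  then have "(cmod (ft (dual \<Lambda> l) m))\<^sup>2 \<le> lev \<Lambda> l - (lev \<Lambda> l)\<^sup>2"
    using m lev_eq[OF B A, of l] by simp
  also have "\<dots> \<le> 1 - lev \<Lambda> l"
    using zero_le_power2[of "1 - lev \<Lambda> l"] by (simp add: power2_diff)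
  finally show "(cmod (ft (dual \<Lambda> l) m))\<^sup>2 \<le> 1 - lev \<Lambda> l" .
qed

text \<open>The vector \<open>\<Sum>l. c l * dual \<Lambda> l\<close> has squared frame seminorm equal to the quadratic form below.\<close>

lemma lev_quadratic_form:
  assumes B: "bessel B \<Lambda>" and A: "lower_frame A \<Lambda>"
  shows "A * Re (\<Sum>i\<in>I. \<Sum>j\<in>I. c i * cnj (c j) * ft (dual \<Lambda> (u i)) (u j))
    \<le> sq.nsq M (\<lambda>t. \<Sum>i\<in>I. c i * expo (u i) t)"
proof -
  interpret F: semi_ip V "fip \<Lambda>" by (rule fip_semi_ip[OF B])
  note dl = dual[OF B A]
  have A0: "A > 0" using A by (simp add: lower_frame_def)
  define f where "f = (\<lambda>t. \<Sum>i\<in>I. c i * dual \<Lambda> (u i) t)"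
  define v where "v = (\<lambda>t. \<Sum>i\<in>I. c i * expo (u i) t)"
  have fV: "f \<in> V" unfolding f_def by (intro sq.sum_mem dl(1))
  have vV: "v \<in> V" unfolding v_def by (intro sq.sum_mem expo_mem)
  define Q where "Q = F.nsq f"
  have Qeq: "of_real Q = (\<Sum>i\<in>I. \<Sum>j\<in>I. c i * cnj (c j) * ft (dual \<Lambda> (u i)) (u j))"
    unfolding Q_def f_def using F.nsq_sum[of I "\<lambda>i. dual \<Lambda> (u i)" c] dl(1) dl(2)[OF dl(1)] by simp
  \<comment> \<open>\<open>f\<close> is the inverse frame operator applied to \<open>v\<close>, so
    its frame energy \<open>Q\<close> is also the plain inner product of \<open>f\<close> and
    \<open>v\<close>. Cauchy--Schwarz and the lower frame bound then give
    \<open>A * Q \<le> sq.nsq M v\<close>.\<close>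
  have "sq_ip M f v = (\<Sum>i\<in>I. cnj (c i) * ft f (u i))"
    unfolding v_def ft_def by (rule sq.ip_sum_right[OF expo_mem fV])
  also have "\<dots> = (\<Sum>i\<in>I. cnj (c i) * fip \<Lambda> f (dual \<Lambda> (u i)))"
    by (intro sum.cong refl) (simp add: dl(2)[OF fV])
  also have "\<dots> = fip \<Lambda> f f"
    using F.ip_sum_right[of I "\<lambda>i. dual \<Lambda> (u i)" f c] dl(1) fV by (simp add: f_def[symmetric])
  also have "\<dots> = of_real Q" unfolding Q_def by (rule F.ip_self[OF fV])
  finally have fv: "sq_ip M f v = of_real Q" .
  have Q0: "Q \<ge> 0" unfolding Q_def by (rule F.nsq_nonneg[OF fV])
  have "Q\<^sup>2 = (cmod (sq_ip M f v))\<^sup>2" by (simp add: fv)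
  also have "\<dots> \<le> sq.nsq M f * sq.nsq M v" by (rule sq.cauchy_schwarz_sq[OF fV vV])
  also have "\<dots> \<le> (Q / A) * sq.nsq M v"
  proof (rule mult_right_mono[OF _ sq.nsq_nonneg[OF vV]])
    have "A * sq.nsq M f \<le> Q" using A fV by (simp add: lower_frame_def Q_def F.nsq_def fip_self)
    then show "sq.nsq M f \<le> Q / A" using A0 by (simp add: field_simps)
  qed
  finally have "A * Q * Q \<le> sq.nsq M v * Q" using A0 by (simp add: power2_eq_square field_simps)
  then have "A * Q \<le> sq.nsq M v"
    using Q0 sq.nsq_nonneg[OF vV] by (cases "Q = 0") auto
  then show ?thesis unfolding Qeq[symmetric] v_def by simp
qed

text \<open>The squared norm of \<open>expo x\<close> is expanded through its dual vector, and
  Cauchy--Schwarz controls the part of the expansion outside \<open>F\<close>. The lemma is applied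
  with a tail bound \<open>T\<close> when \<open>x\<close> lies deep inside the ball that carries
  \<open>F\<close>, and with the Bessel bound elsewhere.\<close>

lemma dual_expansion:
  assumes B: "bessel B \<Lambda>" and A: "lower_frame A \<Lambda>" and F: "finite F" "F \<subseteq> \<Lambda>"
    and T: "\<And>F'. finite F' \<Longrightarrow> F' \<subseteq> \<Lambda> - F \<Longrightarrow> (\<Sum>l\<in>F'. (cmod (ft (expo x) l))\<^sup>2) \<le> T"
  shows "mS - sqrt T * sqrt (mS / A) \<le> Re (\<Sum>m\<in>F. ft (dual \<Lambda> m) x * cnj (ft (expo m) x))"
proof -
  note dl = dual[OF B A]
  have B': "bessel B (\<Lambda> - F)" by (rule bessel_subset[OF B]) blast
  interpret G: semi_ip V "fip (\<Lambda> - F)" by (rule fip_semi_ip[OF B'])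
  have "of_real mS = ft (expo x) x"
    unfolding ft_def by (simp add: sq.ip_self nsq_expo)
  also have "\<dots> = fip \<Lambda> (expo x) (dual \<Lambda> x)" by (rule dl(2)[OF expo_mem])
  also have "\<dots> = fip F (expo x) (dual \<Lambda> x) + fip (\<Lambda> - F) (expo x) (dual \<Lambda> x)"
  proof -
    have "\<Lambda> = F \<union> (\<Lambda> - F)" using F by blast
    then show ?thesis
      unfolding fip_def
      using infsum_Un_disjoint[of "\<lambda>l. ft (expo x) l * cnj (ft (dual \<Lambda> x) l)" F "\<Lambda> - F"]
        fip_summable[OF B' expo_mem[of x] dl(1)[of x]] F(1) by auto
  qed
  also have "fip F (expo x) (dual \<Lambda> x) = (\<Sum>m\<in>F. ft (dual \<Lambda> m) x * cnj (ft (expo m) x))"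
    unfolding fip_def infsum_finite[OF F(1)]
  proof (intro sum.cong refl)
    fix m
    have "ft (expo x) m = cnj (ft (expo m) x)" unfolding ft_def by (rule sq.ip_herm[OF expo_mem expo_mem])
    then show "ft (expo x) m * cnj (ft (dual \<Lambda> x) m) = ft (dual \<Lambda> m) x * cnj (ft (expo m) x)"
      using dual_sym[OF B A, of x m] by simp
  qed
  finally have eq: "complex_of_real mS = (\<Sum>m\<in>F. ft (dual \<Lambda> m) x * cnj (ft (expo m) x)) + fip (\<Lambda> - F) (expo x) (dual \<Lambda> x)" .
  have "cmod (fip (\<Lambda> - F) (expo x) (dual \<Lambda> x)) \<le> G.nm (expo x) * G.nm (dual \<Lambda> x)"
    by (rule G.cauchy_schwarz[OF expo_mem dl(1)])
  also have "\<dots> \<le> sqrt T * sqrt (mS / A)"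
  proof (rule mult_mono)
    have "(\<Sum>\<^sub>\<infinity>l\<in>\<Lambda> - F. (cmod (ft (expo x) l))\<^sup>2) \<le> T"
      by (rule infsum_le_finite_sums[OF bessel_summable(1)[OF B' expo_mem]]) (use T in auto)
    then show "G.nm (expo x) \<le> sqrt T" unfolding G.nm_def G.nsq_def fip_self by simp
    have "(\<Sum>\<^sub>\<infinity>l\<in>\<Lambda> - F. (cmod (ft (dual \<Lambda> x) l))\<^sup>2) \<le> (\<Sum>\<^sub>\<infinity>l\<in>\<Lambda>. (cmod (ft (dual \<Lambda> x) l))\<^sup>2)"
      by (rule infsum_mono2) (use bessel_summable(1)[OF B dl(1)] bessel_summable(1)[OF B' dl(1)] in auto)
    also have "\<dots> \<le> mS / A" by (rule dual_bounds(2)[OF B A])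
    finally show "G.nm (dual \<Lambda> x) \<le> sqrt (mS / A)" unfolding G.nm_def G.nsq_def fip_self by simp
    show "0 \<le> G.nm (dual \<Lambda> x)" by (rule G.nm_nonneg[OF dl(1)])
    show "0 \<le> sqrt T" using T[of "{}"] by simp
  qed
  finally have "Re (fip (\<Lambda> - F) (expo x) (dual \<Lambda> x)) \<le> sqrt T * sqrt (mS / A)"
    using complex_Re_le_cmod order_trans by blast
  moreover have "mS = Re (\<Sum>m\<in>F. ft (dual \<Lambda> m) x * cnj (ft (expo m) x)) + Re (fip (\<Lambda> - F) (expo x) (dual \<Lambda> x))"
    using arg_cong[OF eq, of Re] by simp
  ultimately show ?thesis by linarith
qed

text \<open>The local trace estimate turns the sum of the scores into an integral of
  \<open>G\<close> over the ball. Deep inside, \<open>G\<close> has real part at least about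
  \<open>mS\<close>; in the boundary layer the crude bound \<open>mS - c\<close> is enough, because
  the layer has negligible relative volume.\<close>

lemma lev_density:
  assumes L: "sep \<delta> \<Lambda>" and B: "bessel B \<Lambda>" and A: "lower_frame A \<Lambda>" and e: "\<epsilon> > 0"
  shows "\<exists>r0>0. \<forall>r\<ge>r0. \<forall>y. (mS - \<epsilon>) * vol TYPE('a) r \<le> (\<Sum>l\<in>\<Lambda> \<inter> ball y r. lev \<Lambda> l)"
proof -
  note dl = dual[OF B A]
  have A0: "A > 0" using A by (simp add: lower_frame_def)
  have B0: "B \<ge> 0" using B by (simp add: bessel_def)
  have C0: "mS / A\<^sup>2 \<ge> 0" by simp
  have e4: "\<epsilon> / 4 > 0" using e by simp
  obtain r1 where r1: "boundary_radius \<Lambda> (mS / A\<^sup>2) (\<epsilon> / 4) r1"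
    using boundary_estimate[OF L C0 e4] by blast
  have r1_pos: "r1 > 0" using r1 by (simp add: boundary_radius_def)
  \<comment> \<open>The tail level at which the error in \<open>dual_expansion\<close> is at most
    \<open>\<epsilon> / 4\<close>.\<close>
  define T where "T = (\<epsilon> / (4 * (sqrt (mS / A) + 1)))\<^sup>2"
  have q0: "sqrt (mS / A) \<ge> 0" using A0 by simp
  have T0: "T > 0" unfolding T_def using e q0 by (simp add: zero_less_power2 add_nonneg_eq_0_iff)
  have Ts: "sqrt T * sqrt (mS / A) \<le> \<epsilon> / 4"
  proof -
    define q where "q = sqrt (mS / A)"
    have q: "q \<ge> 0" unfolding q_def by (rule q0)
    have "sqrt T = \<epsilon> / (4 * (q + 1))" unfolding T_def q_def[symmetric] using e q by simp
    then have "sqrt T * q = \<epsilon> / 4 * (q / (q + 1))" by simp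
    also have "\<dots> \<le> \<epsilon> / 4 * 1" using e q by (intro mult_left_mono) (auto simp: divide_le_eq)
    finally show ?thesis by (simp add: q_def)
  qed
  obtain R1 where R1: "tail_radius \<Lambda> (\<lambda>_. 1) T R1"
    using bessel_tail[OF L B one_mem T0] by blast
  define R where "R = max 0 R1"
  \<comment> \<open>The error in \<open>dual_expansion\<close> when the only tail bound is the
    Bessel bound \<open>B * mS\<close>.\<close>
  define c where "c = sqrt (B * mS) * sqrt (mS / A)"
  have c0: "c \<ge> 0" unfolding c_def using B0 q0 by simp
  have "((\<lambda>r. c * (1 - vol TYPE('a) (r + - R) / vol TYPE('a) r)) \<longlongrightarrow> c * (1 - 1)) at_top"
    by (intro tendsto_intros vol_ratio)
  then have "\<forall>\<^sub>F r in at_top. c * (1 - vol TYPE('a) (r + - R) / vol TYPE('a) r) < \<epsilon> / 4"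
    using e4 by (intro order_tendstoD(2)[of _ "c * (1 - 1)"]) auto
  with eventually_gt_at_top[of "0::real"]
  have "\<forall>\<^sub>F r in at_top. 0 < r \<and> c * (vol TYPE('a) r - vol TYPE('a) (r - R)) \<le> \<epsilon> / 4 * vol TYPE('a) r"
  proof eventually_elim
    case (elim r)
    have vr: "vol TYPE('a) r > 0" using elim by (intro vol_pos)
    have "c * (vol TYPE('a) r - vol TYPE('a) (r - R)) = c * (1 - vol TYPE('a) (r + - R) / vol TYPE('a) r) * vol TYPE('a) r"
      using vr by (simp add: field_simps)
    also have "\<dots> \<le> \<epsilon> / 4 * vol TYPE('a) r" using elim vr by (intro mult_right_mono) auto
    finally show ?case using elim by simp
  qed
  then obtain r2 where r2: "\<And>r. r \<ge> r2 \<Longrightarrow> 0 < r \<and> c * (vol TYPE('a) r - vol TYPE('a) (r - R)) \<le> \<epsilon> / 4 * vol TYPE('a) r"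
    by (auto simp: eventually_at_top_linorder)
  have main: "(mS - \<epsilon>) * vol TYPE('a) r \<le> (\<Sum>l\<in>\<Lambda> \<inter> ball y r. lev \<Lambda> l)" if r: "r \<ge> r1" "r \<ge> r2" for r y
  proof -
    define F where "F = \<Lambda> \<inter> ball y r"
    have fin: "finite F" unfolding F_def by (rule sep_finite[OF L bounded_ball])
    have FL: "F \<subseteq> \<Lambda>" by (simp add: F_def)
    define G where "G x = (\<Sum>m\<in>F. ft (dual \<Lambda> m) x * cnj (ft (expo m) x))" for x
    have Gi: "integrable lborel (\<lambda>x. indicator (ball y r) x * G x)"
    proof -
      have gi: "integrable lborel G"
        unfolding G_def
        by (intro Bochner_Integration.integrable_sum sq_space_mult_integrable ft_bessel(2) dl(1) expo_mem)
      show ?thesis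
        by (rule Bochner_Integration.integrable_bound[OF gi]) (use gi in \<open>auto simp: indicator_def\<close>)
    qed
    have G1: "mS - \<epsilon> / 4 \<le> Re (G x)" if x: "x \<in> ball y (r - R)" for x
    proof -
      have "mS - sqrt T * sqrt (mS / A) \<le> Re (G x)"
        unfolding G_def
      proof (rule dual_expansion[OF B A fin FL])
        fix F' assume F': "finite F'" "F' \<subseteq> \<Lambda> - F"
        have "(\<Sum>l\<in>F'. (cmod (ft (\<lambda>_. 1) (l - x)))\<^sup>2) \<le> T"
        proof (rule tail_radiusD[OF R1])
          fix l assume "l \<in> F'"
          then have "dist y l \<ge> r" using F' by (auto simp: F_def)
          then show "R1 \<le> dist l x"
            using x dist_triangle[of y l x] by (simp add: R_def dist_commute)
        qed (use F' in auto)
        then show "(\<Sum>l\<in>F'. (cmod (ft (expo x) l))\<^sup>2) \<le> T" by (simp add: ft_expo)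
      qed
      then show ?thesis using Ts by simp
    qed
    have G2: "mS - c \<le> Re (G x)" for x
      unfolding c_def G_def
    proof (rule dual_expansion[OF B A fin FL])
      fix F' assume "finite F'" "F' \<subseteq> \<Lambda> - F"
      then have "(\<Sum>l\<in>F'. (cmod (ft (expo x) l))\<^sup>2) \<le> B * sq.nsq M (expo x)"
        by (intro besselD[OF B]) auto
      then show "(\<Sum>l\<in>F'. (cmod (ft (expo x) l))\<^sup>2) \<le> B * mS" by (simp add: nsq_expo)
    qed
    let ?B = "ball y r" and ?B' = "ball y (r - R)"
    have Bi: "integrable lborel (indicator (ball y s) :: 'a \<Rightarrow> real)" for s
      using emeasure_lborel_ball_finite[of y s] by (simp add: integrable_indicator_iff)
    have mB: "measure lborel (ball y s) = vol TYPE('a) s" for s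
      using vol_ball[of y s] by simp
    \<comment> \<open>The left side is the integral of a two-level lower bound:
      \<open>mS - \<epsilon> / 4 - c\<close> on the whole ball, raised by \<open>c\<close> on the
      inner ball of radius \<open>r - R\<close>.\<close>
    have "(mS - \<epsilon> / 4 - c) * vol TYPE('a) r + c * vol TYPE('a) (r - R)
       = (LINT x|lborel. (mS - \<epsilon> / 4 - c) * indicator ?B x + c * indicator ?B' x)"
      using Bi by (simp add: mB)
    also have "\<dots> \<le> (LINT x|lborel. Re (indicator ?B x * G x))"
    proof (rule integral_mono)
      show "integrable lborel (\<lambda>x. (mS - \<epsilon> / 4 - c) * indicator ?B x + c * indicator ?B' x)"
        using Bi by (intro Bochner_Integration.integrable_add integrable_mult_right)
      show "integrable lborel (\<lambda>x. Re (indicator ?B x * G x))" by (rule integrable_Re[OF Gi])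
      fix x
      have "?B' \<subseteq> ?B" by (intro subset_ball) (simp add: R_def)
      then show "(mS - \<epsilon> / 4 - c) * indicator ?B x + c * indicator ?B' x \<le> Re (indicator ?B x * G x)"
        using G1[of x] G2[of x] e by (auto simp: indicator_def)
    qed
    also have "\<dots> = Re (LINT x|lborel. indicator ?B x * G x)" by (rule integral_Re[OF Gi])
    finally have low: "(mS - \<epsilon> / 4 - c) * vol TYPE('a) r + c * vol TYPE('a) (r - R) \<le> Re (LINT x|lborel. indicator ?B x * G x)" .
    have "(\<Sum>m\<in>F. sq_ip M (dual \<Lambda> m) (expo m)) = of_real (\<Sum>m\<in>F. lev \<Lambda> m)"
      using lev_eq[OF B A] by (simp add: ft_def)
    then have "cmod (of_real (\<Sum>m\<in>F. lev \<Lambda> m) - (LINT x|lborel. indicator ?B x * G x)) \<le> \<epsilon> / 4 * vol TYPE('a) r"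
      using boundary_radiusD[OF r1 r(1), of F y "dual \<Lambda>"] dl(1) dual_bounds(1)[OF B A]
      unfolding G_def F_def by simp
    then have "\<bar>Re (of_real (\<Sum>m\<in>F. lev \<Lambda> m) - (LINT x|lborel. indicator ?B x * G x))\<bar> \<le> \<epsilon> / 4 * vol TYPE('a) r"
      using abs_Re_le_cmod order_trans by blast
    then have "\<bar>(\<Sum>m\<in>F. lev \<Lambda> m) - Re (LINT x|lborel. indicator ?B x * G x)\<bar> \<le> \<epsilon> / 4 * vol TYPE('a) r"
      unfolding minus_complex.sel Re_complex_of_real .
    then have "Re (LINT x|lborel. indicator ?B x * G x) - \<epsilon> / 4 * vol TYPE('a) r \<le> (\<Sum>m\<in>F. lev \<Lambda> m)"
      by linarith
    moreover have "0 \<le> \<epsilon> * vol TYPE('a) r" using e by simp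
    ultimately show ?thesis
      using low r2[OF r(2)] unfolding F_def[symmetric] by (simp add: algebra_simps)
  qed
  show ?thesis
    by (rule exI[of _ "max r1 r2"]) (use r1_pos main in auto)
qed


section \<open>Riesz sequences of exponentials\<close>

text \<open>Only finite combinations are tested, which is the form that passes to weak limits;
  series are recovered in \<open>riesz_bounds_exp_riesz_sequence\<close>.\<close>

definition riesz_bounds :: "real \<Rightarrow> real \<Rightarrow> 'a set \<Rightarrow> bool" where
  "riesz_bounds A B \<Lambda> \<longleftrightarrow> 0 < A \<and> 0 \<le> B \<and> (\<forall>F c. finite F \<and> F \<subseteq> \<Lambda> \<longrightarrow>
     A * (\<Sum>l\<in>F. (cmod (c l))\<^sup>2) \<le> sq.nsq M (\<lambda>t. \<Sum>l\<in>F. c l * expo l t) \<and>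
     sq.nsq M (\<lambda>t. \<Sum>l\<in>F. c l * expo l t) \<le> B * (\<Sum>l\<in>F. (cmod (c l))\<^sup>2))"

lemma riesz_boundsD:
  assumes "riesz_bounds A B \<Lambda>" "finite F" "F \<subseteq> \<Lambda>"
  shows "A * (\<Sum>l\<in>F. (cmod (c l))\<^sup>2) \<le> sq.nsq M (\<lambda>t. \<Sum>l\<in>F. c l * expo l t)"
    and "sq.nsq M (\<lambda>t. \<Sum>l\<in>F. c l * expo l t) \<le> B * (\<Sum>l\<in>F. (cmod (c l))\<^sup>2)"
  using assms unfolding riesz_bounds_def by blast+

lemma ip_sum_expo: "f \<in> V \<Longrightarrow> sq_ip M f (\<lambda>t. \<Sum>l\<in>F. c l * expo l t) = (\<Sum>l\<in>F. cnj (c l) * ft f l)"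
  unfolding ft_def by (rule sq.ip_sum_right[OF expo_mem])

lemma sum_mult_cnj_le:
  "(cmod (\<Sum>l\<in>F. a l * b l))\<^sup>2 \<le> (\<Sum>l\<in>F. (cmod (a l))\<^sup>2) * (\<Sum>l\<in>F. (cmod (b l))\<^sup>2)"
proof -
  have "cmod (\<Sum>l\<in>F. a l * b l) \<le> (\<Sum>l\<in>F. cmod (a l) * cmod (b l))"
    by (rule order_trans[OF norm_sum]) (simp add: norm_mult)
  then have "(cmod (\<Sum>l\<in>F. a l * b l))\<^sup>2 \<le> (\<Sum>l\<in>F. cmod (a l) * cmod (b l))\<^sup>2"
    by (intro power_mono) auto
  also have "\<dots> \<le> (\<Sum>l\<in>F. (cmod (a l))\<^sup>2) * (\<Sum>l\<in>F. (cmod (b l))\<^sup>2)"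
    by (rule Cauchy_Schwarz_ineq_sum)
  finally show ?thesis .
qed

text \<open>Analysis and synthesis are adjoint, so a bound for one is a bound for the other: test
  \<open>f\<close> against the combination whose coefficients are its own samples.\<close>

lemma riesz_bounds_bessel:
  assumes R: "riesz_bounds A B \<Lambda>"
  shows "bessel B \<Lambda>"
  unfolding bessel_def
proof (intro conjI allI impI)
  show B0: "0 \<le> B" using R by (simp add: riesz_bounds_def)
  fix F f assume "finite F \<and> F \<subseteq> \<Lambda> \<and> f \<in> V"
  then have F: "finite F" "F \<subseteq> \<Lambda>" and f: "f \<in> V" by auto
  define s where "s = (\<Sum>l\<in>F. (cmod (ft f l))\<^sup>2)"
  have s0: "s \<ge> 0" unfolding s_def by (intro sum_nonneg) simp
  define v where "v = (\<lambda>t. \<Sum>l\<in>F. ft f l * expo l t)"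
  have vV: "v \<in> V" unfolding v_def by (rule sum_expo_mem)
  have "sq_ip M f v = (\<Sum>l\<in>F. cnj (ft f l) * ft f l)" unfolding v_def by (rule ip_sum_expo[OF f])
  also have "\<dots> = of_real s" unfolding s_def of_real_sum
    by (intro sum.cong refl) (simp add: complex_norm_square mult.commute del: of_real_power)
  finally have "s\<^sup>2 = (cmod (sq_ip M f v))\<^sup>2" by simp
  also have "\<dots> \<le> sq.nsq M f * sq.nsq M v" by (rule sq.cauchy_schwarz_sq[OF f vV])
  also have "\<dots> \<le> sq.nsq M f * (B * s)"
    unfolding v_def s_def by (intro mult_left_mono riesz_boundsD(2)[OF R F] sq.nsq_nonneg[OF f])
  finally have "s * s \<le> (B * sq.nsq M f) * s" by (simp add: power2_eq_square mult_ac)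
  then show "(\<Sum>l\<in>F. (cmod (ft f l))\<^sup>2) \<le> B * sq.nsq M f"
    unfolding s_def[symmetric] using s0 B0 sq.nsq_nonneg[OF f] by (cases "s = 0") auto
qed

text \<open>The converse half of the adjointness argument: the combination is tested against
  itself.\<close>

lemma bessel_upper_bound:
  assumes B: "bessel B \<Lambda>" and F: "finite F" "F \<subseteq> \<Lambda>"
  shows "sq.nsq M (\<lambda>t. \<Sum>l\<in>F. c l * expo l t) \<le> B * (\<Sum>l\<in>F. (cmod (c l))\<^sup>2)"
proof -
  define v where "v = (\<lambda>t. \<Sum>l\<in>F. c l * expo l t)"
  have vV: "v \<in> V" unfolding v_def by (rule sum_expo_mem)
  have v0: "sq.nsq M v \<ge> 0" by (rule sq.nsq_nonneg[OF vV])
  have B0: "B \<ge> 0" using B by (simp add: bessel_def)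
  have "of_real (sq.nsq M v) = (\<Sum>l\<in>F. cnj (c l) * ft v l)"
    using ip_sum_expo[OF vV, of c F] sq.ip_self[OF vV] by (simp add: v_def)
  then have "(sq.nsq M v)\<^sup>2 = (cmod (\<Sum>l\<in>F. cnj (c l) * ft v l))\<^sup>2"
    by (metis norm_of_real power2_abs)
  also have "\<dots> \<le> (\<Sum>l\<in>F. (cmod (cnj (c l)))\<^sup>2) * (\<Sum>l\<in>F. (cmod (ft v l))\<^sup>2)"
    by (rule sum_mult_cnj_le)
  also have "\<dots> \<le> (\<Sum>l\<in>F. (cmod (c l))\<^sup>2) * (B * sq.nsq M v)"
    using besselD[OF B F vV] by (auto intro!: mult_left_mono sum_nonneg)
  finally have "sq.nsq M v * sq.nsq M v \<le> (B * (\<Sum>l\<in>F. (cmod (c l))\<^sup>2)) * sq.nsq M v"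
    by (simp add: power2_eq_square mult_ac)
  moreover have "0 \<le> B * (\<Sum>l\<in>F. (cmod (c l))\<^sup>2)" using B0 by (intro mult_nonneg_nonneg sum_nonneg) auto
  ultimately show ?thesis unfolding v_def[symmetric] using v0 by (cases "sq.nsq M v = 0") auto
qed

lemma exp_riesz_sequence_bounds:
  assumes "exp_riesz_sequence S \<Lambda>"
  shows "\<exists>A B. riesz_bounds A B \<Lambda>"
proof -
  obtain A B where AB: "0 < A" "A \<le> B" and ex: "\<forall>c\<in>ell2 \<Lambda>.
     \<exists>g. exp_has_L2_sum S \<Lambda> c g \<and>
       A * (\<Sum>\<^sub>\<infinity>l\<in>\<Lambda>. (cmod (c l))\<^sup>2) \<le> (L2_norm S g)\<^sup>2 \<and>
       (L2_norm S g)\<^sup>2 \<le> B * (\<Sum>\<^sub>\<infinity>l\<in>\<Lambda>. (cmod (c l))\<^sup>2)"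
    using assms unfolding exp_riesz_sequence_def by blast
  have "A * (\<Sum>l\<in>F. (cmod (c l))\<^sup>2) \<le> sq.nsq M (\<lambda>t. \<Sum>l\<in>F. c l * expo l t) \<and>
     sq.nsq M (\<lambda>t. \<Sum>l\<in>F. c l * expo l t) \<le> B * (\<Sum>l\<in>F. (cmod (c l))\<^sup>2)" if F: "finite F" "F \<subseteq> \<Lambda>" for F c
  proof -
    \<comment> \<open>Extension by zero turns a finite coefficient vector into an element of
      \<open>ell2 \<Lambda>\<close>. The net of partial sums is constant from \<open>F\<close> on,
      so its limit is the finite sum up to seminorm zero.\<close>
    define d where "d l = (if l \<in> F then c l else 0)" for l
    have d_sum: "(\<Sum>\<^sub>\<infinity>l\<in>\<Lambda>. (cmod (d l))\<^sup>2) = (\<Sum>l\<in>F. (cmod (c l))\<^sup>2)"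
    proof -
      have "(\<Sum>\<^sub>\<infinity>l\<in>\<Lambda>. (cmod (d l))\<^sup>2) = (\<Sum>\<^sub>\<infinity>l\<in>F. (cmod (d l))\<^sup>2)"
        using F by (intro infsum_cong_neutral) (auto simp: d_def)
      then show ?thesis using F by (simp add: d_def)
    qed
    have "(\<lambda>l. (cmod (d l))\<^sup>2) summable_on F" using F by simp
    moreover have "(\<lambda>l. (cmod (d l))\<^sup>2) summable_on \<Lambda> \<longleftrightarrow> (\<lambda>l. (cmod (d l))\<^sup>2) summable_on F"
      by (rule summable_on_cong_neutral) (use F in \<open>auto simp: d_def\<close>)
    ultimately have "d \<in> ell2 \<Lambda>" by (simp add: ell2_def)
    then obtain g where g: "exp_has_L2_sum S \<Lambda> d g"
       "A * (\<Sum>l\<in>F. (cmod (c l))\<^sup>2) \<le> (L2_norm S g)\<^sup>2" "(L2_norm S g)\<^sup>2 \<le> B * (\<Sum>l\<in>F. (cmod (c l))\<^sup>2)"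
      using ex unfolding d_sum[symmetric] by blast
    have gV: "g \<in> V" and lim: "((\<lambda>F. sq.nm M (\<lambda>t. (\<Sum>l\<in>F. d l * expo l t) - g t)) \<longlongrightarrow> 0) (finite_subsets_at_top \<Lambda>)"
      using g(1) unfolding exp_has_L2_sum_def L2_space_eq L2_norm_eq by auto
    define u where "u = (\<lambda>t. \<Sum>l\<in>F. c l * expo l t)"
    have uV: "u \<in> V" unfolding u_def by (rule sum_expo_mem)
    have ev: "\<forall>\<^sub>F F' in finite_subsets_at_top \<Lambda>. sq.nm M (\<lambda>t. (\<Sum>l\<in>F'. d l * expo l t) - g t) = sq.nm M (\<lambda>t. u t - g t)"
      unfolding eventually_finite_subsets_at_top
    proof (intro exI[of _ F] conjI allI impI)
      fix F' assume F': "finite F' \<and> F \<subseteq> F' \<and> F' \<subseteq> \<Lambda>"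
      have "(\<Sum>l\<in>F'. d l * expo l t) = u t" for t
        unfolding u_def using F' by (intro sum.mono_neutral_cong_right) (auto simp: d_def)
      then show "sq.nm M (\<lambda>t. (\<Sum>l\<in>F'. d l * expo l t) - g t) = sq.nm M (\<lambda>t. u t - g t)" by simp
    qed (use F in auto)
    have "((\<lambda>_. sq.nm M (\<lambda>t. u t - g t)) \<longlongrightarrow> 0) (finite_subsets_at_top \<Lambda>)"
      by (rule Lim_transform_eventually[OF lim ev])
    then have z: "sq.nm M (\<lambda>t. u t - g t) = 0"
      using tendsto_const_iff[OF finite_subsets_at_top_neq_bot] by blast
    have "sq.nm M u = sq.nm M g"
      using sq.nm_le_add_diff[OF uV gV] sq.nm_le_add_diff[OF gV uV] z sq.nm_minus_commute[OF uV gV] by simp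
    then have "sq.nsq M u = (L2_norm S g)\<^sup>2"
      using sq.nm_sq[OF uV] by (simp add: L2_norm_eq)
    then show ?thesis using g(2,3) unfolding u_def by simp
  qed
  then have "riesz_bounds A B \<Lambda>" using AB unfolding riesz_bounds_def by auto
  then show ?thesis by blast
qed

text \<open>Remove from \<open>expo m\<close> its projection on the other exponentials. The residue
  is a combination with coefficient 1 at \<open>m\<close>, so the lower Riesz bound keeps its norm
  away from 0; rescaling it gives a biorthogonal vector whose bound does not depend on
  \<open>F\<close>.\<close>

lemma biorthogonal_system:
  assumes R: "riesz_bounds A B \<Lambda>" and F: "finite F" "F \<subseteq> \<Lambda>" and m: "m \<in> F"
  shows "\<exists>h b. h = (\<lambda>t. \<Sum>i\<in>F. b i * expo i t) \<and> sq.nsq M h \<le> 1 / A \<and>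
    (\<forall>i\<in>F. ft h i = (if i = m then 1 else 0))"
proof -
  have A0: "A > 0" using R by (simp add: riesz_bounds_def)
  have Fm: "finite (F - {m})" using F by simp
  obtain a where a: "\<forall>j\<in>F - {m}. sq_ip M (\<lambda>t. expo m t - (\<Sum>i\<in>F - {m}. a i * expo i t)) (expo j) = 0"
    using sq.finite_projection[OF Fm, of expo M "expo m"] by auto
  define w where "w = (\<lambda>t. expo m t - (\<Sum>i\<in>F - {m}. a i * expo i t))"
  have wV: "w \<in> V" unfolding w_def by (intro sq.diff_mem sum_expo_mem expo_mem)
  define a' where "a' i = (if i = m then 1 else - a i)" for i
  have w_sum: "w = (\<lambda>t. \<Sum>i\<in>F. a' i * expo i t)"
  proof
    fix t
    have "(\<Sum>i\<in>F. a' i * expo i t) = a' m * expo m t + (\<Sum>i\<in>F - {m}. a' i * expo i t)"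
      by (rule sum.remove[OF F(1) m])
    also have "(\<Sum>i\<in>F - {m}. a' i * expo i t) = - (\<Sum>i\<in>F - {m}. a i * expo i t)"
      unfolding sum_negf[symmetric] by (intro sum.cong) (auto simp: a'_def)
    finally show "w t = (\<Sum>i\<in>F. a' i * expo i t)" by (simp add: w_def a'_def)
  qed
  have w0: "ft w j = 0" if "j \<in> F" "j \<noteq> m" for j using a that by (auto simp: ft_def w_def)
  have "A * 1 \<le> A * (\<Sum>i\<in>F. (cmod (a' i))\<^sup>2)"
  proof (rule mult_left_mono)
    have "(cmod (a' m))\<^sup>2 \<le> (\<Sum>i\<in>F. (cmod (a' i))\<^sup>2)" by (rule member_le_sum[OF m]) (use F in auto)
    then show "1 \<le> (\<Sum>i\<in>F. (cmod (a' i))\<^sup>2)" by (simp add: a'_def)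
  qed (use A0 in simp)
  also have "\<dots> \<le> sq.nsq M w" unfolding w_sum by (rule riesz_boundsD(1)[OF R F])
  finally have wA: "A \<le> sq.nsq M w" by simp
  then have w_pos: "sq.nsq M w > 0" using A0 by simp
  have "complex_of_real (sq.nsq M w) = (\<Sum>i\<in>F. cnj (a' i) * ft w i)"
    using ip_sum_expo[OF wV, of a' F] sq.ip_self[OF wV] by (simp add: w_sum[symmetric])
  also have "\<dots> = cnj (a' m) * ft w m + (\<Sum>i\<in>F - {m}. cnj (a' i) * ft w i)"
    by (rule sum.remove[OF F(1) m])
  also have "(\<Sum>i\<in>F - {m}. cnj (a' i) * ft w i) = 0" by (intro sum.neutral) (auto simp: w0)
  finally have wm: "ft w m = of_real (sq.nsq M w)" by (simp add: a'_def)
  define z where "z = complex_of_real (1 / sq.nsq M w)"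
  define h where "h = (\<lambda>t. z * w t)"
  have "h = (\<lambda>t. \<Sum>i\<in>F. (z * a' i) * expo i t)"
    unfolding h_def w_sum by (simp add: sum_distrib_left mult.assoc)
  moreover have "sq.nsq M h \<le> 1 / A"
  proof -
    have "sq.nsq M h = (1 / sq.nsq M w)\<^sup>2 * sq.nsq M w"
      unfolding h_def sq.nsq_scale[OF wV] using w_pos by (simp add: z_def norm_divide)
    also have "\<dots> = 1 / sq.nsq M w" using w_pos by (simp add: power2_eq_square)
    also have "\<dots> \<le> 1 / A" using wA A0 w_pos by (intro divide_left_mono) auto
    finally show ?thesis .
  qed
  moreover have "ft h i = (if i = m then 1 else 0)" if "i \<in> F" for i
  proof -
    have "ft h i = z * ft w i" unfolding h_def ft_def by (rule sq.ip_scale[OF wV expo_mem])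
    then show ?thesis using w0[OF that] wm w_pos by (auto simp: z_def)
  qed
  ultimately show ?thesis by (intro exI[of _ h] exI[of _ "\<lambda>i. z * a' i"]) simp
qed

text \<open>Biorthogonality reads off the coefficients of the orthogonal projection of
  \<open>expo x\<close>, so the given combination is this projection and Pythagoras computes the
  distance.\<close>

lemma riesz_projection:
  assumes R: "riesz_bounds A B \<Lambda>" and F: "finite F" "F \<subseteq> \<Lambda>"
    and h: "\<And>m. m \<in> F \<Longrightarrow> h m = (\<lambda>t. \<Sum>i\<in>F. b m i * expo i t)"
    and bio: "\<And>m i. m \<in> F \<Longrightarrow> i \<in> F \<Longrightarrow> ft (h m) i = (if i = m then 1 else 0)"
  shows "sq.nsq M (\<lambda>t. expo x t - (\<Sum>m\<in>F. cnj (ft (h m) x) * expo m t))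
     = mS - Re (\<Sum>m\<in>F. ft (h m) x * cnj (ft (expo m) x))"
proof -
  obtain a where a: "\<forall>j\<in>F. sq_ip M (\<lambda>t. expo x t - (\<Sum>i\<in>F. a i * expo i t)) (expo j) = 0"
    using sq.finite_projection[OF F(1), of expo M "expo x"] by auto
  define p where "p = (\<lambda>t. \<Sum>i\<in>F. a i * expo i t)"
  define q where "q = (\<lambda>t. expo x t - p t)"
  have pV: "p \<in> V" unfolding p_def by (rule sum_expo_mem)
  have qV: "q \<in> V" unfolding q_def by (intro sq.diff_mem pV expo_mem)
  have hV: "h m \<in> V" if "m \<in> F" for m unfolding h[OF that] by (rule sum_expo_mem)
  have q0: "ft q j = 0" if "j \<in> F" for j using a that by (auto simp: q_def p_def ft_def)
  have qspan: "sq_ip M q (\<lambda>t. \<Sum>i\<in>F. c i * expo i t) = 0" for c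
    unfolding ip_sum_expo[OF qV] by (intro sum.neutral) (auto simp: q0)
  have am: "a m = cnj (ft (h m) x)" if m: "m \<in> F" for m
  proof -
    have "sq_ip M p (h m) = (\<Sum>i\<in>F. a i * sq_ip M (expo i) (h m))"
      unfolding p_def by (rule sq.ip_sum[OF expo_mem hV[OF m]])
    also have "\<dots> = (\<Sum>i\<in>F. a i * cnj (ft (h m) i))"
      unfolding ft_def by (intro sum.cong refl) (simp add: sq.ip_herm[OF hV[OF m] expo_mem])
    also have "\<dots> = (\<Sum>i\<in>F. if i = m then a i else 0)"
      by (intro sum.cong refl) (simp add: bio[OF m])
    also have "\<dots> = a m" using F(1) m by simp
    finally have "sq_ip M p (h m) = a m" .
    moreover have "sq_ip M q (h m) = 0" using qspan[of "b m"] unfolding h[OF m] .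
    ultimately have "sq_ip M (expo x) (h m) = a m"
      using sq.ip_diff[OF expo_mem pV hV[OF m], of x] by (simp add: q_def)
    then show ?thesis unfolding ft_def using sq.ip_herm[OF hV[OF m] expo_mem, of x] by simp
  qed
  have "(\<lambda>t. expo x t - (\<Sum>m\<in>F. cnj (ft (h m) x) * expo m t)) = q"
    unfolding q_def p_def using am by simp
  moreover have "sq.nsq M q = mS - Re (sq_ip M p (expo x))"
  proof -
    have qp: "sq_ip M q p = 0" unfolding p_def by (rule qspan)
    have "sq_ip M q q = sq_ip M q (expo x) - sq_ip M q p"
      using sq.ip_diff_right[OF expo_mem pV qV, of x] by (simp add: q_def[symmetric])
    also have "\<dots> = sq_ip M (expo x) (expo x) - sq_ip M p (expo x)"
      unfolding qp using sq.ip_diff[OF expo_mem pV expo_mem, of x x] by (simp add: q_def)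
    finally show ?thesis
      using nsq_expo[of x] by (simp add: sq.nsq_def)
  qed
  moreover have "cnj (sq_ip M p (expo x)) = (\<Sum>m\<in>F. ft (h m) x * cnj (ft (expo m) x))"
  proof -
    have "sq_ip M p (expo x) = (\<Sum>m\<in>F. a m * ft (expo m) x)"
      unfolding p_def ft_def by (rule sq.ip_sum[OF expo_mem expo_mem])
    then show ?thesis using am by simp
  qed
  ultimately show ?thesis by (metis complex_cnj(1) cnj.simps(1))
qed

text \<open>Integrating \<open>riesz_projection\<close> over the ball gives \<open>mS\<close> times
  the volume minus a local trace, and biorthogonality makes the uncut trace equal to the number of
  points. The squared distances are packaged as a measurable function \<open>D\<close>, so that they
  can be averaged afterwards.\<close>

lemma riesz_density:
  assumes L: "sep \<delta> \<Lambda>" and R: "riesz_bounds A B \<Lambda>" and e: "\<epsilon> > 0"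
  shows "\<exists>r0>0. \<forall>r\<ge>r0. \<forall>y. \<exists>c D. D \<in> borel_measurable borel \<and>
    (\<forall>x. D x = sq.nsq M (\<lambda>t. expo x t - (\<Sum>m\<in>\<Lambda> \<inter> ball y r. c x m * expo m t))) \<and>
    integrable lborel (\<lambda>x. indicator (ball y r) x * D x) \<and>
    (LINT x|lborel. indicator (ball y r) x * D x) \<le> (mS + \<epsilon>) * vol TYPE('a) r - real (card (\<Lambda> \<inter> ball y r))"
proof -
  have A0: "A > 0" using R by (simp add: riesz_bounds_def)
  then have C0: "1 / A \<ge> 0" by simp
  obtain r1 where r1: "boundary_radius \<Lambda> (1 / A) \<epsilon> r1"
    using boundary_estimate[OF L C0 e] by blast
  have r1_pos: "r1 > 0" using r1 by (simp add: boundary_radius_def)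
  have "\<exists>c D. D \<in> borel_measurable borel \<and>
    (\<forall>x. D x = sq.nsq M (\<lambda>t. expo x t - (\<Sum>m\<in>\<Lambda> \<inter> ball y r. c x m * expo m t))) \<and>
    integrable lborel (\<lambda>x. indicator (ball y r) x * D x) \<and>
    (LINT x|lborel. indicator (ball y r) x * D x) \<le> (mS + \<epsilon>) * vol TYPE('a) r - real (card (\<Lambda> \<inter> ball y r))"
    if r: "r \<ge> r1" for r y
  proof -
    define F where "F = \<Lambda> \<inter> ball y r"
    have F: "finite F" "F \<subseteq> \<Lambda>" unfolding F_def using sep_finite[OF L bounded_ball] by auto
    have "\<forall>m\<in>F. \<exists>hb. fst hb = (\<lambda>t. \<Sum>i\<in>F. snd hb i * expo i t) \<and> sq.nsq M (fst hb) \<le> 1 / A \<and>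
      (\<forall>i\<in>F. ft (fst hb) i = (if i = m then 1 else 0))"
    proof
      fix m assume "m \<in> F"
      then obtain h b where "h = (\<lambda>t. \<Sum>i\<in>F. b i * expo i t)" "sq.nsq M h \<le> 1 / A"
        "\<forall>i\<in>F. ft h i = (if i = m then 1 else 0)"
        using biorthogonal_system[OF R F] by blast
      then show "\<exists>hb. fst hb = (\<lambda>t. \<Sum>i\<in>F. snd hb i * expo i t) \<and> sq.nsq M (fst hb) \<le> 1 / A \<and>
        (\<forall>i\<in>F. ft (fst hb) i = (if i = m then 1 else 0))"
        by (intro exI[of _ "(h, b)"]) simp
    qed
    from bchoice[OF this] obtain hb where hb: "\<forall>m\<in>F. fst (hb m) = (\<lambda>t. \<Sum>i\<in>F. snd (hb m) i * expo i t) \<and>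
       sq.nsq M (fst (hb m)) \<le> 1 / A \<and> (\<forall>i\<in>F. ft (fst (hb m)) i = (if i = m then 1 else 0))" by blast
    define h where "h m = fst (hb m)" for m
    define b where "b m = snd (hb m)" for m
    have h1: "h m = (\<lambda>t. \<Sum>i\<in>F. b m i * expo i t)" and h2: "sq.nsq M (h m) \<le> 1 / A" if "m \<in> F" for m
      using bspec[OF hb that] by (auto simp: h_def b_def)
    have bio: "ft (h m) i = (if i = m then 1 else 0)" if "m \<in> F" "i \<in> F" for m i
      using bspec[OF hb that(1)] that(2) by (auto simp: h_def)
    have hV: "h m \<in> V" if "m \<in> F" for m unfolding h1[OF that] by (rule sum_expo_mem)
    define G where "G x = (\<Sum>m\<in>F. ft (h m) x * cnj (ft (expo m) x))" for x
    have gi: "integrable lborel G"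
      unfolding G_def
      by (intro Bochner_Integration.integrable_sum sq_space_mult_integrable ft_bessel(2) hV expo_mem)
    have Gi: "integrable lborel (\<lambda>x. indicator (ball y r) x * G x)"
      by (rule Bochner_Integration.integrable_bound[OF gi]) (use gi in \<open>auto simp: indicator_def\<close>)
    define c where "c x m = cnj (ft (h m) x)" for x m
    define D where "D x = mS - Re (G x)" for x
    have D: "D x = sq.nsq M (\<lambda>t. expo x t - (\<Sum>m\<in>F. c x m * expo m t))" for x
      unfolding D_def G_def c_def by (rule riesz_projection[OF R F h1 bio, symmetric])
    have Bi: "integrable lborel (indicator (ball y r) :: 'a \<Rightarrow> real)"
      using emeasure_lborel_ball_finite[of y r] by (simp add: integrable_indicator_iff)
    have Dind: "indicator (ball y r) x * D x = mS * indicator (ball y r) x - Re (indicator (ball y r) x * G x)" for x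
      by (simp add: D_def indicator_def)
    have "(LINT x|lborel. indicator (ball y r) x * D x) = mS * vol TYPE('a) r - Re (LINT x|lborel. indicator (ball y r) x * G x)"
    proof -
      have "(LINT x|lborel. mS * indicator (ball y r) x - Re (indicator (ball y r) x * G x))
         = (LINT x|lborel. mS * indicator (ball y r) x) - (LINT x|lborel. Re (indicator (ball y r) x * G x))"
        by (rule Bochner_Integration.integral_diff) (intro integrable_mult_right Bi, rule integrable_Re[OF Gi])
      also have "(LINT x|lborel. mS * indicator (ball y r) x) = mS * vol TYPE('a) r"
        using vol_ball[of y r] by simp
      also have "(LINT x|lborel. Re (indicator (ball y r) x * G x)) = Re (LINT x|lborel. indicator (ball y r) x * G x)"
        by (rule integral_Re[OF Gi])
      finally show ?thesis unfolding Dind .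
    qed
    moreover have "real (card F) - Re (LINT x|lborel. indicator (ball y r) x * G x) \<le> \<epsilon> * vol TYPE('a) r"
    proof -
      have "(\<Sum>m\<in>F. sq_ip M (h m) (expo m)) = of_real (real (card F))"
        using bio by (simp add: ft_def)
      then have "cmod (of_real (real (card F)) - (LINT x|lborel. indicator (ball y r) x * G x)) \<le> \<epsilon> * vol TYPE('a) r"
        using boundary_radiusD[OF r1 r, of F y h] hV h2 unfolding G_def F_def by simp
      then have "Re (of_real (real (card F)) - (LINT x|lborel. indicator (ball y r) x * G x)) \<le> \<epsilon> * vol TYPE('a) r"
        using complex_Re_le_cmod order_trans by blast
      then show ?thesis by (simp only: minus_complex.sel Re_complex_of_real)
    qed
    moreover have "integrable lborel (\<lambda>x. indicator (ball y r) x * D x)"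
      unfolding Dind using Bi by (intro Bochner_Integration.integrable_diff integrable_mult_right integrable_Re[OF Gi])
    moreover have "D \<in> borel_measurable borel"
      unfolding D_def[abs_def] using borel_measurable_integrable[OF gi] by simp
    ultimately show ?thesis
      unfolding F_def[symmetric] using D by (intro exI[of _ c] exI[of _ D]) (simp add: algebra_simps)
  qed
  then show ?thesis using r1_pos by blast
qed

end

section \<open>Weak limits\<close>

lemma subseq_dichotomy:
  fixes P :: "nat \<Rightarrow> bool"
  shows "\<exists>r :: nat \<Rightarrow> nat. strict_mono r \<and> ((\<forall>n. P (r n)) \<or> (\<forall>n. \<not> P (r n)))"
proof -
  have *: "\<exists>r :: nat \<Rightarrow> nat. strict_mono r \<and> (\<forall>n. Q (r n))" if inf: "infinite {n. Q n}" for Q :: "nat \<Rightarrow> bool"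
    using strict_mono_enumerate[OF inf] enumerate_in_set[OF inf] by (intro exI[of _ "Infinite_Set.enumerate {n. Q n}"]) auto
  have "{n. P n} \<union> {n. \<not> P n} = UNIV" by auto
  then have "infinite {n. P n} \<or> infinite {n. \<not> P n}"
    using infinite_UNIV_nat finite_UnI by metis
  then show ?thesis using *[of P] *[of "\<lambda>n. \<not> P n"] by blast
qed

text \<open>A diagonal subsequence decides for every member of a countable base whether it is
  eventually met or eventually missed by the sets; the limit consists of the points all of whose
  basic neighbourhoods are eventually met.\<close>

lemma weak_compactness:
  fixes L :: "nat \<Rightarrow> 'a::euclidean_space set"
  assumes ne: "\<And>n. L n \<noteq> {}"
  shows "\<exists>k \<Gamma>. strict_mono (k :: nat \<Rightarrow> nat) \<and> weakly_converges (\<lambda>n. L (k n)) \<Gamma>"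
proof -
  obtain \<B> :: "'a set set" where \<B>: "countable \<B>" "topological_basis \<B>"
    using ex_countable_basis by blast
  define U where "U = from_nat_into \<B>"
  have \<B>ne: "\<B> \<noteq> {}" using topological_basisE[OF \<B>(2) open_UNIV, of undefined] by auto
  have U: "\<exists>m. U m = b" if "b \<in> \<B>" for b
    using from_nat_into_surj[OF \<B>(1) that] by (simp add: U_def)
  have Uo: "open (U m)" for m
    unfolding U_def using from_nat_into[OF \<B>ne, of m] topological_basis_open[OF \<B>(2)] by blast
  interpret subseqs "\<lambda>m s. (\<forall>n. L (s n) \<inter> U m \<noteq> {}) \<or> (\<forall>n. L (s n) \<inter> U m = {})"
  proof
    fix m and s :: "nat \<Rightarrow> nat"
    show "\<exists>r' :: nat \<Rightarrow> nat. strict_mono r' \<and> ((\<forall>n. L ((s \<circ> r') n) \<inter> U m \<noteq> {}) \<or> (\<forall>n. L ((s \<circ> r') n) \<inter> U m = {}))"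
      using subseq_dichotomy[of "\<lambda>n. L (s n) \<inter> U m \<noteq> {}"] by (simp add: comp_def)
  qed
  define k where "k = diagseq"
  have k: "strict_mono k" unfolding k_def by (rule subseq_diagseq)
  \<comment> \<open>The diagonal sequence obeys the decision about \<open>U m\<close> only from
    index \<open>m + 1\<close> on.\<close>
  have dich: "(\<forall>n>m. L (k n) \<inter> U m \<noteq> {}) \<or> (\<forall>n>m. L (k n) \<inter> U m = {})" for m
  proof -
    have "(\<forall>n. L ((diagseq \<circ> ((+) (Suc m))) n) \<inter> U m \<noteq> {}) \<or> (\<forall>n. L ((diagseq \<circ> ((+) (Suc m))) n) \<inter> U m = {})"
      by (rule diagseq_holds) auto
    moreover have "\<exists>i. n = Suc m + i" if "n > m" for n using that by (metis Suc_leI le_Suc_ex)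
    ultimately show ?thesis unfolding k_def by fastforce
  qed
  define \<Gamma> where "\<Gamma> = {g. \<forall>m. g \<in> U m \<longrightarrow> (\<forall>n>m. L (k n) \<inter> U m \<noteq> {})}"
  have "weakly_converges (\<lambda>n. L (k n)) \<Gamma>"
    unfolding weakly_converges_def
  proof (intro conjI ballI allI impI)
    fix g assume g: "g \<in> \<Gamma>"
    \<comment> \<open>An almost nearest point. It exists for every \<open>n\<close> because the sets
      are nonempty, and it converges to \<open>g\<close> because the distances from \<open>g\<close>
      to the sets tend to 0.\<close>
    have "\<exists>l. l \<in> L (k n) \<and> dist l g < infdist g (L (k n)) + 1 / real (Suc n)" for n
    proof -
      have "(INF l\<in>L (k n). dist g l) < infdist g (L (k n)) + 1 / real (Suc n)"
        unfolding infdist_notempty[OF ne] by simp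
      from cInf_lessD[OF _ this] ne obtain l where "l \<in> L (k n)" "dist g l < infdist g (L (k n)) + 1 / real (Suc n)"
        by auto
      then show ?thesis by (auto simp: dist_commute)
    qed
    then obtain l where l: "\<And>n. l n \<in> L (k n)" "\<And>n. dist (l n) g < infdist g (L (k n)) + 1 / real (Suc n)" by metis
    have "l \<longlonglongrightarrow> g"
    proof (rule metric_LIMSEQ_I)
      fix e :: real assume e: "e > 0"
      obtain b where b: "b \<in> \<B>" "g \<in> b" "b \<subseteq> ball g (e/2)"
        using topological_basisE[OF \<B>(2) open_ball, of g g "e/2"] e by auto
      obtain m where m: "U m = b" using U[OF b(1)] by blast
      obtain N where N: "inverse (real (Suc N)) < e/2" using reals_Archimedean[of "e/2"] e by auto
      have "dist (l n) g < e" if n: "n \<ge> max (Suc m) N" for n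
      proof -
        have "L (k n) \<inter> U m \<noteq> {}" using g b(2) m n by (auto simp: \<Gamma>_def)
        then obtain x where x: "x \<in> L (k n)" "x \<in> ball g (e/2)" using b(3) m by blast
        then have "infdist g (L (k n)) < e/2" using infdist_le[OF x(1), of g] by simp
        moreover have "1 / real (Suc n) \<le> inverse (real (Suc N))" using n by (simp add: field_simps)
        ultimately show ?thesis using l(2)[of n] N by simp
      qed
      then show "\<exists>no. \<forall>n\<ge>no. dist (l n) g < e" by blast
    qed
    then show "\<exists>l. (\<forall>n. l n \<in> L (k n)) \<and> l \<longlonglongrightarrow> g" using l(1) by blast
  next
    fix j :: "nat \<Rightarrow> nat" and l g
    assume a: "strict_mono j \<and> (\<forall>i. l i \<in> L (k (j i))) \<and> l \<longlonglongrightarrow> g"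
    show "g \<in> \<Gamma>"
      unfolding \<Gamma>_def
    proof (intro CollectI allI impI)
      fix m assume gm: "g \<in> U m"
      have "\<forall>\<^sub>F i in sequentially. l i \<in> U m" using a gm Uo[of m] by (intro topological_tendstoD) auto
      moreover have "\<forall>\<^sub>F i in sequentially. i > m" by (rule eventually_gt_at_top)
      ultimately obtain i where "l i \<in> U m" "i > m" using eventually_happens'[OF sequentially_bot eventually_conj] by blast
      moreover have "j i > m" using a \<open>i > m\<close> seq_suble[of j i] by simp
      ultimately have "\<not> (\<forall>n>m. L (k n) \<inter> U m = {})" using a by blast
      then show "\<And>n. n > m \<Longrightarrow> L (k n) \<inter> U m \<noteq> {}" using dich[of m] by blast
    qed
  qed
  then show ?thesis using k by blast
qed

text \<open>The empty set is split off, being its own weak limit, because the selection of almost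
  nearest points needs nonempty sets.\<close>

lemma weak_compactness_translates:
  fixes \<Lambda> :: "'a::euclidean_space set"
  shows "\<exists>k \<Gamma>. strict_mono (k :: nat \<Rightarrow> nat) \<and> weakly_converges (\<lambda>n. (\<lambda>l. l - z (k n)) ` \<Lambda>) \<Gamma>"
proof (cases "\<Lambda> = {}")
  case True
  then show ?thesis by (intro exI[of _ id] exI[of _ "{}"]) (simp add: strict_mono_id weakly_converges_def)
next
  case False
  then show ?thesis using weak_compactness[of "\<lambda>n. (\<lambda>l. l - z n) ` \<Lambda>"] by simp
qed

lemma weakly_convergesD:
  assumes "weakly_converges L \<Gamma>"
  shows "\<gamma> \<in> \<Gamma> \<Longrightarrow> \<exists>l. (\<forall>n. l n \<in> L n) \<and> l \<longlonglongrightarrow> \<gamma>"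
    and "strict_mono (k :: nat \<Rightarrow> nat) \<Longrightarrow> (\<And>j. l j \<in> L (k j)) \<Longrightarrow> l \<longlonglongrightarrow> \<gamma> \<Longrightarrow> \<gamma> \<in> \<Gamma>"
  using assms unfolding weakly_converges_def by blast+

lemma weak_lift:
  assumes "weakly_converges L \<Gamma>" "G \<subseteq> \<Gamma>"
  shows "\<exists>l. (\<forall>\<gamma>\<in>G. \<forall>n. l \<gamma> n \<in> L n) \<and> (\<forall>\<gamma>\<in>G. l \<gamma> \<longlonglongrightarrow> \<gamma>)"
proof -
  have "\<forall>\<gamma>\<in>G. \<exists>l. (\<forall>n. l n \<in> L n) \<and> l \<longlonglongrightarrow> \<gamma>"
    using weakly_convergesD(1)[OF assms(1)] assms(2) by blast
  from bchoice[OF this] show ?thesis by blast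
qed

text \<open>Sequences tracking two limit points at distance below \<open>d\<close> eventually
  coincide.\<close>

lemma weak_sep:
  assumes W: "weakly_converges L \<Gamma>" and L: "\<And>n. sep d (L n)"
  shows "sep d \<Gamma>"
  unfolding sep_def
proof (intro conjI ballI impI)
  show "0 < d" using L by (simp add: sep_def)
  fix x y assume x: "x \<in> \<Gamma>" and y: "y \<in> \<Gamma>" and xy: "dist x y < d"
  obtain l where l: "\<And>n. l n \<in> L n" "l \<longlonglongrightarrow> x" using weakly_convergesD(1)[OF W x] by blast
  obtain m where m: "\<And>n. m n \<in> L n" "m \<longlonglongrightarrow> y" using weakly_convergesD(1)[OF W y] by blast
  have "(\<lambda>n. dist (l n) (m n)) \<longlonglongrightarrow> dist x y" by (intro tendsto_dist l m)
  then have "\<forall>\<^sub>F n in sequentially. dist (l n) (m n) < d" using xy by (rule order_tendstoD)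
  then have "\<forall>\<^sub>F n in sequentially. l n = m n"
    by eventually_elim (use sepD[OF L] l(1) m(1) in blast)
  then have "m \<longlonglongrightarrow> x" using Lim_transform_eventually[OF l(2)] by blast
  then show "x = y" using m(2) LIMSEQ_unique by blast
qed

lemma weak_lift_inj:
  fixes l :: "'a::metric_space \<Rightarrow> nat \<Rightarrow> 'a"
  assumes lim: "\<And>\<gamma>. \<gamma> \<in> G \<Longrightarrow> l \<gamma> \<longlonglongrightarrow> \<gamma>" and G: "finite G"
  shows "\<forall>\<^sub>F n in sequentially. inj_on (\<lambda>\<gamma>. l \<gamma> n) G"
proof -
  have "\<forall>\<^sub>F n in sequentially. x \<noteq> y \<longrightarrow> l x n \<noteq> l y n" if "x \<in> G" "y \<in> G" for x y
  proof (cases "x = y")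
    case False
    have "(\<lambda>n. dist (l x n) (l y n)) \<longlonglongrightarrow> dist x y" by (intro tendsto_dist lim that)
    then have "\<forall>\<^sub>F n in sequentially. 0 < dist (l x n) (l y n)" using False by (intro order_tendstoD) auto
    then show ?thesis by eventually_elim auto
  qed simp
  then have "\<forall>\<^sub>F n in sequentially. \<forall>x\<in>G. \<forall>y\<in>G. x \<noteq> y \<longrightarrow> l x n \<noteq> l y n"
    using G by (simp add: eventually_ball_finite_distrib)
  then show ?thesis by eventually_elim (auto simp: inj_on_def)
qed

text \<open>The second clause of weak convergence in quantitative form: points in a bounded region
  that stay at distance \<open>\<eta>\<close> from \<open>\<Gamma>\<close> would accumulate, and the
  accumulation point would belong to \<open>\<Gamma>\<close>.\<close>

lemma weak_matching:
  fixes L :: "nat \<Rightarrow> 'a::euclidean_space set"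
  assumes W: "weakly_converges L \<Gamma>" and e: "\<eta> > 0"
  shows "\<forall>\<^sub>F n in sequentially. \<forall>l\<in>L n \<inter> cball 0 R. \<exists>\<gamma>\<in>\<Gamma>. dist l \<gamma> < \<eta>"
proof (rule ccontr)
  define P where "P n = (\<exists>l\<in>L n \<inter> cball 0 R. \<forall>\<gamma>\<in>\<Gamma>. \<eta> \<le> dist l \<gamma>)" for n
  assume "\<not> ?thesis"
  then have "\<not> (\<forall>\<^sub>F n in sequentially. \<not> P n)" by (simp add: P_def not_le)
  then have inf: "infinite {n. P n}"
    unfolding cofinite_eq_sequentially[symmetric] eventually_cofinite by simp
  define k where "k = Infinite_Set.enumerate {n. P n}"
  have k: "strict_mono k" unfolding k_def by (rule strict_mono_enumerate[OF inf])
  have "P (k n)" for n using enumerate_in_set[OF inf, of n] by (simp add: k_def)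
  then obtain l where l: "\<And>n. l n \<in> L (k n)" "\<And>n. l n \<in> cball 0 R" "\<And>n \<gamma>. \<gamma> \<in> \<Gamma> \<Longrightarrow> \<eta> \<le> dist (l n) \<gamma>"
    unfolding P_def by (metis IntE)
  have "seq_compact (cball (0::'a) R)" using compact_cball compact_imp_seq_compact by blast
  then obtain g r where g: "strict_mono (r :: nat \<Rightarrow> nat)" "(l \<circ> r) \<longlonglongrightarrow> g"
    using l(2) unfolding seq_compact_def by meson
  have "g \<in> \<Gamma>"
    by (rule weakly_convergesD(2)[OF W strict_mono_o[OF k g(1)] _ g(2)]) (simp add: l(1))
  then have "\<eta> \<le> dist ((l \<circ> r) n) g" for n using l(3) by simp
  moreover have "\<forall>\<^sub>F n in sequentially. dist ((l \<circ> r) n) g < \<eta>" using g(2) e by (rule tendstoD)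
  ultimately show False using eventually_happens'[OF sequentially_bot] by (metis not_less)
qed

text \<open>Matching points of \<open>L n\<close> with points of \<open>\<Gamma>\<close> at distance
  below \<open>d/2\<close> is injective by separation. The radius grows by 1 because matched points
  also move by less than 1.\<close>

lemma weak_card_le:
  fixes L :: "nat \<Rightarrow> 'a::euclidean_space set"
  assumes W: "weakly_converges L \<Gamma>" and L: "\<And>n. sep d (L n)"
  shows "\<forall>\<^sub>F n in sequentially. card (L n \<inter> cball 0 R) \<le> card (\<Gamma> \<inter> ball 0 (R + 1))"
proof -
  have d: "d > 0" using L by (simp add: sep_def)
  have "min 1 (d/2) > 0" using d by simp
  from weak_matching[OF W this, of R] show ?thesis
  proof eventually_elim
    case (elim n)
    then obtain g where g: "\<And>l. l \<in> L n \<inter> cball 0 R \<Longrightarrow> g l \<in> \<Gamma> \<and> dist l (g l) < min 1 (d/2)" by metis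
    show ?case
    proof (rule card_inj_on_le)
      show "inj_on g (L n \<inter> cball 0 R)"
      proof (rule inj_onI)
        fix x y assume xy: "x \<in> L n \<inter> cball 0 R" "y \<in> L n \<inter> cball 0 R" "g x = g y"
        have "dist x y \<le> dist x (g x) + dist y (g x)" by (rule dist_triangle2)
        then have "dist x y < d" using g[OF xy(1)] g[OF xy(2)] xy(3) by simp
        then show "x = y" using sepD[OF L] xy by blast
      qed
      show "g ` (L n \<inter> cball 0 R) \<subseteq> \<Gamma> \<inter> ball 0 (R + 1)"
      proof
        fix y assume "y \<in> g ` (L n \<inter> cball 0 R)"
        then obtain x where x: "x \<in> L n \<inter> cball 0 R" "y = g x" by blast
        have "dist 0 y \<le> dist 0 x + dist x y" by (rule dist_triangle)
        then show "y \<in> \<Gamma> \<inter> ball 0 (R + 1)" using g[OF x(1)] x by simp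
      qed
      show "finite (\<Gamma> \<inter> ball 0 (R + 1))" by (rule sep_finite[OF weak_sep[OF W L] bounded_ball])
    qed
  qed
qed

context fin_region
begin

section \<open>Riesz bases of exponentials\<close>

lemma sum_diff_expo_le:
  assumes B: "bessel B \<Lambda>" and F: "finite F" "F \<subseteq> \<Lambda>" and G: "finite G" "G \<subseteq> \<Lambda>"
  shows "sq.nsq M (\<lambda>t. (\<Sum>l\<in>F. c l * expo l t) - (\<Sum>l\<in>G. c l * expo l t))
    \<le> B * ((\<Sum>l\<in>F - G. (cmod (c l))\<^sup>2) + (\<Sum>l\<in>G - F. (cmod (c l))\<^sup>2))"
proof -
  define d where "d l = (if l \<in> F then c l else 0) - (if l \<in> G then c l else 0)" for l
  have FG: "finite (F \<union> G)" "F \<union> G \<subseteq> \<Lambda>" using F G by auto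
  have "(\<Sum>l\<in>F \<union> G. d l * expo l t) = (\<Sum>l\<in>F. c l * expo l t) - (\<Sum>l\<in>G. c l * expo l t)" for t
  proof -
    have "(\<Sum>l\<in>F. c l * expo l t) = (\<Sum>l\<in>F \<union> G. (if l \<in> F then c l else 0) * expo l t)"
      using FG by (intro sum.mono_neutral_cong_left) auto
    moreover have "(\<Sum>l\<in>G. c l * expo l t) = (\<Sum>l\<in>F \<union> G. (if l \<in> G then c l else 0) * expo l t)"
      using FG by (intro sum.mono_neutral_cong_left) auto
    ultimately show ?thesis by (simp add: d_def left_diff_distrib sum_subtractf)
  qed
  then have "sq.nsq M (\<lambda>t. (\<Sum>l\<in>F. c l * expo l t) - (\<Sum>l\<in>G. c l * expo l t)) \<le> B * (\<Sum>l\<in>F \<union> G. (cmod (d l))\<^sup>2)"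
    using bessel_upper_bound[OF B FG, of d] by simp
  also have "(\<Sum>l\<in>F \<union> G. (cmod (d l))\<^sup>2) = (\<Sum>l\<in>(F - G) \<union> (G - F). (cmod (c l))\<^sup>2)"
    using FG by (intro sum.mono_neutral_cong_right) (auto simp: d_def)
  also have "\<dots> = (\<Sum>l\<in>F - G. (cmod (c l))\<^sup>2) + (\<Sum>l\<in>G - F. (cmod (c l))\<^sup>2)"
    using F G by (intro sum.union_disjoint) auto
  finally show ?thesis .
qed

text \<open>Partial sums over finite sets \<open>F n\<close> that exhaust the squared coefficients
  up to \<open>1 / Suc n\<close> form a Cauchy sequence. Its limit is the unconditional sum, because
  enlarging \<open>F n\<close> to any finite set adds little.\<close>

lemma riesz_bounds_exp_riesz_sequence:
  assumes R: "riesz_bounds A B \<Lambda>"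
  shows "exp_riesz_sequence S \<Lambda>"
proof -
  have A0: "A > 0" and B0: "B \<ge> 0" using R by (auto simp: riesz_bounds_def)
  note Bs = riesz_bounds_bessel[OF R]
  have "\<exists>g. exp_has_L2_sum S \<Lambda> c g \<and> A * (\<Sum>\<^sub>\<infinity>l\<in>\<Lambda>. (cmod (c l))\<^sup>2) \<le> (L2_norm S g)\<^sup>2 \<and>
       (L2_norm S g)\<^sup>2 \<le> (A + B) * (\<Sum>\<^sub>\<infinity>l\<in>\<Lambda>. (cmod (c l))\<^sup>2)" if c: "c \<in> ell2 \<Lambda>" for c
  proof -
    have cs: "(\<lambda>l. (cmod (c l))\<^sup>2) summable_on \<Lambda>" using c by (simp add: ell2_def)
    define T where "T = (\<Sum>\<^sub>\<infinity>l\<in>\<Lambda>. (cmod (c l))\<^sup>2)"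
    have T0: "T \<ge> 0" unfolding T_def by (intro infsum_nonneg) simp
    have le_T: "(\<Sum>l\<in>F. (cmod (c l))\<^sup>2) \<le> T" if "finite F" "F \<subseteq> \<Lambda>" for F
      unfolding T_def using that by (intro finite_sum_le_infsum[OF cs]) auto
    have "\<exists>F. finite F \<and> F \<subseteq> \<Lambda> \<and> T - 1 / real (Suc n) \<le> (\<Sum>l\<in>F. (cmod (c l))\<^sup>2)" for n
    proof -
      obtain F where "finite F" "F \<subseteq> \<Lambda>" "dist (\<Sum>l\<in>F. (cmod (c l))\<^sup>2) T \<le> 1 / real (Suc n)"
        using infsum_finite_approximation[OF cs, of "1 / real (Suc n)"] unfolding T_def by auto
      then show ?thesis by (intro exI[of _ F]) (auto simp: dist_real_def abs_le_iff)
    qed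
    then obtain F where F: "\<And>n. finite (F n)" "\<And>n. F n \<subseteq> \<Lambda>" "\<And>n. T - 1 / real (Suc n) \<le> (\<Sum>l\<in>F n. (cmod (c l))\<^sup>2)"
      by metis
    have tail: "(\<Sum>l\<in>G - F n. (cmod (c l))\<^sup>2) \<le> 1 / real (Suc n)" if "finite G" "G \<subseteq> \<Lambda>" for G n
    proof -
      have "(\<Sum>l\<in>F n \<union> (G - F n). (cmod (c l))\<^sup>2) \<le> T" using that F by (intro le_T) auto
      moreover have "(\<Sum>l\<in>F n \<union> (G - F n). (cmod (c l))\<^sup>2) = (\<Sum>l\<in>F n. (cmod (c l))\<^sup>2) + (\<Sum>l\<in>G - F n. (cmod (c l))\<^sup>2)"
        using that F by (intro sum.union_disjoint) auto
      ultimately show ?thesis using F(3)[of n] by simp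
    qed
    define u where "u G = (\<lambda>t. \<Sum>l\<in>G. c l * expo l t)" for G
    have uV: "u G \<in> V" for G unfolding u_def by (rule sum_expo_mem)
    have uu: "sq.nsq M (\<lambda>t. u G t - u H t) \<le> B * ((\<Sum>l\<in>G - H. (cmod (c l))\<^sup>2) + (\<Sum>l\<in>H - G. (cmod (c l))\<^sup>2))"
      if "finite G" "G \<subseteq> \<Lambda>" "finite H" "H \<subseteq> \<Lambda>" for G H
      unfolding u_def by (rule sum_diff_expo_le[OF Bs that])
    have small: "\<exists>N. B * (1 / real (Suc N) + 1 / real (Suc N)) < e" if e: "e > 0" for e
    proof -
      obtain N where N: "inverse (real (Suc N)) < e / (2 * B + 1)"
        using reals_Archimedean[of "e / (2 * B + 1)"] e B0 by (auto simp: add_nonneg_pos)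
      have "B * (1 / real (Suc N) + 1 / real (Suc N)) = (2 * B) * inverse (real (Suc N))"
        by (simp add: inverse_eq_divide)
      also have "\<dots> \<le> (2 * B) * (e / (2 * B + 1))" using N B0 by (intro mult_left_mono) auto
      also have "\<dots> < e" using e B0 by (simp add: field_simps add_nonneg_pos)
      finally show ?thesis by blast
    qed
    have mono1: "1 / real (Suc n) \<le> 1 / real (Suc N)" if "n \<ge> N" for n N
      using that by (simp add: field_simps)
    have "\<exists>g\<in>V. (\<lambda>n. sq.nsq M (\<lambda>t. u (F n) t - g t)) \<longlonglongrightarrow> 0"
    proof (rule sq_complete[OF uV])
      fix e :: real assume "e > 0"
      then obtain N where N: "B * (1 / real (Suc N) + 1 / real (Suc N)) < e" using small by blast
      have "sq.nsq M (\<lambda>t. u (F m) t - u (F n) t) < e" if "m \<ge> N" "n \<ge> N" for m n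
      proof -
        have "sq.nsq M (\<lambda>t. u (F m) t - u (F n) t) \<le> B * (1 / real (Suc n) + 1 / real (Suc m))"
          by (rule order_trans[OF uu[OF F(1,2) F(1,2)] mult_left_mono[OF add_mono[OF tail[OF F(1,2)] tail[OF F(1,2)]] B0]])
        also have "\<dots> \<le> B * (1 / real (Suc N) + 1 / real (Suc N))"
          by (intro mult_left_mono add_mono mono1 that B0)
        finally show ?thesis using N by simp
      qed
      then show "\<exists>N. \<forall>m\<ge>N. \<forall>n\<ge>N. sq.nsq M (\<lambda>t. u (F m) t - u (F n) t) < e" by blast
    qed
    then obtain g where gV: "g \<in> V" and g: "(\<lambda>n. sq.nsq M (\<lambda>t. u (F n) t - g t)) \<longlonglongrightarrow> 0" by blast
    have gn: "(\<lambda>n. sq.nm M (\<lambda>t. u (F n) t - g t)) \<longlonglongrightarrow> 0"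
      using tendsto_real_sqrt[OF g] by (simp add: sq.nm_def)
    have "((\<lambda>G. sq.nm M (\<lambda>t. u G t - g t)) \<longlongrightarrow> 0) (finite_subsets_at_top \<Lambda>)"
    proof (rule tendstoI)
      fix e :: real assume e: "e > 0"
      then have "(e/2)\<^sup>2 > 0" by simp
      then obtain N where N: "B * (1 / real (Suc N) + 1 / real (Suc N)) < (e/2)\<^sup>2" using small by blast
      have "\<forall>\<^sub>F n in sequentially. sq.nm M (\<lambda>t. u (F n) t - g t) < e/2 \<and> n \<ge> N"
        using e by (intro eventually_conj order_tendstoD(2)[OF gn] eventually_ge_at_top) simp
      then obtain n where n: "sq.nm M (\<lambda>t. u (F n) t - g t) < e/2" "n \<ge> N"
        using eventually_happens'[OF sequentially_bot] by blast
      show "\<forall>\<^sub>F G in finite_subsets_at_top \<Lambda>. dist (sq.nm M (\<lambda>t. u G t - g t)) 0 < e"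
        unfolding eventually_finite_subsets_at_top
      proof (intro exI[of _ "F n"] conjI allI impI F)
        fix G assume G: "finite G \<and> F n \<subseteq> G \<and> G \<subseteq> \<Lambda>"
        then have Gf: "finite G" "G \<subseteq> \<Lambda>" and e0: "F n - G = {}" by auto
        have "sq.nsq M (\<lambda>t. u G t - u (F n) t) \<le> B * (1 / real (Suc n) + 0)"
        proof -
          have "sq.nsq M (\<lambda>t. u G t - u (F n) t) \<le> B * ((\<Sum>l\<in>G - F n. (cmod (c l))\<^sup>2) + 0)"
            using uu[OF Gf F(1,2), of n] unfolding e0 by simp
          also have "\<dots> \<le> B * (1 / real (Suc n) + 0)"
            using tail[OF Gf, of n] B0 by (intro mult_left_mono add_mono) auto
          finally show ?thesis .
        qed
        also have "\<dots> \<le> B * (1 / real (Suc N) + 1 / real (Suc N))"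
          using mono1[OF n(2)] B0 by (intro mult_left_mono add_mono) auto
        finally have "sq.nm M (\<lambda>t. u G t - u (F n) t) < e/2"
          unfolding sq.nm_def using N e by (intro real_less_lsqrt) auto
        then have "sq.nm M (\<lambda>t. u G t - g t) < e"
          using sq.nm_triangle[OF uV[of G] uV[of "F n"] gV] n(1) by simp
        then show "dist (sq.nm M (\<lambda>t. u G t - g t)) 0 < e"
          using sq.nm_nonneg[OF sq.diff_mem[OF uV[of G] gV]] by simp
      qed
    qed
    then have sum: "exp_has_L2_sum S \<Lambda> c g"
      unfolding exp_has_L2_sum_def L2_space_eq L2_norm_eq using gV by (simp add: u_def)
    have nmlim: "(\<lambda>n. sq.nm M (u (F n))) \<longlonglongrightarrow> sq.nm M g"
    proof (rule LIM_zero_cancel, rule Lim_null_comparison[OF always_eventually gn], rule allI)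
      fix n
      show "norm (sq.nm M (u (F n)) - sq.nm M g) \<le> sq.nm M (\<lambda>t. u (F n) t - g t)"
        using sq.nm_le_add_diff[OF uV[of "F n"] gV] sq.nm_le_add_diff[OF gV uV[of "F n"]]
          sq.nm_minus_commute[OF gV uV[of "F n"]] by (simp add: abs_le_iff)
    qed
    have nlim: "(\<lambda>n. sq.nsq M (u (F n))) \<longlonglongrightarrow> (sq.nm M g)\<^sup>2"
      using tendsto_power[OF nmlim, of 2] by (simp add: sq.nm_sq[OF uV])
    have "A * T \<le> (sq.nm M g)\<^sup>2"
    proof (rule LIMSEQ_le[OF _ nlim])
      show "(\<lambda>n. A * (T - 1 / real (Suc n))) \<longlonglongrightarrow> A * T"
        using tendsto_mult_left[OF tendsto_diff[OF tendsto_const[of T] LIMSEQ_Suc[OF lim_const_over_n[of 1]]], of A] by simp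
      have "A * (T - 1 / real (Suc n)) \<le> sq.nsq M (u (F n))" for n
      proof -
        have "A * (T - 1 / real (Suc n)) \<le> A * (\<Sum>l\<in>F n. (cmod (c l))\<^sup>2)"
          using F(3)[of n] A0 by (intro mult_left_mono) auto
        also have "\<dots> \<le> sq.nsq M (u (F n))" unfolding u_def by (rule riesz_boundsD(1)[OF R F(1,2)])
        finally show ?thesis .
      qed
      then show "\<exists>N. \<forall>n\<ge>N. A * (T - 1 / real (Suc n)) \<le> sq.nsq M (u (F n))" by blast
    qed
    moreover have "(sq.nm M g)\<^sup>2 \<le> B * T"
    proof (rule LIMSEQ_le_const2[OF nlim])
      have "sq.nsq M (u (F n)) \<le> B * T" for n
        unfolding u_def by (rule order_trans[OF riesz_boundsD(2)[OF R F(1,2)] mult_left_mono[OF le_T[OF F(1,2)] B0]])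
      then show "\<exists>N. \<forall>n\<ge>N. sq.nsq M (u (F n)) \<le> B * T" by blast
    qed
    \<comment> \<open>The definition asks for ordered constants, and for an empty family
      \<open>riesz_bounds\<close> does not imply \<open>A \<le> B\<close>; hence the upper constant
      \<open>A + B\<close>.\<close>
    moreover have "B * T \<le> (A + B) * T" using A0 T0 by (intro mult_right_mono) auto
    ultimately show ?thesis
      using sum unfolding L2_norm_eq T_def[symmetric] by (intro exI[of _ g]) auto
  qed
  then show ?thesis unfolding exp_riesz_sequence_def
    using A0 B0 by (intro exI[of _ A] exI[of _ "A + B"]) auto
qed

text \<open>One Landweber step contracts the distance to the span by a fixed factor.\<close>

lemma frame_exp_complete:
  assumes B: "bessel B \<Lambda>" and A: "lower_frame A \<Lambda>"
  shows "exp_complete S \<Lambda>"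
proof -
  have A0: "A > 0" using A by (simp add: lower_frame_def)
  have B0: "B \<ge> 0" using B by (simp add: bessel_def)
  \<comment> \<open>\<open>1 / b\<close> is the step length; adding \<open>A\<close> makes
    \<open>b\<close> positive. The 2 in \<open>\<theta>\<close> below accounts for replacing the
    frame sum by a finite part that still reaches half of the lower bound.\<close>
  define b where "b = A + B"
  have b0: "b > 0" using A0 B0 by (simp add: b_def)
  define \<theta> where "\<theta> = 1 - A / (2 * b)"
  have \<theta>: "0 \<le> \<theta>" "\<theta> < 1" using A0 B0 b0 by (auto simp: \<theta>_def b_def field_simps)
  have step: "\<exists>F c. finite F \<and> F \<subseteq> \<Lambda> \<and> sq.nsq M (\<lambda>t. f t - (\<Sum>l\<in>F. c l * expo l t)) \<le> \<theta> * sq.nsq M f"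
    if f: "f \<in> V" for f
  proof (cases "sq.nsq M f = 0")
    case True
    then show ?thesis by (intro exI[of _ "{}"]) simp
  next
    case False
    then have n0: "sq.nsq M f > 0" using sq.nsq_nonneg[OF f] by simp
    have e: "A / 2 * sq.nsq M f > 0" using n0 A0 by simp
    obtain F where F: "finite F" "F \<subseteq> \<Lambda>" "dist (\<Sum>l\<in>F. (cmod (ft f l))\<^sup>2) (\<Sum>\<^sub>\<infinity>l\<in>\<Lambda>. (cmod (ft f l))\<^sup>2) \<le> A / 2 * sq.nsq M f"
      using infsum_finite_approximation[OF bessel_summable(1)[OF B f] e] by blast
    define s where "s = (\<Sum>l\<in>F. (cmod (ft f l))\<^sup>2)"
    have "A * sq.nsq M f \<le> (\<Sum>\<^sub>\<infinity>l\<in>\<Lambda>. (cmod (ft f l))\<^sup>2)" using A f by (simp add: lower_frame_def)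
    then have s: "A / 2 * sq.nsq M f \<le> s" using F(3) unfolding s_def dist_real_def abs_le_iff by linarith
    define v where "v = (\<lambda>t. \<Sum>l\<in>F. ft f l * expo l t)"
    have vV: "v \<in> V" unfolding v_def by (rule sum_expo_mem)
    have fv: "sq_ip M f v = of_real s"
    proof -
      have "sq_ip M f v = (\<Sum>l\<in>F. cnj (ft f l) * ft f l)" unfolding v_def by (rule ip_sum_expo[OF f])
      also have "\<dots> = of_real s" unfolding s_def of_real_sum
        by (intro sum.cong refl) (simp add: complex_norm_square mult.commute del: of_real_power)
      finally show ?thesis .
    qed
    have s0: "s \<ge> 0" unfolding s_def by (intro sum_nonneg) simp
    have vn: "sq.nsq M v \<le> b * s"
    proof -
      have "sq.nsq M v \<le> B * s" unfolding v_def s_def by (rule bessel_upper_bound[OF B F(1,2)])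
      also have "\<dots> \<le> b * s" using A0 s0 by (intro mult_right_mono) (auto simp: b_def)
      finally show ?thesis .
    qed
    define a where "a = complex_of_real (- (1 / b))"
    have av: "(\<lambda>t. f t - (\<Sum>l\<in>F. (of_real (1 / b) * ft f l) * expo l t)) = (\<lambda>t. a * v t + f t)"
      by (simp add: v_def a_def sum_distrib_left mult.assoc sum_negf)
    have "sq.nsq M (\<lambda>t. f t - (\<Sum>l\<in>F. (of_real (1 / b) * ft f l) * expo l t)) = (cmod a)\<^sup>2 * sq.nsq M v + 2 * Re (a * sq_ip M v f) + sq.nsq M f"
      unfolding av by (rule sq.nsq_lin[OF vV f])
    also have "sq_ip M v f = of_real s" using sq.ip_herm[OF f vV] fv by simp
    also have "(cmod a)\<^sup>2 = (1 / b)\<^sup>2" using b0 by (simp add: a_def norm_divide)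
    also have "Re (a * of_real s) = - (s / b)" by (simp add: a_def)
    finally have eq: "sq.nsq M (\<lambda>t. f t - (\<Sum>l\<in>F. (of_real (1 / b) * ft f l) * expo l t))
       = (1 / b)\<^sup>2 * sq.nsq M v + 2 * (- (s / b)) + sq.nsq M f" .
    have "(1 / b)\<^sup>2 * sq.nsq M v \<le> (1 / b)\<^sup>2 * (b * s)" using vn by (intro mult_left_mono) auto
    also have "\<dots> = s / b" using b0 by (simp add: power2_eq_square)
    finally have "sq.nsq M (\<lambda>t. f t - (\<Sum>l\<in>F. (of_real (1 / b) * ft f l) * expo l t)) \<le> sq.nsq M f - s / b"
      unfolding eq by simp
    also have "\<dots> \<le> sq.nsq M f - (A / 2 * sq.nsq M f) / b"
      by (intro diff_left_mono divide_right_mono s) (use b0 in simp)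
    also have "\<dots> = \<theta> * sq.nsq M f" by (simp add: \<theta>_def left_diff_distrib)
    finally have "sq.nsq M (\<lambda>t. f t - (\<Sum>l\<in>F. (of_real (1 / b) * ft f l) * expo l t)) \<le> \<theta> * sq.nsq M f" .
    then show ?thesis by (intro exI[of _ F] exI[of _ "\<lambda>l. of_real (1 / b) * ft f l"] conjI F(1,2))
  qed
  have iter: "\<exists>F c. finite F \<and> F \<subseteq> \<Lambda> \<and> sq.nsq M (\<lambda>t. f t - (\<Sum>l\<in>F. c l * expo l t)) \<le> \<theta> ^ k * sq.nsq M f"
    if f: "f \<in> V" for f k
  proof (induction k)
    case 0
    show ?case by (intro exI[of _ "{}"]) simp
  next
    case (Suc k)
    then obtain F c where F: "finite F" "F \<subseteq> \<Lambda>" "sq.nsq M (\<lambda>t. f t - (\<Sum>l\<in>F. c l * expo l t)) \<le> \<theta> ^ k * sq.nsq M f" by blast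
    define g where "g = (\<lambda>t. f t - (\<Sum>l\<in>F. c l * expo l t))"
    have gV: "g \<in> V" unfolding g_def by (intro sq.diff_mem f sum_expo_mem)
    obtain G d where G: "finite G" "G \<subseteq> \<Lambda>" "sq.nsq M (\<lambda>t. g t - (\<Sum>l\<in>G. d l * expo l t)) \<le> \<theta> * sq.nsq M g"
      using step[OF gV] by blast
    define a where "a l = (if l \<in> F then c l else 0) + (if l \<in> G then d l else 0)" for l
    have FG: "finite (F \<union> G)" "F \<union> G \<subseteq> \<Lambda>" using F G by auto
    have "(\<Sum>l\<in>F \<union> G. a l * expo l t) = (\<Sum>l\<in>F. c l * expo l t) + (\<Sum>l\<in>G. d l * expo l t)" for t
    proof -
      have "(\<Sum>l\<in>F. c l * expo l t) = (\<Sum>l\<in>F \<union> G. (if l \<in> F then c l else 0) * expo l t)"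
        using FG by (intro sum.mono_neutral_cong_left) auto
      moreover have "(\<Sum>l\<in>G. d l * expo l t) = (\<Sum>l\<in>F \<union> G. (if l \<in> G then d l else 0) * expo l t)"
        using FG by (intro sum.mono_neutral_cong_left) auto
      ultimately show ?thesis by (simp add: a_def distrib_right sum.distrib)
    qed
    then have "(\<lambda>t. g t - (\<Sum>l\<in>G. d l * expo l t)) = (\<lambda>t. f t - (\<Sum>l\<in>F \<union> G. a l * expo l t))"
      by (simp add: g_def diff_diff_eq)
    moreover have "\<theta> * sq.nsq M g \<le> \<theta> * (\<theta> ^ k * sq.nsq M f)"
      using F(3) \<theta>(1) by (intro mult_left_mono) (auto simp: g_def)
    ultimately show ?case using G(3) FG
      by (intro exI[of _ "F \<union> G"] exI[of _ a]) (simp add: mult.assoc)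
  qed
  show ?thesis
    unfolding exp_complete_def L2_space_eq L2_norm_eq
  proof (intro ballI allI impI)
    fix f and e :: real assume f: "f \<in> V" and e: "e > 0"
    have "(\<lambda>k. \<theta> ^ k * sq.nsq M f) \<longlonglongrightarrow> 0 * sq.nsq M f"
      using \<theta> by (intro tendsto_mult_right LIMSEQ_realpow_zero)
    then have "\<forall>\<^sub>F k in sequentially. \<theta> ^ k * sq.nsq M f < e\<^sup>2" using e by (intro order_tendstoD(2)) auto
    then obtain k where k: "\<theta> ^ k * sq.nsq M f < e\<^sup>2" using eventually_happens'[OF sequentially_bot] by blast
    obtain F c where F: "finite F" "F \<subseteq> \<Lambda>" "sq.nsq M (\<lambda>t. f t - (\<Sum>l\<in>F. c l * expo l t)) \<le> \<theta> ^ k * sq.nsq M f"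
      using iter[OF f] by blast
    have "sq.nm M (\<lambda>t. f t - (\<Sum>l\<in>F. c l * expo l t)) < e"
      unfolding sq.nm_def using F(3) k e by (intro real_less_lsqrt) auto
    then show "\<exists>F c. finite F \<and> F \<subseteq> \<Lambda> \<and> sq.nm M (\<lambda>t. f t - (\<Sum>l\<in>F. c l * expo l t)) < e"
      by (intro exI[of _ F] exI[of _ c] conjI F(1,2))
  qed
qed

text \<open>Test \<open>f\<close> against an approximating combination of exponentials.\<close>

lemma lower_bound_by_approximation:
  assumes f: "f \<in> V" and A: "A > 0" and s: "s \<ge> 0"
    and ex: "\<And>e. e > 0 \<Longrightarrow> \<exists>F c. sq.nm M (\<lambda>t. f t - (\<Sum>l\<in>F. c l * expo l t)) < e \<and>
      A * (\<Sum>l\<in>F. (cmod (c l))\<^sup>2) \<le> sq.nsq M (\<lambda>t. \<Sum>l\<in>F. c l * expo l t) \<and> (\<Sum>l\<in>F. (cmod (ft f l))\<^sup>2) \<le> s"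
  shows "A * sq.nsq M f \<le> s"
proof -
  define n where "n = sq.nm M f"
  have n0: "n \<ge> 0" unfolding n_def by (rule sq.nm_nonneg[OF f])
  have n2: "sq.nsq M f = n\<^sup>2" unfolding n_def by (rule sq.nm_sq[OF f, symmetric])
  \<comment> \<open>The squared norm is the inner product with the approximant plus that with the
    error; the first is bounded by Cauchy--Schwarz between coefficients and samples.\<close>
  have bound: "n\<^sup>2 \<le> (n + e) * sqrt (s / A) + e * n" if e: "e > 0" for e
  proof -
    obtain F c where F: "sq.nm M (\<lambda>t. f t - (\<Sum>l\<in>F. c l * expo l t)) < e"
      "A * (\<Sum>l\<in>F. (cmod (c l))\<^sup>2) \<le> sq.nsq M (\<lambda>t. \<Sum>l\<in>F. c l * expo l t)" "(\<Sum>l\<in>F. (cmod (ft f l))\<^sup>2) \<le> s"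
      using ex[OF e] by blast
    define v where "v = (\<lambda>t. \<Sum>l\<in>F. c l * expo l t)"
    have vV: "v \<in> V" unfolding v_def by (rule sum_expo_mem)
    have dV: "(\<lambda>t. f t - v t) \<in> V" by (rule sq.diff_mem[OF f vV])
    have vn: "sq.nm M v \<le> n + e"
    proof -
      have "sq.nm M (\<lambda>t. f t - v t) < e" using F(1) by (simp add: v_def)
      then show ?thesis
        using sq.nm_le_add_diff[OF vV f] sq.nm_minus_commute[OF f vV] unfolding n_def by linarith
    qed
    have c0: "(\<Sum>l\<in>F. (cmod (c l))\<^sup>2) \<ge> 0" by (intro sum_nonneg) simp
    have "(cmod (sq_ip M f v))\<^sup>2 \<le> (\<Sum>l\<in>F. (cmod (cnj (c l)))\<^sup>2) * (\<Sum>l\<in>F. (cmod (ft f l))\<^sup>2)"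
      unfolding v_def ip_sum_expo[OF f] by (rule sum_mult_cnj_le)
    also have "\<dots> \<le> (\<Sum>l\<in>F. (cmod (c l))\<^sup>2) * s" using F(3) c0 by (auto intro: mult_left_mono)
    also have "\<dots> \<le> ((sq.nm M v)\<^sup>2 / A) * s"
      using F(2) A s sq.nm_sq[OF vV] unfolding v_def[symmetric] by (intro mult_right_mono) (simp_all add: field_simps)
    also have "\<dots> = (sq.nm M v * sqrt (s / A))\<^sup>2" using A s by (simp add: power_mult_distrib)
    finally have "cmod (sq_ip M f v) \<le> sq.nm M v * sqrt (s / A)"
      by (rule power2_le_imp_le) (use sq.nm_nonneg[OF vV] A s in simp)
    also have "\<dots> \<le> (n + e) * sqrt (s / A)" using vn A s by (intro mult_right_mono) auto
    finally have 1: "cmod (sq_ip M f v) \<le> (n + e) * sqrt (s / A)" .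
    have "cmod (sq_ip M f (\<lambda>t. f t - v t)) \<le> n * sq.nm M (\<lambda>t. f t - v t)"
      unfolding n_def by (rule sq.cauchy_schwarz[OF f dV])
    also have "\<dots> \<le> n * e"
    proof (rule mult_left_mono[OF _ n0])
      show "sq.nm M (\<lambda>t. f t - v t) \<le> e" using F(1) by (simp add: v_def)
    qed
    finally have 2: "cmod (sq_ip M f (\<lambda>t. f t - v t)) \<le> e * n" by (simp add: mult.commute)
    have "of_real (n\<^sup>2) = sq_ip M f f" using sq.ip_self[OF f] n2 by simp
    also have "\<dots> = sq_ip M f v + sq_ip M f (\<lambda>t. f t - v t)" using sq.ip_diff_right[OF f vV f] by simp
    finally have "cmod (of_real (n\<^sup>2)) \<le> cmod (sq_ip M f v) + cmod (sq_ip M f (\<lambda>t. f t - v t))"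
      by (metis norm_triangle_ineq)
    then show ?thesis using 1 2 by (simp add: norm_power)
  qed
  have "n\<^sup>2 \<le> n * sqrt (s / A)"
  proof (rule field_le_epsilon)
    fix d :: real assume d: "d > 0"
    \<comment> \<open>The total coefficient of \<open>e\<close> in \<open>bound\<close>, so that
      \<open>e = d / (q + 1)\<close> keeps the excess below \<open>d\<close>.\<close>
    define q where "q = sqrt (s / A) + n"
    have q: "q \<ge> 0" using A s n0 by (simp add: q_def)
    have "n\<^sup>2 \<le> (n + d / (q + 1)) * sqrt (s / A) + d / (q + 1) * n"
      using q d by (intro bound) auto
    also have "\<dots> = n * sqrt (s / A) + d / (q + 1) * q" by (simp add: q_def algebra_simps add_divide_distrib)
    also have "d / (q + 1) * q \<le> d" using q d by (simp add: field_simps)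
    finally show "n\<^sup>2 \<le> n * sqrt (s / A) + d" by simp
  qed
  then have "n \<le> sqrt (s / A)" using n0 A s by (cases "n = 0") (auto simp: power2_eq_square)
  then have "n\<^sup>2 \<le> (sqrt (s / A))\<^sup>2" using n0 by (intro power_mono)
  then have "n\<^sup>2 \<le> s / A" using A s by simp
  then show ?thesis unfolding n2 using A by (simp add: field_simps)
qed

lemma exp_completeD:
  assumes "exp_complete S \<Lambda>" "f \<in> V" "e > 0"
  shows "\<exists>F c. finite F \<and> F \<subseteq> \<Lambda> \<and> sq.nm M (\<lambda>t. f t - (\<Sum>l\<in>F. c l * expo l t)) < e"
  using assms(1)[unfolded exp_complete_def L2_space_eq L2_norm_eq, rule_format, OF assms(2,3)] .

text \<open>Completeness supplies approximants from the family itself, for which the lower Riesz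
  inequality is available; the constant carries over unchanged.\<close>

lemma riesz_basis_lower_frame:
  assumes R: "riesz_bounds A B \<Lambda>" and C: "exp_complete S \<Lambda>"
  shows "lower_frame A \<Lambda>"
  unfolding lower_frame_def
proof (intro conjI ballI)
  show A0: "0 < A" using R by (simp add: riesz_bounds_def)
  fix f assume f: "f \<in> V"
  note Bs = riesz_bounds_bessel[OF R]
  show "A * sq.nsq M f \<le> (\<Sum>\<^sub>\<infinity>l\<in>\<Lambda>. (cmod (ft f l))\<^sup>2)"
  proof (rule lower_bound_by_approximation[OF f A0])
    show "0 \<le> (\<Sum>\<^sub>\<infinity>l\<in>\<Lambda>. (cmod (ft f l))\<^sup>2)" by (intro infsum_nonneg) simp
    fix e :: real assume e: "e > 0"
    obtain F c where F: "finite F" "F \<subseteq> \<Lambda>" "sq.nm M (\<lambda>t. f t - (\<Sum>l\<in>F. c l * expo l t)) < e"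
      using exp_completeD[OF C f e] by blast
    note F(3)
    moreover have "(\<Sum>l\<in>F. (cmod (ft f l))\<^sup>2) \<le> (\<Sum>\<^sub>\<infinity>l\<in>\<Lambda>. (cmod (ft f l))\<^sup>2)"
      by (rule finite_sum_le_infsum[OF bessel_summable(1)[OF Bs f] F(1,2)]) simp
    ultimately show "\<exists>F c. sq.nm M (\<lambda>t. f t - (\<Sum>l\<in>F. c l * expo l t)) < e \<and>
      A * (\<Sum>l\<in>F. (cmod (c l))\<^sup>2) \<le> sq.nsq M (\<lambda>t. \<Sum>l\<in>F. c l * expo l t) \<and>
      (\<Sum>l\<in>F. (cmod (ft f l))\<^sup>2) \<le> (\<Sum>\<^sub>\<infinity>l\<in>\<Lambda>. (cmod (ft f l))\<^sup>2)"
      by (intro exI[of _ F] exI[of _ c] conjI riesz_boundsD(1)[OF R F(1,2)])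
  qed
qed


section \<open>Bounds in the limit\<close>

text \<open>A common shift of frequencies is multiplication by a unimodular function.\<close>

lemma nsq_sum_translate:
  "sq.nsq M (\<lambda>t. \<Sum>i\<in>I. c i * expo (u i - z) t) = sq.nsq M (\<lambda>t. \<Sum>i\<in>I. c i * expo (u i) t)"
proof -
  have "(\<Sum>i\<in>I. c i * expo (u i - z) t) = (\<Sum>i\<in>I. c i * expo (u i) t) * expo (- z) t" for t
    by (simp add: sum_distrib_right expo_add[of _ "- z", symmetric] mult.assoc)
  then show ?thesis by (simp add: nsq_modulate)
qed

lemma bessel_translate:
  assumes B: "bessel B \<Lambda>"
  shows "bessel B ((\<lambda>l. l - z) ` \<Lambda>)"
  unfolding bessel_def
proof (intro conjI allI impI)
  show "0 \<le> B" using B by (simp add: bessel_def)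
  fix F f assume "finite F \<and> F \<subseteq> (\<lambda>l. l - z) ` \<Lambda> \<and> f \<in> V"
  then have F: "finite F" "F \<subseteq> (\<lambda>l. l - z) ` \<Lambda>" and f: "f \<in> V" by auto
  define G where "G = (\<lambda>l. l + z) ` F"
  have G: "finite G" "G \<subseteq> \<Lambda>" using F by (auto simp: G_def)
  have "(\<Sum>l\<in>F. (cmod (ft f l))\<^sup>2) = (\<Sum>l\<in>G. (cmod (ft f (l - z)))\<^sup>2)"
    unfolding G_def by (subst sum.reindex) (auto simp: inj_on_def)
  then show "(\<Sum>l\<in>F. (cmod (ft f l))\<^sup>2) \<le> B * sq.nsq M f" using bessel_modulate[OF B G f, of z] by simp
qed

text \<open>The coefficients are indexed by a fixed set \<open>I\<close> while the frequencies
  \<open>u i\<close> may vary; in this form the inequality can be passed to a limit along moving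
  frequencies.\<close>

lemma riesz_bounds_inj:
  assumes R: "riesz_bounds A B \<Lambda>" and I: "finite I" "inj_on u I" "u ` I \<subseteq> \<Lambda>"
  shows "A * (\<Sum>i\<in>I. (cmod (c i))\<^sup>2) \<le> sq.nsq M (\<lambda>t. \<Sum>i\<in>I. c i * expo (u i) t)"
proof -
  define d where "d l = c (the_inv_into I u l)" for l
  have d: "d (u i) = c i" if "i \<in> I" for i using I(2) that by (simp add: d_def the_inv_into_f_f)
  have "(\<Sum>l\<in>u ` I. (cmod (d l))\<^sup>2) = (\<Sum>i\<in>I. (cmod (c i))\<^sup>2)"
    using I(2) d by (simp add: sum.reindex)
  moreover have "(\<Sum>l\<in>u ` I. d l * expo l t) = (\<Sum>i\<in>I. c i * expo (u i) t)" for t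
    using I(2) d by (simp add: sum.reindex)
  ultimately show ?thesis using riesz_boundsD(1)[OF R finite_imageI[OF I(1)] I(3), of d] by simp
qed

text \<open>The Gram matrix depends on the frequencies only through the continuous function
  \<open>ft (\<lambda>_. 1)\<close> at their differences.\<close>

lemma nsq_sum_tendsto:
  assumes "\<And>i. i \<in> I \<Longrightarrow> l i \<longlonglongrightarrow> u i"
  shows "(\<lambda>n. sq.nsq M (\<lambda>t. \<Sum>i\<in>I. c i * expo (l i n) t)) \<longlonglongrightarrow> sq.nsq M (\<lambda>t. \<Sum>i\<in>I. c i * expo (u i) t)"
proof -
  have eq: "sq.nsq M (\<lambda>t. \<Sum>i\<in>I. c i * expo (v i) t) = Re (\<Sum>i\<in>I. \<Sum>j\<in>I. c i * cnj (c j) * ft (\<lambda>_. 1) (v j - v i))" for v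
  proof -
    have "complex_of_real (sq.nsq M (\<lambda>t. \<Sum>i\<in>I. c i * expo (v i) t))
       = (\<Sum>i\<in>I. \<Sum>j\<in>I. c i * cnj (c j) * sq_ip M (expo (v i)) (expo (v j)))"
      by (rule sq.nsq_sum) (rule expo_mem)
    also have "\<dots> = (\<Sum>i\<in>I. \<Sum>j\<in>I. c i * cnj (c j) * ft (\<lambda>_. 1) (v j - v i))"
      by (simp add: ft_def[symmetric] ft_expo)
    finally show ?thesis by (metis Re_complex_of_real)
  qed
  have cont: "isCont (ft (\<lambda>_. 1)) x" for x
    using continuous_on_ft[OF one_mem, of UNIV] by (simp add: continuous_on_eq_continuous_at)
  show ?thesis unfolding eq
    by (intro tendsto_intros isCont_tendsto_compose[OF cont] assms)
qed

lemma weak_bessel: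
  assumes W: "weakly_converges L \<Gamma>" and B: "\<And>n. bessel B (L n)"
  shows "bessel B \<Gamma>"
  unfolding bessel_def
proof (intro conjI allI impI)
  show "0 \<le> B" using B by (simp add: bessel_def)
  fix G f assume "finite G \<and> G \<subseteq> \<Gamma> \<and> f \<in> V"
  then have G: "finite G" "G \<subseteq> \<Gamma>" and f: "f \<in> V" by auto
  obtain l where l: "\<forall>\<gamma>\<in>G. \<forall>n. l \<gamma> n \<in> L n" "\<forall>\<gamma>\<in>G. l \<gamma> \<longlonglongrightarrow> \<gamma>" using weak_lift[OF W G(2)] by blast
  have cont: "isCont (ft f) x" for x
    using continuous_on_ft[OF f, of UNIV] by (simp add: continuous_on_eq_continuous_at)
  have lim: "(\<lambda>n. \<Sum>\<gamma>\<in>G. (cmod (ft f (l \<gamma> n)))\<^sup>2) \<longlonglongrightarrow> (\<Sum>\<gamma>\<in>G. (cmod (ft f \<gamma>))\<^sup>2)"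
    using l(2) by (intro tendsto_intros isCont_tendsto_compose[OF cont]) auto
  have "\<forall>\<^sub>F n in sequentially. inj_on (\<lambda>\<gamma>. l \<gamma> n) G" using l(2) G(1) by (intro weak_lift_inj) auto
  then have "\<forall>\<^sub>F n in sequentially. (\<Sum>\<gamma>\<in>G. (cmod (ft f (l \<gamma> n)))\<^sup>2) \<le> B * sq.nsq M f"
  proof eventually_elim
    case (elim n)
    have "(\<Sum>x\<in>(\<lambda>\<gamma>. l \<gamma> n) ` G. (cmod (ft f x))\<^sup>2) \<le> B * sq.nsq M f"
      by (rule besselD[OF B[of n] _ _ f]) (use l(1) G(1) in auto)
    then show ?case using elim by (simp add: sum.reindex)
  qed
  then show "(\<Sum>\<gamma>\<in>G. (cmod (ft f \<gamma>))\<^sup>2) \<le> B * sq.nsq M f"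
    by (rule tendsto_upperbound[OF lim]) simp
qed

text \<open>Each point in the ball is moved to a nearby point of \<open>\<Gamma>\<close>.
  Injectivity keeps the moved sum below the full sum over \<open>\<Gamma>\<close>, and the change is
  at most the modulus of continuity times a number of points that is bounded independently of
  \<open>n\<close>.\<close>

lemma weak_head_sum:
  assumes W: "weakly_converges L \<Gamma>" and L: "\<And>n. sep d (L n)" and B: "\<And>n. bessel B (L n)"
    and f: "f \<in> V" and e: "\<eta> > 0"
  shows "\<forall>\<^sub>F n in sequentially. (\<Sum>l\<in>L n \<inter> cball 0 R. (cmod (ft f l))\<^sup>2) \<le> (\<Sum>\<^sub>\<infinity>\<gamma>\<in>\<Gamma>. (cmod (ft f \<gamma>))\<^sup>2) + \<eta>"
proof -
  have d: "d > 0" using L by (simp add: sep_def)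
  define N where "N = real (card (\<Gamma> \<inter> ball 0 (R + 1)))"
  have N0: "N \<ge> 0" by (simp add: N_def)
  have "uniformly_continuous_on (cball 0 (R + 1)) (\<lambda>x. (cmod (ft f x))\<^sup>2)"
    by (intro compact_uniformly_continuous continuous_intros continuous_on_ft[OF f] compact_cball)
  moreover have "\<eta> / (N + 1) > 0" using e N0 by simp
  ultimately obtain d' where d': "d' > 0" "\<And>x y. x \<in> cball 0 (R + 1) \<Longrightarrow> y \<in> cball 0 (R + 1) \<Longrightarrow> dist y x < d' \<Longrightarrow>
      dist ((cmod (ft f y))\<^sup>2) ((cmod (ft f x))\<^sup>2) < \<eta> / (N + 1)"
    unfolding uniformly_continuous_on_def by metis
  have sm: "(\<lambda>\<gamma>. (cmod (ft f \<gamma>))\<^sup>2) summable_on \<Gamma>"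
    by (rule bessel_summable(1)[OF weak_bessel[OF W B] f])
  have "min d' (min 1 (d/2)) > 0" using d d' by simp
  from weak_matching[OF W this, of R] weak_card_le[OF W L, of R] show ?thesis
  proof eventually_elim
    case (elim n)
    then obtain g where g: "\<And>l. l \<in> L n \<inter> cball 0 R \<Longrightarrow> g l \<in> \<Gamma> \<and> dist l (g l) < min d' (min 1 (d/2))" by metis
    have inj: "inj_on g (L n \<inter> cball 0 R)"
    proof (rule inj_onI)
      fix x y assume xy: "x \<in> L n \<inter> cball 0 R" "y \<in> L n \<inter> cball 0 R" "g x = g y"
      have "dist x y \<le> dist x (g x) + dist y (g x)" by (rule dist_triangle2)
      then have "dist x y < d" using g[OF xy(1)] g[OF xy(2)] xy(3) by simp
      then show "x = y" using sepD[OF L] xy by blast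
    qed
    have fin: "finite (L n \<inter> cball 0 R)" by (rule sep_finite[OF L bounded_cball])
    have "(\<Sum>l\<in>L n \<inter> cball 0 R. (cmod (ft f l))\<^sup>2) \<le> (\<Sum>l\<in>L n \<inter> cball 0 R. (cmod (ft f (g l)))\<^sup>2 + \<eta> / (N + 1))"
    proof (rule sum_mono)
      fix l assume l: "l \<in> L n \<inter> cball 0 R"
      have "dist 0 (g l) \<le> dist 0 l + dist l (g l)" by (rule dist_triangle)
      then have "g l \<in> cball 0 (R + 1)" "l \<in> cball 0 (R + 1)" using g[OF l] l by auto
      from d'(2)[OF this] g[OF l]
      show "(cmod (ft f l))\<^sup>2 \<le> (cmod (ft f (g l)))\<^sup>2 + \<eta> / (N + 1)" by (simp add: dist_real_def)
    qed
    also have "\<dots> = (\<Sum>x\<in>g ` (L n \<inter> cball 0 R). (cmod (ft f x))\<^sup>2) + real (card (L n \<inter> cball 0 R)) * (\<eta> / (N + 1))"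
      using inj by (simp add: sum.distrib sum.reindex)
    also have "\<dots> \<le> (\<Sum>\<^sub>\<infinity>\<gamma>\<in>\<Gamma>. (cmod (ft f \<gamma>))\<^sup>2) + \<eta>"
    proof (rule add_mono)
      show "(\<Sum>x\<in>g ` (L n \<inter> cball 0 R). (cmod (ft f x))\<^sup>2) \<le> (\<Sum>\<^sub>\<infinity>\<gamma>\<in>\<Gamma>. (cmod (ft f \<gamma>))\<^sup>2)"
        by (rule finite_sum_le_infsum[OF sm]) (use fin g in auto)
      have "real (card (L n \<inter> cball 0 R)) * (\<eta> / (N + 1)) \<le> N * (\<eta> / (N + 1))"
        using elim(2) e N0 by (intro mult_right_mono) (auto simp: N_def)
      also have "\<dots> \<le> \<eta>" using e N0 by (simp add: field_simps)
      finally show "real (card (L n \<inter> cball 0 R)) * (\<eta> / (N + 1)) \<le> \<eta>" .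
    qed
    finally show ?case .
  qed
qed

text \<open>The uniform tail estimate prevents mass from escaping to infinity.\<close>

lemma weak_sum_le:
  assumes L: "sep d \<Lambda>" and B: "bessel B \<Lambda>" and W: "weakly_converges (\<lambda>n. (\<lambda>l. l - z n) ` \<Lambda>) \<Gamma>"
    and f: "f \<in> V" and e: "\<eta> > 0"
  shows "\<forall>\<^sub>F n in sequentially. \<forall>F. finite F \<and> F \<subseteq> (\<lambda>l. l - z n) ` \<Lambda> \<longrightarrow>
    (\<Sum>l\<in>F. (cmod (ft f l))\<^sup>2) \<le> (\<Sum>\<^sub>\<infinity>\<gamma>\<in>\<Gamma>. (cmod (ft f \<gamma>))\<^sup>2) + \<eta>"
proof -
  have e2: "\<eta> / 2 > 0" using e by simp
  obtain R where R: "tail_radius \<Lambda> f (\<eta> / 2) R" using bessel_tail[OF L B f e2] by blast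
  from weak_head_sum[OF W sep_translate[OF L] bessel_translate[OF B] f e2, of R]
  show ?thesis
  proof eventually_elim
    case (elim n)
    show ?case
    proof (intro allI impI)
      fix F assume F: "finite F \<and> F \<subseteq> (\<lambda>l. l - z n) ` \<Lambda>"
      define F' where "F' = (\<lambda>l. l + z n) ` (F - cball 0 R)"
      have "(\<Sum>l\<in>F - cball 0 R. (cmod (ft f l))\<^sup>2) = (\<Sum>l\<in>F'. (cmod (ft f (l - z n)))\<^sup>2)"
        unfolding F'_def by (subst sum.reindex) (auto simp: inj_on_def)
      also have "\<dots> \<le> \<eta> / 2"
      proof (rule tail_radiusD[OF R])
        show "finite F'" "F' \<subseteq> \<Lambda>" using F by (auto simp: F'_def)
        fix l assume "l \<in> F'"
        then show "R \<le> dist l (z n)" by (auto simp: F'_def dist_norm)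
      qed
      finally have 1: "(\<Sum>l\<in>F - cball 0 R. (cmod (ft f l))\<^sup>2) \<le> \<eta> / 2" .
      have "(\<Sum>l\<in>F \<inter> cball 0 R. (cmod (ft f l))\<^sup>2) \<le> (\<Sum>l\<in>(\<lambda>l. l - z n) ` \<Lambda> \<inter> cball 0 R. (cmod (ft f l))\<^sup>2)"
        by (rule sum_mono2[OF sep_finite[OF sep_translate[OF L] bounded_cball]]) (use F in auto)
      then have 2: "(\<Sum>l\<in>F \<inter> cball 0 R. (cmod (ft f l))\<^sup>2) \<le> (\<Sum>\<^sub>\<infinity>\<gamma>\<in>\<Gamma>. (cmod (ft f \<gamma>))\<^sup>2) + \<eta> / 2"
        using elim by simp
      have "(\<Sum>l\<in>F. (cmod (ft f l))\<^sup>2) = (\<Sum>l\<in>F \<inter> cball 0 R. (cmod (ft f l))\<^sup>2) + (\<Sum>l\<in>F - cball 0 R. (cmod (ft f l))\<^sup>2)"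
        using F sum.Int_Diff by blast
      then show "(\<Sum>l\<in>F. (cmod (ft f l))\<^sup>2) \<le> (\<Sum>\<^sub>\<infinity>\<gamma>\<in>\<Gamma>. (cmod (ft f \<gamma>))\<^sup>2) + \<eta>" using 1 2 by simp
    qed
  qed
qed

text \<open>The frame inequality of \<open>\<Lambda>\<close> is applied to a modulated function
  whose samples on \<open>\<Lambda>\<close> are those of \<open>f\<close> on the translate; by
  \<open>weak_sum_le\<close> these sums cannot exceed the sum over \<open>\<Gamma>\<close> by
  much.\<close>

lemma weak_lower_frame:
  assumes L: "sep d \<Lambda>" and B: "bessel B \<Lambda>" and A: "lower_frame A \<Lambda>"
    and W: "weakly_converges (\<lambda>n. (\<lambda>l. l - z n) ` \<Lambda>) \<Gamma>"
  shows "lower_frame A \<Gamma>"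
  unfolding lower_frame_def
proof (intro conjI ballI)
  show "0 < A" using A by (simp add: lower_frame_def)
  fix f assume f: "f \<in> V"
  show "A * sq.nsq M f \<le> (\<Sum>\<^sub>\<infinity>\<gamma>\<in>\<Gamma>. (cmod (ft f \<gamma>))\<^sup>2)"
  proof (rule field_le_epsilon)
    fix \<eta> :: real assume e: "\<eta> > 0"
    then have e2: "\<eta> / 2 > 0" by simp
    obtain n where n: "\<forall>F. finite F \<and> F \<subseteq> (\<lambda>l. l - z n) ` \<Lambda> \<longrightarrow>
      (\<Sum>l\<in>F. (cmod (ft f l))\<^sup>2) \<le> (\<Sum>\<^sub>\<infinity>\<gamma>\<in>\<Gamma>. (cmod (ft f \<gamma>))\<^sup>2) + \<eta> / 2"
      using eventually_happens'[OF sequentially_bot weak_sum_le[OF L B W f e2]] by blast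
    define g where "g = (\<lambda>t. f t * expo (z n) t)"
    have gV: "g \<in> V" unfolding g_def by (rule modulate_mem[OF f])
    have ftg: "ft g l = ft f (l - z n)" for l unfolding g_def by (rule ft_modulate)
    have "A * sq.nsq M f = A * sq.nsq M g" by (simp add: g_def nsq_modulate)
    also have "\<dots> \<le> (\<Sum>\<^sub>\<infinity>l\<in>\<Lambda>. (cmod (ft g l))\<^sup>2)" using A gV by (simp add: lower_frame_def)
    also have "\<dots> \<le> (\<Sum>\<^sub>\<infinity>\<gamma>\<in>\<Gamma>. (cmod (ft f \<gamma>))\<^sup>2) + \<eta> / 2"
    proof (rule infsum_le_finite_sums[OF bessel_summable(1)[OF B gV]])
      fix F assume F: "finite F" "F \<subseteq> \<Lambda>"
      have "(\<Sum>l\<in>F. (cmod (ft g l))\<^sup>2) = (\<Sum>l\<in>(\<lambda>l. l - z n) ` F. (cmod (ft f l))\<^sup>2)"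
        by (subst sum.reindex) (auto simp: inj_on_def ftg)
      then show "(\<Sum>l\<in>F. (cmod (ft g l))\<^sup>2) \<le> (\<Sum>\<^sub>\<infinity>\<gamma>\<in>\<Gamma>. (cmod (ft f \<gamma>))\<^sup>2) + \<eta> / 2"
        using n[rule_format, OF conjI[OF finite_imageI[OF F(1)] image_mono[OF F(2)]]] by (simp only:)
    qed
    finally show "A * sq.nsq M f \<le> (\<Sum>\<^sub>\<infinity>\<gamma>\<in>\<Gamma>. (cmod (ft f \<gamma>))\<^sup>2) + \<eta>" using e by simp
  qed
qed

text \<open>A finite combination over \<open>\<Gamma>\<close> is a limit of combinations over the
  translates with the same coefficients, so the lower bound persists; the upper bound passes through
  the Bessel inequality.\<close>

lemma weak_riesz_bounds:
  assumes R: "riesz_bounds A B \<Lambda>" and W: "weakly_converges (\<lambda>n. (\<lambda>l. l - z n) ` \<Lambda>) \<Gamma>"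
  shows "riesz_bounds A B \<Gamma>"
  unfolding riesz_bounds_def
proof (intro conjI allI impI)
  show "0 < A" "0 \<le> B" using R by (auto simp: riesz_bounds_def)
  fix G c assume "finite G \<and> G \<subseteq> \<Gamma>"
  then have G: "finite G" "G \<subseteq> \<Gamma>" by auto
  obtain l where l: "\<forall>\<gamma>\<in>G. \<forall>n. l \<gamma> n \<in> (\<lambda>l. l - z n) ` \<Lambda>" "\<forall>\<gamma>\<in>G. l \<gamma> \<longlonglongrightarrow> \<gamma>" using weak_lift[OF W G(2)] by blast
  have lim: "(\<lambda>n. sq.nsq M (\<lambda>t. \<Sum>\<gamma>\<in>G. c \<gamma> * expo (l \<gamma> n) t)) \<longlonglongrightarrow> sq.nsq M (\<lambda>t. \<Sum>\<gamma>\<in>G. c \<gamma> * expo \<gamma> t)"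
    by (rule nsq_sum_tendsto) (use l(2) in auto)
  have "\<forall>\<^sub>F n in sequentially. inj_on (\<lambda>\<gamma>. l \<gamma> n) G" using l(2) G(1) by (intro weak_lift_inj) auto
  then have ev: "\<forall>\<^sub>F n in sequentially. A * (\<Sum>\<gamma>\<in>G. (cmod (c \<gamma>))\<^sup>2) \<le> sq.nsq M (\<lambda>t. \<Sum>\<gamma>\<in>G. c \<gamma> * expo (l \<gamma> n) t)"
  proof eventually_elim
    case (elim n)
    have "A * (\<Sum>\<gamma>\<in>G. (cmod (c \<gamma>))\<^sup>2) \<le> sq.nsq M (\<lambda>t. \<Sum>\<gamma>\<in>G. c \<gamma> * expo (l \<gamma> n + z n) t)"
    proof (rule riesz_bounds_inj[OF R G(1)])
      show "inj_on (\<lambda>\<gamma>. l \<gamma> n + z n) G" using elim by (auto simp: inj_on_def)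
      show "(\<lambda>\<gamma>. l \<gamma> n + z n) ` G \<subseteq> \<Lambda>"
      proof (rule image_subsetI)
        fix \<gamma> assume "\<gamma> \<in> G"
        then have "l \<gamma> n \<in> (\<lambda>l. l - z n) ` \<Lambda>" using l(1) by blast
        then show "l \<gamma> n + z n \<in> \<Lambda>" by (auto simp: diff_add_cancel)
      qed
    qed
    then show ?case using nsq_sum_translate[where I=G and c=c and u="\<lambda>\<gamma>. l \<gamma> n + z n" and z="z n"] by simp
  qed
  show "A * (\<Sum>\<gamma>\<in>G. (cmod (c \<gamma>))\<^sup>2) \<le> sq.nsq M (\<lambda>t. \<Sum>\<gamma>\<in>G. c \<gamma> * expo \<gamma> t)"
    by (rule tendsto_lowerbound[OF lim ev]) simp
  show "sq.nsq M (\<lambda>t. \<Sum>\<gamma>\<in>G. c \<gamma> * expo \<gamma> t) \<le> B * (\<Sum>\<gamma>\<in>G. (cmod (c \<gamma>))\<^sup>2)"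
    by (rule bessel_upper_bound[OF weak_bessel[OF W bessel_translate[OF riesz_bounds_bessel[OF R]]] G])
qed

end

section \<open>Beurling densities\<close>

lemma density_ratio:
  fixes \<Lambda> :: "'a::euclidean_space set"
  assumes L: "sep d \<Lambda>" and r: "r > 0"
  shows "emeasure (count_space UNIV) (\<Lambda> \<inter> ball x r) / emeasure lebesgue (ball (0::'a) r)
    = ennreal (real (card (\<Lambda> \<inter> ball x r)) / vol TYPE('a) r)"
proof -
  have "emeasure (count_space UNIV) (\<Lambda> \<inter> ball x r) = ennreal (real (card (\<Lambda> \<inter> ball x r)))"
    using sep_finite[OF L bounded_ball, of x r] by (simp add: emeasure_count_space_finite ennreal_of_nat_eq_real_of_nat)
  moreover have "emeasure lebesgue (ball (0::'a) r) = ennreal (vol TYPE('a) r)"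
    unfolding vol_def by (rule emeasure_eq_measure2) simp
  ultimately show ?thesis using vol_pos[OF r, where 'a='a] by (simp add: divide_ennreal)
qed

lemma lower_density_ge:
  fixes \<Lambda> :: "'a::euclidean_space set"
  assumes L: "sep d \<Lambda>"
    and ev: "\<forall>\<^sub>F r in at_top. \<forall>y. m * vol TYPE('a) r \<le> real (card (\<Lambda> \<inter> ball y r))"
  shows "ennreal m \<le> lower_density \<Lambda>"
  unfolding lower_density_def
proof (rule Liminf_bounded)
  show "\<forall>\<^sub>F r in at_top. ennreal m \<le> (INF x. emeasure (count_space UNIV) (\<Lambda> \<inter> ball x r) / emeasure lebesgue (ball (0::'a) r))"
    using ev eventually_gt_at_top[of 0]
  proof eventually_elim
    case (elim r)
    show ?case unfolding density_ratio[OF L elim(2)]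
    proof (rule INF_greatest, rule ennreal_leI)
      fix x
      have "vol TYPE('a) r > 0" by (rule vol_pos[OF elim(2)])
      then show "m \<le> real (card (\<Lambda> \<inter> ball x r)) / vol TYPE('a) r" using elim(1) by (simp add: le_divide_eq)
    qed
  qed
qed

lemma lower_density_le:
  fixes \<Lambda> :: "'a::euclidean_space set"
  assumes L: "sep d \<Lambda>"
    and ev: "\<forall>\<^sub>F r in at_top. \<exists>y. real (card (\<Lambda> \<inter> ball y r)) \<le> m * vol TYPE('a) r"
  shows "lower_density \<Lambda> \<le> ennreal m"
  unfolding lower_density_def
proof (rule Liminf_le)
  show "\<forall>\<^sub>F r in at_top. (INF x. emeasure (count_space UNIV) (\<Lambda> \<inter> ball x r) / emeasure lebesgue (ball (0::'a) r)) \<le> ennreal m"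
    using ev eventually_gt_at_top[of 0]
  proof eventually_elim
    case (elim r)
    then obtain y where y: "real (card (\<Lambda> \<inter> ball y r)) \<le> m * vol TYPE('a) r" by blast
    have "vol TYPE('a) r > 0" by (rule vol_pos[OF elim(2)])
    then have "ennreal (real (card (\<Lambda> \<inter> ball y r)) / vol TYPE('a) r) \<le> ennreal m"
      using y by (intro ennreal_leI) (simp add: divide_le_eq)
    then show ?case unfolding density_ratio[OF L elim(2)] by (rule INF_lower2[OF UNIV_I])
  qed
qed simp

lemma upper_density_le:
  fixes \<Lambda> :: "'a::euclidean_space set"
  assumes L: "sep d \<Lambda>"
    and ev: "\<forall>\<^sub>F r in at_top. \<forall>y. real (card (\<Lambda> \<inter> ball y r)) \<le> m * vol TYPE('a) r"
  shows "upper_density \<Lambda> \<le> ennreal m"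
  unfolding upper_density_def
proof (rule Limsup_bounded)
  show "\<forall>\<^sub>F r in at_top. (SUP x. emeasure (count_space UNIV) (\<Lambda> \<inter> ball x r) / emeasure lebesgue (ball (0::'a) r)) \<le> ennreal m"
    using ev eventually_gt_at_top[of 0]
  proof eventually_elim
    case (elim r)
    show ?case unfolding density_ratio[OF L elim(2)]
    proof (rule SUP_least, rule ennreal_leI)
      fix x
      have "vol TYPE('a) r > 0" by (rule vol_pos[OF elim(2)])
      then show "real (card (\<Lambda> \<inter> ball x r)) / vol TYPE('a) r \<le> m" using elim(1) by (simp add: divide_le_eq)
    qed
  qed
qed

lemma upper_density_ge:
  fixes \<Lambda> :: "'a::euclidean_space set"
  assumes L: "sep d \<Lambda>"
    and ev: "\<forall>\<^sub>F r in at_top. \<exists>y. m * vol TYPE('a) r \<le> real (card (\<Lambda> \<inter> ball y r))"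
  shows "ennreal m \<le> upper_density \<Lambda>"
  unfolding upper_density_def
proof (rule le_Limsup)
  show "\<forall>\<^sub>F r in at_top. ennreal m \<le> (SUP x. emeasure (count_space UNIV) (\<Lambda> \<inter> ball x r) / emeasure lebesgue (ball (0::'a) r))"
    using ev eventually_gt_at_top[of 0]
  proof eventually_elim
    case (elim r)
    then obtain y where y: "m * vol TYPE('a) r \<le> real (card (\<Lambda> \<inter> ball y r))" by blast
    have "vol TYPE('a) r > 0" by (rule vol_pos[OF elim(2)])
    then have "ennreal m \<le> ennreal (real (card (\<Lambda> \<inter> ball y r)) / vol TYPE('a) r)"
      using y by (intro ennreal_leI) (simp add: le_divide_eq)
    then show ?case unfolding density_ratio[OF L elim(2)] by (rule SUP_upper2[OF UNIV_I])
  qed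
qed simp

text \<open>If all large balls were more crowded than this, the lower density would exceed
  \<open>m\<close>.\<close>

lemma lower_density_eqD:
  fixes \<Lambda> :: "'a::euclidean_space set"
  assumes L: "sep d \<Lambda>" and eq: "lower_density \<Lambda> = ennreal m" and m: "m \<ge> 0" and e: "\<epsilon> > 0"
  shows "\<exists>r\<ge>r0. \<exists>y. real (card (\<Lambda> \<inter> ball y r)) \<le> (m + \<epsilon>) * vol TYPE('a) r"
proof (rule ccontr)
  assume "\<not> ?thesis"
  then have n: "\<And>r y. r \<ge> r0 \<Longrightarrow> (m + \<epsilon>) * vol TYPE('a) r \<le> real (card (\<Lambda> \<inter> ball y r))"
    by (meson less_imp_le not_le)
  have "ennreal (m + \<epsilon>) \<le> lower_density \<Lambda>"
    by (rule lower_density_ge[OF L], unfold eventually_at_top_linorder, intro exI[of _ r0])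
      (simp add: n)
  then show False using eq m e by (simp add: ennreal_le_iff)
qed

lemma upper_density_eqD:
  fixes \<Lambda> :: "'a::euclidean_space set"
  assumes L: "sep d \<Lambda>" and eq: "upper_density \<Lambda> = ennreal m" and m: "m \<ge> 0" and e: "\<epsilon> > 0"
  shows "\<exists>r\<ge>r0. \<exists>y. (m - \<epsilon>) * vol TYPE('a) r \<le> real (card (\<Lambda> \<inter> ball y r))"
proof (rule ccontr)
  assume "\<not> ?thesis"
  then have n: "\<And>r y. r \<ge> r0 \<Longrightarrow> real (card (\<Lambda> \<inter> ball y r)) < (m - \<epsilon>) * vol TYPE('a) r"
    by (meson not_le)
  \<comment> \<open>A negative \<open>m - \<epsilon>\<close> would be sent to 0 by
    \<open>ennreal\<close>, and for \<open>m = 0\<close> the contradiction would be lost. It is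
    excluded because a count of points, which is nonnegative, lies strictly below
    \<open>(m - \<epsilon>) * vol TYPE('a) r0\<close>.\<close>
  have "0 < (m - \<epsilon>) * vol TYPE('a) r0" using n[of r0 0] by (simp add: le_less_trans[OF of_nat_0_le_iff])
  then have me: "m - \<epsilon> > 0" using vol_nonneg[of r0, where 'a='a] by (simp add: zero_less_mult_iff)
  have "upper_density \<Lambda> \<le> ennreal (m - \<epsilon>)"
    by (rule upper_density_le[OF L], unfold eventually_at_top_linorder, intro exI[of _ r0])
      (simp add: less_imp_le n)
  then show False using eq m e me by (simp add: ennreal_le_iff)
qed

lemma vol_shift_eventually:
  assumes "m < (m' :: real)" "0 \<le> m"
  shows "\<forall>\<^sub>F r in at_top. m * vol TYPE('a::euclidean_space) (r + c) \<le> m' * vol TYPE('a) r"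
proof -
  have "((\<lambda>r. m * (vol TYPE('a) (r + c) / vol TYPE('a) r)) \<longlongrightarrow> m * 1) at_top"
    by (intro tendsto_intros vol_ratio)
  then have "\<forall>\<^sub>F r in at_top. m * (vol TYPE('a) (r + c) / vol TYPE('a) r) < m'"
    using assms by (intro order_tendstoD(2)) auto
  with eventually_gt_at_top[of 0] show ?thesis
  proof eventually_elim
    case (elim r)
    have "vol TYPE('a) r > 0" by (rule vol_pos[OF elim(1)])
    then show ?case using elim(2) by (simp add: divide_less_eq less_imp_le)
  qed
qed

text \<open>The average of \<open>\<Phi>\<close> over the ball is at most \<open>\<kappa>\<close>
  divided by the volume, so \<open>\<Phi>\<close> cannot exceed twice this value everywhere.\<close>

lemma exists_small_value:
  fixes \<Phi> :: "'a::euclidean_space \<Rightarrow> ennreal"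
  assumes [measurable]: "\<Phi> \<in> borel_measurable borel" and s: "s > 0" and k: "\<kappa> > 0"
    and le: "(\<integral>\<^sup>+z. \<Phi> z * indicator (ball y s) z \<partial>lborel) \<le> ennreal \<kappa>"
  shows "\<exists>z\<in>ball y s. \<Phi> z \<le> ennreal (2 * \<kappa> / vol TYPE('a) s)"
proof (rule ccontr)
  have v: "vol TYPE('a) s > 0" by (rule vol_pos[OF s])
  have eb: "emeasure lborel (ball y s) = ennreal (vol TYPE('a) s)"
    using emeasure_eq_measure2[of "ball y s" lebesgue] vol_ball[of y s] by simp
  assume "\<not> ?thesis"
  then have "\<And>z. z \<in> ball y s \<Longrightarrow> ennreal (2 * \<kappa> / vol TYPE('a) s) \<le> \<Phi> z"
    by (meson less_imp_le not_le)
  then have "(\<integral>\<^sup>+z. ennreal (2 * \<kappa> / vol TYPE('a) s) * indicator (ball y s) z \<partial>lborel) \<le> ennreal \<kappa>"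
    by (intro order_trans[OF _ le] nn_integral_mono) (auto simp: indicator_def)
  then have "ennreal (2 * \<kappa> / vol TYPE('a) s) * ennreal (vol TYPE('a) s) \<le> ennreal \<kappa>"
    by (simp add: nn_integral_cmult_indicator eb)
  then have "ennreal (2 * \<kappa>) \<le> ennreal \<kappa>" using v k by (simp flip: ennreal_mult)
  then show False using k by (simp add: ennreal_le_iff)
qed

section \<open>Density bounds and averaging over centres\<close>

context fin_region
begin

text \<open>Each score is at most 1, so the number of points dominates the sum of the
  scores.\<close>

lemma frame_lower_density_ge:
  assumes L: "sep \<delta> \<Lambda>" and B: "bessel B \<Lambda>" and A: "lower_frame A \<Lambda>" and e: "\<epsilon> > 0"
  shows "\<forall>\<^sub>F r in at_top. \<forall>y. (mS - \<epsilon>) * vol TYPE('a) r \<le> real (card (\<Lambda> \<inter> ball y r))"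
proof -
  obtain r0 where r0: "\<forall>r\<ge>r0. \<forall>y. (mS - \<epsilon>) * vol TYPE('a) r \<le> (\<Sum>l\<in>\<Lambda> \<inter> ball y r. lev \<Lambda> l)"
    using lev_density[OF L B A e] by blast
  have "(mS - \<epsilon>) * vol TYPE('a) r \<le> real (card (\<Lambda> \<inter> ball y r))" if "r \<ge> r0" for r y
  proof -
    have "(\<Sum>l\<in>\<Lambda> \<inter> ball y r. lev \<Lambda> l) \<le> (\<Sum>l\<in>\<Lambda> \<inter> ball y r. 1)"
      by (intro sum_mono lev_bounds(2)[OF B A]) simp
    moreover have "(mS - \<epsilon>) * vol TYPE('a) r \<le> (\<Sum>l\<in>\<Lambda> \<inter> ball y r. lev \<Lambda> l)" using r0 that by blast
    ultimately show ?thesis by simp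
  qed
  then show ?thesis unfolding eventually_at_top_linorder by blast
qed

text \<open>The integral of the squared distances in \<open>riesz_density\<close> is
  nonnegative.\<close>

lemma riesz_upper_density_le:
  assumes L: "sep \<delta> \<Lambda>" and R: "riesz_bounds A B \<Lambda>" and e: "\<epsilon> > 0"
  shows "\<forall>\<^sub>F r in at_top. \<forall>y. real (card (\<Lambda> \<inter> ball y r)) \<le> (mS + \<epsilon>) * vol TYPE('a) r"
proof -
  obtain r0 where r0: "\<forall>r\<ge>r0. \<forall>y. \<exists>c D. D \<in> borel_measurable borel \<and>
    (\<forall>x. D x = sq.nsq M (\<lambda>t. expo x t - (\<Sum>m\<in>\<Lambda> \<inter> ball y r. c x m * expo m t))) \<and>
    integrable lborel (\<lambda>x. indicator (ball y r) x * D x) \<and>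
    (LINT x|lborel. indicator (ball y r) x * D x) \<le> (mS + \<epsilon>) * vol TYPE('a) r - real (card (\<Lambda> \<inter> ball y r))"
    using riesz_density[OF L R e] by blast
  have "real (card (\<Lambda> \<inter> ball y r)) \<le> (mS + \<epsilon>) * vol TYPE('a) r" if r: "r \<ge> r0" for r y
  proof -
    obtain c D where D: "\<forall>x. D x = sq.nsq M (\<lambda>t. expo x t - (\<Sum>m\<in>\<Lambda> \<inter> ball y r. c x m * expo m t))"
      "(LINT x|lborel. indicator (ball y r) x * D x) \<le> (mS + \<epsilon>) * vol TYPE('a) r - real (card (\<Lambda> \<inter> ball y r))"
      using r0[rule_format, OF r, of y] by (elim exE conjE) (rule that)
    have "D x \<ge> 0" for x
      unfolding D(1)[rule_format] by (intro sq.nsq_nonneg sq.diff_mem expo_mem sum_expo_mem)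
    then have "0 \<le> (LINT x|lborel. indicator (ball y r) x * D x)" by (intro integral_nonneg_AE) auto
    then show ?thesis using D(2) by simp
  qed
  then show ?thesis unfolding eventually_at_top_linorder by blast
qed

text \<open>At critical density there is a large ball whose point count exceeds its sum of scores by
  at most \<open>\<epsilon>\<close> times its volume. Averaging the defects over balls of radius
  \<open>R\<close> centred well inside it produces one such ball with small total defect.\<close>

lemma lev_defect_small:
  assumes L: "sep \<delta> \<Lambda>" and B: "bessel B \<Lambda>" and A: "lower_frame A \<Lambda>"
    and eq: "lower_density \<Lambda> = ennreal mS" and R: "R > 0" and e: "\<eta> > 0"
  shows "\<exists>z. (\<Sum>l\<in>\<Lambda> \<inter> ball z R. 1 - lev \<Lambda> l) \<le> \<eta>"
proof -
  have vR: "vol TYPE('a) R > 0" by (rule vol_pos[OF R])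
  \<comment> \<open>One factor 2 is lost in \<open>exists_small_value\<close>, another in comparing
    the volumes of the balls of radius \<open>r\<close> and \<open>s\<close>.\<close>
  define \<epsilon> where "\<epsilon> = \<eta> / (4 * vol TYPE('a) R)"
  have \<epsilon>: "\<epsilon> > 0" using e vR by (simp add: \<epsilon>_def)
  then have \<epsilon>2: "\<epsilon> / 2 > 0" by simp
  obtain r1 where r1: "\<forall>r\<ge>r1. \<forall>y. (mS - \<epsilon> / 2) * vol TYPE('a) r \<le> (\<Sum>l\<in>\<Lambda> \<inter> ball y r. lev \<Lambda> l)"
    using lev_density[OF L B A \<epsilon>2] by blast
  have "\<forall>\<^sub>F r in at_top. (1/2) * vol TYPE('a) (r + R) \<le> 1 * vol TYPE('a) r"
    by (rule vol_shift_eventually) auto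
  then obtain r2 where r2': "\<forall>r\<ge>r2. (1/2) * vol TYPE('a) (r + R) \<le> 1 * vol TYPE('a) r"
    unfolding eventually_at_top_linorder by blast
  have r2: "vol TYPE('a) (r + R) \<le> 2 * vol TYPE('a) r" if "r \<ge> r2" for r
    using r2'[rule_format, OF that] by simp
  obtain r y where r: "r \<ge> max r1 (max (r2 + R) (R + 1))" and y: "real (card (\<Lambda> \<inter> ball y r)) \<le> (mS + \<epsilon> / 2) * vol TYPE('a) r"
    using lower_density_eqD[OF L eq _ \<epsilon>2, of "max r1 (max (r2 + R) (R + 1))"] by auto
  \<comment> \<open>Balls of radius \<open>R\<close> centred in \<open>ball y s\<close> stay inside
    \<open>ball y r\<close>.\<close>
  define s where "s = r - R"
  have s: "s > 0" using r by (simp add: s_def)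
  define F where "F = \<Lambda> \<inter> ball y r"
  have fin: "finite F" unfolding F_def by (rule sep_finite[OF L bounded_ball])
  have w0: "0 \<le> 1 - lev \<Lambda> l" if "l \<in> \<Lambda>" for l using lev_bounds(2)[OF B A that] by simp
  have tot: "(\<Sum>l\<in>F. 1 - lev \<Lambda> l) \<le> \<epsilon> * vol TYPE('a) r"
  proof -
    have "(mS - \<epsilon> / 2) * vol TYPE('a) r \<le> (\<Sum>l\<in>F. lev \<Lambda> l)" using r1 r by (simp add: F_def)
    then show ?thesis using y unfolding F_def[symmetric] by (simp add: sum_subtractf algebra_simps)
  qed
  \<comment> \<open>The total defect within distance \<open>R\<close> of \<open>z\<close>; in this
    form its integral over all \<open>z\<close> counts each defect with weight
    \<open>vol TYPE('a) R\<close>.\<close>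
  define \<Phi> where "\<Phi> z = (\<Sum>l\<in>F. ennreal (1 - lev \<Lambda> l) * indicator (ball l R) z)" for z
  have [measurable]: "ball (x::'a) q \<in> sets borel" for x q by simp
  have m\<Phi>: "\<Phi> \<in> borel_measurable borel" unfolding \<Phi>_def by measurable
  define \<kappa> where "\<kappa> = \<epsilon> * vol TYPE('a) r * vol TYPE('a) R"
  have vr: "vol TYPE('a) r > 0" using r R by (intro vol_pos) simp
  have \<kappa>: "\<kappa> > 0" using \<epsilon> vR vr by (simp add: \<kappa>_def)
  have eb: "emeasure lborel (ball z R) = ennreal (vol TYPE('a) R)" for z :: 'a
    using emeasure_eq_measure2[of "ball z R" lebesgue] vol_ball[of z R] by simp
  have "(\<integral>\<^sup>+z. \<Phi> z * indicator (ball y s) z \<partial>lborel) \<le> (\<integral>\<^sup>+z. \<Phi> z \<partial>lborel)"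
    by (intro nn_integral_mono) (simp add: indicator_def)
  also have "\<dots> = (\<Sum>l\<in>F. ennreal (1 - lev \<Lambda> l) * ennreal (vol TYPE('a) R))"
    unfolding \<Phi>_def by (subst nn_integral_sum) (auto simp: nn_integral_cmult_indicator eb)
  also have "\<dots> = (\<Sum>l\<in>F. ennreal ((1 - lev \<Lambda> l) * vol TYPE('a) R))"
    by (intro sum.cong refl ennreal_mult[symmetric] w0) (auto simp: F_def)
  also have "\<dots> = ennreal (\<Sum>l\<in>F. (1 - lev \<Lambda> l) * vol TYPE('a) R)"
    by (intro sum_ennreal mult_nonneg_nonneg w0) (auto simp: F_def)
  also have "\<dots> \<le> ennreal \<kappa>"
    unfolding sum_distrib_right[symmetric] \<kappa>_def using tot vR by (intro ennreal_leI mult_right_mono) auto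
  finally have "(\<integral>\<^sup>+z. \<Phi> z * indicator (ball y s) z \<partial>lborel) \<le> ennreal \<kappa>" .
  from exists_small_value[OF m\<Phi> s \<kappa> this] obtain z where z: "z \<in> ball y s" "\<Phi> z \<le> ennreal (2 * \<kappa> / vol TYPE('a) s)"
    by blast
  have Fz: "\<Lambda> \<inter> ball z R = F \<inter> {l. z \<in> ball l R}"
  proof -
    have "l \<in> ball y r" if "l \<in> ball z R" for l
      using that z(1) dist_triangle[of y l z] by (simp add: s_def)
    then show ?thesis by (auto simp: F_def dist_commute)
  qed
  have "\<Phi> z = (\<Sum>l\<in>\<Lambda> \<inter> ball z R. ennreal (1 - lev \<Lambda> l))"
    unfolding \<Phi>_def Fz using fin by (simp add: sum.If_cases indicator_def of_bool_def if_distrib cong: if_cong)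
  also have "\<dots> = ennreal (\<Sum>l\<in>\<Lambda> \<inter> ball z R. 1 - lev \<Lambda> l)"
    by (intro sum_ennreal w0) simp
  finally have "(\<Sum>l\<in>\<Lambda> \<inter> ball z R. 1 - lev \<Lambda> l) \<le> 2 * \<kappa> / vol TYPE('a) s"
    using z(2) \<kappa> vol_pos[OF s, where 'a='a] by (simp add: ennreal_le_iff)
  also have "\<dots> \<le> \<eta>"
  proof -
    have "vol TYPE('a) r \<le> 2 * vol TYPE('a) s" using r2[of s] r by (simp add: s_def)
    then have "2 * \<kappa> \<le> 2 * (\<epsilon> * (2 * vol TYPE('a) s) * vol TYPE('a) R)"
      unfolding \<kappa>_def using \<epsilon> vR by (intro mult_left_mono mult_right_mono) auto
    also have "\<dots> = \<eta> * vol TYPE('a) s" using vR by (simp add: \<epsilon>_def)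
    finally show ?thesis using vol_pos[OF s, where 'a='a] by (simp add: divide_le_eq)
  qed
  finally show ?thesis by blast
qed

text \<open>The matrix with entries \<open>ft (dual \<Lambda> (u i)) (u j)\<close> has diagonal at
  least \<open>1 - h\<close> and off-diagonal entries of modulus at most \<open>sqrt h\<close>.
  Bounding the latter part by the squared l^1 norm of the coefficients is crude but enough, since in
  the application \<open>I\<close> stays fixed while \<open>h\<close> tends to 0.\<close>

lemma lev_form_lower:
  assumes B: "bessel B \<Lambda>" and A: "lower_frame A \<Lambda>" and I: "finite I" "inj_on u I" "u ` I \<subseteq> \<Lambda>"
    and h: "\<And>i. i \<in> I \<Longrightarrow> 1 - lev \<Lambda> (u i) \<le> h" "0 \<le> h"
  shows "A * ((1 - h) * (\<Sum>i\<in>I. (cmod (c i))\<^sup>2) - sqrt h * (\<Sum>i\<in>I. cmod (c i))\<^sup>2)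
    \<le> sq.nsq M (\<lambda>t. \<Sum>i\<in>I. c i * expo (u i) t)"
proof -
  have A0: "A > 0" using A by (simp add: lower_frame_def)
  \<comment> \<open>The off-diagonal penalty is subtracted on the diagonal too, so that its double
    sum becomes a square.\<close>
  have entry: "(if i = j then (1 - h) * (cmod (c i))\<^sup>2 else 0) - sqrt h * (cmod (c i) * cmod (c j))
      \<le> Re (c i * cnj (c j) * ft (dual \<Lambda> (u i)) (u j))" if ij: "i \<in> I" "j \<in> I" for i j
  proof (cases "i = j")
    case True
    have "c i * cnj (c i) * ft (dual \<Lambda> (u i)) (u i) = of_real ((cmod (c i))\<^sup>2 * lev \<Lambda> (u i))"
      unfolding lev_eq[OF B A] by (simp add: complex_norm_square[symmetric])
    then have "Re (c i * cnj (c i) * ft (dual \<Lambda> (u i)) (u i)) = (cmod (c i))\<^sup>2 * lev \<Lambda> (u i)"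
      by (simp only: Re_complex_of_real)
    moreover have "(1 - h) * (cmod (c i))\<^sup>2 \<le> (cmod (c i))\<^sup>2 * lev \<Lambda> (u i)"
      using h(1)[OF ij(1)] by (subst mult.commute) (intro mult_left_mono, auto)
    moreover have "0 \<le> sqrt h * (cmod (c i) * cmod (c i))" using h(2) by simp
    ultimately show ?thesis using True by simp
  next
    case False
    then have "u j \<noteq> u i" using I(2) ij by (auto simp: inj_on_def)
    then have "(cmod (ft (dual \<Lambda> (u i)) (u j)))\<^sup>2 \<le> 1 - lev \<Lambda> (u i)"
      using I(3) ij by (intro lev_bounds(3)[OF B A]) auto
    then have "(cmod (ft (dual \<Lambda> (u i)) (u j)))\<^sup>2 \<le> h" using h(1)[OF ij(1)] by simp
    then have "cmod (ft (dual \<Lambda> (u i)) (u j)) \<le> sqrt h" by (rule real_le_rsqrt)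
    then have "cmod (c i * cnj (c j) * ft (dual \<Lambda> (u i)) (u j)) \<le> (cmod (c i) * cmod (c j)) * sqrt h"
      unfolding norm_mult complex_mod_cnj by (intro mult_left_mono) auto
    then show ?thesis
      using False abs_Re_le_cmod[of "c i * cnj (c j) * ft (dual \<Lambda> (u i)) (u j)"] by (simp add: mult.commute)
  qed
  have "(1 - h) * (\<Sum>i\<in>I. (cmod (c i))\<^sup>2) - sqrt h * (\<Sum>i\<in>I. cmod (c i))\<^sup>2
      = (\<Sum>i\<in>I. \<Sum>j\<in>I. (if i = j then (1 - h) * (cmod (c i))\<^sup>2 else 0) - sqrt h * (cmod (c i) * cmod (c j)))"
  proof -
    have "(\<Sum>i\<in>I. cmod (c i))\<^sup>2 = (\<Sum>i\<in>I. \<Sum>j\<in>I. cmod (c i) * cmod (c j))"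
      by (simp add: power2_eq_square sum_product)
    then show ?thesis using I(1) by (simp add: sum_subtractf sum_distrib_left)
  qed
  also have "\<dots> \<le> (\<Sum>i\<in>I. \<Sum>j\<in>I. Re (c i * cnj (c j) * ft (dual \<Lambda> (u i)) (u j)))"
    by (intro sum_mono entry)
  also have "\<dots> = Re (\<Sum>i\<in>I. \<Sum>j\<in>I. c i * cnj (c j) * ft (dual \<Lambda> (u i)) (u j))"
    by (simp only: Re_sum)
  finally have "A * ((1 - h) * (\<Sum>i\<in>I. (cmod (c i))\<^sup>2) - sqrt h * (\<Sum>i\<in>I. cmod (c i))\<^sup>2)
     \<le> A * Re (\<Sum>i\<in>I. \<Sum>j\<in>I. c i * cnj (c j) * ft (dual \<Lambda> (u i)) (u j))"
    using A0 by (intro mult_left_mono) auto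
  also have "\<dots> \<le> sq.nsq M (\<lambda>t. \<Sum>i\<in>I. c i * expo (u i) t)" by (rule lev_quadratic_form[OF B A])
  finally show ?thesis .
qed

text \<open>A finite subset of \<open>\<Gamma>\<close> lifts to points of \<open>\<Lambda>\<close>
  that eventually lie in the good balls, where every single defect is at most
  \<open>1 / Suc n\<close>. The estimate of \<open>lev_form_lower\<close> then tends to the lower
  Riesz inequality with constant \<open>A\<close>.\<close>

lemma frame_weak_limit_riesz_bounds:
  assumes B: "bessel B \<Lambda>" and A: "lower_frame A \<Lambda>"
    and z: "\<And>n. (\<Sum>l\<in>\<Lambda> \<inter> ball (z n) (real (Suc n)). 1 - lev \<Lambda> l) \<le> 1 / real (Suc n)"
    and L: "sep \<delta> \<Lambda>" and k: "strict_mono (k :: nat \<Rightarrow> nat)"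
    and W: "weakly_converges (\<lambda>n. (\<lambda>l. l - z (k n)) ` \<Lambda>) \<Gamma>"
  shows "riesz_bounds A B \<Gamma>"
  unfolding riesz_bounds_def
proof (intro conjI allI impI)
  show "0 < A" "0 \<le> B" using A B by (auto simp: lower_frame_def bessel_def)
  fix G c assume "finite G \<and> G \<subseteq> \<Gamma>"
  then have G: "finite G" "G \<subseteq> \<Gamma>" by auto
  show "sq.nsq M (\<lambda>t. \<Sum>\<gamma>\<in>G. c \<gamma> * expo \<gamma> t) \<le> B * (\<Sum>\<gamma>\<in>G. (cmod (c \<gamma>))\<^sup>2)"
    by (rule bessel_upper_bound[OF weak_bessel[OF W bessel_translate[OF B]] G])
  obtain l where l: "\<forall>\<gamma>\<in>G. \<forall>n. l \<gamma> n \<in> (\<lambda>l. l - z (k n)) ` \<Lambda>" "\<forall>\<gamma>\<in>G. l \<gamma> \<longlonglongrightarrow> \<gamma>" using weak_lift[OF W G(2)] by blast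
  have lim: "(\<lambda>n. sq.nsq M (\<lambda>t. \<Sum>\<gamma>\<in>G. c \<gamma> * expo (l \<gamma> n) t)) \<longlonglongrightarrow> sq.nsq M (\<lambda>t. \<Sum>\<gamma>\<in>G. c \<gamma> * expo \<gamma> t)"
    by (rule nsq_sum_tendsto) (use l(2) in auto)
  define P where "P = (\<Sum>\<gamma>\<in>G. (cmod (c \<gamma>))\<^sup>2)"
  define Q where "Q = (\<Sum>\<gamma>\<in>G. cmod (c \<gamma>))\<^sup>2"
  have hlim: "(\<lambda>n. 1 / real (Suc n)) \<longlonglongrightarrow> 0" by (rule LIMSEQ_Suc[OF lim_const_over_n])
  have "(\<lambda>n. A * ((1 - 1 / real (Suc n)) * P - sqrt (1 / real (Suc n)) * Q)) \<longlonglongrightarrow> A * ((1 - 0) * P - sqrt 0 * Q)"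
    by (intro tendsto_intros hlim)
  then have lowlim: "(\<lambda>n. A * ((1 - 1 / real (Suc n)) * P - sqrt (1 / real (Suc n)) * Q)) \<longlonglongrightarrow> A * P" by simp
  have ev_inj: "\<forall>\<^sub>F n in sequentially. inj_on (\<lambda>\<gamma>. l \<gamma> n) G" using l(2) G(1) by (intro weak_lift_inj) auto
  have "\<forall>\<^sub>F n in sequentially. norm (l \<gamma> n) < real (Suc n)" if "\<gamma> \<in> G" for \<gamma>
  proof -
    have "(\<lambda>n. norm (l \<gamma> n)) \<longlonglongrightarrow> norm \<gamma>" using l(2) that by (intro tendsto_norm) auto
    then have "\<forall>\<^sub>F n in sequentially. norm (l \<gamma> n) < norm \<gamma> + 1" by (rule order_tendstoD) simp
    note a = this
    obtain N where N: "norm \<gamma> + 1 < real N" using reals_Archimedean2 by blast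
    show ?thesis
      using a eventually_ge_at_top[of N]
    proof eventually_elim
      case (elim n)
      then show ?case using N by simp
    qed
  qed
  then have ev_ball: "\<forall>\<^sub>F n in sequentially. \<forall>\<gamma>\<in>G. norm (l \<gamma> n) < real (Suc n)"
    using G(1) by (simp add: eventually_ball_finite_distrib)
  have "\<forall>\<^sub>F n in sequentially. A * ((1 - 1 / real (Suc n)) * P - sqrt (1 / real (Suc n)) * Q)
      \<le> sq.nsq M (\<lambda>t. \<Sum>\<gamma>\<in>G. c \<gamma> * expo (l \<gamma> n) t)"
    using ev_inj ev_ball
  proof eventually_elim
    case (elim n)
    have kn: "n \<le> k n" by (rule seq_suble[OF k])
    have mem: "l \<gamma> n + z (k n) \<in> \<Lambda>" if "\<gamma> \<in> G" for \<gamma>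
    proof -
      have "l \<gamma> n \<in> (\<lambda>l. l - z (k n)) ` \<Lambda>" using l(1) that by blast
      then show ?thesis by (auto simp: diff_add_cancel)
    qed
    have "A * ((1 - 1 / real (Suc n)) * P - sqrt (1 / real (Suc n)) * Q)
      \<le> sq.nsq M (\<lambda>t. \<Sum>\<gamma>\<in>G. c \<gamma> * expo (l \<gamma> n + z (k n)) t)"
      unfolding P_def Q_def
    proof (rule lev_form_lower[OF B A G(1)])
      show "inj_on (\<lambda>\<gamma>. l \<gamma> n + z (k n)) G" using elim(1) by (auto simp: inj_on_def)
      show "(\<lambda>\<gamma>. l \<gamma> n + z (k n)) ` G \<subseteq> \<Lambda>" using mem by (rule image_subsetI)
      fix \<gamma> assume g: "\<gamma> \<in> G"
      let ?m = "l \<gamma> n + z (k n)" and ?F = "\<Lambda> \<inter> ball (z (k n)) (real (Suc (k n)))"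
      \<comment> \<open>The translation is by \<open>z (k n)\<close>, whose good ball has radius
        \<open>Suc (k n)\<close>; \<open>n \<le> k n\<close> reconciles the two indices.\<close>
      have "norm (l \<gamma> n) < real (Suc (k n))" using elim(2) g kn by fastforce
      then have m: "?m \<in> ?F" using mem[OF g] by (simp add: dist_norm)
      have "(1 - lev \<Lambda> ?m) \<le> (\<Sum>l\<in>?F. 1 - lev \<Lambda> l)"
        by (rule member_le_sum[OF m]) (use lev_bounds(2)[OF B A] sep_finite[OF L bounded_ball] in auto)
      also have "\<dots> \<le> 1 / real (Suc (k n))" by (rule z)
      also have "\<dots> \<le> 1 / real (Suc n)" using kn by (simp add: field_simps)
      finally show "1 - lev \<Lambda> ?m \<le> 1 / real (Suc n)" .
    qed simp
    then show ?case using nsq_sum_translate[where I=G and c=c and u="\<lambda>\<gamma>. l \<gamma> n + z (k n)" and z="z (k n)"] by simp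
  qed
  then show "A * (\<Sum>\<gamma>\<in>G. (cmod (c \<gamma>))\<^sup>2) \<le> sq.nsq M (\<lambda>t. \<Sum>\<gamma>\<in>G. c \<gamma> * expo \<gamma> t)"
    unfolding P_def[symmetric] by (intro tendsto_le[OF sequentially_bot lim lowlim])
qed

text \<open>The squared distance is \<open>2 * mS - 2 * Re (ft (\<lambda>_. 1) (y - x))\<close>, and
  this transform is continuous at 0 with value \<open>mS\<close> there; so \<open>s\<close> depends
  only on \<open>e\<close>.\<close>

lemma nm_expo_diff_small:
  assumes e: "e > 0"
  shows "\<exists>s>0. \<forall>x y. dist x y < s \<longrightarrow> sq.nm M (\<lambda>t. expo x t - expo y t) < e"
proof -
  have eq: "sq.nsq M (\<lambda>t. expo x t - expo y t) = 2 * mS - 2 * Re (ft (\<lambda>_. 1) (y - x))" for x y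
    using sq.nsq_diff[OF expo_mem expo_mem, of x y] by (simp add: nsq_expo ft_def[symmetric] ft_expo)
  have one0: "ft (\<lambda>_. 1) 0 = of_real mS"
    using nsq_expo[of 0] sq.ip_self[OF one_mem] by (simp add: ft_def expo_0[abs_def])
  have "isCont (ft (\<lambda>_. 1)) 0"
    using continuous_on_ft[OF one_mem, of UNIV] by (simp add: continuous_on_eq_continuous_at)
  moreover have "e\<^sup>2 / 2 > 0" using e by simp
  ultimately obtain s where s: "s > 0" "\<And>x. dist x 0 < s \<Longrightarrow> dist (ft (\<lambda>_. 1) x) (ft (\<lambda>_. 1) 0) < e\<^sup>2 / 2"
    unfolding continuous_at_eps_delta by (metis dist_norm)
  have "sq.nm M (\<lambda>t. expo x t - expo y t) < e" if "dist x y < s" for x y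
  proof -
    have "dist (y - x) 0 < s" using that by (simp add: dist_norm norm_minus_commute)
    then have "cmod (ft (\<lambda>_. 1) (y - x) - of_real mS) < e\<^sup>2 / 2" using s(2)[of "y - x"] one0 by (simp add: dist_norm)
    then have "\<bar>Re (ft (\<lambda>_. 1) (y - x) - of_real mS)\<bar> < e\<^sup>2 / 2"
      using abs_Re_le_cmod le_less_trans by blast
    then have "\<bar>Re (ft (\<lambda>_. 1) (y - x)) - mS\<bar> < e\<^sup>2 / 2" by (simp only: minus_complex.sel Re_complex_of_real)
    then have "sq.nsq M (\<lambda>t. expo x t - expo y t) < e\<^sup>2" unfolding eq by linarith
    then show ?thesis unfolding sq.nm_def using e by (intro real_less_lsqrt) auto
  qed
  then show ?thesis using s(1) by blast
qed

section \<open>Critical density\<close>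

text \<open>Averaging is used twice: over centres \<open>z\<close>, to find a ball on which the
  integral of the squared distances is small, and over a small ball around each \<open>x\<close>, to
  find a nearby \<open>x'\<close> whose distance to the span is small. Since \<open>expo x\<close>
  and \<open>expo x'\<close> are close, the coefficients found for \<open>x'\<close> serve for
  \<open>x\<close> as well.\<close>

lemma riesz_cover:
  assumes L: "sep \<delta> \<Lambda>" and Rb: "riesz_bounds A B \<Lambda>"
    and eq: "upper_density \<Lambda> = ennreal mS" and R: "R > 0" and e: "e > 0"
  shows "\<exists>z G c. finite G \<and> G \<subseteq> (\<lambda>l. l - z) ` \<Lambda> \<and>
    (\<forall>x. norm x < R \<longrightarrow> sq.nm M (\<lambda>t. expo x t - (\<Sum>l\<in>G. c x l * expo l t)) < e)"
proof -
  have e2: "e / 2 > 0" using e by simp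
  obtain s where s: "s > 0" and s_small: "\<And>x y. dist x y < s \<Longrightarrow> sq.nm M (\<lambda>t. expo x t - expo y t) < e / 2"
    using nm_expo_diff_small[OF e2] by blast
  have vs: "vol TYPE('a) s > 0" by (rule vol_pos[OF s])
  \<comment> \<open>The enlargement makes room for \<open>ball x s\<close> around every
    \<open>x\<close> with \<open>dist x z < R\<close>.\<close>
  define R' where "R' = R + s"
  have R': "R' > 0" using R s by (simp add: R'_def)
  have vR: "vol TYPE('a) R' > 0" by (rule vol_pos[OF R'])
  \<comment> \<open>Then \<open>2 * \<eta> / vol TYPE('a) s\<close> is half of the square of
    \<open>e / 2\<close>, which leaves a strict margin.\<close>
  define \<eta> where "\<eta> = (e / 2)\<^sup>2 * vol TYPE('a) s / 4"
  have \<eta>: "\<eta> > 0" using e vs by (simp add: \<eta>_def)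
  define \<epsilon> where "\<epsilon> = \<eta> / (4 * vol TYPE('a) R')"
  have \<epsilon>: "\<epsilon> > 0" using \<eta> vR by (simp add: \<epsilon>_def)
  then have \<epsilon>2: "\<epsilon> / 2 > 0" by simp
  obtain r1 where r1: "\<forall>r\<ge>r1. \<forall>y. \<exists>c D. D \<in> borel_measurable borel \<and>
    (\<forall>x. D x = sq.nsq M (\<lambda>t. expo x t - (\<Sum>m\<in>\<Lambda> \<inter> ball y r. c x m * expo m t))) \<and>
    integrable lborel (\<lambda>x. indicator (ball y r) x * D x) \<and>
    (LINT x|lborel. indicator (ball y r) x * D x) \<le> (mS + \<epsilon> / 2) * vol TYPE('a) r - real (card (\<Lambda> \<inter> ball y r))"
    using riesz_density[OF L Rb \<epsilon>2] by blast
  have "\<forall>\<^sub>F r in at_top. (1/2) * vol TYPE('a) (r + R') \<le> 1 * vol TYPE('a) r"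
    by (rule vol_shift_eventually) auto
  then obtain r2 where r2': "\<forall>r\<ge>r2. (1/2) * vol TYPE('a) (r + R') \<le> 1 * vol TYPE('a) r"
    unfolding eventually_at_top_linorder by blast
  have r2: "vol TYPE('a) (r + R') \<le> 2 * vol TYPE('a) r" if "r \<ge> r2" for r
    using r2'[rule_format, OF that] by simp
  obtain r y where r: "r \<ge> max r1 (max (r2 + R') (R' + 1))" and y: "(mS - \<epsilon> / 2) * vol TYPE('a) r \<le> real (card (\<Lambda> \<inter> ball y r))"
    using upper_density_eqD[OF L eq _ \<epsilon>2, of "max r1 (max (r2 + R') (R' + 1))"] by auto
  define F where "F = \<Lambda> \<inter> ball y r"
  have fin: "finite F" unfolding F_def by (rule sep_finite[OF L bounded_ball])
  have r1r: "r1 \<le> r" using r by simp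
  from r1[rule_format, OF r1r, of y, folded F_def] obtain c D where mD: "D \<in> borel_measurable borel"
    and D: "\<forall>x. D x = sq.nsq M (\<lambda>t. expo x t - (\<Sum>m\<in>F. c x m * expo m t))"
    and Di: "integrable lborel (\<lambda>x. indicator (ball y r) x * D x)"
    and Dle: "(LINT x|lborel. indicator (ball y r) x * D x) \<le> (mS + \<epsilon> / 2) * vol TYPE('a) r - real (card F)"
    by (elim exE conjE) (rule that)
  have D0: "D x \<ge> 0" for x
    unfolding D[rule_format] by (intro sq.nsq_nonneg sq.diff_mem expo_mem sum_expo_mem)
  note mD [measurable]
  have [measurable]: "ball (x::'a) q \<in> sets borel" for x q by simp
  have vr: "vol TYPE('a) r > 0" using r R' by (intro vol_pos) simp
  have tot: "(\<integral>\<^sup>+x. ennreal (indicator (ball y r) x * D x) \<partial>lborel) \<le> ennreal (\<epsilon> * vol TYPE('a) r)"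
  proof -
    have "(\<integral>\<^sup>+x. ennreal (indicator (ball y r) x * D x) \<partial>lborel) = ennreal (LINT x|lborel. indicator (ball y r) x * D x)"
      by (rule nn_integral_eq_integral[OF Di]) (simp add: D0)
    also have "\<dots> \<le> ennreal (\<epsilon> * vol TYPE('a) r)"
      using Dle y unfolding F_def[symmetric] by (intro ennreal_leI) (simp add: algebra_simps)
    finally show ?thesis .
  qed
  \<comment> \<open>Membership in \<open>ball z R'\<close> is written as a condition on
    \<open>dist z x\<close>, which is jointly measurable in \<open>z\<close> and
    \<open>x\<close>.\<close>
  define \<Phi> where "\<Phi> z = (\<integral>\<^sup>+x. ennreal (indicator (ball y r) x * D x) * (if dist z x < R' then 1 else 0) \<partial>lborel)" for z
  have m\<Phi>: "\<Phi> \<in> borel_measurable borel"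
    unfolding \<Phi>_def by measurable
  define s' where "s' = r - R'"
  have s': "s' > 0" using r by (simp add: s'_def)
  define \<kappa> where "\<kappa> = \<epsilon> * vol TYPE('a) r * vol TYPE('a) R'"
  have \<kappa>: "\<kappa> > 0" using \<epsilon> vR vr by (simp add: \<kappa>_def)
  have inner: "(\<integral>\<^sup>+z. (if dist z x < R' then 1 else 0) \<partial>lborel) = ennreal (vol TYPE('a) R')" for x :: 'a
  proof -
    have "(\<integral>\<^sup>+z. (if dist z x < R' then 1 else 0) \<partial>lborel) = (\<integral>\<^sup>+z. indicator (ball x R') z \<partial>lborel)"
      by (intro nn_integral_cong) (auto simp: indicator_def dist_commute)
    also have "\<dots> = emeasure lborel (ball x R')" by simp
    also have "\<dots> = ennreal (vol TYPE('a) R')"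
      using emeasure_eq_measure2[of "ball x R'" lebesgue] vol_ball[of x R'] by simp
    finally show ?thesis .
  qed
  have "(\<integral>\<^sup>+z. \<Phi> z * indicator (ball y s') z \<partial>lborel) \<le> (\<integral>\<^sup>+z. \<Phi> z \<partial>lborel)"
    by (intro nn_integral_mono) (simp add: indicator_def)
  also have "\<dots> = (\<integral>\<^sup>+x. (\<integral>\<^sup>+z. ennreal (indicator (ball y r) x * D x) * (if dist z x < R' then 1 else 0) \<partial>lborel) \<partial>lborel)"
    unfolding \<Phi>_def by (rule lborel_pair.Fubini') measurable
  also have "\<dots> = (\<integral>\<^sup>+x. ennreal (indicator (ball y r) x * D x) * ennreal (vol TYPE('a) R') \<partial>lborel)"
    by (subst nn_integral_cmult) (simp_all add: inner)
  also have "\<dots> = (\<integral>\<^sup>+x. ennreal (indicator (ball y r) x * D x) \<partial>lborel) * ennreal (vol TYPE('a) R')"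
    by (rule nn_integral_multc) measurable
  also have "\<dots> \<le> ennreal (\<epsilon> * vol TYPE('a) r) * ennreal (vol TYPE('a) R')"
    by (intro mult_right_mono tot) simp
  also have "\<dots> = ennreal \<kappa>" unfolding \<kappa>_def using \<epsilon> vr vR by (intro ennreal_mult[symmetric]) auto
  finally have "(\<integral>\<^sup>+z. \<Phi> z * indicator (ball y s') z \<partial>lborel) \<le> ennreal \<kappa>" .
  from exists_small_value[OF m\<Phi> s' \<kappa> this] obtain z where z: "z \<in> ball y s'" "\<Phi> z \<le> ennreal (2 * \<kappa> / vol TYPE('a) s')"
    by blast
  have "2 * \<kappa> / vol TYPE('a) s' \<le> \<eta>"
  proof -
    have "vol TYPE('a) r \<le> 2 * vol TYPE('a) s'" using r2[of s'] r by (simp add: s'_def)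
    then have "2 * \<kappa> \<le> 2 * (\<epsilon> * (2 * vol TYPE('a) s') * vol TYPE('a) R')"
      unfolding \<kappa>_def using \<epsilon> vR by (intro mult_left_mono mult_right_mono) auto
    also have "\<dots> = \<eta> * vol TYPE('a) s'" using vR by (simp add: \<epsilon>_def)
    finally show ?thesis using vol_pos[OF s', where 'a='a] by (simp add: divide_le_eq)
  qed
  then have z\<Phi>: "\<Phi> z \<le> ennreal \<eta>" using z(2) by (meson ennreal_leI order_trans)
  have near: "\<exists>x'. sq.nm M (\<lambda>t. expo x t - (\<Sum>m\<in>F. c x' m * expo m t)) < e" if x: "dist x z < R" for x
  proof -
    have mD': "(\<lambda>x. ennreal (D x)) \<in> borel_measurable borel" by measurable
    have "(\<integral>\<^sup>+w. ennreal (D w) * indicator (ball x s) w \<partial>lborel) \<le> \<Phi> z"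
      unfolding \<Phi>_def
    proof (rule nn_integral_mono)
      fix w :: 'a
      show "ennreal (D w) * indicator (ball x s) w \<le> ennreal (indicator (ball y r) w * D w) * (if dist z w < R' then 1 else 0)"
      proof (cases "w \<in> ball x s")
        case True
        have 1: "dist z w < R'"
          using True x dist_triangle[of z w x] by (simp add: R'_def dist_commute)
        have 2: "w \<in> ball y r"
          using 1 z(1) dist_triangle[of y w z] by (simp add: s'_def)
        show ?thesis using 1 2 True by simp
      qed simp
    qed
    then have "(\<integral>\<^sup>+w. ennreal (D w) * indicator (ball x s) w \<partial>lborel) \<le> ennreal \<eta>" using z\<Phi> by (rule order_trans)
    from exists_small_value[OF mD' s \<eta> this] obtain x' where x': "x' \<in> ball x s" "ennreal (D x') \<le> ennreal (2 * \<eta> / vol TYPE('a) s)"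
      by blast
    have "D x' \<le> 2 * \<eta> / vol TYPE('a) s" using x'(2) \<eta> vs by (simp add: ennreal_le_iff)
    also have "\<dots> = (e / 2)\<^sup>2 / 2" using vs by (simp add: \<eta>_def)
    also have "\<dots> < (e / 2)\<^sup>2" using e by simp
    finally have "sq.nm M (\<lambda>t. expo x' t - (\<Sum>m\<in>F. c x' m * expo m t)) < e / 2"
      unfolding sq.nm_def D[rule_format, symmetric] using e by (intro real_less_lsqrt) (auto simp: D0)
    moreover have "sq.nm M (\<lambda>t. expo x t - expo x' t) < e / 2" using s_small[of x x'] x'(1) by simp
    moreover have "sq.nm M (\<lambda>t. expo x t - (\<Sum>m\<in>F. c x' m * expo m t))
        \<le> sq.nm M (\<lambda>t. expo x t - expo x' t) + sq.nm M (\<lambda>t. expo x' t - (\<Sum>m\<in>F. c x' m * expo m t))"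
      by (rule sq.nm_triangle[OF expo_mem expo_mem sum_expo_mem])
    ultimately show ?thesis by (intro exI[of _ x']) simp
  qed
  define p where "p x = (SOME x'. sq.nm M (\<lambda>t. expo x t - (\<Sum>m\<in>F. c x' m * expo m t)) < e)" for x
  have p: "sq.nm M (\<lambda>t. expo x t - (\<Sum>m\<in>F. c (p x) m * expo m t)) < e" if "dist x z < R" for x
    unfolding p_def by (rule someI_ex[OF near[OF that]])
  define G where "G = (\<lambda>l. l - z) ` F"
  \<comment> \<open>Translation back to the origin: target and frequencies are both moved by
    \<open>z\<close>.\<close>
  define c' where "c' x l = c (p (x + z)) (l + z)" for x l
  have "sq.nm M (\<lambda>t. expo x t - (\<Sum>l\<in>G. c' x l * expo l t)) < e" if x: "norm x < R" for x
  proof -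
    let ?f = "\<lambda>t. expo (x + z) t - (\<Sum>m\<in>F. c (p (x + z)) m * expo m t)"
    have "expo x t - (\<Sum>l\<in>G. c' x l * expo l t) = ?f t * expo (- z) t" for t
    proof -
      have "(\<Sum>l\<in>G. c' x l * expo l t) = (\<Sum>m\<in>F. c (p (x + z)) m * expo (m - z) t)"
        unfolding G_def by (subst sum.reindex) (auto simp: inj_on_def c'_def)
      also have "\<dots> = (\<Sum>m\<in>F. c (p (x + z)) m * expo m t) * expo (- z) t"
        by (simp add: sum_distrib_right expo_add[of _ "- z", symmetric] mult.assoc)
      finally show ?thesis using expo_add[of "x + z" "- z" t] by (simp add: left_diff_distrib)
    qed
    then have "sq.nsq M (\<lambda>t. expo x t - (\<Sum>l\<in>G. c' x l * expo l t)) = sq.nsq M ?f"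
      by (simp add: nsq_modulate)
    then show ?thesis using p[of "x + z"] x by (simp add: sq.nm_def dist_norm)
  qed
  moreover have "finite G" "G \<subseteq> (\<lambda>l. l - z) ` \<Lambda>" using fin by (auto simp: G_def F_def)
  ultimately show ?thesis by (intro exI[of _ z] exI[of _ G] exI[of _ c']) simp
qed

text \<open>No approximation inside the span of \<open>\<Gamma>\<close> is made. A function is
  approximated by arbitrary exponentials, and these by combinations over a translate of
  \<open>\<Lambda>\<close>; \<open>lower_bound_by_approximation\<close> then uses the Riesz bound of
  the translate together with the comparison of its sample sums with those over
  \<open>\<Gamma>\<close>.\<close>

lemma riesz_weak_limit_lower_frame:
  assumes L: "sep \<delta> \<Lambda>" and Rb: "riesz_bounds A B \<Lambda>"
    and G: "\<And>n. finite (G n)" "\<And>n. G n \<subseteq> (\<lambda>l. l - z n) ` \<Lambda>"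
    and c: "\<And>n x. norm x < real (Suc n) \<Longrightarrow>
      sq.nm M (\<lambda>t. expo x t - (\<Sum>l\<in>G n. c n x l * expo l t)) < 1 / real (Suc n)"
    and k: "strict_mono (k :: nat \<Rightarrow> nat)"
    and W: "weakly_converges (\<lambda>n. (\<lambda>l. l - z (k n)) ` \<Lambda>) \<Gamma>"
  shows "lower_frame A \<Gamma>"
  unfolding lower_frame_def
proof (intro conjI ballI)
  show A0: "0 < A" using Rb by (simp add: riesz_bounds_def)
  note Bs = riesz_bounds_bessel[OF Rb]
  fix f assume f: "f \<in> V"
  show "A * sq.nsq M f \<le> (\<Sum>\<^sub>\<infinity>\<gamma>\<in>\<Gamma>. (cmod (ft f \<gamma>))\<^sup>2)"
  proof (rule field_le_epsilon)
    fix \<eta> :: real assume \<eta>: "\<eta> > 0"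
    show "A * sq.nsq M f \<le> (\<Sum>\<^sub>\<infinity>\<gamma>\<in>\<Gamma>. (cmod (ft f \<gamma>))\<^sup>2) + \<eta>"
    proof (rule lower_bound_by_approximation[OF f A0])
      show "0 \<le> (\<Sum>\<^sub>\<infinity>\<gamma>\<in>\<Gamma>. (cmod (ft f \<gamma>))\<^sup>2) + \<eta>" using \<eta> by (intro add_nonneg_nonneg infsum_nonneg) auto
      fix e :: real assume "e > 0"
      then have e2: "e / 2 > 0" by simp
      obtain X a where X: "finite X" "sq.nm M (\<lambda>t. f t - (\<Sum>x\<in>X. a x * expo x t)) < e / 2"
        using expo_dense[OF f e2] by blast
      \<comment> \<open>Bounds the total weight of the errors made in approximating the finitely
        many \<open>expo x\<close>; the 1 keeps it positive.\<close>
      define K where "K = (\<Sum>x\<in>X. cmod (a x)) + 1"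
      have K: "K > 0" unfolding K_def by (intro add_nonneg_pos sum_nonneg) auto
      obtain N1 where N1: "inverse (real (Suc N1)) < e / 2 / K" using reals_Archimedean[of "e / 2 / K"] e2 K by auto
      \<comment> \<open>Puts all of \<open>X\<close> into the ball on which the approximations at
        stage \<open>j\<close> are valid.\<close>
      obtain N2 where N2: "(\<Sum>x\<in>X. norm x) < real N2" using reals_Archimedean2 by blast
      have "\<forall>\<^sub>F n in sequentially. n \<ge> max N1 N2" by (rule eventually_ge_at_top)
      then obtain n where n: "n \<ge> max N1 N2" and sums: "\<forall>F. finite F \<and> F \<subseteq> (\<lambda>l. l - z (k n)) ` \<Lambda> \<longrightarrow>
        (\<Sum>l\<in>F. (cmod (ft f l))\<^sup>2) \<le> (\<Sum>\<^sub>\<infinity>\<gamma>\<in>\<Gamma>. (cmod (ft f \<gamma>))\<^sup>2) + \<eta>"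
        using eventually_happens'[OF sequentially_bot eventually_conj[OF _ weak_sum_le[OF L Bs W f \<eta>]]] by blast
      define j where "j = k n"
      have jn: "j \<ge> n" unfolding j_def by (rule seq_suble[OF k])
      define d where "d l = (\<Sum>x\<in>X. a x * c j x l)" for l
      define v where "v = (\<lambda>t. \<Sum>l\<in>G j. d l * expo l t)"
      have vV: "v \<in> V" unfolding v_def by (rule sum_expo_mem)
      have "(\<lambda>t. (\<Sum>x\<in>X. a x * expo x t) - v t) = (\<lambda>t. \<Sum>x\<in>X. a x * (expo x t - (\<Sum>l\<in>G j. c j x l * expo l t)))"
      proof
        fix t
        have "v t = (\<Sum>l\<in>G j. \<Sum>x\<in>X. a x * (c j x l * expo l t))"
          by (simp add: v_def d_def sum_distrib_right mult.assoc)
        also have "\<dots> = (\<Sum>x\<in>X. \<Sum>l\<in>G j. a x * (c j x l * expo l t))" by (rule sum.swap)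
        finally show "(\<Sum>x\<in>X. a x * expo x t) - v t = (\<Sum>x\<in>X. a x * (expo x t - (\<Sum>l\<in>G j. c j x l * expo l t)))"
          by (simp add: right_diff_distrib sum_subtractf sum_distrib_left)
      qed
      then have "sq.nm M (\<lambda>t. (\<Sum>x\<in>X. a x * expo x t) - v t)
          \<le> (\<Sum>x\<in>X. cmod (a x) * sq.nm M (\<lambda>t. expo x t - (\<Sum>l\<in>G j. c j x l * expo l t)))"
        using sq.nm_sum[of X "\<lambda>x t. expo x t - (\<Sum>l\<in>G j. c j x l * expo l t)" M a]
        by (simp add: sq.diff_mem sum_expo_mem)
      also have "\<dots> \<le> (\<Sum>x\<in>X. cmod (a x) * (1 / real (Suc j)))"
      proof (intro sum_mono mult_left_mono)
        fix x assume x: "x \<in> X"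
        have "norm x \<le> (\<Sum>x\<in>X. norm x)" using X(1) x by (intro member_le_sum) auto
        also have "\<dots> < real (Suc j)" using N2 n jn by linarith
        finally show "sq.nm M (\<lambda>t. expo x t - (\<Sum>l\<in>G j. c j x l * expo l t)) \<le> 1 / real (Suc j)"
          by (intro less_imp_le c)
      qed simp
      also have "\<dots> \<le> K * (1 / real (Suc j))"
        unfolding sum_distrib_right[symmetric] by (intro mult_right_mono) (auto simp: K_def)
      also have "\<dots> \<le> K * inverse (real (Suc N1))"
        using n jn K by (intro mult_left_mono) (auto simp: field_simps)
      also have "\<dots> < K * (e / 2 / K)" using N1 K by (intro mult_strict_left_mono) auto
      also have "\<dots> = e / 2" using K by simp
      finally have "sq.nm M (\<lambda>t. (\<Sum>x\<in>X. a x * expo x t) - v t) < e / 2" .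
      then have 1: "sq.nm M (\<lambda>t. f t - v t) < e"
        using sq.nm_triangle[OF f sum_expo_mem[where X=X and a=a] vV] X(2) by linarith
      have 2: "A * (\<Sum>l\<in>G j. (cmod (d l))\<^sup>2) \<le> sq.nsq M v"
      proof -
        have "A * (\<Sum>l\<in>G j. (cmod (d l))\<^sup>2) \<le> sq.nsq M (\<lambda>t. \<Sum>l\<in>G j. d l * expo (l + z j) t)"
        proof (rule riesz_bounds_inj[OF Rb G(1)])
          show "inj_on (\<lambda>l. l + z j) (G j)" by (auto simp: inj_on_def)
          show "(\<lambda>l. l + z j) ` G j \<subseteq> \<Lambda>" using G(2)[of j] by auto
        qed
        also have "\<dots> = sq.nsq M v"
          unfolding v_def using nsq_sum_translate[where I="G j" and c=d and u="\<lambda>l. l + z j" and z="z j"] by simp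
        finally show ?thesis .
      qed
      have 3: "(\<Sum>l\<in>G j. (cmod (ft f l))\<^sup>2) \<le> (\<Sum>\<^sub>\<infinity>\<gamma>\<in>\<Gamma>. (cmod (ft f \<gamma>))\<^sup>2) + \<eta>"
        using sums[rule_format, OF conjI[OF G(1) G(2)[of "k n"]]] by (simp only: j_def)
      show "\<exists>F c. sq.nm M (\<lambda>t. f t - (\<Sum>l\<in>F. c l * expo l t)) < e \<and>
        A * (\<Sum>l\<in>F. (cmod (c l))\<^sup>2) \<le> sq.nsq M (\<lambda>t. \<Sum>l\<in>F. c l * expo l t) \<and>
        (\<Sum>l\<in>F. (cmod (ft f l))\<^sup>2) \<le> (\<Sum>\<^sub>\<infinity>\<gamma>\<in>\<Gamma>. (cmod (ft f \<gamma>))\<^sup>2) + \<eta>"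
        by (intro exI[of _ "G j"] exI[of _ d] conjI 1[unfolded v_def] 2[unfolded v_def] 3)
    qed
  qed
qed

section \<open>The equivalences for frames and for Riesz sequences\<close>

lemma bounds_exp_riesz_basis:
  assumes R: "riesz_bounds A B \<Gamma>" and A: "lower_frame A' \<Gamma>"
  shows "exp_riesz_basis S \<Gamma>"
  unfolding exp_riesz_basis_def
  using riesz_bounds_exp_riesz_sequence[OF R] frame_exp_complete[OF riesz_bounds_bessel[OF R] A] by blast

lemma exp_riesz_basis_bounds:
  assumes "exp_riesz_basis S \<Gamma>"
  shows "\<exists>A B. riesz_bounds A B \<Gamma> \<and> lower_frame A \<Gamma>"
proof -
  obtain A B where R: "riesz_bounds A B \<Gamma>"
    using exp_riesz_sequence_bounds assms unfolding exp_riesz_basis_def by blast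
  moreover have "lower_frame A \<Gamma>"
    using riesz_basis_lower_frame[OF R] assms unfolding exp_riesz_basis_def by blast
  ultimately show ?thesis by blast
qed

lemma frame_critical_imp_riesz_basis:
  assumes L: "sep \<delta> \<Lambda>" and B: "bessel B \<Lambda>" and A: "lower_frame A \<Lambda>"
    and eq: "lower_density \<Lambda> = ennreal mS"
  shows "\<exists>\<Gamma>\<in>weak_limits \<Lambda>. exp_riesz_basis S \<Gamma>"
proof -
  have "\<exists>z. (\<Sum>l\<in>\<Lambda> \<inter> ball z (real (Suc n)). 1 - lev \<Lambda> l) \<le> 1 / real (Suc n)" for n
    by (rule lev_defect_small[OF L B A eq]) simp_all
  then obtain z where z: "\<And>n. (\<Sum>l\<in>\<Lambda> \<inter> ball (z n) (real (Suc n)). 1 - lev \<Lambda> l) \<le> 1 / real (Suc n)" by metis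
  obtain k \<Gamma> where k: "strict_mono (k :: nat \<Rightarrow> nat)" and W: "weakly_converges (\<lambda>n. (\<lambda>l. l - z (k n)) ` \<Lambda>) \<Gamma>"
    using weak_compactness_translates[of z \<Lambda>] by blast
  have "exp_riesz_basis S \<Gamma>"
    by (rule bounds_exp_riesz_basis[OF frame_weak_limit_riesz_bounds[OF B A z L k W] weak_lower_frame[OF L B A W]])
  moreover have "\<Gamma> \<in> weak_limits \<Lambda>" unfolding weak_limits_def using W by (intro CollectI exI[of _ "\<lambda>n. z (k n)"])
  ultimately show ?thesis by blast
qed

lemma riesz_critical_imp_riesz_basis:
  assumes L: "sep \<delta> \<Lambda>" and R: "riesz_bounds A B \<Lambda>" and eq: "upper_density \<Lambda> = ennreal mS"
  shows "\<exists>\<Gamma>\<in>weak_limits \<Lambda>. exp_riesz_basis S \<Gamma>"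
proof -
  define P where "P n z G c \<longleftrightarrow> finite G \<and> G \<subseteq> (\<lambda>l. l - z) ` \<Lambda> \<and> (\<forall>x. norm x < real (Suc n) \<longrightarrow>
      sq.nm M (\<lambda>t. expo x t - (\<Sum>l\<in>G. c x l * expo l t)) < 1 / real (Suc n))" for n z G c
  have "\<exists>z G c. P n z G c" for n
    unfolding P_def by (rule riesz_cover[OF L R eq]) simp_all
  then obtain z G c where P: "\<And>n. P n (z n) (G n) (c n)" by metis
  have G: "\<And>n. finite (G n)" "\<And>n. G n \<subseteq> (\<lambda>l. l - z n) ` \<Lambda>"
    and c: "\<And>n x. norm x < real (Suc n) \<Longrightarrow>
      sq.nm M (\<lambda>t. expo x t - (\<Sum>l\<in>G n. c n x l * expo l t)) < 1 / real (Suc n)"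
    using P unfolding P_def by blast+
  obtain k \<Gamma> where k: "strict_mono (k :: nat \<Rightarrow> nat)" and W: "weakly_converges (\<lambda>n. (\<lambda>l. l - z (k n)) ` \<Lambda>) \<Gamma>"
    using weak_compactness_translates[of z \<Lambda>] by blast
  have "exp_riesz_basis S \<Gamma>"
    by (rule bounds_exp_riesz_basis[OF weak_riesz_bounds[OF R W] riesz_weak_limit_lower_frame[OF L R G c k W]])
  moreover have "\<Gamma> \<in> weak_limits \<Lambda>" unfolding weak_limits_def using W by (intro CollectI exI[of _ "\<lambda>n. z (k n)"])
  ultimately show ?thesis by blast
qed

lemma card_translate_ball: "card (\<Lambda> \<inter> ball x r) = card ((\<lambda>l. l - x) ` \<Lambda> \<inter> ball 0 r)" for \<Lambda> :: "'a set"
proof -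
  have "(\<lambda>l. l - x) ` \<Lambda> \<inter> ball 0 r = (\<lambda>l. l - x) ` (\<Lambda> \<inter> ball x r)"
    by (auto simp: dist_norm norm_minus_commute)
  then show ?thesis by (simp add: card_image inj_on_def)
qed

text \<open>One inequality is the frame density bound for \<open>\<Lambda>\<close>. For the other,
  the Riesz bounds of \<open>\<Gamma>\<close> limit its point counts from above, and for every
  radius some ball of \<open>\<Lambda>\<close> contains no more points than the ball of
  \<open>\<Gamma>\<close> around 0 with radius larger by 1.\<close>

lemma riesz_basis_imp_lower_density:
  assumes L: "sep \<delta> \<Lambda>" and B: "bessel B \<Lambda>" and A: "lower_frame A \<Lambda>"
    and \<Gamma>: "\<Gamma> \<in> weak_limits \<Lambda>" "exp_riesz_basis S \<Gamma>"
  shows "lower_density \<Lambda> = ennreal mS"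
proof (rule antisym)
  obtain z where W: "weakly_converges (\<lambda>n. (\<lambda>l. l - z n) ` \<Lambda>) \<Gamma>" using \<Gamma>(1) by (auto simp: weak_limits_def)
  obtain A' B' where R: "riesz_bounds A' B' \<Gamma>" using exp_riesz_basis_bounds[OF \<Gamma>(2)] by blast
  have LL: "sep \<delta> ((\<lambda>l. l - z n) ` \<Lambda>)" for n by (rule sep_translate[OF L])
  have L\<Gamma>: "sep \<delta> \<Gamma>" by (rule weak_sep[OF W LL])
  show "lower_density \<Lambda> \<le> ennreal mS"
  proof (rule ennreal_le_epsilon)
    fix e :: real assume e: "e > 0"
    then have e2: "e / 2 > 0" by simp
    have "\<forall>\<^sub>F r in at_top. \<forall>y. real (card (\<Gamma> \<inter> ball y r)) \<le> (mS + e / 2) * vol TYPE('a) r"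
      by (rule riesz_upper_density_le[OF L\<Gamma> R e2])
    then obtain r0 where r0: "\<forall>r\<ge>r0. \<forall>y. real (card (\<Gamma> \<inter> ball y r)) \<le> (mS + e / 2) * vol TYPE('a) r"
      unfolding eventually_at_top_linorder by blast
    have "\<forall>\<^sub>F r in at_top. (mS + e / 2) * vol TYPE('a) (r + 1) \<le> (mS + e) * vol TYPE('a) r"
      using e by (intro vol_shift_eventually) (auto intro: add_nonneg_nonneg)
    then have "\<forall>\<^sub>F r in at_top. \<exists>y. real (card (\<Lambda> \<inter> ball y r)) \<le> (mS + e) * vol TYPE('a) r"
      using eventually_ge_at_top[of r0]
    proof eventually_elim
      case (elim r)
      obtain n where n: "card ((\<lambda>l. l - z n) ` \<Lambda> \<inter> cball 0 r) \<le> card (\<Gamma> \<inter> ball 0 (r + 1))"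
        using eventually_happens'[OF sequentially_bot weak_card_le[OF W LL, of r]] by blast
      have "card (\<Lambda> \<inter> ball (z n) r) \<le> card ((\<lambda>l. l - z n) ` \<Lambda> \<inter> cball 0 r)"
        using ball_subset_cball[of 0 r]
        by (subst card_translate_ball, intro card_mono sep_finite[OF LL bounded_cball]) auto
      then have "real (card (\<Lambda> \<inter> ball (z n) r)) \<le> real (card (\<Gamma> \<inter> ball 0 (r + 1)))" using n by simp
      also have "\<dots> \<le> (mS + e / 2) * vol TYPE('a) (r + 1)" using r0 elim(2) by simp
      finally show ?case using elim(1) by (intro exI[of _ "z n"]) simp
    qed
    from lower_density_le[OF L this] show "lower_density \<Lambda> \<le> ennreal mS + ennreal e"
      using e by simp
  qed
  show "ennreal mS \<le> lower_density \<Lambda>"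
  proof (rule ennreal_le_epsilon)
    fix e :: real assume e: "e > 0"
    \<comment> \<open>If \<open>mS < e\<close>, the negative difference is sent to 0 by
      \<open>ennreal\<close>, so this case is separate.\<close>
    have "ennreal mS \<le> ennreal (mS - e) + ennreal e"
    proof (cases "mS \<ge> e")
      case False
      then have "ennreal mS \<le> ennreal e" by (intro ennreal_leI) simp
      then show ?thesis by (simp add: add_increasing)
    qed (use e in \<open>simp flip: ennreal_plus\<close>)
    also have "\<dots> \<le> lower_density \<Lambda> + ennreal e"
      by (intro add_right_mono lower_density_ge[OF L] frame_lower_density_ge[OF L B A e])
    finally show "ennreal mS \<le> lower_density \<Lambda> + ennreal e" .
  qed
qed

text \<open>The mirror argument: the frame bound of \<open>\<Gamma>\<close> bounds its point counts
  from below, and the points of \<open>\<Gamma>\<close> in an open ball lift to equally many points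
  of a translate in the same ball, so here the radius need not change.\<close>

lemma riesz_basis_imp_upper_density:
  assumes L: "sep \<delta> \<Lambda>" and R: "riesz_bounds A B \<Lambda>"
    and \<Gamma>: "\<Gamma> \<in> weak_limits \<Lambda>" "exp_riesz_basis S \<Gamma>"
  shows "upper_density \<Lambda> = ennreal mS"
proof (rule antisym)
  show "upper_density \<Lambda> \<le> ennreal mS"
  proof (rule ennreal_le_epsilon)
    fix e :: real assume e: "e > 0"
    from upper_density_le[OF L riesz_upper_density_le[OF L R e]]
    show "upper_density \<Lambda> \<le> ennreal mS + ennreal e" using e by simp
  qed
  obtain z where W: "weakly_converges (\<lambda>n. (\<lambda>l. l - z n) ` \<Lambda>) \<Gamma>" using \<Gamma>(1) by (auto simp: weak_limits_def)
  obtain A' B' where R': "riesz_bounds A' B' \<Gamma>" and A': "lower_frame A' \<Gamma>" using exp_riesz_basis_bounds[OF \<Gamma>(2)] by blast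
  have LL: "sep \<delta> ((\<lambda>l. l - z n) ` \<Lambda>)" for n by (rule sep_translate[OF L])
  have L\<Gamma>: "sep \<delta> \<Gamma>" by (rule weak_sep[OF W LL])
  show "ennreal mS \<le> upper_density \<Lambda>"
  proof (rule ennreal_le_epsilon)
    fix e :: real assume e: "e > 0"
    have "ennreal mS \<le> ennreal (mS - e) + ennreal e"
    proof (cases "mS \<ge> e")
      case False
      then have "ennreal mS \<le> ennreal e" by (intro ennreal_leI) simp
      then show ?thesis by (simp add: add_increasing)
    qed (use e in \<open>simp flip: ennreal_plus\<close>)
    also have "\<dots> \<le> upper_density \<Lambda> + ennreal e"
    proof (rule add_right_mono, rule upper_density_ge[OF L])
      show "\<forall>\<^sub>F r in at_top. \<exists>y. (mS - e) * vol TYPE('a) r \<le> real (card (\<Lambda> \<inter> ball y r))"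
        using frame_lower_density_ge[OF L\<Gamma> riesz_bounds_bessel[OF R'] A' e]
      proof eventually_elim
        case (elim r)
        define G where "G = \<Gamma> \<inter> ball 0 r"
        have fin: "finite G" unfolding G_def by (rule sep_finite[OF L\<Gamma> bounded_ball])
        have "G \<subseteq> \<Gamma>" by (simp add: G_def)
        from weak_lift[OF W this] obtain l where l: "\<forall>\<gamma>\<in>G. \<forall>n. l \<gamma> n \<in> (\<lambda>l. l - z n) ` \<Lambda>" "\<forall>\<gamma>\<in>G. l \<gamma> \<longlonglongrightarrow> \<gamma>" by blast
        have "\<forall>\<^sub>F n in sequentially. inj_on (\<lambda>\<gamma>. l \<gamma> n) G" using l(2) fin by (intro weak_lift_inj) auto
        moreover have "\<forall>\<^sub>F n in sequentially. \<forall>\<gamma>\<in>G. l \<gamma> n \<in> ball 0 r"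
        proof (rule eventually_ball_finite[OF fin], rule ballI)
          fix \<gamma> assume g: "\<gamma> \<in> G"
          show "\<forall>\<^sub>F n in sequentially. l \<gamma> n \<in> ball 0 r"
            by (rule topological_tendstoD[OF l(2)[rule_format, OF g] open_ball]) (use g in \<open>simp add: G_def\<close>)
        qed
        ultimately obtain n where n: "inj_on (\<lambda>\<gamma>. l \<gamma> n) G" "\<forall>\<gamma>\<in>G. l \<gamma> n \<in> ball 0 r"
          using eventually_happens'[OF sequentially_bot eventually_conj] by blast
        have "card G \<le> card ((\<lambda>l. l - z n) ` \<Lambda> \<inter> ball 0 r)"
          by (rule card_inj_on_le[OF n(1)]) (use l(1) n(2) sep_finite[OF LL bounded_ball] in auto)
        then have "real (card (\<Gamma> \<inter> ball 0 r)) \<le> real (card (\<Lambda> \<inter> ball (z n) r))"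
          by (subst (2) card_translate_ball) (simp add: G_def)
        then show ?case using elim by (intro exI[of _ "z n"]) (meson order_trans)
      qed
    qed
    finally show "ennreal mS \<le> upper_density \<Lambda> + ennreal e" .
  qed
qed

end

theorem theorem1p1:
  fixes S \<Lambda> :: "'a::euclidean_space set"
  assumes S_measurable: "S \<in> sets lebesgue"
    and S_finite: "emeasure lebesgue S < \<infinity>"
    and separated: "uniform_discrete \<Lambda>"
  shows "(exp_frame S \<Lambda> \<longrightarrow>
            (lower_density \<Lambda> = emeasure lebesgue S \<longleftrightarrow>
              (\<exists>\<Gamma>\<in>weak_limits \<Lambda>. exp_riesz_basis S \<Gamma>))) \<and>
         (exp_riesz_sequence S \<Lambda> \<longrightarrow>
            (upper_density \<Lambda> = emeasure lebesgue S \<longleftrightarrow>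
              (\<exists>\<Gamma>\<in>weak_limits \<Lambda>. exp_riesz_basis S \<Gamma>)))"
proof -
  interpret fin_region S using S_measurable S_finite by unfold_locales
  obtain \<delta> where L: "sep \<delta> \<Lambda>" using separated by (auto simp: uniform_discrete_def sep_def)
  show ?thesis
    unfolding emeasure_S
  proof (intro conjI impI)
    assume "exp_frame S \<Lambda>"
    then obtain A B where "bessel B \<Lambda>" "lower_frame A \<Lambda>" using exp_frame_bounds by blast
    then show "lower_density \<Lambda> = ennreal mS \<longleftrightarrow> (\<exists>\<Gamma>\<in>weak_limits \<Lambda>. exp_riesz_basis S \<Gamma>)"
      using frame_critical_imp_riesz_basis[OF L] riesz_basis_imp_lower_density[OF L] by blast
  next
    assume "exp_riesz_sequence S \<Lambda>"
    then obtain A B where "riesz_bounds A B \<Lambda>" using exp_riesz_sequence_bounds by blast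
    then show "upper_density \<Lambda> = ennreal mS \<longleftrightarrow> (\<exists>\<Gamma>\<in>weak_limits \<Lambda>. exp_riesz_basis S \<Gamma>)"
      using riesz_critical_imp_riesz_basis[OF L] riesz_basis_imp_upper_density[OF L] by blast
  qed
qed

end
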